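(* Let $K$ be a simplicial complex on $[m]$ and let $L_k$ ($k=1,\dots,m$) be a simplicial complex on $[n_k]$, $L_k\ne\{\,\},\Delta^{[n_k]}$, such that the pair $(\Delta^{[n_k]},L_k)$ is densely split on $\mathcal X_{n_k}$. Then the following diagram commutes: $$\begin{array}{ccc} H_*^{\mathcal L_n}(\mathcal Z^*(K;L_1,\dots,L_m))&\cong&H_*^{\mathcal L_m}(K)\,\widehat\otimes\,H_*^{\mathcal L_m;\mathcal L_n}(\underline\Delta,\underline L)\\ \downarrow{\scriptstyle\overline\gamma_{\mathcal Z^*(K;L_1,\dots,L_m)}}&&\downarrow{\scriptstyle\overline\gamma_K\widehat\otimes\overline\gamma_{(\underline\Delta,\underline L)}}\\ H^*_{\mathcal L_n}(\mathcal Z^*(K^\circ;L_1^\circ,\dots,L_m^\circ))&\cong&H^*_{\mathcal L_m}(K^\circ)\,\widehat\otimes\,H^*_{\mathcal L_m;\mathcal L_n}(\underline\Delta,\underline L^\circ) \end{array}$$ where $\overline\gamma_{(\underline\Delta,\underline L)}$ is the restriction of $\gamma_{(\underline\Delta,\underline L)}=\gamma_{L_1}\otimes\cdots\otimes\gamma_{L_m}$. Equivalently, for each $(\tilde\sigma,\tilde\omega)\in\mathcal L_n$, $$\gamma_{\mathcal Z^*(K;L_1,\dots,L_m),\tilde\sigma,\tilde\omega}=\gamma_{K,\sigma,\omega}\otimes\gamma_{L_1,\sigma_1,\omega_1}\otimes\cdots\otimes\gamma_{L_m,\sigma_m,\omega_m},$$ where $\sigma_k=\tilde\sigma\cap[n_k]$,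 $\omega_k=\tilde\omega\cap[n_k]$, $\omega=\{k:\omega_k\ne\emptyset\}$ and $\sigma=\{k:\omega_k=\emptyset,\ \sigma_k\notin L_k\}$.
   Context: **Complexes.** $[m]=\{1,\dots,m\}$; a simplicial complex on a finite set is a set of subsets closed under taking subsets (ghost vertices, the void complex $\{\,\}$ and $\{\emptyset\}$ allowed); $\Delta^S$ is all subsets of $S$; the dual of $K$ relative to $S\neq\emptyset$ is $K^\circ=\{S\setminus\tau:\tau\subset S,\tau\notin K\}$. Duals of $K$, $L_k$, $\mathcal Z^*(\cdot)$ are relative to $[m]$, $[n_k]$, $[n]=[n_1]\sqcup\cdots\sqcup[n_m]$. $X*Y=\{\sigma\sqcup\tau:\sigma\in X,\tau\in Y\}$. $\mathcal Z^*(K;L_1,\dots,L_m)=\bigcup_{\tau\in K}Y_1*\cdots*Y_m$, $Y_k=\Delta^{[n_k]}$ if $k\in\tau$, $Y_k=L_k$ otherwise; one has $\mathcal Z^*(K;L_1,\dots,L_m)^\circ=\mathcal Z^*(K^\circ;L_1^\circ,\dots,L_m^\circ)$. **Total (co)homology.** $\mathcal X=\{\mathrm e,\mathrm n,\mathrm i\}$; $\mathcal X_m=\{(\sigma,\omega):\sigma,\omega\subset[m],\sigma\cap\omega=\emptyset\}\cong\mathcal X^m$ ($s_k=\mathrm e,\mathrm n,\mathrm i$ for $k\in\sigma$, $k\in\omega$, otherwise); $\mathcal L_m=\{(\sigma,\omega)\in\mathcal X_m:\omega\ne\emptyset\}$. $T_*^{\mathcal X}$ is free on $\mathrm e,\mathrm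 n,\mathrm i$ (degree 0), $\bar{\mathrm n}$ (degree 1, index $\mathrm n$), $d\bar{\mathrm n}=\mathrm n$; $S_*^{\mathcal X}=\mathbb Z(\mathrm n,\mathrm i)$; $T_*^{\mathcal X_m}(K)=\sum_{\tau\in K}\otimes_kU_k\subset(T_*^{\mathcal X})^{\otimes m}$ with $U_k=T_*^{\mathcal X}$ if $k\in\tau$, $S_*^{\mathcal X}$ otherwise. Its homology is $\oplus H_*^{\sigma,\omega}(K)$, dually $\oplus H^*_{\sigma,\omega}(K)$; superscripts/subscripts $\mathcal D\subset\mathcal X_m$ mean restriction to indices in $\mathcal D$. $H_*^{\sigma,\omega}(K)$ is identified with $\widetilde H_{*-1}(K_{\sigma,\omega})$, $H^*_{\sigma,\omega}(K)$ with $\widetilde H^{*-1}(K_{\sigma,\omega})$, where $K_{\sigma,\omega}=\{\tau\subset\omega:\tau\cup\sigma\in K\}$ if $\sigma\in K$, $\{\,\}$ otherwise. **Densely split.** $(\Delta^{[l]},L)$ is densely split on $\mathcal X_l$ if for all $(\sigma,\omega)\in\mathcal X_l$ the map $H_*^{\sigma,\omega}(L)\to H_*^{\sigma,\omega}(\Delta^{[l]})$ has free kernel, cokernel and coimage. Its densely indexed homology $H_*^{\mathcal X;\mathcal X_l}(\Delta^{[l]},L)=\oplus H_*^{s;\sigma,\omega}$ has: $H_*^{\mathrm n;\sigma,\omega}=H_*^{\sigma,\omega}(L)$ if $\omega\ne\emptyset$, else $0$; $H_*^{\mathrm i;\sigma,\emptyset}=H_*^{\sigma,\emptyset}(L)=\mathbb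 Z(\mathrm i_\sigma)$ if $\sigma\in L$; $H_*^{\mathrm e;\sigma,\emptyset}=H_*^{\sigma,\emptyset}(\Delta^{[l]})=\mathbb Z(\mathrm e_\sigma)$ if $\sigma\notin L$; other $\mathrm i$- and $\mathrm e$-groups $0$. Cohomology is similar. $H_*^{\mathcal X_m;\mathcal X_n}(\underline\Delta,\underline L)=\otimes_kH_*^{\mathcal X;\mathcal X_{n_k}}(\Delta^{[n_k]},L_k)$, indexed by $\mathcal X_m\times\mathcal X_n$ ($\mathcal X_n=\prod_k\mathcal X_{n_k}$ via intersecting with $[n_k]$); $H_*^{\mathcal L_m;\mathcal L_n}$ is its restriction to $\mathcal L_m\times\mathcal L_n$; $H^*_{\mathcal L_m;\mathcal L_n}(\underline\Delta,\underline L^\circ)$ is the cohomology analogue for $(\Delta^{[n_k]},L_k^\circ)$. $\widehat\otimes$ is the diagonal tensor product over the first index: $A\widehat\otimes B=\oplus_{s}A^s\otimes B^{s;\cdot}$. **Horizontal isomorphisms.** $T_*^{\mathcal X_n}(\mathcal Z^*(K;L_1,\dots,L_m))=\sum_{\tau\in K}\otimes_kE_k$ with $E_k=T_*^{\mathcal X_{n_k}}(\Delta^{[n_k]})$ if $k\in\tau$, $T_*^{\mathcal X_{n_k}}(L_k)$ otherwise. For each $k$, with $\theta_k\colon H_*^{\mathcal X_{n_k}}(L_k)\to H_*^{\mathcal X_{n_k}}(\Delta^{[n_k]})$, choose cycles representing bases of $\ker\theta_k$ and (a complement) $\operatorname{coim}\theta_k$ in $T_*(L_k)$, cycles in $T_*(\Delta^{[n_k]})$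 representing a basis of $\operatorname{coker}\theta_k$, and chains bounding the representatives of $\ker\theta_k$; they span a subcomplex $C_k=\operatorname{coker}\theta_k\oplus\operatorname{coim}\theta_k\oplus(\ker\theta_k\oplus\Sigma\ker\theta_k)$, and $q_k\colon T_*(\Delta^{[n_k]})\to C_k$ is a homotopy equivalence left inverse to inclusion restricting to $T_*(L_k)\to H_*(L_k)=\ker\theta_k\oplus\operatorname{coim}\theta_k$. Identify $C_k\cong T_*^{\mathcal X}\widehat\otimes H_*^{\mathcal X;\mathcal X_{n_k}}(\Delta^{[n_k]},L_k)$ by $x\mapsto\mathrm e\otimes x,\ \mathrm n\otimes x,\ \mathrm i\otimes x$ on coker, ker, coim and $\bar x\mapsto\bar{\mathrm n}\otimes x$. Tensoring gives a homotopy equivalence onto $T_*^{\mathcal X_m}(K)\widehat\otimes H_*^{\mathcal X_m;\mathcal X_n}(\underline\Delta,\underline L)$, inducing the upper isomorphism; the lower one is the dual construction. **Duality maps.** For $L$ on $[l]$ and $(\sigma,\omega)\in\mathcal X_l$ put $\sigma'=[l]\setminus(\sigma\cup\omega)$. For $\omega\ne\emptyset$, $\gamma_{L,\sigma,\omega}\colon H_*^{\sigma,\omega}(L)\to H^{|\omega|-*-1}_{\sigma',\omega}(L^\circ)$ is $\bar\psi\partial^{-1}$, where $\partial\colon H_*(\Delta^\omega,L_{\sigma,\omega})\to\widetilde H_{*-1}(L_{\sigma,\omega})$ is the boundary isomorphism and $\bar\psi$ is induced by the dual complex isomorphism $\eta\mapsto\omega\setminus\eta$ ($\eta\subset\omega,\eta\notin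 L_{\sigma,\omega}$) onto $\widetilde C^*((L_{\sigma,\omega})^\circ)$, using $(L_{\sigma,\omega})^\circ=(L^\circ)_{\sigma',\omega}$ (dual relative to $\omega$). For $\omega=\emptyset$: $\gamma_L(\mathrm e_\sigma)=\mathrm i_{\sigma'}$, $\gamma_L(\mathrm i_\sigma)=\mathrm e_{\sigma'}$; the map on $H_*^{\mathcal X;\mathcal X_l}(\Delta^{[l]},L)\to H^*_{\mathcal X;\mathcal X_l}(\Delta^{[l]},L^\circ)$ is called $\gamma_L$, with local maps $\gamma_{L,\sigma,\omega}$. $\overline\gamma_K\colon H_*^{\mathcal L_m}(K)\to H^*_{\mathcal L_m}(K^\circ)$ is $\oplus_{\omega\neq\emptyset}\gamma_{K,\sigma,\omega}$ (similarly for complexes on $[n]$). *)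

theory Defs
  imports "HOL-Algebra.Free_Abelian_Groups" "HOL-Library.Product_Lexorder"
begin

section \<open>Simplicial complexes, duals and polyhedral joins\<close>

text \<open>The void complex \<open>{}\<close> and ghost vertices are allowed.\<close>

definition simplicial_complex :: "'a set \<Rightarrow> 'a set set \<Rightarrow> bool" where
  "simplicial_complex V K \<longleftrightarrow> K \<subseteq> Pow V \<and> (\<forall>\<tau>\<in>K. \<forall>\<rho>. \<rho> \<subseteq> \<tau> \<longrightarrow> \<rho> \<in> K)"

definition dual_complex :: "'a set \<Rightarrow> 'a set set \<Rightarrow> 'a set set" where
  "dual_complex V K = {V - \<tau> | \<tau>. \<tau> \<subseteq> V \<and> \<tau> \<notin> K}"

definition polyhedral_join ::
    "nat \<Rightarrow> (nat \<Rightarrow> 'a set) \<Rightarrow> nat set set \<Rightarrow> (nat \<Rightarrow> 'a set set) \<Rightarrow> (nat \<times> 'a) set set" where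
  "polyhedral_join m V K L =
    (\<Union>\<tau>\<in>K. {Sigma {1..m} \<rho> | \<rho>. \<forall>k\<in>{1..m}. \<rho> k \<in> (if k \<in> \<tau> then Pow (V k) else L k)})"

definition local_complex :: "'a set set \<Rightarrow> 'a set \<times> 'a set \<Rightarrow> 'a set set" where
  "local_complex K = (\<lambda>(\<sigma>, \<omega>). if \<sigma> \<in> K then {\<tau>. \<tau> \<subseteq> \<omega> \<and> \<tau> \<union> \<sigma> \<in> K} else {})"

definition X_index :: "'a set \<Rightarrow> ('a set \<times> 'a set) set" where
  "X_index V = {(\<sigma>, \<omega>). \<sigma> \<subseteq> V \<and> \<omega> \<subseteq> V \<and> \<sigma> \<inter> \<omega> = {}}"

definition L_index :: "'a set \<Rightarrow> ('a set \<times> 'a set) set" where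
  "L_index V = {(\<sigma>, \<omega>) \<in> X_index V. \<omega> \<noteq> {}}"

definition opposite :: "'a set \<Rightarrow> 'a set \<times> 'a set \<Rightarrow> 'a set \<times> 'a set" where
  "opposite V = (\<lambda>(\<sigma>, \<omega>). (V - (\<sigma> \<union> \<omega>), \<omega>))"

datatype letter = Le | Ln | Li

definition letter_of :: "'a set \<times> 'a set \<Rightarrow> 'a \<Rightarrow> letter" where
  "letter_of s k = (if k \<in> fst s then Le else if k \<in> snd s then Ln else Li)"


section \<open>Homology and cohomology groups\<close>

text \<open>
  The word of \<open>T\<^sup>X \<otimes> \<dots> \<otimes> T\<^sup>X\<close> carrying \<open>e\<close> on \<open>\<sigma>\<close>, \<open>n-bar\<close> on \<open>\<tau> \<subseteq> \<omega>\<close>, \<open>n\<close> on \<open>\<omega> - \<tau>\<close> and \<open>i\<close>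
  elsewhere has index \<open>(\<sigma>, \<omega>)\<close>, has degree \<open>card \<tau>\<close>, and lies in \<open>T(K)\<close> iff \<open>\<sigma> \<union> \<tau> \<in> K\<close>.  So the
  index-\<open>(\<sigma>, \<omega>)\<close> summand of \<open>T(K)\<close> is the free abelian group on \<open>local_complex K (\<sigma>, \<omega>)\<close>, graded by
  cardinality; \<open>d n-bar = n\<close> and the Koszul rule give the differential below.  The empty simplex is
  a generator of degree 0: this is the augmented simplicial chain complex shifted by one.
  Groups are total: a graded group is represented by the direct sum of its homogeneous parts.
\<close>

definition boundary :: "('a::linorder set \<Rightarrow>\<^sub>0 int) \<Rightarrow> ('a set \<Rightarrow>\<^sub>0 int)" where
  "boundary = frag_extend (\<lambda>\<tau>. \<Sum>v\<in>\<tau>. frag_cmul ((-1) ^ card {u \<in> \<tau>. u < v}) (frag_of (\<tau> - {v})))"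

definition boundaries :: "'a::linorder set set \<Rightarrow> ('a set \<Rightarrow>\<^sub>0 int) set" where
  "boundaries X = boundary ` carrier (free_Abelian_group X)"

definition homology :: "'a::linorder set set \<Rightarrow> ('a set \<Rightarrow>\<^sub>0 int) set monoid" where
  "homology X =
    subgroup_generated (free_Abelian_group X) {c \<in> carrier (free_Abelian_group X). boundary c = 0}
      Mod boundaries X"

text \<open>
  Cochains on a finite complex \<open>X\<close> are written in the dual basis, so that they are again elements
  of \<open>free_Abelian_group X\<close>; \<open>pairing\<close> is evaluation and the coboundary of \<open>f\<close> is \<open>f \<circ> boundary\<close>,
  without extra sign.
\<close>

definition pairing :: "('b \<Rightarrow>\<^sub>0 int) \<Rightarrow> ('b \<Rightarrow>\<^sub>0 int) \<Rightarrow> int" where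
  "pairing f c = (\<Sum>\<tau>\<in>Poly_Mapping.keys c. Poly_Mapping.lookup f \<tau> * Poly_Mapping.lookup c \<tau>)"

definition coboundary :: "'a::linorder set set \<Rightarrow> ('a set \<Rightarrow>\<^sub>0 int) \<Rightarrow> ('a set \<Rightarrow>\<^sub>0 int)" where
  "coboundary X f = (\<Sum>\<tau>\<in>X. frag_cmul (pairing f (boundary (frag_of \<tau>))) (frag_of \<tau>))"

definition coboundaries :: "'a::linorder set set \<Rightarrow> ('a set \<Rightarrow>\<^sub>0 int) set" where
  "coboundaries X = coboundary X ` carrier (free_Abelian_group X)"

definition cohomology :: "'a::linorder set set \<Rightarrow> ('a set \<Rightarrow>\<^sub>0 int) set monoid" where
  "cohomology X =
    subgroup_generated (free_Abelian_group X) {f \<in> carrier (free_Abelian_group X). coboundary X f = 0}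
      Mod coboundaries X"

definition cochain_restrict :: "'b set \<Rightarrow> ('b \<Rightarrow>\<^sub>0 int) \<Rightarrow> ('b \<Rightarrow>\<^sub>0 int)" where
  "cochain_restrict X = frag_extend (\<lambda>\<tau>. if \<tau> \<in> X then frag_of \<tau> else 0)"

definition homogeneous :: "nat \<Rightarrow> ('a set \<Rightarrow>\<^sub>0 int) \<Rightarrow> bool" where
  "homogeneous p c \<longleftrightarrow> (\<forall>\<tau>\<in>Poly_Mapping.keys c. card \<tau> = p)"

text \<open>
  Elements of quotients of free abelian groups are cosets.  \<open>class_map B f\<close> sends the class of \<open>c\<close>
  to the class of \<open>f c\<close> modulo \<open>B\<close>; it is used only when the result does not depend on the chosen
  representative.
\<close>

definition rep :: "'b set \<Rightarrow> 'b" where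
  "rep x = (SOME c. c \<in> x)"

definition class_map ::
    "('c \<Rightarrow>\<^sub>0 int) set \<Rightarrow> (('b \<Rightarrow>\<^sub>0 int) \<Rightarrow> ('c \<Rightarrow>\<^sub>0 int)) \<Rightarrow> ('b \<Rightarrow>\<^sub>0 int) set \<Rightarrow> ('c \<Rightarrow>\<^sub>0 int) set" where
  "class_map B f x = B #>\<^bsub>free_Abelian_group UNIV\<^esub> f (rep x)"


section \<open>Densely split pairs and their densely indexed homology\<close>

definition free_abelian :: "('b, 'c) monoid_scheme \<Rightarrow> bool" where
  "free_abelian G \<longleftrightarrow> (\<exists>S :: 'b set. G \<cong> free_Abelian_group S)"

definition densely_split :: "'a::linorder set \<Rightarrow> 'a set set \<Rightarrow> bool" where
  "densely_split V L \<longleftrightarrow> (\<forall>t\<in>X_index V.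
    let G = homology (local_complex L t);
        H = homology (local_complex (Pow V) t);
        \<theta> = class_map (boundaries (local_complex (Pow V) t)) id
    in free_abelian (subgroup_generated G (kernel G H \<theta>)) \<and>
       free_abelian (H Mod (\<theta> ` carrier G)) \<and>
       free_abelian (G Mod kernel G H \<theta>))"

text \<open>
  The generators \<open>e\<^sub>\<sigma>\<close> and \<open>i\<^sub>\<sigma>\<close> are the classes of the empty simplex.  \<open>homology {}\<close> and
  \<open>cohomology {}\<close> serve as the zero group.
\<close>

definition dense_homology ::
    "letter \<Rightarrow> 'a::linorder set \<Rightarrow> 'a set set \<Rightarrow> 'a set \<times> 'a set \<Rightarrow> ('a set \<Rightarrow>\<^sub>0 int) set monoid" where
  "dense_homology x V L t = (case x of
      Ln \<Rightarrow> if snd t \<noteq> {} then homology (local_complex L t) else homology {}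
    | Li \<Rightarrow> if snd t = {} \<and> fst t \<in> L then homology (local_complex L t) else homology {}
    | Le \<Rightarrow> if snd t = {} \<and> fst t \<notin> L then homology (local_complex (Pow V) t) else homology {})"

definition dense_cohomology ::
    "letter \<Rightarrow> 'a::linorder set \<Rightarrow> 'a set set \<Rightarrow> 'a set \<times> 'a set \<Rightarrow> ('a set \<Rightarrow>\<^sub>0 int) set monoid" where
  "dense_cohomology x V L t = (case x of
      Ln \<Rightarrow> if snd t \<noteq> {} then cohomology (local_complex L t) else cohomology {}
    | Li \<Rightarrow> if snd t = {} \<and> fst t \<in> L then cohomology (local_complex L t) else cohomology {}
    | Le \<Rightarrow> if snd t = {} \<and> fst t \<notin> L then cohomology (local_complex (Pow V) t) else cohomology {})"


section \<open>Tensor products of abelian groups\<close>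

definition tensor_relations :: "'i set \<Rightarrow> ('i \<Rightarrow> 'b monoid) \<Rightarrow> (('i \<Rightarrow> 'b) \<Rightarrow>\<^sub>0 int) set" where
  "tensor_relations I G = carrier (subgroup_generated
     (free_Abelian_group (\<Pi>\<^sub>E i\<in>I. carrier (G i)))
     {frag_of (x(i := y \<otimes>\<^bsub>G i\<^esub> z)) - frag_of (x(i := y)) - frag_of (x(i := z)) | x i y z.
        x \<in> (\<Pi>\<^sub>E i\<in>I. carrier (G i)) \<and> i \<in> I \<and> y \<in> carrier (G i) \<and> z \<in> carrier (G i)})"

definition tensor_group :: "'i set \<Rightarrow> ('i \<Rightarrow> 'b monoid) \<Rightarrow> (('i \<Rightarrow> 'b) \<Rightarrow>\<^sub>0 int) set monoid" where
  "tensor_group I G = free_Abelian_group (\<Pi>\<^sub>E i\<in>I. carrier (G i)) Mod tensor_relations I G"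

text \<open>The map \<open>\<Otimes>f\<^sub>i\<close> from \<open>tensor_group I G\<close> to \<open>tensor_group I H\<close>, without signs.\<close>

definition tensor_map ::
    "'i set \<Rightarrow> ('i \<Rightarrow> 'c monoid) \<Rightarrow> ('i \<Rightarrow> 'b \<Rightarrow> 'c)
      \<Rightarrow> (('i \<Rightarrow> 'b) \<Rightarrow>\<^sub>0 int) set \<Rightarrow> (('i \<Rightarrow> 'c) \<Rightarrow>\<^sub>0 int) set" where
  "tensor_map I H f =
    class_map (tensor_relations I H) (frag_extend (\<lambda>x. frag_of (\<lambda>i\<in>I. f i (x i))))"

text \<open>\<open>graded_sign d deg\<close> multiplies a homogeneous chain \<open>c\<close> by \<open>(-1) ^ (d * deg c)\<close>.\<close>

definition graded_sign :: "nat \<Rightarrow> ('b \<Rightarrow> nat) \<Rightarrow> ('b \<Rightarrow>\<^sub>0 int) \<Rightarrow> ('b \<Rightarrow>\<^sub>0 int)" where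
  "graded_sign d deg = frag_extend (\<lambda>\<tau>. frag_cmul ((-1) ^ (d * deg \<tau>)) (frag_of \<tau>))"


section \<open>Duality maps\<close>

definition relative_homology ::
    "'a::linorder set set \<Rightarrow> 'a set set \<Rightarrow> ('a set \<Rightarrow>\<^sub>0 int) set monoid" where
  "relative_homology Y X =
    subgroup_generated (free_Abelian_group Y)
      {c \<in> carrier (free_Abelian_group Y). boundary c \<in> carrier (free_Abelian_group X)}
    Mod {b + a | b a. b \<in> boundaries Y \<and> a \<in> carrier (free_Abelian_group X)}"

text \<open>
  The complex isomorphism \<open>C(\<Delta>\<^sup>\<omega>, X) \<rightarrow> C\<^sup>*(X\<^sup>\<circ>)\<close>, \<open>\<eta> \<mapsto> \<plusminus> (\<omega> - \<eta>)\<close>.  The sign is the one for which it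
  strictly commutes with the differentials; it is unique up to a global sign.
\<close>

definition complement_map ::
    "'a::linorder set \<Rightarrow> 'a set set \<Rightarrow> ('a set \<Rightarrow>\<^sub>0 int) \<Rightarrow> ('a set \<Rightarrow>\<^sub>0 int)" where
  "complement_map \<omega> X = frag_extend (\<lambda>\<eta>. if \<eta> \<in> X then 0
     else frag_cmul ((-1) ^ (\<Sum>v\<in>\<eta>. card {u \<in> \<omega>. u < v})) (frag_of (\<omega> - \<eta>)))"

definition gamma ::
    "'a::linorder set \<Rightarrow> 'a set set \<Rightarrow> 'a set \<times> 'a set
      \<Rightarrow> ('a set \<Rightarrow>\<^sub>0 int) set \<Rightarrow> ('a set \<Rightarrow>\<^sub>0 int) set" where
  "gamma V L t x = (let \<omega> = snd t; X = local_complex L t in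
     class_map (coboundaries (local_complex (dual_complex V L) (opposite V t))) (complement_map \<omega> X)
       (inv_into (carrier (relative_homology (Pow \<omega>) X)) (class_map (boundaries X) boundary) x))"

text \<open>
  On \<open>e\<^sub>\<sigma>\<close> and \<open>i\<^sub>\<sigma>\<close> the duality map is the identity of representatives, since all four
  generators \<open>e\<^sub>\<sigma>\<close>, \<open>i\<^sub>\<sigma>\<close> (in homology) and \<open>i\<^sub>\<sigma>\<^sub>'\<close>, \<open>e\<^sub>\<sigma>\<^sub>'\<close> (in cohomology) are the class of the empty
  simplex.
\<close>

definition dense_gamma ::
    "letter \<Rightarrow> 'a::linorder set \<Rightarrow> 'a set set \<Rightarrow> 'a set \<times> 'a set
      \<Rightarrow> ('a set \<Rightarrow>\<^sub>0 int) set \<Rightarrow> ('a set \<Rightarrow>\<^sub>0 int) set" where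
  "dense_gamma x V L t = (if x = Ln \<and> snd t \<noteq> {} then gamma V L t else id)"

definition gamma_bar ::
    "'a::linorder set \<Rightarrow> 'a set set \<Rightarrow> ('a set \<times> 'a set \<Rightarrow> ('a set \<Rightarrow>\<^sub>0 int) set)
      \<Rightarrow> ('a set \<times> 'a set \<Rightarrow> ('a set \<Rightarrow>\<^sub>0 int) set)" where
  "gamma_bar V K y = (\<lambda>t\<in>L_index V. gamma V K (opposite V t) (y (opposite V t)))"


section \<open>Both rows of the diagram\<close>

text \<open>\<open>L_homology V K\<close> is \<open>H\<^sub>*\<close> of \<open>K\<close> restricted to the indices with \<open>\<omega> \<noteq> {}\<close>.\<close>

definition L_homology ::
    "'a::linorder set \<Rightarrow> 'a set set \<Rightarrow> ('a set \<times> 'a set \<Rightarrow> ('a set \<Rightarrow>\<^sub>0 int) set) monoid" where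
  "L_homology V K = sum_group (L_index V) (\<lambda>t. homology (local_complex K t))"

definition L_cohomology ::
    "'a::linorder set \<Rightarrow> 'a set set \<Rightarrow> ('a set \<times> 'a set \<Rightarrow> ('a set \<Rightarrow>\<^sub>0 int) set) monoid" where
  "L_cohomology V K = sum_group (L_index V) (\<lambda>t. cohomology (local_complex K t))"

definition block :: "(nat \<times> 'a) set \<times> (nat \<times> 'a) set \<Rightarrow> nat \<Rightarrow> 'a set \<times> 'a set" where
  "block t k = ({v. (k, v) \<in> fst t}, {v. (k, v) \<in> snd t})"

text \<open>The pair \<open>(\<sigma>, \<omega>)\<close> determined by an index \<open>t\<close> on the disjoint union.\<close>

definition block_index ::
    "nat \<Rightarrow> (nat \<Rightarrow> 'a set set) \<Rightarrow> (nat \<times> 'a) set \<times> (nat \<times> 'a) set \<Rightarrow> nat set \<times> nat set" where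
  "block_index m L t =
    ({k \<in> {1..m}. snd (block t k) = {} \<and> fst (block t k) \<notin> L k},
     {k \<in> {1..m}. snd (block t k) \<noteq> {}})"

text \<open>
  The factors of \<open>H\<^sup>s(K) \<otimes> H\<^sup>s\<^sup>;\<^sup>t(\<Delta>, L)\<close>, whose second part is itself a tensor product over
  \<open>k = 1, \<dots>, m\<close>, as one family over \<open>{0..m}\<close>: factor 0 belongs to \<open>K\<close> and
  factor \<open>k \<ge> 1\<close> to \<open>L\<^sub>k\<close>.
\<close>

definition hom_factor ::
    "(nat \<Rightarrow> nat set) \<Rightarrow> nat set set \<Rightarrow> (nat \<Rightarrow> nat set set) \<Rightarrow> nat set \<times> nat set
      \<Rightarrow> (nat \<times> nat) set \<times> (nat \<times> nat) set \<Rightarrow> nat \<Rightarrow> (nat set \<Rightarrow>\<^sub>0 int) set monoid" where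
  "hom_factor V K L s t k = (if k = 0 then homology (local_complex K s)
     else dense_homology (letter_of s k) (V k) (L k) (block t k))"

definition cohom_factor ::
    "(nat \<Rightarrow> nat set) \<Rightarrow> nat set set \<Rightarrow> (nat \<Rightarrow> nat set set) \<Rightarrow> nat set \<times> nat set
      \<Rightarrow> (nat \<times> nat) set \<times> (nat \<times> nat) set \<Rightarrow> nat \<Rightarrow> (nat set \<Rightarrow>\<^sub>0 int) set monoid" where
  "cohom_factor V K L s t k = (if k = 0 then cohomology (local_complex K s)
     else dense_cohomology (letter_of s k) (V k) (L k) (block t k))"

definition diagonal_homology where
  "diagonal_homology m V K L = sum_group (L_index {1..m} \<times> L_index (Sigma {1..m} V))
     (\<lambda>(s, t). tensor_group {0..m} (hom_factor V K L s t))"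

definition diagonal_cohomology where
  "diagonal_cohomology m V K L = sum_group (L_index {1..m} \<times> L_index (Sigma {1..m} V))
     (\<lambda>(s, t). tensor_group {0..m} (cohom_factor V K L s t))"


section \<open>The right vertical map\<close>

text \<open>
  Tensor products of graded maps carry the Koszul sign
  \<open>(f \<otimes> g) (x \<otimes> y) = (-1) ^ (deg f * deg y) f x \<otimes> g y\<close>.
  The degree of a duality map at \<open>(\<sigma>, \<omega>)\<close> is \<open>card \<omega> - 1\<close> modulo 2, that of \<open>e\<^sub>\<sigma> \<mapsto> i\<^sub>\<sigma>\<^sub>'\<close> and
  \<open>i\<^sub>\<sigma> \<mapsto> e\<^sub>\<sigma>\<^sub>'\<close> is 0.  The degree of a class in \<open>H\<^sub>p\<^sup>\<sigma>\<^sup>,\<^sup>\<omega>(L)\<close>, identified with reduced homology of degree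
  \<open>p - 1\<close>, is \<open>p - 1\<close> (written \<open>p + 1\<close> below, which has the same parity), that of \<open>e\<^sub>\<sigma>\<close> and \<open>i\<^sub>\<sigma>\<close> is 0.
  \<open>gamma_degree_before k\<close> is the total degree of the maps on the factors preceding \<open>k\<close>.
\<close>

definition gamma_degree_before ::
    "nat set \<times> nat set \<Rightarrow> (nat \<times> 'a) set \<times> (nat \<times> 'a) set \<Rightarrow> nat \<Rightarrow> nat" where
  "gamma_degree_before s t k =
    (card (snd s) - 1) + (\<Sum>i\<in>{1..<k}. if letter_of s i = Ln then card (snd (block t i)) - 1 else 0)"

definition gamma_factor ::
    "nat \<Rightarrow> (nat \<Rightarrow> nat set) \<Rightarrow> nat set set \<Rightarrow> (nat \<Rightarrow> nat set set) \<Rightarrow> nat set \<times> nat set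
      \<Rightarrow> (nat \<times> nat) set \<times> (nat \<times> nat) set \<Rightarrow> nat
      \<Rightarrow> (nat set \<Rightarrow>\<^sub>0 int) set \<Rightarrow> (nat set \<Rightarrow>\<^sub>0 int) set" where
  "gamma_factor m V K L s t k x =
    (if k = 0 then gamma {1..m} K s x
     else dense_gamma (letter_of s k) (V k) (L k) (block t k)
       (if letter_of s k = Ln
        then graded_sign (gamma_degree_before s t k) (\<lambda>\<tau>. card \<tau> + 1) ` x
        else x))"

text \<open>\<open>gamma_K \<otimes> gamma_L1 \<otimes> \<dots> \<otimes> gamma_Lm\<close> at the indices \<open>s\<close>, \<open>t\<close>.\<close>

definition gamma_tensor where
  "gamma_tensor m V K L s t = tensor_map {0..m}
     (cohom_factor V (dual_complex {1..m} K) (\<lambda>k. dual_complex (V k) (L k))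
        (opposite {1..m} s) (opposite (Sigma {1..m} V) t))
     (gamma_factor m V K L s t)"

definition gamma_bar_tensor where
  "gamma_bar_tensor m V K L y = (\<lambda>(s, t)\<in>L_index {1..m} \<times> L_index (Sigma {1..m} V).
     let s' = opposite {1..m} s; t' = opposite (Sigma {1..m} V) t
     in gamma_tensor m V K L s' t' (y (s', t')))"


section \<open>Horizontal isomorphisms\<close>

text \<open>
  Choice of representatives at an index \<open>(\<sigma>, \<omega>)\<close> with \<open>\<omega> \<noteq> {}\<close>, where the whole of \<open>H\<^sup>\<sigma>\<^sup>,\<^sup>\<omega>(L)\<close> is the
  kernel of \<open>\<theta>\<close> because \<open>H\<^sup>\<sigma>\<^sup>,\<^sup>\<omega>\<close> of the simplex vanishes.  \<open>z x\<close> is a chain of the simplex, linear in the class \<open>x\<close>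
  (so it is determined by its values on a basis), whose boundary is a cycle of \<open>L\<close> representing
  \<open>x\<close>.  Thus \<open>boundary (z x)\<close> and \<open>z x\<close> are the images of \<open>n \<otimes> x\<close> and \<open>n-bar \<otimes> x\<close> in \<open>C\<^sub>k\<close>.
\<close>

definition bounding_choice ::
    "'a::linorder set set \<Rightarrow> 'a set \<times> 'a set
      \<Rightarrow> (('a set \<Rightarrow>\<^sub>0 int) set \<Rightarrow> ('a set \<Rightarrow>\<^sub>0 int)) \<Rightarrow> bool" where
  "bounding_choice L t z \<longleftrightarrow>
    z \<in> hom (homology (local_complex L t)) (free_Abelian_group (Pow (snd t))) \<and>
    (\<forall>x\<in>carrier (homology (local_complex L t)).
       boundary (z x) \<in> x \<and> (\<forall>p. \<forall>c\<in>x. homogeneous p c \<longrightarrow> homogeneous (Suc p) (z x)))"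

text \<open>
  Dually, \<open>f y\<close> is a cochain of the simplex, linear in \<open>y\<close>, whose restriction to \<open>L\<close> is a cocycle
  representing \<open>y\<close>.  For \<open>q : T(\<Delta>) \<rightarrow> C\<close> as in the construction, the transpose of \<open>q\<close> sends the
  dual classes \<open>n \<otimes> y\<close> and \<open>n-bar \<otimes> y\<close> to such an \<open>f y\<close> and its coboundary.
\<close>

definition extension_choice ::
    "'a::linorder set set \<Rightarrow> 'a set \<times> 'a set
      \<Rightarrow> (('a set \<Rightarrow>\<^sub>0 int) set \<Rightarrow> ('a set \<Rightarrow>\<^sub>0 int)) \<Rightarrow> bool" where
  "extension_choice L t f \<longleftrightarrow>
    f \<in> hom (cohomology (local_complex L t)) (free_Abelian_group (Pow (snd t))) \<and>
    (\<forall>y\<in>carrier (cohomology (local_complex L t)).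
       cochain_restrict (local_complex L t) (f y) \<in> y \<and>
       (\<forall>p. \<forall>c\<in>y. homogeneous p c \<longrightarrow> homogeneous p (f y)))"

text \<open>
  The tensor product of chains on the blocks, as a chain on the disjoint union; the vertices of
  the latter are ordered lexicographically.  The same formula serves for cochains.
\<close>

definition join_chain :: "nat set \<Rightarrow> (nat \<Rightarrow> ('a set \<Rightarrow>\<^sub>0 int)) \<Rightarrow> ((nat \<times> 'a) set \<Rightarrow>\<^sub>0 int)" where
  "join_chain I c = (\<Sum>\<rho>\<in>(\<Pi>\<^sub>E k\<in>I. Poly_Mapping.keys (c k)).
     frag_cmul (\<Prod>k\<in>I. Poly_Mapping.lookup (c k) (\<rho> k)) (frag_of (Sigma I \<rho>)))"

text \<open>
  The image of \<open>\<tau> \<otimes> x\<^sub>1 \<otimes> \<dots> \<otimes> x\<^sub>m\<close> in the tensor product of the \<open>C\<^sub>k\<close>.  Distributing the letters of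
  \<open>\<tau>\<close> over the factors moves every \<open>n-bar\<close> at a position \<open>i > k\<close> past \<open>x\<^sub>k\<close>; this is the source of
  \<open>graded_sign\<close>.
\<close>

definition upper_chain ::
    "nat \<Rightarrow> (nat \<Rightarrow> nat set \<times> nat set \<Rightarrow> (nat set \<Rightarrow>\<^sub>0 int) set \<Rightarrow> (nat set \<Rightarrow>\<^sub>0 int))
      \<Rightarrow> (nat \<times> nat) set \<times> (nat \<times> nat) set \<Rightarrow> (nat \<Rightarrow> (nat set \<Rightarrow>\<^sub>0 int) set)
      \<Rightarrow> nat set \<Rightarrow> ((nat \<times> nat) set \<Rightarrow>\<^sub>0 int)" where
  "upper_chain m z t x \<tau> = join_chain {1..m} (\<lambda>k.
     let y = graded_sign (card {i \<in> \<tau>. k < i}) card ` x k in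
     if snd (block t k) = {} then rep y
     else if k \<in> \<tau> then z k (block t k) y
     else boundary (z k (block t k) y))"

definition lower_cochain ::
    "nat \<Rightarrow> (nat \<Rightarrow> nat set \<times> nat set \<Rightarrow> (nat set \<Rightarrow>\<^sub>0 int) set \<Rightarrow> (nat set \<Rightarrow>\<^sub>0 int))
      \<Rightarrow> (nat \<times> nat) set \<times> (nat \<times> nat) set \<Rightarrow> (nat \<Rightarrow> (nat set \<Rightarrow>\<^sub>0 int) set)
      \<Rightarrow> nat set \<Rightarrow> ((nat \<times> nat) set \<Rightarrow>\<^sub>0 int)" where
  "lower_cochain m f t x \<tau> = join_chain {1..m} (\<lambda>k.
     let y = graded_sign (card {i \<in> \<tau>. k < i}) card ` x k in
     if snd (block t k) = {} then rep y
     else if k \<in> \<tau> then coboundary (Pow (snd (block t k))) (f k (block t k) y)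
     else f k (block t k) y)"

text \<open>
  The horizontal isomorphisms, oriented from the diagonal tensor product to the (co)homology of
  the polyhedral join: the upper one is induced by the tensor product of the inclusions
  \<open>C\<^sub>k \<rightarrow> T(\<Delta>)\<close>, hence inverse to the one induced by the tensor product of the \<open>q\<^sub>k\<close>; the lower one
  is induced by the transpose of the tensor product of the \<open>q\<^sub>k\<close>.
\<close>

definition upper_local where
  "upper_local m V K L z t =
    class_map (boundaries (local_complex (polyhedral_join m V K L) t))
      (frag_extend (\<lambda>x. frag_extend (upper_chain m z t x) (rep (x 0))))"

definition lower_local where
  "lower_local m V K L f t = (let X = local_complex (polyhedral_join m V K L) t in
    class_map (coboundaries X)
      (frag_extend (\<lambda>x. cochain_restrict X (frag_extend (lower_cochain m f t x) (rep (x 0))))))"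

text \<open>The summand at \<open>(s, t)\<close> with \<open>s \<noteq> block_index m L t\<close> is zero.\<close>

definition upper_iso where
  "upper_iso m V K L z y =
    (\<lambda>t\<in>L_index (Sigma {1..m} V). upper_local m V K L z t (y (block_index m L t, t)))"

definition lower_iso where
  "lower_iso m V K L f y =
    (\<lambda>t\<in>L_index (Sigma {1..m} V). lower_local m V K L f t (y (block_index m L t, t)))"

end

theory Submission
  imports Defs
begin

text \<open>
  The proof works at one index \<open>t\<close> at a time. There the local complex of the polyhedral join is the join, over a
  complex on the set \<open>W\<close> of blocks with \<open>\<omega>\<^sub>k \<noteq> {}\<close>, of the pairs formed by a nonempty simplex \<open>\<Delta>\<close> and the local
  complex \<open>Y\<close> of the block (\<open>join_index\<close>). All summands off the diagonal vanish, since some tensor factor is zero, so the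
  global statements are sums of the local ones.

  The upper map substitutes chains for letters (\<open>block_chain\<close>): the chosen bounding chain for \<open>n-bar\<close> and its boundary
  for \<open>n\<close>. Since the letters satisfy \<open>d n-bar = n\<close>, this commutes with the boundary. Each pair of a block splits: the
  simplex is acyclic, and the span \<open>C\<close> of the representatives and of their bounding chains is a retract of its chains by
  a retraction homotopic to the identity, with a homotopy that preserves \<open>Y\<close> (\<open>bounded_pair.splitting\<close>). Tensoring these
  homotopies keeps the chains of the join (\<open>kunneth.H_Z\<close>), so these retract onto the direct sum of copies of the chains of
  the complex on \<open>W\<close>, one for each choice of a basis element in every block. This makes the upper map an isomorphism (\<open>kunneth_iso\<close>).

  For the square, a duality map sends the class of \<open>boundary w\<close> to the class of the complement of the relative cycle \<open>w\<close>
  (\<open>duality_class\<close>). The complement of a tensor product of chains is, up to signs, the tensor product of the complements,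
  and it exchanges the letters \<open>n-bar\<close> and \<open>n\<close>; hence the complement of a block chain is a block cochain built from the
  complements. The signs agree exactly: those of the letters, of the lexicographic order and of the tensor
  product of the duality maps cancel (\<open>complement_map_block_chain\<close>, \<open>gamma_degree_parity\<close>). The representatives chosen in the
  two rows need not correspond under complements, but the class of a block chain depends only on the classes of the relative
  cycles substituted (\<open>block_chain_independent\<close>). This gives the commutative square (\<open>local_commutes\<close>).

  The lower map then is an isomorphism because the duality maps are: their tensor product is onto and its composite
  with the lower map is the composite of two isomorphisms (\<open>lower_local_iso\<close>).
\<close>

section \<open>Additive and multi-additive maps on free abelian groups\<close>

text \<open>
  Chains with support in \<open>S\<close> are kept as a subset of one ambient type, so that chains of different
  complexes can be compared and added without passing between carriers.
\<close>

definition frags :: "'b set \<Rightarrow> ('b \<Rightarrow>\<^sub>0 int) set" where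
  "frags S = {c. Poly_Mapping.keys c \<subseteq> S}"

definition additive_subset :: "'b::ab_group_add set \<Rightarrow> bool" where
  "additive_subset A \<longleftrightarrow> 0 \<in> A \<and> (\<forall>x\<in>A. \<forall>y\<in>A. x - y \<in> A)"

definition additive_map :: "('b::ab_group_add \<Rightarrow> 'c::ab_group_add) \<Rightarrow> bool" where
  "additive_map g \<longleftrightarrow> (\<forall>x y. g (x + y) = g x + g y)"

named_theorems additive_dist \<open>compatibility of particular maps with addition\<close>

declare frag_extend_add [additive_dist] lookup_add [additive_dist] frag_cmul_distrib2 [additive_dist]

lemma carrier_eq_frags: "carrier (free_Abelian_group S) = frags S"
  by (auto simp: frags_def)

lemma additive_subsetD:
  assumes "additive_subset A"
  shows "0 \<in> A" "x \<in> A \<Longrightarrow> y \<in> A \<Longrightarrow> x - y \<in> A"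
    "x \<in> A \<Longrightarrow> - x \<in> A" "x \<in> A \<Longrightarrow> y \<in> A \<Longrightarrow> x + y \<in> A"
proof -
  have 0: "0 \<in> A" using assms by (auto simp: additive_subset_def)
  show d: "x - y \<in> A" if "x \<in> A" "y \<in> A" for x y
    using that assms by (auto simp: additive_subset_def)
  show m: "- x \<in> A" if "x \<in> A" for x using d[OF 0 that] by simp
  show "x + y \<in> A" if "x \<in> A" "y \<in> A" using d[OF that(1) m[OF that(2)]] by simp
  show "0 \<in> A" by (rule 0)
qed

lemma additive_subset_sum:
  assumes "additive_subset A" "\<And>i. i \<in> I \<Longrightarrow> g i \<in> A"
  shows "sum g I \<in> A"
  using assms(2) by (induction I rule: infinite_finite_induct) (auto intro: additive_subsetD[OF assms(1)])

lemma additive_subset_cmul: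
  assumes "additive_subset A" "c \<in> A"
  shows "frag_cmul n c \<in> A"
  by (rule frag_closure_minus_cmul[where P = "\<lambda>x. x \<in> A"]) (use assms in \<open>auto intro: additive_subsetD\<close>)

lemma additive_subset_frags [simp]: "additive_subset (frags S)"
  using keys_diff by (fastforce simp: additive_subset_def frags_def)

lemmas fragsD = additive_subsetD[OF additive_subset_frags]
lemmas frags_sum = additive_subset_sum[OF additive_subset_frags]
lemmas frags_cmul = additive_subset_cmul[OF additive_subset_frags]

lemma frags_of [simp]: "frag_of \<tau> \<in> frags S \<longleftrightarrow> \<tau> \<in> S"
  by (simp add: frags_def)

lemma frags_mono: "S \<subseteq> S' \<Longrightarrow> c \<in> frags S \<Longrightarrow> c \<in> frags S'"
  by (auto simp: frags_def)

lemma additive_mapI: "(\<And>x y. g (x + y) = g x + g y) \<Longrightarrow> additive_map g"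
  by (simp add: additive_map_def)

lemma
  assumes "additive_map g"
  shows additive_map_add: "g (x + y) = g x + g y"
    and additive_map_zero: "g 0 = 0"
    and additive_map_minus: "g (- x) = - g x"
    and additive_map_diff: "g (x - y) = g x - g y"
proof -
  show a: "g (x + y) = g x + g y" for x y using assms by (simp add: additive_map_def)
  show z: "g 0 = 0" using a[of 0 0] by simp
  show m: "g (- x) = - g x" for x using a[of x "- x"] z by (simp add: eq_neg_iff_add_eq_0 add.commute)
  show "g (x - y) = g x - g y" using a[of x "- y"] m by simp
qed

lemma additive_map_sum: "additive_map g \<Longrightarrow> g (sum h I) = (\<Sum>i\<in>I. g (h i))"
  by (induction I rule: infinite_finite_induct) (auto simp: additive_map_zero additive_map_add)

lemma additive_map_cmul:
  fixes g :: "('b \<Rightarrow>\<^sub>0 int) \<Rightarrow> ('c \<Rightarrow>\<^sub>0 int)"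
  assumes "additive_map g"
  shows "g (frag_cmul n c) = frag_cmul n (g c)"
proof -
  have "g (frag_cmul (int k) c) = frag_cmul (int k) (g c)" for k
    by (induction k) (simp_all add: additive_map_zero[OF assms] frag_cmul_distrib additive_map_add[OF assms])
  then show ?thesis
    by (metis (no_types, opaque_lifting) frag_cmul_diff_distrib additive_map_diff[OF assms] int_diff_cases)
qed

lemma additive_map_lookup [simp]: "additive_map (\<lambda>c::'b \<Rightarrow>\<^sub>0 int. Poly_Mapping.lookup c x)"
  by (simp add: additive_map_def lookup_add)

lemma additive_map_frag_extend [simp]: "additive_map (frag_extend g)"
  by (simp add: additive_map_def frag_extend_add)

lemma additive_map_cmul' [simp]: "additive_map (frag_cmul n)"
  by (simp add: additive_map_def frag_cmul_distrib2)

lemma additive_map_id [simp]: "additive_map (\<lambda>x. x)" "additive_map id"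
  by (simp_all add: additive_map_def)

lemma additive_map_const0 [simp]: "additive_map (\<lambda>x. 0)"
  by (simp add: additive_map_def)

lemma additive_map_comp: "additive_map g \<Longrightarrow> additive_map h \<Longrightarrow> additive_map (\<lambda>x. g (h x))"
  by (simp add: additive_map_def)

lemma additive_map_plus: "additive_map g \<Longrightarrow> additive_map h \<Longrightarrow> additive_map (\<lambda>x. g x + h x)"
  by (simp add: additive_map_def)

lemma additive_map_sub: "additive_map g \<Longrightarrow> additive_map h \<Longrightarrow> additive_map (\<lambda>x. g x - h x)"
  by (simp add: additive_map_def)

lemma additive_map_uminus: "additive_map g \<Longrightarrow> additive_map (\<lambda>x. - g x)"
  by (simp add: additive_map_def)

lemma additive_map_sum_fun: "(\<And>i. i \<in> I \<Longrightarrow> additive_map (g i)) \<Longrightarrow> additive_map (\<lambda>x. \<Sum>i\<in>I. g i x)"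
  by (simp add: additive_map_def sum.distrib)

lemmas additive_intros = additive_map_comp additive_map_plus additive_map_sub additive_map_uminus
  additive_map_sum_fun

lemma additive_map_into:
  assumes "additive_map g" "additive_subset A" "\<And>\<tau>. \<tau> \<in> S \<Longrightarrow> g (frag_of \<tau>) \<in> A" "c \<in> frags S"
  shows "g c \<in> A"
  using assms(4)[unfolded frags_def, simplified]
proof (induction c rule: frag_induction)
  case zero
  then show ?case by (simp add: additive_map_zero[OF assms(1)] additive_subsetD(1)[OF assms(2)])
next
  case (diff a b)
  then show ?case by (simp add: additive_map_diff[OF assms(1)] additive_subsetD(2)[OF assms(2)])
qed (use assms(3) in auto)

lemma additive_map_eqI:
  assumes "additive_map g" "additive_map h" "\<And>\<tau>. \<tau> \<in> S \<Longrightarrow> g (frag_of \<tau>) = h (frag_of \<tau>)" "c \<in> frags S"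
  shows "g c = h c"
proof -
  have "additive_subset {0}" by (simp add: additive_subset_def)
  from additive_map_into[OF additive_map_sub[OF assms(1,2)] this _ assms(4)] assms(3)
  show ?thesis by simp
qed

lemma frags_UNIV [simp]: "c \<in> frags UNIV"
  by (simp add: frags_def)

lemma additive_subset_image:
  assumes "additive_map g" "additive_subset A"
  shows "additive_subset (g ` A)"
  unfolding additive_subset_def
proof safe
  show "0 \<in> g ` A" using additive_subsetD(1)[OF assms(2)] additive_map_zero[OF assms(1)] by (metis imageI)
  show "g x - g y \<in> g ` A" if "x \<in> A" "y \<in> A" for x y
    using that additive_subsetD(2)[OF assms(2)] additive_map_diff[OF assms(1)] by (metis imageI)
qed

text \<open>
  Families of chains are total functions, so a map of the factors in \<open>I\<close> must ignore the values outside \<open>I\<close>.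
\<close>

definition multi_additive :: "nat set \<Rightarrow> ((nat \<Rightarrow> 'b::ab_group_add) \<Rightarrow> 'c::ab_group_add) \<Rightarrow> bool" where
  "multi_additive I F \<longleftrightarrow>
     (\<forall>c. \<forall>k\<in>I. \<forall>a b. F (c(k := a + b)) = F (c(k := a)) + F (c(k := b))) \<and>
     (\<forall>c c'. (\<forall>k\<in>I. c k = c' k) \<longrightarrow> F c = F c')"

lemma multi_additive_cong: "multi_additive I F \<Longrightarrow> (\<And>k. k \<in> I \<Longrightarrow> c k = c' k) \<Longrightarrow> F c = F c'"
  unfolding multi_additive_def by blast

lemma multi_additive_slot: "multi_additive I F \<Longrightarrow> k \<in> I \<Longrightarrow> additive_map (\<lambda>a. F (c(k := a)))"
  unfolding multi_additive_def additive_map_def by blast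

text \<open>
  Identities between tensor products of chains need only be checked on tensor products of simplices:
  expand the slots one at a time.
\<close>

lemma multi_additive_into:
  fixes F :: "(nat \<Rightarrow> ('b \<Rightarrow>\<^sub>0 int)) \<Rightarrow> 'c::ab_group_add"
  assumes fin: "finite I" and F: "multi_additive I F" and A: "additive_subset A"
    and eq: "\<And>\<rho>. (\<And>k. k \<in> I \<Longrightarrow> \<rho> k \<in> S k) \<Longrightarrow> F (\<lambda>k. frag_of (\<rho> k)) \<in> A"
    and c: "\<And>k. k \<in> I \<Longrightarrow> c k \<in> frags (S k)"
  shows "F c \<in> A"
proof -
  have "F c \<in> A" if "finite J" "J \<subseteq> I" "\<And>k. k \<in> I \<Longrightarrow> c k \<in> frags (S k)"
    "\<And>k. k \<in> I - J \<Longrightarrow> \<exists>\<rho>\<in>S k. c k = frag_of \<rho>" for J c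
    using that
  proof (induction J arbitrary: c rule: finite_induct)
    case empty
    then have "\<forall>k\<in>I. \<exists>\<rho>\<in>S k. c k = frag_of \<rho>" by auto
    then obtain \<rho> where \<rho>: "\<forall>k\<in>I. \<rho> k \<in> S k \<and> c k = frag_of (\<rho> k)" unfolding Bex_def by (rule bchoice[THEN exE])
    have "F c = F (\<lambda>k. frag_of (\<rho> k))" by (rule multi_additive_cong[OF F]) (use \<rho> in auto)
    also have "\<dots> \<in> A" by (rule eq) (use \<rho> in auto)
    finally show ?case .
  next
    case (insert j J)
    have jI: "j \<in> I" using insert by auto
    have "F (c(j := a)) \<in> A" if "a \<in> frags (S j)" for a
    proof (rule additive_map_into[OF multi_additive_slot[OF F jI] A _ that])
      fix \<tau> assume "\<tau> \<in> S j"
      then show "F (c(j := frag_of \<tau>)) \<in> A"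
        by (intro insert.IH) (use insert.prems in auto)
    qed
    from this[of "c j"] show ?case using insert.prems jI by auto
  qed
  from this[of I c] show ?thesis using fin c by blast
qed

lemma multi_additive_eqI:
  fixes F G :: "(nat \<Rightarrow> ('b \<Rightarrow>\<^sub>0 int)) \<Rightarrow> 'c::ab_group_add"
  assumes fin: "finite I" and F: "multi_additive I F" and G: "multi_additive I G"
    and eq: "\<And>\<rho>. (\<And>k. k \<in> I \<Longrightarrow> \<rho> k \<in> S k) \<Longrightarrow> F (\<lambda>k. frag_of (\<rho> k)) = G (\<lambda>k. frag_of (\<rho> k))"
    and c: "\<And>k. k \<in> I \<Longrightarrow> c k \<in> frags (S k)"
  shows "F c = G c"
proof -
  have m: "multi_additive I (\<lambda>c. F c - G c)"
    unfolding multi_additive_def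
  proof (intro conjI allI ballI impI)
    fix c k a b assume k: "k \<in> I"
    show "F (c(k := a + b)) - G (c(k := a + b)) = F (c(k := a)) - G (c(k := a)) + (F (c(k := b)) - G (c(k := b)))"
      using F G k by (simp add: multi_additive_def)
  next
    fix c c' :: "nat \<Rightarrow> ('b \<Rightarrow>\<^sub>0 int)" assume "\<forall>k\<in>I. c k = c' k"
    then show "F c - G c = F c' - G c'"
      using multi_additive_cong[OF F, of c c'] multi_additive_cong[OF G, of c c'] by simp
  qed
  have "F c - G c \<in> {0}"
    by (rule multi_additive_into[OF fin m _ _ c]) (use eq in \<open>auto simp: additive_subset_def\<close>)
  then show ?thesis by simp
qed

lemma multi_additive_comp_slots:
  fixes g :: "nat \<Rightarrow> 'd::ab_group_add \<Rightarrow> 'b::ab_group_add"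
  assumes "multi_additive I F" "\<And>k. k \<in> I \<Longrightarrow> additive_map (g k)"
  shows "multi_additive I (\<lambda>c. F (\<lambda>k. g k (c k)))"
  unfolding multi_additive_def
proof (intro conjI allI ballI impI)
  fix c k a b assume k: "k \<in> I"
  have *: "(\<lambda>i. g i ((c(k := x)) i)) = (\<lambda>i. g i (c i))(k := g k x)" for x by auto
  show "F (\<lambda>i. g i ((c(k := a + b)) i)) = F (\<lambda>i. g i ((c(k := a)) i)) + F (\<lambda>i. g i ((c(k := b)) i))"
    unfolding * additive_map_add[OF assms(2)[OF k]]
    using assms(1) k by (simp add: multi_additive_def)
next
  fix c c' :: "nat \<Rightarrow> 'd" assume "\<forall>k\<in>I. c k = c' k"
  then show "F (\<lambda>k. g k (c k)) = F (\<lambda>k. g k (c' k))"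
    by (intro multi_additive_cong[OF assms(1)]) auto
qed

lemma multi_additive_post:
  assumes "multi_additive I F" "additive_map h"
  shows "multi_additive I (\<lambda>c. h (F c))"
  using assms unfolding multi_additive_def additive_map_def by metis

lemma multi_additive_sum:
  fixes F :: "'j \<Rightarrow> (nat \<Rightarrow> 'd::ab_group_add) \<Rightarrow> 'b::ab_group_add"
  assumes "\<And>j. j \<in> J \<Longrightarrow> multi_additive I (F j)"
  shows "multi_additive I (\<lambda>c. \<Sum>j\<in>J. F j c)"
  unfolding multi_additive_def
proof (intro conjI allI ballI impI)
  fix c k a b assume k: "k \<in> I"
  show "(\<Sum>j\<in>J. F j (c(k := a + b))) = (\<Sum>j\<in>J. F j (c(k := a))) + (\<Sum>j\<in>J. F j (c(k := b)))"
    unfolding sum.distrib[symmetric]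
    by (rule sum.cong) (use assms k in \<open>auto simp: multi_additive_def\<close>)
next
  fix c c' :: "nat \<Rightarrow> 'd" assume "\<forall>k\<in>I. c k = c' k"
  then show "(\<Sum>j\<in>J. F j c) = (\<Sum>j\<in>J. F j c')"
    by (intro sum.cong refl multi_additive_cong[OF assms]) auto
qed

lemma multi_additive_prod:
  fixes l :: "nat \<Rightarrow> 'b::ab_group_add \<Rightarrow> int"
  assumes "finite I" "\<And>k. k \<in> I \<Longrightarrow> additive_map (l k)"
  shows "multi_additive I (\<lambda>c. \<Prod>k\<in>I. l k (c k))"
  unfolding multi_additive_def
proof (intro conjI allI ballI impI)
  fix c k a b assume k: "k \<in> I"
  have *: "(\<Prod>i\<in>I. l i ((c(k := x)) i)) = l k x * (\<Prod>i\<in>I - {k}. l i (c i))" for x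
    by (subst prod.remove[OF assms(1) k]) (auto intro!: prod.cong)
  show "(\<Prod>i\<in>I. l i ((c(k := a + b)) i)) = (\<Prod>i\<in>I. l i ((c(k := a)) i)) + (\<Prod>i\<in>I. l i ((c(k := b)) i))"
    unfolding * additive_map_add[OF assms(2)[OF k]] by (simp add: distrib_right)
qed (auto intro!: prod.cong)

section \<open>Tensor products of chains on disjoint blocks\<close>

lemma join_chain_supset:
  assumes "finite I" "\<And>k. k \<in> I \<Longrightarrow> finite (S k)" "\<And>k. k \<in> I \<Longrightarrow> Poly_Mapping.keys (c k) \<subseteq> S k"
  shows "join_chain I c = (\<Sum>\<rho>\<in>(\<Pi>\<^sub>E k\<in>I. S k).
     frag_cmul (\<Prod>k\<in>I. Poly_Mapping.lookup (c k) (\<rho> k)) (frag_of (Sigma I \<rho>)))"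
  unfolding join_chain_def
proof (rule sum.mono_neutral_left)
  show "finite (Pi\<^sub>E I S)" using assms by (auto intro: finite_PiE)
  show "(\<Pi>\<^sub>E k\<in>I. Poly_Mapping.keys (c k)) \<subseteq> Pi\<^sub>E I S" using assms(3) by (intro PiE_mono)
  show "\<forall>\<rho>\<in>Pi\<^sub>E I S - (\<Pi>\<^sub>E k\<in>I. Poly_Mapping.keys (c k)).
     frag_cmul (\<Prod>k\<in>I. Poly_Mapping.lookup (c k) (\<rho> k)) (frag_of (Sigma I \<rho>)) = 0"
  proof
    fix \<rho> assume "\<rho> \<in> Pi\<^sub>E I S - (\<Pi>\<^sub>E k\<in>I. Poly_Mapping.keys (c k))"
    then obtain k where "k \<in> I" "\<rho> k \<notin> Poly_Mapping.keys (c k)" by (auto simp: PiE_iff)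
    then have "(\<Prod>k\<in>I. Poly_Mapping.lookup (c k) (\<rho> k)) = 0"
      using assms(1) by (auto simp: in_keys_iff)
    then show "frag_cmul (\<Prod>k\<in>I. Poly_Mapping.lookup (c k) (\<rho> k)) (frag_of (Sigma I \<rho>)) = 0" by simp
  qed
qed

lemma multi_additive_join_chain [simp]:
  assumes "finite I"
  shows "multi_additive I (join_chain I)"
  unfolding multi_additive_def
proof (intro conjI allI ballI impI)
  fix c :: "nat \<Rightarrow> ('b set \<Rightarrow>\<^sub>0 int)" and k and a b :: "'b set \<Rightarrow>\<^sub>0 int" assume k: "k \<in> I"
  let ?S = "\<lambda>i. Poly_Mapping.keys (c i) \<union> Poly_Mapping.keys a \<union> Poly_Mapping.keys b"
  have *: "join_chain I (c(k := x)) = (\<Sum>\<rho>\<in>(\<Pi>\<^sub>E k\<in>I. ?S k).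
     frag_cmul (Poly_Mapping.lookup x (\<rho> k) * (\<Prod>i\<in>I - {k}. Poly_Mapping.lookup (c i) (\<rho> i))) (frag_of (Sigma I \<rho>)))"
    if "Poly_Mapping.keys x \<subseteq> ?S k" for x
  proof (subst join_chain_supset[OF assms, of ?S])
    fix \<rho>
    have "(\<Prod>i\<in>I. Poly_Mapping.lookup ((c(k := x)) i) (\<rho> i))
       = Poly_Mapping.lookup x (\<rho> k) * (\<Prod>i\<in>I - {k}. Poly_Mapping.lookup (c i) (\<rho> i))" for \<rho>
      by (subst prod.remove[OF assms k]) (auto intro!: prod.cong)
    then show "(\<Sum>\<rho>\<in>Pi\<^sub>E I ?S. frag_cmul (\<Prod>i\<in>I. Poly_Mapping.lookup ((c(k := x)) i) (\<rho> i)) (frag_of (Sigma I \<rho>)))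
      = (\<Sum>\<rho>\<in>Pi\<^sub>E I ?S. frag_cmul (Poly_Mapping.lookup x (\<rho> k) *
            (\<Prod>i\<in>I - {k}. Poly_Mapping.lookup (c i) (\<rho> i))) (frag_of (Sigma I \<rho>)))"
      by simp
  qed (use that in auto)
  show "join_chain I (c(k := a + b)) = join_chain I (c(k := a)) + join_chain I (c(k := b))"
  proof -
    have 1: "Poly_Mapping.keys (a + b) \<subseteq> ?S k" using keys_add[of a b] by auto
    have 2: "Poly_Mapping.keys a \<subseteq> ?S k" "Poly_Mapping.keys b \<subseteq> ?S k" by auto
    show ?thesis
      unfolding *[OF 1] *[OF 2(1)] *[OF 2(2)] sum.distrib[symmetric]
      by (simp only: lookup_add distrib_right frag_cmul_distrib)
  qed
next
  fix c c' :: "nat \<Rightarrow> ('b set \<Rightarrow>\<^sub>0 int)" assume eq: "\<forall>k\<in>I. c k = c' k"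
  have "(\<Pi>\<^sub>E k\<in>I. Poly_Mapping.keys (c k)) = (\<Pi>\<^sub>E k\<in>I. Poly_Mapping.keys (c' k))"
    using eq by (intro PiE_cong) auto
  then show "join_chain I c = join_chain I c'"
    unfolding join_chain_def using eq by (auto intro!: sum.cong arg_cong2[where f = frag_cmul] prod.cong)
qed

lemma PiE_singleton_restrict: "(\<Pi>\<^sub>E k\<in>I. {\<rho> k}) = {restrict \<rho> I}"
proof -
  have "(\<Pi>\<^sub>E k\<in>I. {\<rho> k}) = (\<Pi>\<^sub>E k\<in>I. {restrict \<rho> I k})" by (intro PiE_cong) auto
  also have "\<dots> = {restrict \<rho> I}" by (rule PiE_singleton) (rule restrict_extensional)
  finally show ?thesis .
qed

lemma join_chain_frag_of:
  assumes "finite I" shows "join_chain I (\<lambda>k. frag_of (\<rho> k)) = frag_of (Sigma I \<rho>)"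
proof -
  have e: "(\<Pi>\<^sub>E k\<in>I. {\<rho> k}) = {restrict \<rho> I}"
    by (rule PiE_singleton_restrict)
  have "Sigma I (restrict \<rho> I) = Sigma I \<rho>" by auto
  then show ?thesis unfolding join_chain_def by (simp add: e)
qed

definition slice :: "(nat \<times> 'a) set \<Rightarrow> nat \<Rightarrow> 'a set" where
  "slice \<eta> k = {v. (k, v) \<in> \<eta>}"

lemma slice_Sigma [simp]: "k \<in> I \<Longrightarrow> slice (Sigma I \<rho>) k = \<rho> k"
  by (auto simp: slice_def)

lemma Sigma_slice: "\<eta> \<subseteq> Sigma I D \<Longrightarrow> Sigma I (slice \<eta>) = \<eta>"
  by (auto simp: slice_def)

text \<open>
  The tensor product of linear maps on the blocks without Koszul signs; these are inserted explicitly, by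
  letting the sign \<open>(-1) ^ deg\<close> act on the preceding blocks.
\<close>

definition tensor_op :: "nat set \<Rightarrow> (nat \<Rightarrow> ('a set \<Rightarrow>\<^sub>0 int) \<Rightarrow> ('b set \<Rightarrow>\<^sub>0 int))
    \<Rightarrow> ((nat \<times> 'a) set \<Rightarrow>\<^sub>0 int) \<Rightarrow> ((nat \<times> 'b) set \<Rightarrow>\<^sub>0 int)" where
  "tensor_op I g = frag_extend (\<lambda>\<eta>. join_chain I (\<lambda>k. g k (frag_of (slice \<eta> k))))"

lemma additive_map_tensor_op [simp]: "additive_map (tensor_op I g)"
  by (simp add: tensor_op_def)

lemmas tensor_op_simps = additive_map_zero[OF additive_map_tensor_op] additive_map_add[OF additive_map_tensor_op]
  additive_map_diff[OF additive_map_tensor_op] additive_map_minus[OF additive_map_tensor_op]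
  additive_map_cmul[OF additive_map_tensor_op] additive_map_sum[OF additive_map_tensor_op]

declare additive_map_add[OF additive_map_tensor_op, additive_dist]

lemma join_chain_cong: "finite I \<Longrightarrow> (\<And>k. k \<in> I \<Longrightarrow> c k = c' k) \<Longrightarrow> join_chain I c = join_chain I c'"
  using multi_additive_cong[OF multi_additive_join_chain] by blast

lemma tensor_op_join_chain:
  assumes "finite I" "\<And>k. k \<in> I \<Longrightarrow> additive_map (g k)"
  shows "tensor_op I g (join_chain I c) = join_chain I (\<lambda>k. g k (c k))"
proof (rule multi_additive_eqI[OF assms(1), where S = "\<lambda>_. UNIV" and c = c
      and F = "\<lambda>c. tensor_op I g (join_chain I c)" and G = "\<lambda>c. join_chain I (\<lambda>k. g k (c k))"])
  show "multi_additive I (\<lambda>a. tensor_op I g (join_chain I a))"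
    by (rule multi_additive_post[OF multi_additive_join_chain[OF assms(1)] additive_map_tensor_op])
  show "multi_additive I (\<lambda>a. join_chain I (\<lambda>k. g k (a k)))"
    by (rule multi_additive_comp_slots[OF multi_additive_join_chain[OF assms(1)] assms(2)])
  show "tensor_op I g (join_chain I (\<lambda>k. frag_of (\<rho> k))) = join_chain I (\<lambda>k. g k (frag_of (\<rho> k)))" for \<rho>
    by (simp add: join_chain_frag_of assms(1) tensor_op_def) (auto intro!: join_chain_cong[OF assms(1)])
qed simp

lemma tensor_op_comp:
  assumes "finite I" "\<And>k. k \<in> I \<Longrightarrow> additive_map (g k)"
  shows "tensor_op I g (tensor_op I h c) = tensor_op I (\<lambda>k x. g k (h k x)) c"
proof (rule additive_map_eqI[where S = UNIV and c = c and g = "\<lambda>c. tensor_op I g (tensor_op I h c)"])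
  show "tensor_op I g (tensor_op I h (frag_of \<tau>)) = tensor_op I (\<lambda>k x. g k (h k x)) (frag_of \<tau>)" for \<tau>
    unfolding tensor_op_def[of I h] tensor_op_def[of I "\<lambda>k x. g k (h k x)"]
    by (simp add: tensor_op_join_chain[OF assms])
qed (simp_all add: additive_map_def additive_dist)

lemma join_chain_in_frags:
  assumes "finite I" "\<And>k. k \<in> I \<Longrightarrow> c k \<in> frags (S k)"
    and "\<And>\<rho>. (\<And>k. k \<in> I \<Longrightarrow> \<rho> k \<in> S k) \<Longrightarrow> Sigma I \<rho> \<in> Z"
  shows "join_chain I c \<in> frags Z"
  by (rule multi_additive_into[where F = "join_chain I" and S = S])
     (use assms in \<open>auto simp: join_chain_frag_of\<close>)

lemma join_chain_upd_add: "finite I \<Longrightarrow> k \<in> I \<Longrightarrow>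
    join_chain I (c(k := a + b)) = join_chain I (c(k := a)) + join_chain I (c(k := b))"
  using multi_additive_join_chain[of I] unfolding multi_additive_def by blast

lemma join_chain_zero:
  assumes "finite I" "k \<in> I" "c k = 0" shows "join_chain I c = 0"
  using additive_map_zero[OF multi_additive_slot[OF multi_additive_join_chain[OF assms(1)] assms(2)], of c]
  by (simp flip: assms(3))

lemma join_chain_scale:
  assumes "finite I"
  shows "join_chain I (\<lambda>k. frag_cmul (a k) (c k)) = frag_cmul (\<Prod>k\<in>I. a k) (join_chain I c)"
proof (rule multi_additive_eqI[OF assms, where S = "\<lambda>_. UNIV" and c = c
      and F = "\<lambda>c. join_chain I (\<lambda>k. frag_cmul (a k) (c k))"
      and G = "\<lambda>c. frag_cmul (\<Prod>k\<in>I. a k) (join_chain I c)"])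
  show "multi_additive I (\<lambda>c. join_chain I (\<lambda>k. frag_cmul (a k) (c k)))"
    by (rule multi_additive_comp_slots) (use assms in auto)
  show "multi_additive I (\<lambda>c. frag_cmul (\<Prod>k\<in>I. a k) (join_chain I c))"
    by (rule multi_additive_post) (use assms in auto)
  fix \<rho> :: "nat \<Rightarrow> 'b set"
  have "join_chain I (\<lambda>k. frag_cmul (a k) (frag_of (\<rho> k))) = (\<Sum>\<rho>'\<in>(\<Pi>\<^sub>E k\<in>I. {\<rho> k}).
     frag_cmul (\<Prod>k\<in>I. Poly_Mapping.lookup (frag_cmul (a k) (frag_of (\<rho> k))) (\<rho>' k)) (frag_of (Sigma I \<rho>')))"
    by (rule join_chain_supset) (use assms in \<open>auto simp: in_keys_iff split: if_splits\<close>)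
  also have "(\<Pi>\<^sub>E k\<in>I. {\<rho> k}) = {restrict \<rho> I}"
    by (rule PiE_singleton_restrict)
  also have "(\<Sum>\<rho>'\<in>{restrict \<rho> I}.
     frag_cmul (\<Prod>k\<in>I. Poly_Mapping.lookup (frag_cmul (a k) (frag_of (\<rho> k))) (\<rho>' k)) (frag_of (Sigma I \<rho>')))
     = frag_cmul (\<Prod>k\<in>I. a k) (frag_of (Sigma I \<rho>))"
    by (auto intro!: arg_cong2[where f = frag_cmul] arg_cong[where f = frag_of] prod.cong)
  finally show "join_chain I (\<lambda>k. frag_cmul (a k) (frag_of (\<rho> k))) = frag_cmul (\<Prod>k\<in>I. a k) (join_chain I (\<lambda>k. frag_of (\<rho> k)))"
    by (simp add: join_chain_frag_of[OF assms])
qed simp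

lemma join_chain_sum:
  assumes "finite I" "\<And>k. k \<in> I \<Longrightarrow> finite (J k)"
  shows "join_chain I (\<lambda>k. \<Sum>i\<in>J k. c k i) = (\<Sum>j\<in>(\<Pi>\<^sub>E k\<in>I. J k). join_chain I (\<lambda>k. c k (j k)))"
proof -
  have "join_chain I (\<lambda>k. if k \<in> A then \<Sum>i\<in>J k. c k i else d k) =
     (\<Sum>j\<in>(\<Pi>\<^sub>E k\<in>A. J k). join_chain I (\<lambda>k. if k \<in> A then c k (j k) else d k))" if "finite A" "A \<subseteq> I" for A d
    using that
  proof (induction A arbitrary: d rule: finite_induct)
    case (insert a A)
    have aI: "a \<in> I" using insert by auto
    have "join_chain I (\<lambda>k. if k \<in> insert a A then \<Sum>i\<in>J k. c k i else d k)
      = join_chain I ((\<lambda>k. if k \<in> A then \<Sum>i\<in>J k. c k i else d k)(a := \<Sum>i\<in>J a. c a i))"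
      using insert.hyps by (intro join_chain_cong assms(1)) auto
    also have "\<dots> = (\<Sum>i\<in>J a. join_chain I ((\<lambda>k. if k \<in> A then \<Sum>i\<in>J k. c k i else d k)(a := c a i)))"
      by (rule additive_map_sum[OF multi_additive_slot[OF multi_additive_join_chain[OF assms(1)] aI]])
    also have "\<dots> = (\<Sum>i\<in>J a. join_chain I (\<lambda>k. if k \<in> A then \<Sum>i\<in>J k. c k i else (d(a := c a i)) k))"
      using insert.hyps by (intro sum.cong join_chain_cong assms(1) refl) auto
    also have "\<dots> = (\<Sum>i\<in>J a. \<Sum>j\<in>(\<Pi>\<^sub>E k\<in>A. J k). join_chain I (\<lambda>k. if k \<in> A then c k (j k) else (d(a := c a i)) k))"
      using insert by auto
    also have "\<dots> = (\<Sum>(i, j)\<in>J a \<times> (\<Pi>\<^sub>E k\<in>A. J k). join_chain I (\<lambda>k. if k \<in> insert a A then c k ((j(a := i)) k) else d k))"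
      unfolding sum.cartesian_product
      using insert.hyps by (intro sum.cong refl) (auto intro!: join_chain_cong assms(1))
    also have "\<dots> = (\<Sum>j\<in>(\<Pi>\<^sub>E k\<in>insert a A. J k). join_chain I (\<lambda>k. if k \<in> insert a A then c k (j k) else d k))"
      unfolding PiE_insert_eq
      by (subst sum.reindex[OF inj_combinator[OF insert.hyps(2)]]) (simp add: case_prod_unfold comp_def)
    finally show ?case .
  qed simp
  from this[OF assms(1) order_refl, of "\<lambda>_. 0"] show ?thesis
    by (simp cong: join_chain_cong[OF assms(1)])
qed

section \<open>Boundaries, signs and cones\<close>

definition down_closed :: "'a set set \<Rightarrow> bool" where
  "down_closed X \<longleftrightarrow> (\<forall>\<tau>\<in>X. \<forall>\<rho>. \<rho> \<subseteq> \<tau> \<longrightarrow> \<rho> \<in> X)"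

definition incidence :: "'a::linorder \<Rightarrow> 'a set \<Rightarrow> int" where
  "incidence v \<tau> = (-1) ^ card {u \<in> \<tau>. u < v}"

abbreviation eps :: "nat \<Rightarrow> ('a set \<Rightarrow>\<^sub>0 int) \<Rightarrow> ('a set \<Rightarrow>\<^sub>0 int)" where
  "eps n \<equiv> graded_sign n card"

lemma incidence_square [simp]: "incidence v \<tau> * incidence v \<tau> = 1"
  by (simp add: incidence_def flip: power_mult_distrib)

lemma incidence_insert_self: "incidence v (insert v \<tau>) = incidence v \<tau>"
  unfolding incidence_def by (rule arg_cong[where f = "\<lambda>A. (-1) ^ card A"]) auto

lemma incidence_diff_self: "incidence v (\<tau> - {v}) = incidence v \<tau>"
  unfolding incidence_def by (rule arg_cong[where f = "\<lambda>A. (-1) ^ card A"]) auto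

lemma incidence_insert:
  assumes "finite \<tau>" "v \<notin> \<tau>"
  shows "incidence u (insert v \<tau>) = (if v < u then - incidence u \<tau> else incidence u \<tau>)"
proof -
  have "{x \<in> insert v \<tau>. x < u} = (if v < u then insert v {x \<in> \<tau>. x < u} else {x \<in> \<tau>. x < u})" by auto
  then show ?thesis using assms by (auto simp: incidence_def)
qed

lemma boundary_frag_of: "boundary (frag_of \<tau>) = (\<Sum>v\<in>\<tau>. frag_cmul (incidence v \<tau>) (frag_of (\<tau> - {v})))"
  by (simp add: boundary_def incidence_def)

lemma additive_map_boundary [simp]: "additive_map boundary"
  by (simp add: boundary_def)

lemma additive_map_graded_sign [simp]: "additive_map (graded_sign n deg)"
  by (simp add: graded_sign_def)

lemmas boundary_simps = additive_map_zero[OF additive_map_boundary] additive_map_add[OF additive_map_boundary]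
  additive_map_diff[OF additive_map_boundary] additive_map_minus[OF additive_map_boundary]
  additive_map_cmul[OF additive_map_boundary] additive_map_sum[OF additive_map_boundary]

declare additive_map_add[OF additive_map_boundary, additive_dist]

lemmas graded_sign_simps = additive_map_zero[OF additive_map_graded_sign] additive_map_add[OF additive_map_graded_sign]
  additive_map_diff[OF additive_map_graded_sign] additive_map_minus[OF additive_map_graded_sign]
  additive_map_cmul[OF additive_map_graded_sign] additive_map_sum[OF additive_map_graded_sign]

declare additive_map_add[OF additive_map_graded_sign, additive_dist]

lemma graded_sign_of: "graded_sign n deg (frag_of \<tau>) = frag_cmul ((-1) ^ (n * deg \<tau>)) (frag_of \<tau>)"
  by (simp add: graded_sign_def)

lemma graded_sign_frags: "c \<in> frags S \<Longrightarrow> graded_sign n deg c \<in> frags S"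
  by (rule additive_map_into[where S = S and c = c and g = "graded_sign n deg"]) (auto simp: graded_sign_of intro!: frags_cmul)

lemma graded_sign_comp: "graded_sign n deg (graded_sign k deg c) = graded_sign (n + k) deg c"
  by (rule additive_map_eqI[where S = UNIV and c = c and g = "\<lambda>c. graded_sign n deg (graded_sign k deg c)"])
     (auto simp: additive_map_def additive_dist graded_sign_of graded_sign_simps power_add algebra_simps)

lemma graded_sign_even: "even n \<Longrightarrow> graded_sign n deg c = c"
  by (rule additive_map_eqI[where S = UNIV and c = c and h = "\<lambda>c. c"]) (auto simp: graded_sign_of)

lemma graded_sign_parity:
  assumes "even (n + k)" shows "graded_sign n deg c = graded_sign k deg c"
proof -
  have "graded_sign n deg c = graded_sign n deg (graded_sign (k + k) deg c)"
    by (simp add: graded_sign_even)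
  also have "\<dots> = graded_sign ((n + k) + k) deg c"
    by (simp add: graded_sign_comp add.assoc)
  also have "\<dots> = graded_sign (n + k) deg (graded_sign k deg c)"
    by (simp add: graded_sign_comp)
  finally show ?thesis using assms by (simp add: graded_sign_even)
qed

lemma graded_sign_shift: "graded_sign n (\<lambda>\<tau>. card \<tau> + 1) c = frag_cmul ((-1) ^ n) (eps n c)"
  by (rule additive_map_eqI[where S = UNIV and c = c and h = "\<lambda>c. frag_cmul ((-1) ^ n) (eps n c)"])
     (auto simp: additive_map_def additive_dist graded_sign_of power_add)

lemma boundary_eps: "boundary (eps n c) = frag_cmul ((-1) ^ n) (eps n (boundary c))"
proof (rule additive_map_eqI[where S = UNIV and c = c and g = "\<lambda>c. boundary (eps n c)"
      and h = "\<lambda>c. frag_cmul ((-1) ^ n) (eps n (boundary c))"])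
  fix \<tau> :: "'a set"
  show "boundary (eps n (frag_of \<tau>)) = frag_cmul ((-1) ^ n) (eps n (boundary (frag_of \<tau>)))"
  proof (cases "finite \<tau>")
    case True
    have "(-1) ^ (n * card \<tau>) = (-1 :: int) ^ n * (-1) ^ (n * card (\<tau> - {v}))" if "v \<in> \<tau>" for v
      using True that by (simp add: card_Suc_Diff1[OF True that, symmetric] power_add del: card_Diff_insert)
    then show ?thesis
      by (auto simp: graded_sign_of graded_sign_simps boundary_simps boundary_frag_of frag_cmul_sum ac_simps
          intro!: sum.cong)
  qed (simp add: graded_sign_of boundary_simps graded_sign_simps boundary_frag_of)
qed (simp_all add: additive_map_def additive_dist)

lemma eps_boundary: "eps n (boundary c) = frag_cmul ((-1) ^ n) (boundary (eps n c))"
  by (simp add: boundary_eps flip: power_mult_distrib)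

lemma boundary_frags:
  assumes "down_closed X" "c \<in> frags X" shows "boundary c \<in> frags X"
  by (rule additive_map_into[OF _ _ _ assms(2)])
     (use assms(1) in \<open>auto simp: boundary_frag_of down_closed_def intro!: frags_sum frags_cmul\<close>)

text \<open>Joining with a vertex \<open>v\<close>; on finite sets this contracts the augmented chain complex.\<close>

definition cone :: "'a::linorder \<Rightarrow> ('a set \<Rightarrow>\<^sub>0 int) \<Rightarrow> ('a set \<Rightarrow>\<^sub>0 int)" where
  "cone v = frag_extend (\<lambda>\<eta>. if v \<in> \<eta> then 0 else frag_cmul (incidence v \<eta>) (frag_of (insert v \<eta>)))"

lemma additive_map_cone [simp]: "additive_map (cone v)"
  by (simp add: cone_def)

lemmas cone_simps = additive_map_zero[OF additive_map_cone] additive_map_add[OF additive_map_cone]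
  additive_map_diff[OF additive_map_cone] additive_map_minus[OF additive_map_cone]
  additive_map_cmul[OF additive_map_cone] additive_map_sum[OF additive_map_cone]

declare additive_map_add[OF additive_map_cone, additive_dist]

lemma cone_of: "cone v (frag_of \<eta>) = (if v \<in> \<eta> then 0 else frag_cmul (incidence v \<eta>) (frag_of (insert v \<eta>)))"
  by (simp add: cone_def)

lemma cone_homotopy_of:
  assumes "finite \<eta>"
  shows "boundary (cone v (frag_of \<eta>)) + cone v (boundary (frag_of \<eta>)) = frag_of \<eta>"
proof (cases "v \<in> \<eta>")
  case True
  have "cone v (boundary (frag_of \<eta>)) = (\<Sum>u\<in>\<eta>. frag_cmul (incidence u \<eta>) (cone v (frag_of (\<eta> - {u}))))"
    by (simp add: boundary_frag_of cone_simps)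
  also have "\<dots> = (\<Sum>u\<in>\<eta>. if u = v then frag_of \<eta> else 0)"
    using True by (intro sum.cong refl) (auto simp: cone_of insert_absorb incidence_diff_self)
  finally show ?thesis using True assms by (simp add: cone_of boundary_simps)
next
  case False
  have "boundary (cone v (frag_of \<eta>)) = frag_cmul (incidence v \<eta>) (boundary (frag_of (insert v \<eta>)))"
    using False by (simp add: cone_of boundary_simps)
  also have "\<dots> = frag_of \<eta> + (\<Sum>u\<in>\<eta>. frag_cmul (incidence v \<eta> * incidence u (insert v \<eta>)) (frag_of (insert v \<eta> - {u})))"
    using assms False by (simp add: boundary_frag_of incidence_insert_self frag_cmul_distrib2 frag_cmul_sum)
  finally have 1: "boundary (cone v (frag_of \<eta>)) = \<dots>" .
  have "cone v (boundary (frag_of \<eta>)) = (\<Sum>u\<in>\<eta>. frag_cmul (incidence u \<eta>) (cone v (frag_of (\<eta> - {u}))))"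
    by (simp add: boundary_frag_of cone_simps)
  also have "\<dots> = (\<Sum>u\<in>\<eta>. - frag_cmul (incidence v \<eta> * incidence u (insert v \<eta>)) (frag_of (insert v \<eta> - {u})))"
  proof (rule sum.cong[OF refl])
    fix u assume u: "u \<in> \<eta>"
    have uv: "u \<noteq> v" using u False by auto
    have "incidence v \<eta> = incidence v (insert u (\<eta> - {u}))" using u by (simp add: insert_absorb)
    also have "\<dots> = (if u < v then - incidence v (\<eta> - {u}) else incidence v (\<eta> - {u}))"
      using assms by (intro incidence_insert) auto
    finally have v: "incidence v \<eta> = \<dots>" .
    consider "u < v" "\<not> v < u" | "\<not> u < v" "v < u" using uv by (metis neq_iff order.asym)
    then have "incidence v \<eta> * incidence u (insert v \<eta>) = - (incidence u \<eta> * incidence v (\<eta> - {u}))"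
      by cases (simp_all only: v incidence_insert[OF assms False, of u] if_True if_False mult_minus_left mult_minus_right mult.commute)
    moreover have "insert v \<eta> - {u} = insert v (\<eta> - {u})" using uv by auto
    ultimately show "frag_cmul (incidence u \<eta>) (cone v (frag_of (\<eta> - {u}))) =
      - frag_cmul (incidence v \<eta> * incidence u (insert v \<eta>)) (frag_of (insert v \<eta> - {u}))"
      using False by (simp add: cone_of)
  qed
  finally show ?thesis by (simp only: 1) (simp del: minus_frag_cmul add: sum_negf)
qed

lemma cone_homotopy:
  assumes "c \<in> frags {\<tau>. finite \<tau>}"
  shows "boundary (cone v c) + cone v (boundary c) = c"
  by (rule additive_map_eqI[OF _ _ _ assms, where g = "\<lambda>c. boundary (cone v c) + cone v (boundary c)" and h = "\<lambda>c. c"])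
     (auto simp: additive_map_def additive_dist cone_homotopy_of)

lemma cone_eps: "c \<in> frags {\<tau>. finite \<tau>} \<Longrightarrow> cone v (eps 1 c) = - eps 1 (cone v c)"
  by (rule additive_map_eqI[where S = "{\<tau>. finite \<tau>}" and c = c and g = "\<lambda>c. cone v (eps 1 c)" and h = "\<lambda>c. - eps 1 (cone v c)"])
     (auto simp: additive_map_def additive_dist cone_of graded_sign_of cone_simps graded_sign_simps mult.commute)

text \<open>
  Since \<open>cone v\<close> is a contraction, \<open>boundary (boundary (cone v c)) = cone v (boundary (boundary c))\<close>,
  so \<open>boundary \<circ> boundary = 0\<close> follows by induction on the number of vertices.
\<close>

lemma boundary_boundary [simp]: "boundary (boundary c) = 0"
proof (rule additive_map_eqI[where S = UNIV and c = c and g = "\<lambda>c. boundary (boundary c)" and h = "\<lambda>c. 0"])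
  fix \<tau> :: "'a set"
  show "boundary (boundary (frag_of \<tau>)) = 0"
  proof (cases "finite \<tau>")
    case True
    then show ?thesis
    proof (induction \<tau> rule: finite_induct)
      case (insert v \<tau>)
      let ?c = "frag_of \<tau>"
      have fin: "?c \<in> frags {\<tau>. finite \<tau>}" using insert by simp
      have fin': "boundary ?c \<in> frags {\<tau>. finite \<tau>}"
        by (rule boundary_frags[OF _ fin]) (auto simp: down_closed_def intro: finite_subset)
      have 1: "boundary (cone v ?c) = ?c - cone v (boundary ?c)"
        using cone_homotopy[OF fin, of v] by (simp add: algebra_simps)
      have 2: "boundary (cone v (boundary ?c)) = boundary ?c"
        using cone_homotopy[OF fin', of v] insert.IH by (simp add: cone_simps)
      have 3: "frag_of (insert v \<tau>) = frag_cmul (incidence v \<tau>) (cone v ?c)"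
        using insert by (simp add: cone_of)
      show ?case unfolding 3 by (simp add: boundary_simps 1 2)
    qed (simp add: boundary_frag_of boundary_simps)
  qed (simp add: boundary_frag_of boundary_simps)
qed (simp_all add: additive_map_def additive_dist)

lemma frags_finite: "finite D \<Longrightarrow> c \<in> frags (Pow D) \<Longrightarrow> c \<in> frags {\<tau>. finite \<tau>}"
  by (rule frags_mono) (auto intro: finite_subset)

lemma down_closed_Pow [simp]: "down_closed (Pow D)"
  by (auto simp: down_closed_def)

lemma cone_frags: "v \<in> D \<Longrightarrow> c \<in> frags (Pow D) \<Longrightarrow> cone v c \<in> frags (Pow D)"
  by (rule additive_map_into[where S = "Pow D" and c = c and g = "cone v"]) (auto simp: cone_of intro!: frags_cmul fragsD(1))

text \<open>The cone with apex any vertex of \<open>D\<close> bounds the cycle.\<close>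

lemma simplex_acyclic:
  assumes "finite D" "D \<noteq> {}" "c \<in> frags (Pow D)" "boundary c = 0"
  obtains d where "d \<in> frags (Pow D)" "boundary d = c"
proof -
  obtain v where v: "v \<in> D" using assms by auto
  show ?thesis
    using that[of "cone v c"] cone_frags[OF v assms(3)] cone_homotopy[OF frags_finite[OF assms(1,3)], of v] assms(4)
    by (simp add: cone_simps)
qed

text \<open>
  In the lexicographic order all vertices of the blocks before \<open>k\<close> precede \<open>(k, v)\<close>: their number is
  the exponent of the Koszul sign.
\<close>

lemma incidence_Sigma:
  fixes \<rho> :: "nat \<Rightarrow> 'a::linorder set"
  assumes "finite I" "k \<in> I" "\<And>i. i \<in> I \<Longrightarrow> finite (\<rho> i)"
  shows "incidence (k, v) (Sigma I \<rho>) = (-1) ^ (\<Sum>i\<in>{i \<in> I. i < k}. card (\<rho> i)) * incidence v (\<rho> k)"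
proof -
  have "{u \<in> Sigma I \<rho>. u < (k, v)} = Sigma {i \<in> I. i < k} \<rho> \<union> Pair k ` {u \<in> \<rho> k. u < v}"
    using assms(2) by (auto simp: less_prod_def')
  moreover have "card (Sigma {i \<in> I. i < k} \<rho> \<union> Pair k ` {u \<in> \<rho> k. u < v})
      = (\<Sum>i\<in>{i \<in> I. i < k}. card (\<rho> i)) + card {u \<in> \<rho> k. u < v}"
    using assms by (subst card_Un_disjoint) (auto simp: card_image inj_on_def)
  ultimately show ?thesis by (simp add: incidence_def power_add)
qed

text \<open>
  One summand of the differential of a tensor product: \<open>eps 1\<close> on the blocks before \<open>k\<close> is the Koszul sign.
\<close>

definition slot_boundary :: "nat \<Rightarrow> nat \<Rightarrow> ('a::linorder set \<Rightarrow>\<^sub>0 int) \<Rightarrow> ('a set \<Rightarrow>\<^sub>0 int)" where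
  "slot_boundary k i = (if i < k then eps 1 else if i = k then boundary else (\<lambda>c. c))"

lemma additive_map_slot_boundary [simp]: "additive_map (slot_boundary k i)"
  by (auto simp: slot_boundary_def)

lemma boundary_join_chain:
  assumes fin: "finite I" and c: "\<And>k. k \<in> I \<Longrightarrow> c k \<in> frags {\<tau>. finite \<tau>}"
  shows "boundary (join_chain I c) = (\<Sum>k\<in>I. join_chain I (\<lambda>i. slot_boundary k i (c i)))"
proof (rule multi_additive_eqI[OF fin _ _ _ c, where F = "\<lambda>c. boundary (join_chain I c)"
      and G = "\<lambda>c. \<Sum>k\<in>I. join_chain I (\<lambda>i. slot_boundary k i (c i))"])
  show "multi_additive I (\<lambda>c. boundary (join_chain I c) :: (nat \<times> 'a) set \<Rightarrow>\<^sub>0 int)"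
    by (rule multi_additive_post[OF multi_additive_join_chain[OF fin] additive_map_boundary])
  show "multi_additive I (\<lambda>c. \<Sum>k\<in>I. join_chain I (\<lambda>i. slot_boundary k i (c i)) :: (nat \<times> 'a) set \<Rightarrow>\<^sub>0 int)"
    by (intro multi_additive_sum multi_additive_comp_slots[OF multi_additive_join_chain[OF fin]] additive_map_slot_boundary)
next
  fix \<rho> :: "nat \<Rightarrow> 'a set" assume "\<And>k. k \<in> I \<Longrightarrow> \<rho> k \<in> {\<tau>. finite \<tau>}"
  then have \<rho>: "\<And>k. k \<in> I \<Longrightarrow> finite (\<rho> k)" by simp
  have "join_chain I (\<lambda>i. slot_boundary k i (frag_of (\<rho> i))) =
      (\<Sum>v\<in>\<rho> k. frag_cmul (incidence (k, v) (Sigma I \<rho>)) (frag_of (Sigma I \<rho> - {(k, v)})))" if k: "k \<in> I" for k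
  proof -
    let ?s = "\<lambda>v i. if i < k then (-1) ^ card (\<rho> i) else if i = k then incidence v (\<rho> k) else (1::int)"
    let ?r = "\<lambda>v. \<rho>(k := \<rho> k - {v})"
    let ?c = "\<lambda>i. slot_boundary k i (frag_of (\<rho> i))"
    have "join_chain I ?c = join_chain I (?c(k := \<Sum>v\<in>\<rho> k. frag_cmul (incidence v (\<rho> k)) (frag_of (\<rho> k - {v}))))"
      by (intro join_chain_cong fin) (auto simp: slot_boundary_def boundary_frag_of)
    also have "\<dots> = (\<Sum>v\<in>\<rho> k. join_chain I (?c(k := frag_cmul (incidence v (\<rho> k)) (frag_of (\<rho> k - {v})))))"
      by (rule additive_map_sum[OF multi_additive_slot[OF multi_additive_join_chain[OF fin] k]])
    also have "\<dots> = (\<Sum>v\<in>\<rho> k. join_chain I (\<lambda>i. frag_cmul (?s v i) (frag_of (?r v i))))"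
      by (intro sum.cong refl join_chain_cong fin) (auto simp: slot_boundary_def graded_sign_of)
    also have "\<dots> = (\<Sum>v\<in>\<rho> k. frag_cmul (\<Prod>i\<in>I. ?s v i) (frag_of (Sigma I (?r v))))"
      by (simp only: join_chain_scale[OF fin] join_chain_frag_of[OF fin])
    also have "\<dots> = (\<Sum>v\<in>\<rho> k. frag_cmul (incidence (k, v) (Sigma I \<rho>)) (frag_of (Sigma I \<rho> - {(k, v)})))"
    proof (rule sum.cong[OF refl])
      fix v
      have "Sigma I (?r v) = Sigma I \<rho> - {(k, v)}" using k by (auto split: if_splits)
      moreover have "(\<Prod>i\<in>I. ?s v i) = incidence v (\<rho> k) * (\<Prod>i\<in>I - {k}. ?s v i)"
        using prod.remove[OF fin k, of "?s v"] by simp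
      moreover have "(\<Prod>i\<in>I - {k}. ?s v i) = (\<Prod>i\<in>{i \<in> I. i < k}. (-1) ^ card (\<rho> i))"
        by (rule prod.mono_neutral_cong_right) (use fin in auto)
      ultimately show "frag_cmul (\<Prod>i\<in>I. ?s v i) (frag_of (Sigma I (?r v))) =
          frag_cmul (incidence (k, v) (Sigma I \<rho>)) (frag_of (Sigma I \<rho> - {(k, v)}))"
        by (simp add: incidence_Sigma[OF fin k \<rho>] power_sum mult.commute)
    qed
    finally show ?thesis .
  qed
  then show "boundary (join_chain I (\<lambda>k. frag_of (\<rho> k)))
      = (\<Sum>k\<in>I. join_chain I (\<lambda>i. slot_boundary k i (frag_of (\<rho> i))))"
    using \<rho> fin by (simp add: join_chain_frag_of[OF fin] boundary_frag_of sum.Sigma case_prod_unfold)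
qed

lemma boundary_eq_tensor_op:
  assumes fin: "finite I" and D: "\<And>k. k \<in> I \<Longrightarrow> finite (D k)" and c: "c \<in> frags (Pow (Sigma I D))"
  shows "boundary c = (\<Sum>k\<in>I. tensor_op I (slot_boundary k) c)"
proof (rule additive_map_eqI[OF _ _ _ c, where h = "\<lambda>c. \<Sum>k\<in>I. tensor_op I (slot_boundary k) c"])
  fix \<eta> assume "\<eta> \<in> Pow (Sigma I D)"
  then have \<eta>: "\<eta> \<subseteq> Sigma I D" by simp
  have f: "finite (slice \<eta> k)" if "k \<in> I" for k
    by (rule finite_subset[OF _ D[OF that]]) (use \<eta> in \<open>auto simp: slice_def\<close>)
  have "boundary (join_chain I (\<lambda>k. frag_of (slice \<eta> k))) =
     (\<Sum>k\<in>I. join_chain I (\<lambda>i. slot_boundary k i (frag_of (slice \<eta> i))))"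
    by (rule boundary_join_chain) (use fin f in auto)
  then show "boundary (frag_of \<eta>) = (\<Sum>k\<in>I. tensor_op I (slot_boundary k) (frag_of \<eta>))"
    by (simp add: join_chain_frag_of[OF fin] Sigma_slice[OF \<eta>] tensor_op_def)
qed (auto intro!: additive_map_sum_fun)

section \<open>Cochains and complements\<close>

lemma additive_map_cochain_restrict [simp]: "additive_map (cochain_restrict X)"
  by (simp add: cochain_restrict_def)

lemmas cochain_restrict_simps = additive_map_zero[OF additive_map_cochain_restrict] additive_map_add[OF additive_map_cochain_restrict]
  additive_map_diff[OF additive_map_cochain_restrict] additive_map_minus[OF additive_map_cochain_restrict]
  additive_map_cmul[OF additive_map_cochain_restrict] additive_map_sum[OF additive_map_cochain_restrict]

declare additive_map_add[OF additive_map_cochain_restrict, additive_dist]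

lemma cochain_restrict_of: "cochain_restrict X (frag_of \<tau>) = (if \<tau> \<in> X then frag_of \<tau> else 0)"
  by (simp add: cochain_restrict_def)

lemma cochain_restrict_frags: "cochain_restrict X c \<in> frags X"
  by (rule additive_map_into[where S = UNIV and c = c and g = "cochain_restrict X"]) (auto simp: cochain_restrict_of intro: fragsD(1))

lemma cochain_restrict_id: "c \<in> frags X \<Longrightarrow> cochain_restrict X c = c"
  by (rule additive_map_eqI[where S = X and c = c and g = "cochain_restrict X" and h = "\<lambda>c. c"]) (auto simp: cochain_restrict_of)

lemma lookup_cochain_restrict:
  "Poly_Mapping.lookup (cochain_restrict X c) \<tau> = (if \<tau> \<in> X then Poly_Mapping.lookup c \<tau> else 0)"
  by (rule additive_map_eqI[where S = UNIV and c = c and g = "\<lambda>c. Poly_Mapping.lookup (cochain_restrict X c) \<tau>"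
        and h = "\<lambda>c. if \<tau> \<in> X then Poly_Mapping.lookup c \<tau> else 0"])
     (auto simp: additive_map_def additive_dist cochain_restrict_of)

lemma cochain_restrict_eq_0:
  assumes "cochain_restrict X c = 0" "c \<in> frags Y"
  shows "c \<in> frags (Y - X)"
  unfolding frags_def
proof safe
  fix \<tau> assume \<tau>: "\<tau> \<in> Poly_Mapping.keys c"
  then show "\<tau> \<in> Y" using assms(2) by (auto simp: frags_def)
  assume "\<tau> \<in> X"
  then have "Poly_Mapping.lookup c \<tau> = 0" using lookup_cochain_restrict[of X c \<tau>] assms(1) by simp
  then show False using \<tau> by (simp add: in_keys_iff)
qed

lemma cochain_restrict_graded_sign: "cochain_restrict X (graded_sign n deg c) = graded_sign n deg (cochain_restrict X c)"
  by (rule additive_map_eqI[where S = UNIV and c = c and g = "\<lambda>c. cochain_restrict X (graded_sign n deg c)"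
        and h = "\<lambda>c. graded_sign n deg (cochain_restrict X c)"])
     (auto simp: additive_map_def additive_dist cochain_restrict_of graded_sign_of graded_sign_simps cochain_restrict_simps)

lemma
  fixes f c :: "'b \<Rightarrow>\<^sub>0 int"
  shows additive_map_pairing: "additive_map (pairing f)" and additive_map_pairing_left: "additive_map (\<lambda>f. pairing f c)"
proof -
  have eq: "pairing f c = (\<Sum>\<tau>\<in>A. Poly_Mapping.lookup f \<tau> * Poly_Mapping.lookup c \<tau>)"
    if "finite A" "Poly_Mapping.keys c \<subseteq> A" for A and f c :: "'b \<Rightarrow>\<^sub>0 int"
    unfolding pairing_def by (rule sum.mono_neutral_left) (use that in \<open>auto simp: in_keys_iff\<close>)
  show "additive_map (pairing f)"
  proof (rule additive_mapI)
    fix x y :: "'b \<Rightarrow>\<^sub>0 int"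
    let ?A = "Poly_Mapping.keys x \<union> Poly_Mapping.keys y"
    have 1: "Poly_Mapping.keys (x + y) \<subseteq> ?A" by (rule keys_add)
    show "pairing f (x + y) = pairing f x + pairing f y"
      by (subst (1 2 3) eq[where A = ?A])
         (use 1 in \<open>simp_all add: lookup_add distrib_left sum.distrib\<close>)
  qed
  show "additive_map (\<lambda>f. pairing f c)"
    by (rule additive_mapI) (simp add: pairing_def lookup_add distrib_right sum.distrib)
qed

lemma pairing_of_left: "pairing (frag_of \<rho>) c = Poly_Mapping.lookup c \<rho>"
  by (simp add: pairing_def in_keys_iff if_distrib[of "\<lambda>x. x * _"] cong: if_cong)

lemma additive_map_coboundary [simp]: "additive_map (coboundary X)"
  unfolding coboundary_def
  by (rule additive_mapI) (simp add: additive_map_add[OF additive_map_pairing_left] frag_cmul_distrib sum.distrib)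

lemmas coboundary_simps = additive_map_zero[OF additive_map_coboundary] additive_map_add[OF additive_map_coboundary]
  additive_map_diff[OF additive_map_coboundary] additive_map_minus[OF additive_map_coboundary]
  additive_map_cmul[OF additive_map_coboundary] additive_map_sum[OF additive_map_coboundary]

declare additive_map_add[OF additive_map_coboundary, additive_dist]

lemma coboundary_frags: "coboundary X f \<in> frags X"
  unfolding coboundary_def by (auto intro!: frags_sum frags_cmul)

lemma coboundary_restrict:
  assumes "finite Y" "X \<subseteq> Y"
  shows "cochain_restrict X (coboundary Y f) = coboundary X f"
proof -
  have "cochain_restrict X (coboundary Y f) =
     (\<Sum>\<tau>\<in>Y. frag_cmul (pairing f (boundary (frag_of \<tau>))) (if \<tau> \<in> X then frag_of \<tau> else 0))"
    by (simp add: coboundary_def cochain_restrict_simps cochain_restrict_of)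
  also have "\<dots> = coboundary X f"
    unfolding coboundary_def by (rule sum.mono_neutral_cong_right) (use assms in auto)
  finally show ?thesis .
qed

lemma coboundary_of_restrict:
  assumes "down_closed X"
  shows "coboundary X (cochain_restrict X f) = coboundary X f"
proof -
  have "pairing (cochain_restrict X f) c = pairing f c" if "c \<in> frags X" for c
    unfolding pairing_def
    by (rule sum.cong) (use that in \<open>auto simp: lookup_cochain_restrict frags_def\<close>)
  then show ?thesis unfolding coboundary_def
    by (intro sum.cong refl) (simp add: boundary_frags[OF assms])
qed

lemma coboundary_simplex_of:
  assumes "finite D" "\<rho> \<subseteq> D"
  shows "coboundary (Pow D) (frag_of \<rho>) = (\<Sum>v\<in>D - \<rho>. frag_cmul (incidence v \<rho>) (frag_of (insert v \<rho>)))"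
proof (rule poly_mapping_eqI)
  fix \<tau>
  have finD: "finite (Pow D)" using assms by simp
  have "Poly_Mapping.lookup (coboundary (Pow D) (frag_of \<rho>)) \<tau> =
    (\<Sum>\<tau>'\<in>Pow D. pairing (frag_of \<rho>) (boundary (frag_of \<tau>')) * (if \<tau> = \<tau>' then 1 else 0))"
    by (simp add: coboundary_def lookup_sum)
  also have "\<dots> = (if \<tau> \<subseteq> D then Poly_Mapping.lookup (boundary (frag_of \<tau>)) \<rho> else 0)"
    using finD by (simp add: if_distrib[of "(*) _"] pairing_of_left cong: if_cong)
  also have "\<dots> = (if \<tau> \<subseteq> D then (\<Sum>v\<in>\<tau>. if \<rho> = \<tau> - {v} then incidence v \<tau> else 0) else 0)"
    by (simp add: boundary_frag_of lookup_sum if_distrib[of "(*) _"] cong: if_cong)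
  also have "\<dots> = (\<Sum>v\<in>D - \<rho>. if \<tau> = insert v \<rho> then incidence v \<rho> else 0)"
  proof (cases "\<tau> \<subseteq> D")
    case True
    have "(\<Sum>v\<in>\<tau>. if \<rho> = \<tau> - {v} then incidence v \<tau> else 0) = (\<Sum>v\<in>{v\<in>\<tau>. \<rho> = \<tau> - {v}}. incidence v \<tau>)"
      using True assms by (subst sum.inter_filter) (auto intro: finite_subset)
    also have "\<dots> = (\<Sum>v\<in>{v\<in>D - \<rho>. \<tau> = insert v \<rho>}. incidence v \<rho>)"
      using True assms by (intro sum.cong) (auto simp: incidence_diff_self incidence_insert_self)
    also have "\<dots> = (\<Sum>v\<in>D - \<rho>. if \<tau> = insert v \<rho> then incidence v \<rho> else 0)"
      using assms by (subst sum.inter_filter) auto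
    finally show ?thesis using True by simp
  next
    case False
    have "(\<Sum>v\<in>D - \<rho>. if \<tau> = insert v \<rho> then incidence v \<rho> else 0) = 0"
      by (rule sum.neutral) (use False assms in auto)
    then show ?thesis using False by simp
  qed
  also have "\<dots> = Poly_Mapping.lookup (\<Sum>v\<in>D - \<rho>. frag_cmul (incidence v \<rho>) (frag_of (insert v \<rho>))) \<tau>"
    by (simp add: lookup_sum if_distrib[of "(*) _"] cong: if_cong)
  finally show "Poly_Mapping.lookup (coboundary (Pow D) (frag_of \<rho>)) \<tau> =
    Poly_Mapping.lookup (\<Sum>v\<in>D - \<rho>. frag_cmul (incidence v \<rho>) (frag_of (insert v \<rho>))) \<tau>" .
qed

text \<open>
  \<open>complement D\<close> identifies the chains of a simplex with its cochains; on chains modulo a subcomplex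
  \<open>X\<close> it becomes \<open>complement_map D X\<close>.
\<close>

definition complement_sign :: "'a::linorder set \<Rightarrow> 'a set \<Rightarrow> int" where
  "complement_sign D \<eta> = (-1) ^ (\<Sum>v\<in>\<eta>. card {u \<in> D. u < v})"

abbreviation complement :: "'a::linorder set \<Rightarrow> ('a set \<Rightarrow>\<^sub>0 int) \<Rightarrow> ('a set \<Rightarrow>\<^sub>0 int)" where
  "complement D \<equiv> complement_map D {}"

lemma additive_map_complement_map [simp]: "additive_map (complement_map D X)"
  by (simp add: complement_map_def)

lemmas complement_simps = additive_map_zero[OF additive_map_complement_map] additive_map_add[OF additive_map_complement_map]
  additive_map_diff[OF additive_map_complement_map] additive_map_minus[OF additive_map_complement_map]
  additive_map_cmul[OF additive_map_complement_map] additive_map_sum[OF additive_map_complement_map]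

declare additive_map_add[OF additive_map_complement_map, additive_dist]

lemma complement_of: "complement D (frag_of \<eta>) = frag_cmul (complement_sign D \<eta>) (frag_of (D - \<eta>))"
  by (simp add: complement_map_def complement_sign_def)

lemma complement_frags: "complement D c \<in> frags (Pow D)"
  by (rule additive_map_into[where S = UNIV and c = c and g = "complement D"]) (auto simp: complement_of intro!: frags_cmul)

lemma complement_sign_square [simp]: "complement_sign D \<eta> * complement_sign D \<eta> = 1"
  by (simp add: complement_sign_def flip: power_mult_distrib)

lemma complement_complement:
  assumes "finite D" "c \<in> frags (Pow D)"
  shows "complement D (complement D c) = frag_cmul (complement_sign D D) c"
proof (rule additive_map_eqI[OF _ _ _ assms(2), where g = "\<lambda>c. complement D (complement D c)"])
  fix \<tau> assume "\<tau> \<in> Pow D"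
  then have \<tau>: "\<tau> \<subseteq> D" by simp
  have "complement_sign D D = complement_sign D \<tau> * complement_sign D (D - \<tau>)"
    unfolding complement_sign_def power_add[symmetric] using sum.subset_diff[OF \<tau> assms(1), of "\<lambda>v. card {u \<in> D. u < v}"] by (simp add: add.commute)
  then show "complement D (complement D (frag_of \<tau>)) = frag_cmul (complement_sign D D) (frag_of \<tau>)"
    using \<tau> by (simp add: complement_of complement_simps double_diff)
qed (simp_all add: additive_map_def additive_dist)

text \<open>
  Adding a vertex to \<open>D - \<eta>\<close> is removing it from \<open>\<eta>\<close>; the sign of the complement turns one incidence
  number into the other.
\<close>

lemma coboundary_complement:
  assumes "finite D" "c \<in> frags (Pow D)"
  shows "coboundary (Pow D) (complement D c) = complement D (boundary c)"
proof (rule additive_map_eqI[OF _ _ _ assms(2), where g = "\<lambda>c. coboundary (Pow D) (complement D c)"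
      and h = "\<lambda>c. complement D (boundary c)"])
  fix \<tau> assume "\<tau> \<in> Pow D"
  then have \<tau>: "\<tau> \<subseteq> D" by simp
  have "coboundary (Pow D) (complement D (frag_of \<tau>)) =
      frag_cmul (complement_sign D \<tau>) (\<Sum>v\<in>D - (D - \<tau>). frag_cmul (incidence v (D - \<tau>)) (frag_of (insert v (D - \<tau>))))"
    by (simp add: complement_of coboundary_simps coboundary_simplex_of[OF assms(1)])
  also have "\<dots> = (\<Sum>v\<in>\<tau>. frag_cmul (incidence v \<tau>) (frag_cmul (complement_sign D (\<tau> - {v})) (frag_of (D - (\<tau> - {v})))))"
    unfolding frag_cmul_sum
  proof (rule sum.cong)
    fix v assume v: "v \<in> \<tau>"
    have fin: "finite \<tau>" using \<tau> assms finite_subset by auto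
    have 1: "complement_sign D \<tau> = (-1) ^ card {u \<in> D. u < v} * complement_sign D (\<tau> - {v})"
      unfolding complement_sign_def power_add[symmetric] using sum.remove[OF fin v, of "\<lambda>v. card {u \<in> D. u < v}"] by simp
    have "{u \<in> D. u < v} = {u \<in> \<tau>. u < v} \<union> {u \<in> D - \<tau>. u < v}" using \<tau> by auto
    moreover have "card ({u \<in> \<tau>. u < v} \<union> {u \<in> D - \<tau>. u < v}) = card {u \<in> \<tau>. u < v} + card {u \<in> D - \<tau>. u < v}"
      using assms(1) fin by (intro card_Un_disjoint) auto
    ultimately have "(-1) ^ card {u \<in> D. u < v} = incidence v \<tau> * incidence v (D - \<tau>)"
      by (simp add: incidence_def power_add)
    then have "complement_sign D \<tau> * incidence v (D - \<tau>) = incidence v \<tau> * complement_sign D (\<tau> - {v})"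
      using 1 incidence_square[of v "D - \<tau>"] by (simp add: ac_simps)
    moreover have "insert v (D - \<tau>) = D - (\<tau> - {v})" using v \<tau> by auto
    ultimately show "frag_cmul (complement_sign D \<tau>) (frag_cmul (incidence v (D - \<tau>)) (frag_of (insert v (D - \<tau>))))
       = frag_cmul (incidence v \<tau>) (frag_cmul (complement_sign D (\<tau> - {v})) (frag_of (D - (\<tau> - {v}))))"
      by simp
  qed (use \<tau> in auto)
  finally show "coboundary (Pow D) (complement D (frag_of \<tau>)) = complement D (boundary (frag_of \<tau>))"
    by (simp add: complement_of complement_simps boundary_frag_of)
qed (simp_all add: additive_map_def additive_dist)

lemma complement_map_eq_restrict:
  assumes "c \<in> frags (Pow D)"
  shows "complement_map D X c = cochain_restrict (dual_complex D X) (complement D c)"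
proof (rule additive_map_eqI[OF _ _ _ assms, where h = "\<lambda>c. cochain_restrict (dual_complex D X) (complement D c)"])
  fix \<tau> assume "\<tau> \<in> Pow D"
  then have "D - \<tau> \<in> dual_complex D X \<longleftrightarrow> \<tau> \<notin> X"
    by (auto simp: dual_complex_def) (metis double_diff order_refl)
  then show "complement_map D X (frag_of \<tau>) = cochain_restrict (dual_complex D X) (complement D (frag_of \<tau>))"
    by (simp add: complement_of cochain_restrict_simps cochain_restrict_of)
       (simp add: complement_map_def complement_sign_def)
qed (simp_all add: additive_map_def additive_dist)

lemma complement_eps:
  assumes "finite D" "c \<in> frags (Pow D)"
  shows "complement D (eps n c) = frag_cmul ((-1) ^ (n * card D)) (eps n (complement D c))"
proof (rule additive_map_eqI[OF _ _ _ assms(2), where g = "\<lambda>c. complement D (eps n c)"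
      and h = "\<lambda>c. frag_cmul ((-1) ^ (n * card D)) (eps n (complement D c))"])
  fix \<tau> assume "\<tau> \<in> Pow D"
  then have c: "card D = card \<tau> + card (D - \<tau>)"
    using assms(1) by (simp add: card_Diff_subset finite_subset card_mono)
  have "(-1) ^ (n * card \<tau>) = (-1 :: int) ^ (n * card D) * (-1) ^ (n * card (D - \<tau>))"
    unfolding c distrib_left power_add by (simp flip: power_mult_distrib)
  then show "complement D (eps n (frag_of \<tau>)) = frag_cmul ((-1) ^ (n * card D)) (eps n (complement D (frag_of \<tau>)))"
    by (simp add: complement_of graded_sign_of graded_sign_simps complement_simps ac_simps)
qed (simp_all add: additive_map_def additive_dist)

text \<open>
  A vertex of block \<open>k\<close> is preceded by all vertices of the earlier blocks, which changes the sign of the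
  complement by their number for each vertex of the simplex in block \<open>k\<close>.
\<close>

lemma complement_join_chain:
  fixes D :: "nat \<Rightarrow> 'a::linorder set"
  assumes fin: "finite I" and D: "\<And>k. k \<in> I \<Longrightarrow> finite (D k)" and c: "\<And>k. k \<in> I \<Longrightarrow> c k \<in> frags (Pow (D k))"
  shows "complement (Sigma I D) (join_chain I c) =
    join_chain I (\<lambda>k. complement (D k) (eps (\<Sum>i\<in>{i \<in> I. i < k}. card (D i)) (c k)))"
proof (rule multi_additive_eqI[OF fin _ _ _ c, where F = "\<lambda>c. complement (Sigma I D) (join_chain I c)"
      and G = "\<lambda>c. join_chain I (\<lambda>k. complement (D k) (eps (\<Sum>i\<in>{i \<in> I. i < k}. card (D i)) (c k)))"])
  show "multi_additive I (\<lambda>c. complement (Sigma I D) (join_chain I c))"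
    by (rule multi_additive_post[OF multi_additive_join_chain[OF fin] additive_map_complement_map])
  show "multi_additive I (\<lambda>c. join_chain I (\<lambda>k. complement (D k) (eps (\<Sum>i\<in>{i \<in> I. i < k}. card (D i)) (c k))))"
    by (rule multi_additive_comp_slots[OF multi_additive_join_chain[OF fin]]) (simp add: additive_map_def additive_dist)
next
  fix \<rho> :: "nat \<Rightarrow> 'a set" assume \<rho>': "\<And>k. k \<in> I \<Longrightarrow> \<rho> k \<in> Pow (D k)"
  let ?W = "\<lambda>k. \<Sum>i\<in>{i \<in> I. i < k}. card (D i)"
  have \<rho>: "\<rho> k \<subseteq> D k" "finite (\<rho> k)" if "k \<in> I" for k using \<rho>'[OF that] D[OF that] by (auto intro: finite_subset)
  have card: "card {u \<in> Sigma I D. u < (k, v)} = ?W k + card {u \<in> D k. u < v}" if k: "k \<in> I" for k v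
  proof -
    have "{u \<in> Sigma I D. u < (k, v)} = Sigma {i \<in> I. i < k} D \<union> Pair k ` {u \<in> D k. u < v}"
      using k by (auto simp: less_prod_def')
    moreover have "card (Sigma {i \<in> I. i < k} D \<union> Pair k ` {u \<in> D k. u < v}) = ?W k + card {u \<in> D k. u < v}"
      using fin D k by (subst card_Un_disjoint) (auto simp: card_image inj_on_def)
    ultimately show ?thesis by simp
  qed
  have "(\<Sum>x\<in>Sigma I \<rho>. card {u \<in> Sigma I D. u < x}) = (\<Sum>k\<in>I. \<Sum>v\<in>\<rho> k. ?W k + card {u \<in> D k. u < v})"
    using fin \<rho> by (subst sum.Sigma) (auto simp: card intro!: sum.cong)
  also have "\<dots> = (\<Sum>k\<in>I. ?W k * card (\<rho> k) + (\<Sum>v\<in>\<rho> k. card {u \<in> D k. u < v}))"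
    by (simp add: sum.distrib mult.commute)
  finally have "complement_sign (Sigma I D) (Sigma I \<rho>) = (\<Prod>k\<in>I. (-1) ^ (?W k * card (\<rho> k)) * complement_sign (D k) (\<rho> k))"
    by (simp add: complement_sign_def power_sum power_add)
  moreover have "Sigma I D - Sigma I \<rho> = Sigma I (\<lambda>k. D k - \<rho> k)" by auto
  ultimately have "complement (Sigma I D) (frag_of (Sigma I \<rho>)) =
     join_chain I (\<lambda>k. frag_cmul ((-1) ^ (?W k * card (\<rho> k)) * complement_sign (D k) (\<rho> k)) (frag_of (D k - \<rho> k)))"
    by (simp add: complement_of join_chain_scale[OF fin] join_chain_frag_of[OF fin])
  then show "complement (Sigma I D) (join_chain I (\<lambda>k. frag_of (\<rho> k))) =
       join_chain I (\<lambda>k. complement (D k) (eps (?W k) (frag_of (\<rho> k))))"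
    by (simp add: join_chain_frag_of[OF fin] graded_sign_of complement_simps complement_of)
qed

section \<open>Quotients of groups of chains\<close>

definition coset :: "'b::ab_group_add set \<Rightarrow> 'b \<Rightarrow> 'b set" where
  "coset B c = (\<lambda>b. b + c) ` B"

text \<open>
  Homology, cohomology, relative homology and tensor products are all quotients \<open>S / B\<close> of subgroups
  of a free abelian group; \<open>quotient_of S B H\<close> records this without mentioning how \<open>H\<close> was built.
\<close>

definition quotient_of :: "('b \<Rightarrow>\<^sub>0 int) set \<Rightarrow> ('b \<Rightarrow>\<^sub>0 int) set \<Rightarrow> ('b \<Rightarrow>\<^sub>0 int) set monoid \<Rightarrow> bool" where
  "quotient_of S B H \<longleftrightarrow> additive_subset S \<and> additive_subset B \<and> B \<subseteq> S \<and>
     carrier H = coset B ` S \<and> \<one>\<^bsub>H\<^esub> = B \<and>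
     (\<forall>c\<in>S. \<forall>d\<in>S. coset B c \<otimes>\<^bsub>H\<^esub> coset B d = coset B (c + d))"

lemma mem_coset: "x \<in> coset B c \<longleftrightarrow> x - c \<in> B"
  unfolding coset_def image_iff by (metis add_diff_cancel_right' diff_add_cancel)

lemma coset_eq_iff:
  assumes "additive_subset B" shows "coset B c = coset B d \<longleftrightarrow> c - d \<in> B"
proof
  assume "coset B c = coset B d"
  moreover have "c \<in> coset B c" using assms by (simp add: mem_coset additive_subsetD)
  ultimately show "c - d \<in> B" by (simp add: mem_coset)
next
  assume d: "c - d \<in> B"
  have "x - c \<in> B \<longleftrightarrow> x - d \<in> B" for x
    using additive_subsetD(4)[OF assms _ d, of "x - c"] additive_subsetD(2)[OF assms _ d, of "x - d"] by auto
  then show "coset B c = coset B d" by (auto simp: mem_coset)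
qed

lemma coset_zero: "coset B 0 = B"
  by (simp add: coset_def)

lemma quotient_ofD:
  assumes "quotient_of S B H"
  shows "additive_subset S" "additive_subset B" "B \<subseteq> S" "carrier H = coset B ` S" "\<one>\<^bsub>H\<^esub> = coset B 0"
    "c \<in> S \<Longrightarrow> d \<in> S \<Longrightarrow> coset B c \<otimes>\<^bsub>H\<^esub> coset B d = coset B (c + d)"
    "c \<in> S \<Longrightarrow> coset B c \<in> carrier H"
  using assms by (auto simp: quotient_of_def coset_zero)

lemma group_quotient:
  assumes "quotient_of S B H" shows "group H"
proof (rule groupI)
  note q = quotient_ofD[OF assms] and S = additive_subsetD[OF quotient_ofD(1)[OF assms]]
  show "x \<otimes>\<^bsub>H\<^esub> y \<in> carrier H" if "x \<in> carrier H" "y \<in> carrier H" for x y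
    using that by (auto simp: q(4,6) S)
  show "\<one>\<^bsub>H\<^esub> \<in> carrier H" by (simp add: q(5,7) S)
  show "x \<otimes>\<^bsub>H\<^esub> y \<otimes>\<^bsub>H\<^esub> z = x \<otimes>\<^bsub>H\<^esub> (y \<otimes>\<^bsub>H\<^esub> z)" if "x \<in> carrier H" "y \<in> carrier H" "z \<in> carrier H" for x y z
    using that by (auto simp: q(4,6) S add.assoc)
  show "\<one>\<^bsub>H\<^esub> \<otimes>\<^bsub>H\<^esub> x = x" if "x \<in> carrier H" for x
    using that by (auto simp: q(4,5,6) S)
  show "\<exists>y\<in>carrier H. y \<otimes>\<^bsub>H\<^esub> x = \<one>\<^bsub>H\<^esub>" if x: "x \<in> carrier H" for x
  proof -
    from x obtain c where c: "c \<in> S" "x = coset B c" by (auto simp: q(4))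
    then have "coset B (- c) \<otimes>\<^bsub>H\<^esub> x = \<one>\<^bsub>H\<^esub>" by (simp add: q(5,6) S)
    then show ?thesis using c S(3) q(7) by blast
  qed
qed

lemma rep_in: "x \<noteq> {} \<Longrightarrow> rep x \<in> x"
  unfolding rep_def by (rule someI_ex) auto

lemma rep_coset:
  assumes "additive_subset B" shows "rep (coset B c) - c \<in> B"
proof -
  have "c \<in> coset B c" using assms by (simp add: mem_coset additive_subsetD)
  then have "rep (coset B c) \<in> coset B c" by (intro rep_in) auto
  then show ?thesis by (simp add: mem_coset)
qed

lemma quotient_rep:
  assumes "quotient_of S B H" "x \<in> carrier H"
  shows "rep x \<in> S" "x = coset B (rep x)"
proof -
  note q = quotient_ofD[OF assms(1)]
  obtain c where c: "c \<in> S" "x = coset B c" using assms(2) by (auto simp: q(4))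
  have "rep x - c \<in> B" unfolding c(2) by (rule rep_coset[OF q(2)])
  then show "x = coset B (rep x)" using c(2) coset_eq_iff[OF q(2), of "rep x" c] by simp
  have "rep x - c \<in> S" using \<open>rep x - c \<in> B\<close> q(3) by auto
  from additive_subsetD(4)[OF q(1) this c(1)] show "rep x \<in> S" by simp
qed

lemma quotient_mem:
  assumes "quotient_of S B H" "x \<in> carrier H" "c \<in> x"
  shows "c \<in> S" "x = coset B c"
proof -
  note q = quotient_ofD[OF assms(1)] and r = quotient_rep[OF assms(1,2)]
  have "c - rep x \<in> B" using assms(3) r(2) mem_coset by blast
  then show "x = coset B c" using coset_eq_iff[OF q(2), of c "rep x"] r(2) by simp
  have "c - rep x \<in> S" using \<open>c - rep x \<in> B\<close> q(3) by auto
  from additive_subsetD(4)[OF q(1) this r(1)] show "c \<in> S" by simp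
qed

lemma class_map_eq: "class_map B f x = coset B (f (rep x))"
  by (auto simp: class_map_def r_coset_def coset_def)

lemma class_map_coset:
  assumes "quotient_of S B H" "additive_subset B'" "additive_map f" "\<And>b. b \<in> B \<Longrightarrow> f b \<in> B'"
  shows "class_map B' f (coset B c) = coset B' (f c)"
proof -
  have "f (rep (coset B c)) - f c = f (rep (coset B c) - c)" by (simp add: additive_map_diff[OF assms(3)])
  also have "\<dots> \<in> B'" by (rule assms(4)) (rule rep_coset[OF quotient_ofD(2)[OF assms(1)]])
  finally show ?thesis by (simp add: class_map_eq coset_eq_iff[OF assms(2)])
qed

lemma class_map_hom:
  assumes q: "quotient_of S B H" and q': "quotient_of S' B' H'"
    and f: "additive_map f" "\<And>b. b \<in> B \<Longrightarrow> f b \<in> B'" "\<And>c. c \<in> S \<Longrightarrow> f c \<in> S'"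
  shows "class_map B' f \<in> hom H H'"
proof (rule homI)
  note Q = quotient_ofD[OF q] and Q' = quotient_ofD[OF q']
  note cm = class_map_coset[OF q Q'(2) f(1,2), simplified]
  show "class_map B' f x \<in> carrier H'" if "x \<in> carrier H" for x
    using that by (auto simp: Q(4) cm Q'(7) f(3))
  show "class_map B' f (x \<otimes>\<^bsub>H\<^esub> y) = class_map B' f x \<otimes>\<^bsub>H'\<^esub> class_map B' f y" if "x \<in> carrier H" "y \<in> carrier H" for x y
    using that by (auto simp: Q(4,6) cm Q'(6) f(3) additive_map_add[OF f(1)])
qed

lemma quotient_FactGroup:
  assumes "carrier G = S" "\<And>x y. x \<otimes>\<^bsub>G\<^esub> y = x + y" "additive_subset S" "additive_subset B" "B \<subseteq> S"
  shows "quotient_of S B (G Mod B)"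
  unfolding quotient_of_def
proof (intro conjI ballI)
  have r: "B #>\<^bsub>G\<^esub> c = coset B c" for c by (auto simp: r_coset_def coset_def assms(2))
  show "carrier (G Mod B) = coset B ` S"
    by (auto simp: FactGroup_def RCOSETS_def assms(1) r)
  fix c d
  have "coset B c <#>\<^bsub>G\<^esub> coset B d = coset B (c + d)"
  proof
    show "coset B c <#>\<^bsub>G\<^esub> coset B d \<subseteq> coset B (c + d)"
    proof
      fix x assume "x \<in> coset B c <#>\<^bsub>G\<^esub> coset B d"
      then obtain a b where ab: "x = a + b" "a - c \<in> B" "b - d \<in> B" by (auto simp: set_mult_def assms(2) mem_coset)
      have "x - (c + d) = (a - c) + (b - d)" by (simp add: ab(1))
      also have "\<dots> \<in> B" by (rule additive_subsetD(4)[OF assms(4) ab(2,3)])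
      finally show "x \<in> coset B (c + d)" by (simp only: mem_coset)
    qed
    show "coset B (c + d) \<subseteq> coset B c <#>\<^bsub>G\<^esub> coset B d"
    proof
      fix x assume x: "x \<in> coset B (c + d)"
      have "x - d \<in> coset B c" "d \<in> coset B d" using x assms(4) by (simp_all add: mem_coset additive_subsetD algebra_simps)
      moreover have "x = (x - d) \<otimes>\<^bsub>G\<^esub> d" by (simp add: assms(2))
      ultimately show "x \<in> coset B c <#>\<^bsub>G\<^esub> coset B d" unfolding set_mult_def by blast
    qed
  qed
  then show "coset B c \<otimes>\<^bsub>G Mod B\<^esub> coset B d = coset B (c + d)" by (simp add: FactGroup_def)
qed (use assms in \<open>auto simp: FactGroup_def\<close>)

lemma carrier_subgroup_generated_frags:
  assumes "additive_subset S" "S \<subseteq> frags X"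
  shows "carrier (subgroup_generated (free_Abelian_group X) S) = S"
proof -
  have "subgroup S (free_Abelian_group X)"
  proof (rule group.subgroupI[OF group_free_Abelian_group])
    show "S \<subseteq> carrier (free_Abelian_group X)" using assms(2) by (auto simp: carrier_eq_frags)
    show "inv\<^bsub>free_Abelian_group X\<^esub> a \<in> S" if "a \<in> S" for a
      using that assms by (subst inv_free_Abelian_group) (auto simp: frags_def additive_subsetD)
      show "S \<noteq> {}" using additive_subsetD(1)[OF assms(1)] by auto
    show "a \<otimes>\<^bsub>free_Abelian_group X\<^esub> b \<in> S" if "a \<in> S" "b \<in> S" for a b
      using additive_subsetD(4)[OF assms(1) that] by simp
  qed
  then show ?thesis by (rule subgroup.carrier_subgroup_generated_subgroup)
qed

lemma quotient_subgroup_generated: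
  assumes "additive_subset S" "S \<subseteq> frags X" "additive_subset B" "B \<subseteq> S"
  shows "quotient_of S B (subgroup_generated (free_Abelian_group X) S Mod B)"
  by (rule quotient_FactGroup) (use assms in \<open>auto simp: carrier_subgroup_generated_frags\<close>)

subsection \<open>Homology and cohomology\<close>

definition cycles :: "'a::linorder set set \<Rightarrow> ('a set \<Rightarrow>\<^sub>0 int) set" where
  "cycles X = {c \<in> frags X. boundary c = 0}"

definition cocycles :: "'a::linorder set set \<Rightarrow> ('a set \<Rightarrow>\<^sub>0 int) set" where
  "cocycles X = {f \<in> frags X. coboundary X f = 0}"

lemma additive_subset_Int: "additive_subset A \<Longrightarrow> additive_subset B \<Longrightarrow> additive_subset (A \<inter> B)"
  by (auto simp: additive_subset_def)

lemma additive_subset_vimage: "additive_map g \<Longrightarrow> additive_subset A \<Longrightarrow> additive_subset {c. g c \<in> A}"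
  by (auto simp: additive_subset_def additive_map_zero additive_map_diff)

lemma additive_subset_kernel: "additive_map g \<Longrightarrow> additive_subset {c \<in> frags X. g c \<in> A}" if "additive_subset A"
  using additive_subset_Int[OF additive_subset_frags additive_subset_vimage[OF _ that], of g X]
  by (simp add: Int_def)

lemma additive_subset_singleton_zero: "additive_subset {0}"
  by (simp add: additive_subset_def)

lemma additive_subset_cycles: "additive_subset (cycles X)"
  using additive_subset_kernel[OF additive_subset_singleton_zero additive_map_boundary, of X] by (simp add: cycles_def)

lemma additive_subset_cocycles: "additive_subset (cocycles X)"
  using additive_subset_kernel[OF additive_subset_singleton_zero additive_map_coboundary, of X X] by (simp add: cocycles_def)

lemma boundaries_eq: "boundaries X = boundary ` frags X"
  by (simp add: boundaries_def carrier_eq_frags)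

lemma coboundaries_eq: "coboundaries X = coboundary X ` frags X"
  by (simp add: coboundaries_def carrier_eq_frags)

lemma additive_subset_boundaries: "additive_subset (boundaries X)"
  unfolding boundaries_eq by (rule additive_subset_image) simp_all

lemma additive_subset_coboundaries: "additive_subset (coboundaries X)"
  unfolding coboundaries_eq by (rule additive_subset_image) simp_all

lemma quotient_homology:
  assumes "down_closed X"
  shows "quotient_of (cycles X) (boundaries X) (homology X)"
  unfolding homology_def carrier_eq_frags cycles_def[symmetric]
proof (rule quotient_subgroup_generated[OF additive_subset_cycles _ additive_subset_boundaries])
  show "boundaries X \<subseteq> cycles X" using boundary_frags[OF assms] by (auto simp: boundaries_eq cycles_def)
qed (auto simp: cycles_def)

lemma pairing_coboundary:
  assumes "finite X" "c \<in> frags X"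
  shows "pairing (coboundary X f) c = pairing f (boundary c)"
proof (rule additive_map_eqI[OF _ _ _ assms(2), where h = "\<lambda>c. pairing f (boundary c)"])
  show "additive_map (pairing (coboundary X f))" by (rule additive_map_pairing)
  show "additive_map (\<lambda>c. pairing f (boundary c))"
    by (simp add: additive_map_def boundary_simps additive_map_add[OF additive_map_pairing])
  show "pairing (coboundary X f) (frag_of \<tau>) = pairing f (boundary (frag_of \<tau>))" if "\<tau> \<in> X" for \<tau>
    using that assms(1)
    by (simp add: pairing_def[of _ "frag_of \<tau>"] coboundary_def lookup_sum if_distrib[of "(*) _"] cong: if_cong)
qed

lemma coboundary_coboundary:
  assumes "finite X" "down_closed X"
  shows "coboundary X (coboundary X f) = 0"
proof -
  have "pairing (coboundary X f) (boundary (frag_of \<tau>)) = 0" if "\<tau> \<in> X" for \<tau>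
    using that boundary_frags[OF assms(2)]
    by (simp add: pairing_coboundary[OF assms(1)] additive_map_zero[OF additive_map_pairing])
  then show ?thesis unfolding coboundary_def[of X "coboundary X f"] by simp
qed

lemma quotient_cohomology:
  assumes "finite X" "down_closed X"
  shows "quotient_of (cocycles X) (coboundaries X) (cohomology X)"
  unfolding cohomology_def carrier_eq_frags cocycles_def[symmetric]
proof (rule quotient_subgroup_generated[OF additive_subset_cocycles _ additive_subset_coboundaries])
  show "coboundaries X \<subseteq> cocycles X"
    using coboundary_coboundary[OF assms] coboundary_frags by (auto simp: coboundaries_eq cocycles_def)
qed (auto simp: cocycles_def)

definition relative_cycles :: "'a::linorder set set \<Rightarrow> 'a set set \<Rightarrow> ('a set \<Rightarrow>\<^sub>0 int) set" where
  "relative_cycles Y X = {c \<in> frags Y. boundary c \<in> frags X}"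

definition relative_boundaries :: "'a::linorder set set \<Rightarrow> 'a set set \<Rightarrow> ('a set \<Rightarrow>\<^sub>0 int) set" where
  "relative_boundaries Y X = {b + a | b a. b \<in> boundaries Y \<and> a \<in> frags X}"

lemma additive_subset_relative_boundaries: "additive_subset (relative_boundaries Y X)"
  unfolding additive_subset_def
proof (intro conjI ballI)
  have "0 = (0 :: 'a set \<Rightarrow>\<^sub>0 int) + 0" by simp
  then show "0 \<in> relative_boundaries Y X" unfolding relative_boundaries_def
    using additive_subsetD(1)[OF additive_subset_boundaries] fragsD(1) by blast
  fix x y assume "x \<in> relative_boundaries Y X" "y \<in> relative_boundaries Y X"
  then obtain b a b' a' where *: "x = b + a" "y = b' + a'" "b \<in> boundaries Y" "b' \<in> boundaries Y" "a \<in> frags X" "a' \<in> frags X"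
    by (auto simp: relative_boundaries_def)
  have "x - y = (b - b') + (a - a')" by (simp add: *)
  then show "x - y \<in> relative_boundaries Y X" unfolding relative_boundaries_def
    using * additive_subsetD(2)[OF additive_subset_boundaries] fragsD(2) by blast
qed

lemma quotient_relative_homology:
  assumes "down_closed Y" "down_closed X" "X \<subseteq> Y"
  shows "quotient_of (relative_cycles Y X) (relative_boundaries Y X) (relative_homology Y X)"
  unfolding relative_homology_def carrier_eq_frags relative_cycles_def[symmetric] relative_boundaries_def[symmetric]
proof (rule quotient_subgroup_generated)
  show "additive_subset (relative_cycles Y X)" unfolding relative_cycles_def
    by (rule additive_subset_kernel) simp_all
  show "relative_cycles Y X \<subseteq> frags Y" by (auto simp: relative_cycles_def)
  show "relative_boundaries Y X \<subseteq> relative_cycles Y X"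
    using boundary_frags[OF assms(1)] boundary_frags[OF assms(2)] frags_mono[OF assms(3)]
    by (auto simp: relative_boundaries_def relative_cycles_def boundaries_eq boundary_simps intro!: fragsD(4))
qed (rule additive_subset_relative_boundaries)

subsection \<open>Tensor products\<close>

abbreviation tensor_generators :: "'i set \<Rightarrow> ('i \<Rightarrow> 'b monoid) \<Rightarrow> ('i \<Rightarrow> 'b) set" where
  "tensor_generators I G \<equiv> \<Pi>\<^sub>E i\<in>I. carrier (G i)"

definition pure_tensor :: "'i set \<Rightarrow> ('i \<Rightarrow> 'b monoid) \<Rightarrow> ('i \<Rightarrow> 'b) \<Rightarrow> (('i \<Rightarrow> 'b) \<Rightarrow>\<^sub>0 int) set" where
  "pure_tensor I G x = coset (tensor_relations I G) (frag_of x)"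

definition multilinearity_relations :: "'i set \<Rightarrow> ('i \<Rightarrow> 'b monoid) \<Rightarrow> (('i \<Rightarrow> 'b) \<Rightarrow>\<^sub>0 int) set" where
  "multilinearity_relations I G = {frag_of (x(i := y \<otimes>\<^bsub>G i\<^esub> z)) - frag_of (x(i := y)) - frag_of (x(i := z)) | x i y z.
        x \<in> (\<Pi>\<^sub>E i\<in>I. carrier (G i)) \<and> i \<in> I \<and> y \<in> carrier (G i) \<and> z \<in> carrier (G i)}"

lemma PiE_upd: "x \<in> Pi\<^sub>E I A \<Longrightarrow> i \<in> I \<Longrightarrow> y \<in> A i \<Longrightarrow> x(i := y) \<in> Pi\<^sub>E I A"
  by (auto simp: PiE_iff extensional_def)

lemma multilinearity_relations_frags:
  assumes "\<forall>i\<in>I. group (G i)"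
  shows "multilinearity_relations I G \<subseteq> frags (tensor_generators I G)"
proof
  fix r assume "r \<in> multilinearity_relations I G"
  then obtain x i y z where r: "r = frag_of (x(i := y \<otimes>\<^bsub>G i\<^esub> z)) - frag_of (x(i := y)) - frag_of (x(i := z))"
    and *: "x \<in> tensor_generators I G" "i \<in> I" "y \<in> carrier (G i)" "z \<in> carrier (G i)"
    by (auto simp: multilinearity_relations_def)
  have "y \<otimes>\<^bsub>G i\<^esub> z \<in> carrier (G i)" using bspec[OF assms *(2)] * by (simp add: group.is_monoid monoid.m_closed)
  with * have "x(i := w) \<in> tensor_generators I G" if "w \<in> {y \<otimes>\<^bsub>G i\<^esub> z, y, z}" for w
    using that by (intro PiE_upd[where A = "\<lambda>i. carrier (G i)"]) auto
  then show "r \<in> frags (tensor_generators I G)" unfolding r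
    by (intro fragsD(2)) (simp_all only: frags_of insert_iff simp_thms)
qed

lemma tensor_relations_induct:
  assumes G: "\<forall>i\<in>I. group (G i)" and A: "additive_subset A" and R: "multilinearity_relations I G \<subseteq> A"
  shows "tensor_relations I G \<subseteq> A"
proof
  fix r assume "r \<in> tensor_relations I G"
  then have "r \<in> generate (free_Abelian_group (tensor_generators I G)) (multilinearity_relations I G)"
    using multilinearity_relations_frags[OF G]
    by (simp add: tensor_relations_def multilinearity_relations_def[symmetric] carrier_subgroup_generated
        carrier_eq_frags Int_absorb1[OF multilinearity_relations_frags[OF G]])
  then show "r \<in> A"
  proof (induction rule: generate.induct)
    case one then show ?case using A by (simp add: additive_subsetD)
  next
    case (incl h) then show ?case using R by auto
  next
    case (inv h)
    then have "Poly_Mapping.keys h \<subseteq> tensor_generators I G" using multilinearity_relations_frags[OF G] by (auto simp: frags_def)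
    then show ?case using R inv A by (auto simp: additive_subsetD)
  next
    case (eng h1 h2) then show ?case using A by (simp add: additive_subsetD)
  qed
qed

lemma tensor_relations_incl:
  assumes "\<forall>i\<in>I. group (G i)" "r \<in> multilinearity_relations I G"
  shows "r \<in> tensor_relations I G"
  using assms(2) subsetD[OF multilinearity_relations_frags[OF assms(1)] assms(2)]
  unfolding tensor_relations_def multilinearity_relations_def[symmetric] carrier_subgroup_generated carrier_eq_frags
  by (auto intro: generate.incl)

lemma quotient_tensor:
  assumes G: "\<forall>i\<in>I. group (G i)"
  shows "quotient_of (frags (tensor_generators I G)) (tensor_relations I G) (tensor_group I G)"
  unfolding tensor_group_def
proof (rule quotient_FactGroup)
  let ?F = "free_Abelian_group (tensor_generators I G)"
  show "tensor_relations I G \<subseteq> frags (tensor_generators I G)"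
    by (rule tensor_relations_induct[OF G additive_subset_frags multilinearity_relations_frags[OF G]])
  then have sub: "tensor_relations I G \<subseteq> carrier ?F" by (simp add: carrier_eq_frags)
  have "subgroup (tensor_relations I G) ?F" unfolding tensor_relations_def
    by (rule group.subgroup_subgroup_generated[OF group_free_Abelian_group])
  then have sg: "subgroup (tensor_relations I G) ?F" .
  show "additive_subset (tensor_relations I G)"
    unfolding additive_subset_def
  proof (intro conjI ballI)
    show "0 \<in> tensor_relations I G" using subgroup.one_closed[OF sg] by simp
    fix x y assume xy: "x \<in> tensor_relations I G" "y \<in> tensor_relations I G"
    have "inv\<^bsub>?F\<^esub> y = - y" using xy sub by (auto simp: inv_free_Abelian_group)
    then show "x - y \<in> tensor_relations I G"
      using subgroup.m_closed[OF sg xy(1) subgroup.m_inv_closed[OF sg xy(2)]] by simp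
  qed
qed (auto simp: carrier_eq_frags)

lemma tensor_induct:
  assumes G: "\<forall>i\<in>I. group (G i)" and u: "u \<in> carrier (tensor_group I G)"
    and zero: "P \<one>\<^bsub>tensor_group I G\<^esub>"
    and pure: "\<And>x. x \<in> tensor_generators I G \<Longrightarrow> P (pure_tensor I G x)"
    and diff: "\<And>u v. \<lbrakk>u \<in> carrier (tensor_group I G); v \<in> carrier (tensor_group I G); P u; P v\<rbrakk>
       \<Longrightarrow> P (u \<otimes>\<^bsub>tensor_group I G\<^esub> inv\<^bsub>tensor_group I G\<^esub> v)"
  shows "P u"
proof -
  let ?R = "tensor_relations I G" and ?T = "tensor_group I G"
  note q = quotient_tensor[OF G]
  note Q = quotient_ofD[OF q]
  interpret T: group ?T by (rule group_quotient[OF q])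
  obtain c where c: "c \<in> frags (tensor_generators I G)" "u = coset ?R c" using u Q(4) by auto
  have "Poly_Mapping.keys c \<subseteq> tensor_generators I G" using c(1) by (simp add: frags_def)
  then have "c \<in> frags (tensor_generators I G) \<and> P (coset ?R c)"
  proof (induction c rule: frag_induction)
    case zero then show ?case using assms(3) Q(5) fragsD(1)[of "tensor_generators I G"] by simp
  next
    case (one x) then show ?case using pure[of x] by (simp add: pure_tensor_def)
  next
    case (diff a b)
    then have mem: "a \<in> frags (tensor_generators I G)" "b \<in> frags (tensor_generators I G)" by auto
    note mem = mem fragsD(2)[OF mem]
    have ab: "coset ?R a \<in> carrier ?T" "coset ?R b \<in> carrier ?T" "coset ?R (a - b) \<in> carrier ?T"
      using Q(7) mem by blast+
    have "coset ?R (a - b) \<otimes>\<^bsub>?T\<^esub> coset ?R b = coset ?R a"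
      using Q(6)[OF mem(3,2)] by simp
    then have "coset ?R (a - b) = coset ?R a \<otimes>\<^bsub>?T\<^esub> inv\<^bsub>?T\<^esub> coset ?R b"
      using ab T.inv_solve_right' by (metis T.inv_solve_right)
    then show ?case using assms(5)[OF ab(1,2)] diff mem by auto
  qed
  then show ?thesis using c(2) by simp
qed

lemma pure_tensor_in [intro]:
  assumes "\<forall>i\<in>I. group (G i)" "x \<in> tensor_generators I G"
  shows "pure_tensor I G x \<in> carrier (tensor_group I G)"
  unfolding pure_tensor_def by (rule quotient_ofD(7)[OF quotient_tensor[OF assms(1)]]) (simp only: frags_of assms(2))

lemma pure_tensor_mult:
  assumes G: "\<forall>i\<in>I. group (G i)" and x: "x \<in> tensor_generators I G" "i \<in> I" "y \<in> carrier (G i)" "z \<in> carrier (G i)"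
  shows "pure_tensor I G (x(i := y \<otimes>\<^bsub>G i\<^esub> z)) =
    pure_tensor I G (x(i := y)) \<otimes>\<^bsub>tensor_group I G\<^esub> pure_tensor I G (x(i := z))"
proof -
  note Q = quotient_ofD[OF quotient_tensor[OF G]]
  have "frag_of (x(i := y \<otimes>\<^bsub>G i\<^esub> z)) - (frag_of (x(i := y)) + frag_of (x(i := z))) \<in> multilinearity_relations I G"
    unfolding multilinearity_relations_def mem_Collect_eq
    by (rule exI[of _ x], rule exI[of _ i], rule exI[of _ y], rule exI[of _ z]) (use x in auto)
  then have "frag_of (x(i := y \<otimes>\<^bsub>G i\<^esub> z)) - (frag_of (x(i := y)) + frag_of (x(i := z))) \<in> tensor_relations I G"
    by (rule tensor_relations_incl[OF G, rotated])
  moreover have "x(i := y) \<in> tensor_generators I G" "x(i := z) \<in> tensor_generators I G"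
    using x by (auto intro!: PiE_upd[where A = "\<lambda>i. carrier (G i)"])
  ultimately show ?thesis unfolding pure_tensor_def by (subst Q(6)) (auto simp: coset_eq_iff[OF Q(2)])
qed

lemma pure_tensor_one:
  assumes G: "\<forall>i\<in>I. group (G i)" and x: "x \<in> tensor_generators I G" "i \<in> I" "x i = \<one>\<^bsub>G i\<^esub>"
  shows "pure_tensor I G x = \<one>\<^bsub>tensor_group I G\<^esub>"
proof -
  interpret T: group "tensor_group I G" by (rule group_quotient[OF quotient_tensor[OF G]])
  have one: "\<one>\<^bsub>G i\<^esub> \<in> carrier (G i)" "\<one>\<^bsub>G i\<^esub> \<otimes>\<^bsub>G i\<^esub> \<one>\<^bsub>G i\<^esub> = \<one>\<^bsub>G i\<^esub>"
    using bspec[OF G x(2)] by (simp_all add: group.is_monoid)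
  have "x(i := \<one>\<^bsub>G i\<^esub>) = x" using x(3) by auto
  then have "pure_tensor I G x \<otimes>\<^bsub>tensor_group I G\<^esub> pure_tensor I G x = pure_tensor I G x"
    using pure_tensor_mult[OF G x(1,2) one(1,1)] one(2) by simp
  then show ?thesis using pure_tensor_in[OF G x(1)] by (simp add: T.l_cancel_one)
qed

text \<open>By multilinearity a pure tensor with a neutral entry is neutral.\<close>

lemma tensor_trivial:
  assumes G: "\<forall>i\<in>I. group (G i)" and i: "i \<in> I" "carrier (G i) = {\<one>\<^bsub>G i\<^esub>}"
  shows "carrier (tensor_group I G) = {\<one>\<^bsub>tensor_group I G\<^esub>}"
proof -
  interpret T: group "tensor_group I G" by (rule group_quotient[OF quotient_tensor[OF G]])
  have "u = \<one>\<^bsub>tensor_group I G\<^esub>" if "u \<in> carrier (tensor_group I G)" for u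
  proof (rule tensor_induct[OF G that])
    fix x assume x: "x \<in> tensor_generators I G"
    then have "x i = \<one>\<^bsub>G i\<^esub>" using i by (auto simp: PiE_iff)
    then show "pure_tensor I G x = \<one>\<^bsub>tensor_group I G\<^esub>" by (intro pure_tensor_one[OF G x i(1)])
  qed auto
  then show ?thesis by auto
qed

text \<open>The universal property: a map multilinear modulo \<open>B'\<close> induces a homomorphism.\<close>

lemma tensor_universal:
  assumes G: "\<forall>i\<in>I. group (G i)" and q': "quotient_of S' B' H'"
    and F: "\<And>x. x \<in> tensor_generators I G \<Longrightarrow> F x \<in> S'"
    and mult: "\<And>x i y z. \<lbrakk>x \<in> tensor_generators I G; i \<in> I; y \<in> carrier (G i); z \<in> carrier (G i)\<rbrakk>
      \<Longrightarrow> F (x(i := y \<otimes>\<^bsub>G i\<^esub> z)) - F (x(i := y)) - F (x(i := z)) \<in> B'"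
  shows "class_map B' (frag_extend F) \<in> hom (tensor_group I G) H'"
    and "class_map B' (frag_extend F) (pure_tensor I G x) = coset B' (F x)"
proof -
  note q = quotient_tensor[OF G]
  have "additive_subset {c. frag_extend F c \<in> B'}"
    by (rule additive_subset_vimage[OF additive_map_frag_extend quotient_ofD(2)[OF q']])
  moreover have "multilinearity_relations I G \<subseteq> {c. frag_extend F c \<in> B'}"
    using mult by (auto simp: multilinearity_relations_def frag_extend_diff)
  ultimately have R: "frag_extend F b \<in> B'" if "b \<in> tensor_relations I G" for b
    using tensor_relations_induct[OF G] that by blast
  show "class_map B' (frag_extend F) \<in> hom (tensor_group I G) H'"
  proof (rule class_map_hom[OF q q' additive_map_frag_extend R])
    show "frag_extend F c \<in> S'" if "c \<in> frags (tensor_generators I G)" for c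
      by (rule additive_map_into[OF additive_map_frag_extend quotient_ofD(1)[OF q'] _ that]) (simp add: F)
  qed
  show "class_map B' (frag_extend F) (pure_tensor I G x) = coset B' (F x)"
    unfolding pure_tensor_def
    by (subst class_map_coset[OF q quotient_ofD(2)[OF q'] additive_map_frag_extend R]) auto
qed

lemma
  assumes G: "\<forall>i\<in>I. group (G i)" and H: "\<forall>i\<in>I. group (H i)"
    and f: "\<And>i. i \<in> I \<Longrightarrow> f i \<in> hom (G i) (H i)"
  shows tensor_map_hom: "tensor_map I H f \<in> hom (tensor_group I G) (tensor_group I H)"
    and tensor_map_pure: "x \<in> tensor_generators I G \<Longrightarrow>
      tensor_map I H f (pure_tensor I G x) = pure_tensor I H (\<lambda>i\<in>I. f i (x i))"
proof -
  have F: "frag_of (\<lambda>i\<in>I. f i (x i)) \<in> frags (tensor_generators I H)" if "x \<in> tensor_generators I G" for x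
  proof -
    have "(\<lambda>i\<in>I. f i (x i)) \<in> tensor_generators I H"
      using that f by (auto simp: PiE_iff hom_def Pi_def)
    then show ?thesis by (simp only: frags_of)
  qed
  have m: "frag_of (\<lambda>j\<in>I. f j ((x(i := y \<otimes>\<^bsub>G i\<^esub> z)) j)) - frag_of (\<lambda>j\<in>I. f j ((x(i := y)) j))
     - frag_of (\<lambda>j\<in>I. f j ((x(i := z)) j)) \<in> tensor_relations I H"
    if x: "x \<in> tensor_generators I G" "i \<in> I" "y \<in> carrier (G i)" "z \<in> carrier (G i)" for x i y z
  proof (rule tensor_relations_incl[OF H])
    let ?x = "\<lambda>j\<in>I. f j (x j)"
    have e: "(\<lambda>j\<in>I. f j ((x(i := w)) j)) = ?x(i := f i w)" for w using x(2) by auto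
    have "f i (y \<otimes>\<^bsub>G i\<^esub> z) = f i y \<otimes>\<^bsub>H i\<^esub> f i z" by (rule hom_mult[OF f[OF x(2)] x(3,4)])
    moreover have "?x \<in> tensor_generators I H" "f i y \<in> carrier (H i)" "f i z \<in> carrier (H i)"
      using x f by (auto simp: PiE_iff hom_def Pi_def)
    ultimately show "frag_of (\<lambda>j\<in>I. f j ((x(i := y \<otimes>\<^bsub>G i\<^esub> z)) j)) - frag_of (\<lambda>j\<in>I. f j ((x(i := y)) j))
     - frag_of (\<lambda>j\<in>I. f j ((x(i := z)) j)) \<in> multilinearity_relations I H"
      unfolding multilinearity_relations_def mem_Collect_eq e
      by (intro exI[of _ ?x] exI[of _ i] exI[of _ "f i y"] exI[of _ "f i z"]) (use x in auto)
  qed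
  show "tensor_map I H f \<in> hom (tensor_group I G) (tensor_group I H)"
    unfolding tensor_map_def
    by (rule tensor_universal(1)[OF G quotient_tensor[OF H]]) (use F m in auto)
  show "tensor_map I H f (pure_tensor I G x) = pure_tensor I H (\<lambda>i\<in>I. f i (x i))" if "x \<in> tensor_generators I G"
    unfolding tensor_map_def pure_tensor_def[of I H]
    by (rule tensor_universal(2)[OF G quotient_tensor[OF H]]) (use F m in auto)
qed

lemma tensor_hom_eqI:
  assumes G: "\<forall>i\<in>I. group (G i)" and H: "group H"
    and h: "h \<in> hom (tensor_group I G) H" and h': "h' \<in> hom (tensor_group I G) H"
    and eq: "\<And>x. x \<in> tensor_generators I G \<Longrightarrow> h (pure_tensor I G x) = h' (pure_tensor I G x)"
    and u: "u \<in> carrier (tensor_group I G)"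
  shows "h u = h' u"
proof -
  have T: "group (tensor_group I G)" by (rule group_quotient[OF quotient_tensor[OF G]])
  interpret h: group_hom "tensor_group I G" H h using T H h by (simp add: group_hom_def group_hom_axioms_def)
  interpret h': group_hom "tensor_group I G" H h' using T H h' by (simp add: group_hom_def group_hom_axioms_def)
  show ?thesis
    by (rule tensor_induct[OF G u]) (auto simp: eq)
qed

lemma tensor_hom_surj:
  assumes G: "\<forall>i\<in>I. group (G i)" and H: "group H" and h: "h \<in> hom H (tensor_group I G)"
    and pure: "\<And>x. x \<in> tensor_generators I G \<Longrightarrow> pure_tensor I G x \<in> h ` carrier H"
  shows "h ` carrier H = carrier (tensor_group I G)"
proof
  have T: "group (tensor_group I G)" by (rule group_quotient[OF quotient_tensor[OF G]])
  interpret h: group_hom H "tensor_group I G" h using T H h by (simp add: group_hom_def group_hom_axioms_def)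
  show "h ` carrier H \<subseteq> carrier (tensor_group I G)" by auto
  show "carrier (tensor_group I G) \<subseteq> h ` carrier H"
  proof
    fix u assume "u \<in> carrier (tensor_group I G)"
    then show "u \<in> h ` carrier H"
    proof (rule tensor_induct[OF G, where P = "\<lambda>u. u \<in> h ` carrier H"])
      show "\<one>\<^bsub>tensor_group I G\<^esub> \<in> h ` carrier H" by (metis h.hom_one h.G.one_closed imageI)
      fix u v assume "u \<in> h ` carrier H" "v \<in> h ` carrier H"
      then obtain a b where ab: "a \<in> carrier H" "b \<in> carrier H" "u = h a" "v = h b" by auto
      then have "u \<otimes>\<^bsub>tensor_group I G\<^esub> inv\<^bsub>tensor_group I G\<^esub> v = h (a \<otimes>\<^bsub>H\<^esub> inv\<^bsub>H\<^esub> b)" by simp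
      then show "u \<otimes>\<^bsub>tensor_group I G\<^esub> inv\<^bsub>tensor_group I G\<^esub> v \<in> h ` carrier H" using ab by blast
    qed (rule pure)
  qed
qed

section \<open>Combinatorial Alexander duality\<close>

lemma dual_complex_iff: "\<eta> \<subseteq> D \<Longrightarrow> D - \<eta> \<in> dual_complex D X \<longleftrightarrow> \<eta> \<notin> X"
  by (auto simp: dual_complex_def) (metis double_diff order_refl)

lemma dual_complex_iff': "\<eta> \<subseteq> D \<Longrightarrow> \<eta> \<in> dual_complex D X \<longleftrightarrow> D - \<eta> \<notin> X"
  using dual_complex_iff[of "D - \<eta>" D X] by (simp add: double_diff)

lemma dual_complex_subset: "dual_complex D X \<subseteq> Pow D"
  by (auto simp: dual_complex_def)

lemma down_closed_dual:
  assumes "down_closed X" shows "down_closed (dual_complex D X)"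
  unfolding down_closed_def
proof (intro ballI allI impI)
  fix \<tau> \<rho> assume \<tau>: "\<tau> \<in> dual_complex D X" and \<rho>: "\<rho> \<subseteq> \<tau>"
  then have "\<tau> \<subseteq> D" using dual_complex_subset[of D X] by auto
  moreover have "D - \<tau> \<subseteq> D - \<rho>" using \<rho> by auto
  ultimately show "\<rho> \<in> dual_complex D X"
    using \<tau> \<rho> assms dual_complex_iff'[of \<tau> D X] dual_complex_iff'[of \<rho> D X] by (auto simp: down_closed_def)
qed

lemma complement_map_zero:
  assumes "c \<in> frags X" shows "complement_map D X c = 0"
  by (rule additive_map_eqI[OF _ _ _ assms, where h = "\<lambda>c. 0"]) (auto simp: complement_map_def)

lemma complement_map_eq_0:
  assumes "finite D" "c \<in> frags (Pow D)" "complement_map D X c = 0"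
  shows "c \<in> frags X"
proof -
  let ?c = "complement D c"
  have "?c \<in> frags (Pow D - dual_complex D X)"
    by (rule cochain_restrict_eq_0[OF _ complement_frags]) (use assms complement_map_eq_restrict[OF assms(2), of X] in simp)
  then have "complement D ?c \<in> frags X"
    by (rule additive_map_into[rotated 3])
       (auto simp: complement_of dual_complex_iff' intro!: frags_cmul)
  then have "frag_cmul (complement_sign D D) (complement D ?c) \<in> frags X" by (rule frags_cmul)
  then show ?thesis by (simp add: complement_complement[OF assms(1,2)])
qed

lemma coboundary_complement_map:
  assumes "finite D" "down_closed X" "c \<in> frags (Pow D)"
  shows "coboundary (dual_complex D X) (complement_map D X c) = complement_map D X (boundary c)"
proof -
  have "boundary c \<in> frags (Pow D)" by (rule boundary_frags[OF _ assms(3)]) simp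
  then have "complement_map D X (boundary c) = cochain_restrict (dual_complex D X) (coboundary (Pow D) (complement D c))"
    by (simp add: complement_map_eq_restrict[of _ D X] coboundary_complement[OF assms(1,3)])
  also have "\<dots> = coboundary (dual_complex D X) (complement D c)"
    by (rule coboundary_restrict) (use assms(1) dual_complex_subset in auto)
  also have "\<dots> = coboundary (dual_complex D X) (complement_map D X c)"
    by (simp add: complement_map_eq_restrict[OF assms(3), of X] coboundary_of_restrict[OF down_closed_dual[OF assms(2)]])
  finally show ?thesis ..
qed

lemma complement_map_surj:
  assumes "finite D" "f \<in> frags (dual_complex D X)"
  obtains c where "c \<in> frags (Pow D)" "complement_map D X c = f"
proof -
  let ?c = "frag_cmul (complement_sign D D) (complement D f)"
  have f: "f \<in> frags (Pow D)" using assms(2) frags_mono[OF dual_complex_subset] by auto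
  have c: "?c \<in> frags (Pow D)" by (intro frags_cmul complement_frags)
  have "complement D ?c = f" by (simp add: complement_simps complement_complement[OF assms(1) f])
  then have "complement_map D X ?c = f"
    using cochain_restrict_id[OF assms(2)] by (simp add: complement_map_eq_restrict[OF c, of X])
  with c show ?thesis by (rule that)
qed

text \<open>
  The duality map of a pair of a simplex and a subcomplex; \<open>gamma\<close> is the case of a local complex.
\<close>

definition duality :: "'a::linorder set \<Rightarrow> 'a set set \<Rightarrow> ('a set \<Rightarrow>\<^sub>0 int) set \<Rightarrow> ('a set \<Rightarrow>\<^sub>0 int) set" where
  "duality D X x = class_map (coboundaries (dual_complex D X)) (complement_map D X)
     (inv_into (carrier (relative_homology (Pow D) X)) (class_map (boundaries X) boundary) x)"

locale simplex_pair =
  fixes D :: "'a::linorder set" and X :: "'a set set"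
  assumes fin: "finite D" and ne: "D \<noteq> {}" and down: "down_closed X" and sub: "X \<subseteq> Pow D"
begin

lemma finite_dual: "finite (dual_complex D X)"
  by (rule finite_subset[OF dual_complex_subset]) (simp add: fin)

lemmas q_homology = quotient_homology[OF down]
lemmas q_cohomology = quotient_cohomology[OF finite_dual down_closed_dual[OF down]]
lemmas q_relative = quotient_relative_homology[OF down_closed_Pow down sub]

lemma boundary_relative: "b \<in> relative_boundaries (Pow D) X \<Longrightarrow> boundary b \<in> boundaries X"
  by (auto simp: relative_boundaries_def boundaries_eq boundary_simps)

lemma complement_relative: "b \<in> relative_boundaries (Pow D) X \<Longrightarrow> complement_map D X b \<in> coboundaries (dual_complex D X)"
proof -
  assume "b \<in> relative_boundaries (Pow D) X"
  then obtain d a where "b = boundary d + a" "d \<in> frags (Pow D)" "a \<in> frags X"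
    by (auto simp: relative_boundaries_def boundaries_eq)
  then have "complement_map D X b = coboundary (dual_complex D X) (complement_map D X d)"
    by (simp add: complement_simps complement_map_zero coboundary_complement_map[OF fin down])
  moreover have "complement_map D X d \<in> frags (dual_complex D X)"
    using \<open>d \<in> frags (Pow D)\<close> by (simp add: complement_map_eq_restrict[of _ D X] cochain_restrict_frags)
  ultimately show ?thesis by (auto simp: coboundaries_eq)
qed

text \<open>The boundary isomorphism of the pair, because the simplex is acyclic.\<close>

lemma relative_boundary_iff:
  assumes "w \<in> relative_cycles (Pow D) X"
  shows "boundary w \<in> boundaries X \<longleftrightarrow> w \<in> relative_boundaries (Pow D) X"
proof
  assume "boundary w \<in> boundaries X"
  then obtain a where a: "a \<in> frags X" "boundary w = boundary a" by (auto simp: boundaries_eq)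
  have "w - a \<in> frags (Pow D)"
    using assms a(1) frags_mono[OF sub] by (auto simp: relative_cycles_def intro: fragsD(2))
  then obtain d where "d \<in> frags (Pow D)" "boundary d = w - a"
    using simplex_acyclic[OF fin ne, of "w - a"] a(2) by (auto simp: boundary_simps)
  then show "w \<in> relative_boundaries (Pow D) X"
    using a(1) unfolding relative_boundaries_def boundaries_eq
    by (intro CollectI exI[of _ "boundary d"] exI[of _ a] conjI imageI) simp_all
qed (rule boundary_relative)

lemma bounding_chain:
  assumes "c \<in> cycles X"
  obtains w where "w \<in> relative_cycles (Pow D) X" "boundary w = c"
proof -
  have "c \<in> frags (Pow D)" "boundary c = 0" using assms frags_mono[OF sub] by (auto simp: cycles_def)
  then obtain w where "w \<in> frags (Pow D)" "boundary w = c" using simplex_acyclic[OF fin ne, of c] by blast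
  then show ?thesis using that[of w] assms by (auto simp: relative_cycles_def cycles_def)
qed

lemma boundary_in_cycles: "w \<in> relative_cycles (Pow D) X \<Longrightarrow> boundary w \<in> cycles X"
  by (simp add: relative_cycles_def cycles_def)

lemma homology_class_bounding:
  assumes "x \<in> carrier (homology X)"
  obtains w where "w \<in> relative_cycles (Pow D) X" "x = coset (boundaries X) (boundary w)"
proof -
  note r = quotient_rep[OF q_homology assms]
  obtain w where "w \<in> relative_cycles (Pow D) X" "boundary w = rep x" using bounding_chain[OF r(1)] .
  then show ?thesis using that[of w] r(2) by simp
qed

lemma duality_class:
  assumes w: "w \<in> relative_cycles (Pow D) X"
  shows "duality D X (coset (boundaries X) (boundary w)) = coset (coboundaries (dual_complex D X)) (complement_map D X w)"
proof -
  let ?H = "relative_homology (Pow D) X" and ?R = "relative_boundaries (Pow D) X"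
  note Q = quotient_ofD[OF q_relative]
  have cm: "class_map (boundaries X) boundary (coset ?R c) = coset (boundaries X) (boundary c)" for c
    by (rule class_map_coset[OF q_relative additive_subset_boundaries additive_map_boundary boundary_relative])
  have "inj_on (class_map (boundaries X) boundary) (carrier ?H)"
  proof (rule inj_onI)
    fix x y assume "x \<in> carrier ?H" "y \<in> carrier ?H" and eq: "class_map (boundaries X) boundary x = class_map (boundaries X) boundary y"
    then obtain c d where cd: "c \<in> relative_cycles (Pow D) X" "d \<in> relative_cycles (Pow D) X" "x = coset ?R c" "y = coset ?R d"
      by (auto simp: Q(4))
    then have "boundary (c - d) \<in> boundaries X"
      using eq by (simp add: cm coset_eq_iff[OF additive_subset_boundaries] boundary_simps)
    then have "c - d \<in> ?R" using relative_boundary_iff additive_subsetD(2)[OF Q(1)] cd by blast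
    then show "x = y" by (simp add: cd coset_eq_iff[OF Q(2)])
  qed
  from inv_into_f_f[OF this Q(7)[OF w]]
  have "inv_into (carrier ?H) (class_map (boundaries X) boundary) (coset (boundaries X) (boundary w)) = coset ?R w"
    by (simp add: cm)
  then show ?thesis unfolding duality_def
    by (simp add: class_map_coset[OF q_relative additive_subset_coboundaries additive_map_complement_map complement_relative])
qed

lemma complement_map_cocycles:
  assumes "w \<in> relative_cycles (Pow D) X" shows "complement_map D X w \<in> cocycles (dual_complex D X)"
  using assms unfolding cocycles_def relative_cycles_def
  by (auto simp: coboundary_complement_map[OF fin down] complement_map_zero)
     (simp add: complement_map_eq_restrict[of _ D X] cochain_restrict_frags)

lemma duality_iso: "duality D X \<in> iso (homology X) (cohomology (dual_complex D X))"
proof (rule isoI)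
  note Q = quotient_ofD[OF q_homology] and Q' = quotient_ofD[OF q_cohomology]
  have into: "duality D X x \<in> carrier (cohomology (dual_complex D X))" if x: "x \<in> carrier (homology X)" for x
  proof -
    obtain w where "w \<in> relative_cycles (Pow D) X" "x = coset (boundaries X) (boundary w)"
      using homology_class_bounding[OF x] .
    then show ?thesis by (simp add: duality_class Q'(7) complement_map_cocycles)
  qed
  show "duality D X \<in> hom (homology X) (cohomology (dual_complex D X))"
  proof (rule homI[OF into])
    fix x y assume xy: "x \<in> carrier (homology X)" "y \<in> carrier (homology X)"
    obtain w v where wv: "w \<in> relative_cycles (Pow D) X" "x = coset (boundaries X) (boundary w)"
      "v \<in> relative_cycles (Pow D) X" "y = coset (boundaries X) (boundary v)"
      using homology_class_bounding[OF xy(1)] homology_class_bounding[OF xy(2)] by metis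
    then have "x \<otimes>\<^bsub>homology X\<^esub> y = coset (boundaries X) (boundary (w + v))"
      by (simp add: Q(6) boundary_in_cycles boundary_simps)
    moreover have "w + v \<in> relative_cycles (Pow D) X"
      using wv additive_subsetD(4)[OF quotient_ofD(1)[OF q_relative]] by auto
    ultimately show "duality D X (x \<otimes>\<^bsub>homology X\<^esub> y) = duality D X x \<otimes>\<^bsub>cohomology (dual_complex D X)\<^esub> duality D X y"
      using wv by (simp add: duality_class Q'(6) complement_map_cocycles complement_simps)
  qed auto
  show "bij_betw (duality D X) (carrier (homology X)) (carrier (cohomology (dual_complex D X)))"
    unfolding bij_betw_def
  proof (intro conjI inj_onI)
    fix x y assume xy: "x \<in> carrier (homology X)" "y \<in> carrier (homology X)" and eq: "duality D X x = duality D X y"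
    obtain w v where wv: "w \<in> relative_cycles (Pow D) X" "x = coset (boundaries X) (boundary w)"
      "v \<in> relative_cycles (Pow D) X" "y = coset (boundaries X) (boundary v)"
      using homology_class_bounding[OF xy(1)] homology_class_bounding[OF xy(2)] by metis
    have wv': "w - v \<in> frags (Pow D)" using wv by (auto simp: relative_cycles_def intro: fragsD(2))
    have "complement_map D X (w - v) \<in> coboundaries (dual_complex D X)"
      using eq wv by (simp add: duality_class coset_eq_iff[OF Q'(2)] complement_simps)
    then obtain g where g: "g \<in> frags (dual_complex D X)" "complement_map D X (w - v) = coboundary (dual_complex D X) g"
      by (auto simp: coboundaries_eq)
    obtain d where d: "d \<in> frags (Pow D)" "complement_map D X d = g" using complement_map_surj[OF fin g(1)] .
    have "w - v - boundary d \<in> frags (Pow D)"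
      by (intro fragsD(2) wv' boundary_frags[OF _ d(1)]) simp
    then have "w - v - boundary d \<in> frags X"
      by (rule complement_map_eq_0[OF fin])
         (use g(2) d coboundary_complement_map[OF fin down d(1)] in \<open>simp add: complement_simps\<close>)
    then have "boundary (w - v - boundary d) \<in> boundaries X" by (auto simp: boundaries_eq)
    then show "x = y" by (simp add: wv coset_eq_iff[OF Q(2)] boundary_simps)
  next
    show "duality D X ` carrier (homology X) = carrier (cohomology (dual_complex D X))"
    proof (intro equalityI subsetI)
    fix y assume "y \<in> carrier (cohomology (dual_complex D X))"
    then obtain f where f: "f \<in> cocycles (dual_complex D X)" "y = coset (coboundaries (dual_complex D X)) f" by (auto simp: Q'(4))
    then obtain w where w: "w \<in> frags (Pow D)" "complement_map D X w = f"
      using complement_map_surj[OF fin] by (auto simp: cocycles_def)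
    have "boundary w \<in> frags X"
      by (rule complement_map_eq_0[OF fin])
         (use f w coboundary_complement_map[OF fin down w(1)] boundary_frags[OF down_closed_Pow w(1)] in \<open>auto simp: cocycles_def\<close>)
    then have "w \<in> relative_cycles (Pow D) X" using w by (simp add: relative_cycles_def)
    then show "y \<in> duality D X ` carrier (homology X)"
      unfolding f(2) w(2)[symmetric] duality_class[OF \<open>w \<in> relative_cycles (Pow D) X\<close>, symmetric]
      by (intro imageI Q(7) boundary_in_cycles)
    qed (use into in auto)
  qed
qed

end

lemma down_closed_local: "down_closed K \<Longrightarrow> down_closed (local_complex K t)"
  unfolding down_closed_def local_complex_def
  by (auto split: prod.splits if_splits) (metis Un_mono order_refl)+

lemma local_complex_subset: "local_complex K t \<subseteq> Pow (snd t)"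
  by (auto simp: local_complex_def split: prod.splits if_splits)

text \<open>
  Both sides say of \<open>\<eta> \<subseteq> \<omega>\<close> that \<open>(\<omega> - \<eta>) \<union> \<sigma>\<close> is not a face of \<open>K\<close>, because the complement of
  \<open>\<eta> \<union> \<sigma>'\<close> in \<open>V\<close> is \<open>(\<omega> - \<eta>) \<union> \<sigma>\<close>.
\<close>

lemma local_dual:
  assumes K: "down_closed K" and t: "t \<in> X_index V"
  shows "local_complex (dual_complex V K) (opposite V t) = dual_complex (snd t) (local_complex K t)"
proof -
  obtain \<sigma> \<omega> where t': "t = (\<sigma>, \<omega>)" by (cases t)
  have s: "\<sigma> \<subseteq> V" "\<omega> \<subseteq> V" "\<sigma> \<inter> \<omega> = {}" using t by (auto simp: X_index_def t')
  have 1: "V - (\<sigma> \<union> \<omega>) \<in> dual_complex V K \<longleftrightarrow> \<sigma> \<union> \<omega> \<notin> K"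
    by (rule dual_complex_iff) (use s in auto)
  have 2: "\<eta> \<union> (V - (\<sigma> \<union> \<omega>)) \<in> dual_complex V K \<longleftrightarrow> \<sigma> \<union> (\<omega> - \<eta>) \<notin> K" if "\<eta> \<subseteq> \<omega>" for \<eta>
  proof -
    have "V - (\<eta> \<union> (V - (\<sigma> \<union> \<omega>))) = \<sigma> \<union> (\<omega> - \<eta>)" using s that by auto
    moreover have "\<eta> \<union> (V - (\<sigma> \<union> \<omega>)) \<subseteq> V" using s that by auto
    ultimately show ?thesis using dual_complex_iff' by metis
  qed
  have 3: "\<omega> - \<eta> \<in> local_complex K t \<longleftrightarrow> \<sigma> \<union> (\<omega> - \<eta>) \<in> K" for \<eta>
    using K unfolding down_closed_def local_complex_def t' by (auto simp: Un_commute)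
  have 4: "\<sigma> \<union> \<omega> \<in> K \<Longrightarrow> \<sigma> \<union> (\<omega> - \<eta>) \<in> K" for \<eta> using K unfolding down_closed_def by (metis Diff_subset Un_mono order_refl)
  have "\<eta> \<in> local_complex (dual_complex V K) (opposite V t) \<longleftrightarrow> \<eta> \<subseteq> \<omega> \<and> \<sigma> \<union> (\<omega> - \<eta>) \<notin> K" for \<eta>
    using 1 2 4 by (auto simp: local_complex_def opposite_def t')
  moreover have "\<eta> \<in> dual_complex \<omega> (local_complex K t) \<longleftrightarrow> \<eta> \<subseteq> \<omega> \<and> \<sigma> \<union> (\<omega> - \<eta>) \<notin> K" for \<eta>
    using dual_complex_iff'[of \<eta> \<omega> "local_complex K t"] 3[of \<eta>] dual_complex_subset[of \<omega> "local_complex K t"] by auto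
  ultimately show ?thesis by (auto simp: t')
qed

lemma gamma_eq_duality:
  assumes "down_closed L" "t \<in> X_index V"
  shows "gamma V L t = duality (snd t) (local_complex L t)"
  by (rule ext) (simp add: gamma_def duality_def Let_def local_dual[OF assms])

lemma opposite_X_index: "t \<in> X_index V \<Longrightarrow> opposite V t \<in> X_index V"
  by (auto simp: X_index_def opposite_def)

lemma opposite_opposite: "t \<in> X_index V \<Longrightarrow> opposite V (opposite V t) = t"
  by (auto simp: X_index_def opposite_def)

lemma snd_opposite [simp]: "snd (opposite V t) = snd t"
  by (simp add: opposite_def split: prod.splits)

lemma opposite_L_index: "t \<in> L_index V \<Longrightarrow> opposite V t \<in> L_index V"
  by (auto simp: X_index_def L_index_def opposite_def)

lemma L_index_X_index: "t \<in> L_index V \<Longrightarrow> t \<in> X_index V" and L_index_nonempty: "t \<in> L_index V \<Longrightarrow> snd t \<noteq> {}"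
  by (auto simp: L_index_def)

section \<open>Splitting the chains of a pair\<close>

(* Keeps the lower bound of the index sets {1..m} in the form in which they are stated. *)
declare One_nat_def [simp del]

definition is_basis ::
    "('b \<Rightarrow>\<^sub>0 int) set \<Rightarrow> nat \<Rightarrow> (nat \<Rightarrow> 'b \<Rightarrow>\<^sub>0 int) \<Rightarrow> (nat \<Rightarrow> ('b \<Rightarrow>\<^sub>0 int) \<Rightarrow> int) \<Rightarrow> bool" where
  "is_basis M r \<beta> coef \<longleftrightarrow> (\<forall>i<r. \<beta> i \<in> M) \<and>
    (\<forall>i. \<forall>x\<in>M. \<forall>y\<in>M. coef i (x + y) = coef i x + coef i y) \<and>
    (\<forall>i<r. \<forall>j<r. coef i (\<beta> j) = (if i = j then 1 else 0)) \<and>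
    (\<forall>x\<in>M. x = (\<Sum>i<r. frag_cmul (coef i x) (\<beta> i)))"

lemma is_basisD:
  assumes "is_basis M r \<beta> coef"
  shows "i < r \<Longrightarrow> \<beta> i \<in> M" "x \<in> M \<Longrightarrow> y \<in> M \<Longrightarrow> coef i (x + y) = coef i x + coef i y"
    "i < r \<Longrightarrow> j < r \<Longrightarrow> coef i (\<beta> j) = (if i = j then 1 else 0)"
    "x \<in> M \<Longrightarrow> (\<Sum>i<r. frag_cmul (coef i x) (\<beta> i)) = x"
  using assms unfolding is_basis_def by auto

text \<open>
  Subgroups of finitely generated free abelian groups are free: the coefficients of a basis
  element in a subgroup form an ideal of the integers, and its generator is realised by a new basis element.
\<close>

lemma finite_basis:
  fixes M :: "('b \<Rightarrow>\<^sub>0 int) set"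
  assumes "finite S" "additive_subset M" "M \<subseteq> frags S"
  shows "\<exists>r \<beta> coef. is_basis M r \<beta> coef"
  using assms
proof (induction S arbitrary: M rule: finite_induct)
  case empty
  then have "M = {0}" using additive_subsetD(1)[of M] by (auto simp: frags_def)
  then have "is_basis M 0 (\<lambda>_. 0) (\<lambda>_ _. 0)" by (simp add: is_basis_def)
  then show ?case by blast
next
  case (insert s S)
  have drop: "x \<in> frags S" if "x \<in> frags (insert s S)" "Poly_Mapping.lookup x s = 0" for x :: "'b \<Rightarrow>\<^sub>0 int"
  proof -
    have "s \<notin> Poly_Mapping.keys x" using that(2) by (simp add: in_keys_iff)
    then show ?thesis using that(1) by (auto simp: frags_def)
  qed
  note M = additive_subsetD[OF insert.prems(1)] additive_subset_cmul[OF insert.prems(1)]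
  let ?l = "\<lambda>x. Poly_Mapping.lookup x s"
  show ?case
  proof (cases "\<forall>x\<in>M. ?l x = 0")
    case True
    have "M \<subseteq> frags S" using drop insert.prems(2) True by blast
    then show ?thesis by (rule insert.IH[OF insert.prems(1)])
  next
    case False
    then obtain x0 where x0: "x0 \<in> M" "?l x0 \<noteq> 0" by auto
    define Q where "Q d \<longleftrightarrow> 0 < d \<and> (\<exists>x\<in>M. ?l x = int d)" for d :: nat
    have "?l (- x0) = - ?l x0" by simp
    then have "\<exists>x\<in>M. ?l x = \<bar>?l x0\<bar>"
      using x0(1) M(3)[OF x0(1)] by (cases "0 \<le> ?l x0") (metis abs_of_nonneg, metis abs_of_neg not_le)
    then have "Q (nat \<bar>?l x0\<bar>)"
      using x0(2) unfolding Q_def by simp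
    then have "Q (LEAST d. Q d)" by (rule LeastI)
    moreover define d where "d = (LEAST d. Q d)"
    ultimately have Qd: "Q d" by simp
    then obtain m0 where d: "0 < d" "m0 \<in> M" "?l m0 = int d" unfolding Q_def by blast
    have least: "d \<le> d'" if "Q d'" for d' unfolding d_def by (rule Least_le) (rule that)
    define q where "q x = ?l x div int d" for x
    have red: "x - frag_cmul (q x) m0 \<in> M" if "x \<in> M" for x using M(2)[OF that M(5)[OF d(2)]] .
    have dvd: "int d dvd ?l x" if "x \<in> M" for x
    proof (rule ccontr)
      assume "\<not> int d dvd ?l x"
      then have "?l x mod int d \<noteq> 0" by (simp add: dvd_eq_mod_eq_0)
      then have pos: "0 < ?l x mod int d" "?l x mod int d < int d"
        using d(1) pos_mod_sign[of "int d" "?l x"] pos_mod_bound[of "int d" "?l x"] by linarith+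
      have "?l (x - frag_cmul (q x) m0) = ?l x mod int d"
        by (simp add: lookup_minus d(3) q_def minus_div_mult_eq_mod)
      then have "Q (nat (?l x mod int d))" using pos red[OF that] unfolding Q_def by force
      from least[OF this] pos show False by linarith
    qed
    let ?M = "M \<inter> frags S"
    have red': "x - frag_cmul (q x) m0 \<in> ?M" if x: "x \<in> M" for x
    proof -
      have "?l (x - frag_cmul (q x) m0) = 0" using dvd[OF x] by (simp add: lookup_minus d(3) q_def)
      moreover have "x - frag_cmul (q x) m0 \<in> frags (insert s S)" using red[OF x] insert.prems(2) by auto
      ultimately show ?thesis using red[OF x] drop by blast
    qed
    have q_add: "q (x + y) = q x + q y" if "x \<in> M" "y \<in> M" for x y
      unfolding q_def lookup_add using dvd[OF that(1)] by (rule div_plus_div_distrib_dvd_left)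
    have "additive_subset ?M" by (rule additive_subset_Int) (use insert.prems in auto)
    from insert.IH[OF this inf_le2] obtain r \<beta> coef where "is_basis ?M r \<beta> coef" by blast
    note IH = is_basisD[OF this]
    define \<beta>' where "\<beta>' = \<beta>(r := m0)"
    define coef' where "coef' i x = (if i = r then q x else coef i (x - frag_cmul (q x) m0))" for i x
    have z: "coef i 0 = 0" for i using IH(2)[of 0 0] M(1) fragsD(1)[of S] by simp
    have qm: "q m0 = 1" using d by (simp add: q_def)
    have q\<beta>: "q (\<beta> j) = 0" if "j < r" for j
    proof -
      have "s \<notin> Poly_Mapping.keys (\<beta> j)" using IH(1) that insert.hyps(2) by (auto simp: frags_def)
      then show ?thesis by (simp add: q_def in_keys_iff)
    qed
    have "is_basis M (Suc r) \<beta>' coef'"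
      unfolding is_basis_def
    proof (intro conjI allI impI ballI)
      show "\<beta>' i \<in> M" if "i < Suc r" for i using that IH(1) d(2) by (auto simp: \<beta>'_def less_Suc_eq)
      show "coef' i (x + y) = coef' i x + coef' i y" if "x \<in> M" "y \<in> M" for i x y
      proof -
        have "x + y - frag_cmul (q (x + y)) m0 = (x - frag_cmul (q x) m0) + (y - frag_cmul (q y) m0)"
          by (simp add: q_add[OF that] frag_cmul_distrib)
        then show ?thesis
          by (simp only: coef'_def IH(2)[OF red'[OF that(1)] red'[OF that(2)]] q_add[OF that]) simp
      qed
      show "coef' i (\<beta>' j) = (if i = j then 1 else 0)" if "i < Suc r" "j < Suc r" for i j
        using that IH(3) by (auto simp: coef'_def \<beta>'_def less_Suc_eq qm q\<beta> z)
      show "x = (\<Sum>i<Suc r. frag_cmul (coef' i x) (\<beta>' i))" if "x \<in> M" for x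
      proof -
        have "x - frag_cmul (q x) m0 = (\<Sum>i<r. frag_cmul (coef' i x) (\<beta>' i))"
          using IH(4)[OF red'[OF that]] by (simp add: coef'_def \<beta>'_def)
        then show ?thesis by (simp add: coef'_def \<beta>'_def algebra_simps)
      qed
    qed
    then show ?thesis by blast
  qed
qed

text \<open>
  The image is free, so the preimages of a basis may be chosen freely.
\<close>

lemma additive_section:
  fixes g :: "('b \<Rightarrow>\<^sub>0 int) \<Rightarrow> ('c \<Rightarrow>\<^sub>0 int)"
  assumes "finite S" "additive_map g" "additive_subset A" "g ` A \<subseteq> frags S"
  obtains s where "\<And>x. x \<in> g ` A \<Longrightarrow> s x \<in> A" "\<And>x. x \<in> g ` A \<Longrightarrow> g (s x) = x"
    "\<And>x y. x \<in> g ` A \<Longrightarrow> y \<in> g ` A \<Longrightarrow> s (x + y) = s x + s y"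
proof -
  obtain r \<beta> coef where "is_basis (g ` A) r \<beta> coef"
    using finite_basis[OF assms(1) additive_subset_image[OF assms(2,3)] assms(4)] by blast
  note b = is_basisD[OF this]
  from b(1) have "\<forall>i\<in>{..<r}. \<exists>a\<in>A. g a = \<beta> i" by (force simp: image_iff)
  then obtain a where a: "\<And>i. i < r \<Longrightarrow> a i \<in> A \<and> g (a i) = \<beta> i" using bchoice[of "{..<r}"] by (metis lessThan_iff)
  show ?thesis
  proof (rule that[of "\<lambda>x. \<Sum>i<r. frag_cmul (coef i x) (a i)"])
    show "(\<Sum>i<r. frag_cmul (coef i x) (a i)) \<in> A" for x
      by (intro additive_subset_sum[OF assms(3)] additive_subset_cmul[OF assms(3)]) (use a in auto)
    show "g (\<Sum>i<r. frag_cmul (coef i x) (a i)) = x" if "x \<in> g ` A" for x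
      using b(4)[OF that] a by (simp add: additive_map_sum[OF assms(2)] additive_map_cmul[OF assms(2)])
    show "(\<Sum>i<r. frag_cmul (coef i (x + y)) (a i)) = (\<Sum>i<r. frag_cmul (coef i x) (a i)) + (\<Sum>i<r. frag_cmul (coef i y) (a i))"
      if "x \<in> g ` A" "y \<in> g ` A" for x y
      using b(2)[OF that] by (simp add: frag_cmul_distrib sum.distrib)
  qed
qed

text \<open>
  The section of the boundary map can be chosen to anticommute with the sign \<open>eps 1\<close>: keep only its
  components that change the parity of the degree.
\<close>

lemma boundary_section:
  fixes X :: "'a::linorder set set"
  assumes "finite X" "down_closed X"
  obtains s where "\<And>x. x \<in> boundaries X \<Longrightarrow> s x \<in> frags X" "\<And>x. x \<in> boundaries X \<Longrightarrow> boundary (s x) = x"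
    "\<And>x y. x \<in> boundaries X \<Longrightarrow> y \<in> boundaries X \<Longrightarrow> s (x + y) = s x + s y"
    "\<And>x. x \<in> boundaries X \<Longrightarrow> s (eps 1 x) = - eps 1 (s x)"
proof -
  let ?E = "cochain_restrict {\<tau> :: 'a set. even (card \<tau>)}" and ?O = "cochain_restrict {\<tau> :: 'a set. odd (card \<tau>)}"
  have split: "?E c + ?O c = c" for c
    by (rule additive_map_eqI[where S = UNIV and c = c and g = "\<lambda>c. ?E c + ?O c" and h = "\<lambda>c. c"])
       (auto simp: additive_map_def additive_dist cochain_restrict_of)
  have E: "eps 1 (?E c) = ?E c" for c
    by (rule additive_map_eqI[where S = UNIV and c = c and g = "\<lambda>c. eps 1 (?E c)" and h = ?E])
       (auto simp: additive_map_def additive_dist cochain_restrict_of graded_sign_of graded_sign_simps)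
  have O: "eps 1 (?O c) = - ?O c" for c
    by (rule additive_map_eqI[where S = UNIV and c = c and g = "\<lambda>c. eps 1 (?O c)" and h = "\<lambda>c. - ?O c"])
       (auto simp: additive_map_def additive_dist cochain_restrict_of graded_sign_of graded_sign_simps)
  have bE: "boundary (?E c) = ?O (boundary c)" if "c \<in> frags X" for c
  proof -
    have odd: "cochain_restrict {\<tau>. even (card \<tau>)} (boundary (?E c)) = 0"
    proof (rule additive_map_eqI[where S = UNIV and c = c and g = "\<lambda>c. ?E (boundary (?E c))" and h = "\<lambda>c. 0"])
      fix \<tau> :: "'a set"
      show "?E (boundary (?E (frag_of \<tau>))) = 0"
      proof (cases "even (card \<tau>) \<and> finite \<tau>")
        case True
        then show ?thesis
          by (auto simp: cochain_restrict_of boundary_frag_of cochain_restrict_simps card_Diff_singleton_if intro!: sum.neutral)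
      qed (auto simp: cochain_restrict_of boundary_frag_of cochain_restrict_simps boundary_simps)
    qed (auto simp: additive_map_def additive_dist)
    have even: "cochain_restrict {\<tau>. odd (card \<tau>)} (boundary (?O c)) = 0"
    proof (rule additive_map_eqI[where S = UNIV and c = c and g = "\<lambda>c. ?O (boundary (?O c))" and h = "\<lambda>c. 0"])
      fix \<tau> :: "'a set"
      show "?O (boundary (?O (frag_of \<tau>))) = 0"
      proof (cases "odd (card \<tau>) \<and> finite \<tau>")
        case True
        then show ?thesis
          by (auto simp: cochain_restrict_of boundary_frag_of cochain_restrict_simps card_Diff_singleton_if intro!: sum.neutral)
      qed (auto simp: cochain_restrict_of boundary_frag_of cochain_restrict_simps boundary_simps)
    qed (auto simp: additive_map_def additive_dist)
    have "boundary (?E c) = ?O (boundary (?E c))" using split[of "boundary (?E c)"] odd by simp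
    also have "\<dots> = ?O (boundary (?E c + ?O c))" using even by (simp add: boundary_simps cochain_restrict_simps del: split)
    finally show ?thesis by (simp add: split)
  qed
  have bO: "boundary (?O c) = ?E (boundary c)" if "c \<in> frags X" for c
  proof -
    have "boundary (?E c) + boundary (?O c) = ?E (boundary c) + ?O (boundary c)"
      by (simp only: split boundary_simps(2)[symmetric])
    then show ?thesis using bE[OF that] by simp
  qed
  have into: "cochain_restrict A c \<in> frags X" if "c \<in> frags X" for c A
    by (rule additive_map_into[where g = "cochain_restrict A", OF _ _ _ that]) (auto simp: cochain_restrict_of fragsD(1))
  have BE: "?E x \<in> boundaries X" and BO: "?O x \<in> boundaries X" if "x \<in> boundaries X" for x
    using that bE[symmetric] bO[symmetric] into by (auto simp: boundaries_eq)
  obtain s0 where s0: "\<And>x. x \<in> boundaries X \<Longrightarrow> s0 x \<in> frags X" "\<And>x. x \<in> boundaries X \<Longrightarrow> boundary (s0 x) = x"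
    "\<And>x y. x \<in> boundaries X \<Longrightarrow> y \<in> boundaries X \<Longrightarrow> s0 (x + y) = s0 x + s0 y"
    using additive_section[OF assms(1) additive_map_boundary additive_subset_frags, of X] boundary_frags[OF assms(2)]
    unfolding boundaries_eq by blast
  have zz: "s0 0 = 0" using s0(3)[of 0 0] additive_subsetD(1)[OF additive_subset_boundaries[of X]] by simp
  have s0m: "s0 (- x) = - s0 x" if "x \<in> boundaries X" for x
    using s0(3)[OF that additive_subsetD(3)[OF additive_subset_boundaries that]] zz by (simp add: eq_neg_iff_add_eq_0 add.commute)
  have EE: "?E (eps 1 x) = ?E x" and OO: "?O (eps 1 x) = - ?O x" for x
    by (simp_all only: cochain_restrict_graded_sign E O)
  show ?thesis
  proof (rule that[of "\<lambda>x. ?E (s0 (?O x)) + ?O (s0 (?E x))"])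
    fix x assume x: "x \<in> boundaries X"
    show "?E (s0 (?O x)) + ?O (s0 (?E x)) \<in> frags X"
      by (intro fragsD(4) into s0(1) BE BO x)
    show "boundary (?E (s0 (?O x)) + ?O (s0 (?E x))) = x"
    proof -
      have "?O (?O x) = ?O x" "?E (?E x) = ?E x" by (simp_all add: cochain_restrict_id[OF cochain_restrict_frags])
      then show ?thesis
        using split[of x] by (simp add: boundary_simps bE[OF s0(1)[OF BO[OF x]]] bO[OF s0(1)[OF BE[OF x]]] s0(2) BE[OF x] BO[OF x] add.commute)
    qed
    show "?E (s0 (?O (eps 1 x))) + ?O (s0 (?E (eps 1 x))) = - eps 1 (?E (s0 (?O x)) + ?O (s0 (?E x)))"
      by (simp only: EE OO s0m[OF BO[OF x]] graded_sign_simps cochain_restrict_simps E O) simp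
    fix y assume y: "y \<in> boundaries X"
    show "?E (s0 (?O (x + y))) + ?O (s0 (?E (x + y))) = ?E (s0 (?O x)) + ?O (s0 (?E x)) + (?E (s0 (?O y)) + ?O (s0 (?E y)))"
      by (simp add: cochain_restrict_simps s0(3) BE BO x y)
  qed
qed

text \<open>
  A choice \<open>\<zeta>\<close> of bounding chains for the cycles of \<open>X\<close> inside the simplex splits the chains of the
  pair: \<open>\<phi>\<close> below retracts all chains onto the representatives \<open>boundary (\<zeta> c)\<close>, and
  \<open>P = \<phi> + \<zeta> \<circ> \<phi> \<circ> boundary\<close> is a retraction onto the span of the \<open>\<zeta> c\<close> and \<open>boundary (\<zeta> c)\<close> which
  is chain homotopic to the identity by a homotopy \<open>h\<close> that preserves \<open>X\<close>.
\<close>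

locale bounded_pair = simplex_pair D X for D :: "'a::linorder set" and X +
  fixes \<zeta> :: "('a set \<Rightarrow>\<^sub>0 int) \<Rightarrow> ('a set \<Rightarrow>\<^sub>0 int)"
  assumes \<zeta>_frags: "\<And>c. c \<in> cycles X \<Longrightarrow> \<zeta> c \<in> frags (Pow D)"
    and \<zeta>_boundary: "\<And>c. c \<in> cycles X \<Longrightarrow> boundary (\<zeta> c) - c \<in> boundaries X"
    and \<zeta>_add: "\<And>c d. c \<in> cycles X \<Longrightarrow> d \<in> cycles X \<Longrightarrow> \<zeta> (c + d) = \<zeta> c + \<zeta> d"
    and \<zeta>_class: "\<And>c. c \<in> boundaries X \<Longrightarrow> \<zeta> c = 0"
    and \<zeta>_eps: "\<And>c. c \<in> cycles X \<Longrightarrow> \<zeta> (eps 1 c) = - eps 1 (\<zeta> c)"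
begin

lemma boundaries_cycles: "c \<in> boundaries X \<Longrightarrow> c \<in> cycles X"
  using boundary_frags[OF down] by (auto simp: boundaries_eq cycles_def)

lemma \<zeta>_diff: "c \<in> cycles X \<Longrightarrow> d \<in> cycles X \<Longrightarrow> \<zeta> (c - d) = \<zeta> c - \<zeta> d"
  using \<zeta>_add[of "c - d" d] additive_subsetD(2)[OF additive_subset_cycles, of c X d] by simp

lemma \<zeta>_boundary_\<zeta>:
  assumes "c \<in> cycles X" shows "boundary (\<zeta> c) \<in> cycles X" "\<zeta> (boundary (\<zeta> c)) = \<zeta> c"
proof -
  have d: "boundary (\<zeta> c) - c \<in> cycles X" using \<zeta>_boundary[OF assms] boundaries_cycles by auto
  show c: "boundary (\<zeta> c) \<in> cycles X" using additive_subsetD(4)[OF additive_subset_cycles d assms] by simp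
  show "\<zeta> (boundary (\<zeta> c)) = \<zeta> c" using \<zeta>_diff[OF c assms] \<zeta>_class[OF \<zeta>_boundary[OF assms]] by simp
qed

lemma splitting:
  obtains r :: nat and b w :: "nat \<Rightarrow> 'a set \<Rightarrow>\<^sub>0 int" and \<alpha> :: "nat \<Rightarrow> ('a set \<Rightarrow>\<^sub>0 int) \<Rightarrow> int" and h where
    "\<And>i. i < r \<Longrightarrow> w i = \<zeta> (b i)" "\<And>i. i < r \<Longrightarrow> b i = boundary (w i)"
    "\<And>i. i < r \<Longrightarrow> b i \<in> cycles X" "\<And>i. i < r \<Longrightarrow> w i \<in> frags (Pow D)"
    "\<And>c. c \<in> cycles X \<Longrightarrow> \<exists>n. c - (\<Sum>i<r. frag_cmul (n i) (b i)) \<in> boundaries X"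
    "\<And>i. additive_map (\<alpha> i)" "\<And>i j. i < r \<Longrightarrow> j < r \<Longrightarrow> \<alpha> i (b j) = (if i = j then 1 else 0)"
    "\<And>i j n. i < r \<Longrightarrow> j < r \<Longrightarrow> \<alpha> i (eps n (w j)) = 0"
    "\<And>i c. i < r \<Longrightarrow> c \<in> frags X \<Longrightarrow> \<alpha> i (boundary c) = 0"
    "additive_map h" "\<And>c. c \<in> frags X \<Longrightarrow> h c \<in> frags X" "\<And>c. c \<in> frags (Pow D) \<Longrightarrow> h c \<in> frags (Pow D)"
    "\<And>c. c \<in> frags (Pow D) \<Longrightarrow> h (eps 1 c) = - eps 1 (h c)"
    "\<And>c. c \<in> frags (Pow D) \<Longrightarrow> boundary (h c) + h (boundary c) =
       c - ((\<Sum>i<r. frag_cmul (\<alpha> i c) (b i)) + (\<Sum>i<r. frag_cmul (\<alpha> i (boundary c)) (w i)))"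
    "\<And>c. c \<in> frags (Pow D) \<Longrightarrow> (\<Sum>i<r. frag_cmul (\<alpha> i (eps 1 c)) (b i)) = eps 1 (\<Sum>i<r. frag_cmul (\<alpha> i c) (b i))"
    "\<And>c. c \<in> frags (Pow D) \<Longrightarrow> (\<Sum>i<r. frag_cmul (\<alpha> i (eps 1 c)) (w i)) = - eps 1 (\<Sum>i<r. frag_cmul (\<alpha> i c) (w i))"
proof -
  have finX: "finite X" by (rule finite_subset[OF sub]) (simp add: fin)
  obtain s where s: "\<And>x. x \<in> boundaries X \<Longrightarrow> s x \<in> frags X" "\<And>x. x \<in> boundaries X \<Longrightarrow> boundary (s x) = x"
    "\<And>x y. x \<in> boundaries X \<Longrightarrow> y \<in> boundaries X \<Longrightarrow> s (x + y) = s x + s y"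
    "\<And>x. x \<in> boundaries X \<Longrightarrow> s (eps 1 x) = - eps 1 (s x)"
    using boundary_section[OF finX down] by blast
  define \<rho> where "\<rho> = cochain_restrict X"
  have \<rho>: "additive_map \<rho>" "\<And>c. \<rho> c \<in> frags X" "\<And>c. c \<in> frags X \<Longrightarrow> \<rho> c = c" "\<And>c. \<rho> (eps 1 c) = eps 1 (\<rho> c)"
    by (simp_all add: \<rho>_def cochain_restrict_frags cochain_restrict_id cochain_restrict_graded_sign)
  note Bnd = additive_subsetD[OF additive_subset_boundaries[of X]]
  note Cyc = additive_subsetD[OF additive_subset_cycles[of X]]
  have bX: "boundary c \<in> boundaries X" if "c \<in> frags X" for c using that by (auto simp: boundaries_eq)
  have s_0: "s 0 = 0" using s(3)[OF Bnd(1) Bnd(1)] by simp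
  have \<zeta>_0: "\<zeta> 0 = 0" using \<zeta>_add[OF Cyc(1) Cyc(1)] by simp
  \<comment> \<open>Restriction to \<open>X\<close> followed by \<open>c \<mapsto> c - s (boundary c)\<close> projects all chains onto the cycles of \<open>X\<close>.\<close>
  define e where "e c = \<rho> c - s (boundary (\<rho> c))" for c
  have e: "additive_map e" "\<And>c. e c \<in> cycles X" "\<And>c. c \<in> cycles X \<Longrightarrow> e c = c" "\<And>c. e (eps 1 c) = eps 1 (e c)"
  proof -
    show "additive_map e"
      by (rule additive_mapI) (simp add: e_def additive_map_add[OF \<rho>(1)] boundary_simps s(3) bX \<rho>(2))
    show "e c \<in> cycles X" for c
      using s(1,2)[OF bX[OF \<rho>(2)[of c]]] \<rho>(2) by (auto simp: cycles_def e_def boundary_simps intro!: fragsD(2))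
    show "e c = c" if "c \<in> cycles X" for c using that by (simp add: cycles_def e_def \<rho>(3) s_0)
    show "e (eps 1 c) = eps 1 (e c)" for c
    proof -
      have "boundary (eps 1 (\<rho> c)) = eps 1 (boundary (- \<rho> c))" by (simp add: boundary_eps boundary_simps graded_sign_simps)
      then have "s (boundary (\<rho> (eps 1 c))) = - eps 1 (s (boundary (- \<rho> c)))"
        using s(4)[OF bX[OF fragsD(3)[OF \<rho>(2)[of c]]]] by (simp add: \<rho>(4))
      moreover have "s (boundary (- \<rho> c)) = - s (boundary (\<rho> c))"
        using s(3)[OF bX[OF fragsD(3)[OF \<rho>(2)[of c]]] bX[OF \<rho>(2)[of c]]] by (simp add: boundary_simps s_0 eq_neg_iff_add_eq_0)
      ultimately show ?thesis by (simp add: e_def \<rho>(4) graded_sign_simps)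
    qed
  qed
  \<comment> \<open>\<open>M\<close> is the group of chosen representatives: it meets every homology class of \<open>X\<close> exactly once.\<close>
  define M where "M = (\<lambda>c. boundary (\<zeta> c)) ` cycles X"
  have M_cycles: "\<mu> \<in> cycles X" and M_fix: "boundary (\<zeta> \<mu>) = \<mu>" if "\<mu> \<in> M" for \<mu>
    using that \<zeta>_boundary_\<zeta> by (auto simp: M_def)
  have M: "additive_subset M"
    unfolding additive_subset_def
  proof (intro conjI ballI)
    show "0 \<in> M" unfolding M_def using Cyc(1) \<zeta>_0 by (intro image_eqI[of _ _ 0]) (auto simp: boundary_simps)
    fix x y assume "x \<in> M" "y \<in> M"
    then obtain c d where cd: "c \<in> cycles X" "d \<in> cycles X" "x = boundary (\<zeta> c)" "y = boundary (\<zeta> d)" by (auto simp: M_def)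
    then have "x - y = boundary (\<zeta> (c - d))" by (simp add: \<zeta>_diff boundary_simps)
    then show "x - y \<in> M" unfolding M_def using Cyc(2)[OF cd(1,2)] by blast
  qed
  define \<phi>0 where "\<phi>0 c = boundary (\<zeta> (e c))" for c
  have \<phi>0: "additive_map \<phi>0" "\<And>c. \<phi>0 c \<in> M" "\<And>\<mu>. \<mu> \<in> M \<Longrightarrow> \<phi>0 \<mu> = \<mu>" "\<And>c. \<phi>0 (eps 1 c) = eps 1 (\<phi>0 c)"
    "\<And>c. c \<in> frags X \<Longrightarrow> \<phi>0 (boundary c) = 0"
  proof -
    show "additive_map \<phi>0" by (rule additive_mapI) (simp add: \<phi>0_def additive_map_add[OF e(1)] \<zeta>_add e(2) boundary_simps)
    show "\<phi>0 c \<in> M" for c unfolding \<phi>0_def M_def using e(2) by blast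
    show "\<phi>0 \<mu> = \<mu>" if "\<mu> \<in> M" for \<mu> by (simp add: \<phi>0_def e(3)[OF M_cycles[OF that]] M_fix[OF that])
    show "\<phi>0 (eps 1 c) = eps 1 (\<phi>0 c)" for c by (simp add: \<phi>0_def e(4) \<zeta>_eps[OF e(2)] boundary_simps boundary_eps)
    show "\<phi>0 (boundary c) = 0" if "c \<in> frags X" for c
      by (simp add: \<phi>0_def e(3)[OF boundaries_cycles[OF bX[OF that]]] \<zeta>_class[OF bX[OF that]] boundary_simps)
  qed
  \<comment> \<open>The correction makes \<open>\<phi>\<close> vanish on the chosen bounding chains and changes nothing on \<open>X\<close>.\<close>
  define \<phi> where "\<phi> c = \<phi>0 c - \<phi>0 (\<zeta> (\<phi>0 (boundary c)))" for c
  have \<zeta>\<phi>0: "additive_map (\<lambda>c. \<zeta> (\<phi>0 c))"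
    by (rule additive_mapI) (simp add: additive_map_add[OF \<phi>0(1)] \<zeta>_add M_cycles \<phi>0(2))
  have \<phi>: "additive_map \<phi>" "\<And>c. \<phi> c \<in> M" "\<And>\<mu>. \<mu> \<in> M \<Longrightarrow> \<phi> \<mu> = \<mu>" "\<And>c. \<phi> (eps 1 c) = eps 1 (\<phi> c)"
    "\<And>c. c \<in> frags X \<Longrightarrow> \<phi> c = \<phi>0 c" "\<And>c. \<phi> (boundary c) = \<phi>0 (boundary c)" "\<And>\<mu>. \<mu> \<in> M \<Longrightarrow> \<phi> (\<zeta> \<mu>) = 0"
  proof -
    show "additive_map \<phi>"
      unfolding \<phi>_def
      by (rule additive_mapI) (simp add: additive_map_add[OF \<phi>0(1)] \<zeta>_add M_cycles \<phi>0(2) boundary_simps)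
    show "\<phi> c \<in> M" for c unfolding \<phi>_def by (intro additive_subsetD(2)[OF M] \<phi>0(2))
    show "\<phi> \<mu> = \<mu>" if "\<mu> \<in> M" for \<mu>
      using M_cycles[OF that] by (simp add: \<phi>_def \<phi>0(3)[OF that] cycles_def additive_map_zero[OF \<phi>0(1)] \<zeta>_0)
    show "\<phi> (eps 1 c) = eps 1 (\<phi> c)" for c
    proof -
      have "\<phi>0 (boundary (eps 1 c)) = - eps 1 (\<phi>0 (boundary c))"
        by (simp add: boundary_eps additive_map_minus[OF \<phi>0(1)] \<phi>0(4))
      moreover have "\<zeta> (- eps 1 (\<phi>0 (boundary c))) = eps 1 (\<zeta> (\<phi>0 (boundary c)))"
      proof -
        have "eps 1 (\<phi>0 (boundary c)) \<in> cycles X" using \<phi>0(2)[of "eps 1 (boundary c)"] M_cycles by (simp add: \<phi>0(4))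
        then have "\<zeta> (- eps 1 (\<phi>0 (boundary c))) = - \<zeta> (eps 1 (\<phi>0 (boundary c)))"
          using \<zeta>_diff[OF Cyc(1)] \<zeta>_0 by simp
        then show ?thesis by (simp add: \<zeta>_eps[OF M_cycles[OF \<phi>0(2)]])
      qed
      ultimately show ?thesis by (simp add: \<phi>_def \<phi>0(4) graded_sign_simps)
    qed
    show "\<phi> c = \<phi>0 c" if "c \<in> frags X" for c by (simp add: \<phi>_def \<phi>0(5)[OF that] \<zeta>_0 additive_map_zero[OF \<phi>0(1)])
    show "\<phi> (boundary c) = \<phi>0 (boundary c)" for c by (simp add: \<phi>_def additive_map_zero[OF \<phi>0(1)] \<zeta>_0)
    show "\<phi> (\<zeta> \<mu>) = 0" if "\<mu> \<in> M" for \<mu> by (simp add: \<phi>_def M_fix[OF that] \<phi>0(3)[OF that])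
  qed
  have \<zeta>\<phi>: "additive_map (\<lambda>c. \<zeta> (\<phi> c))"
    by (rule additive_mapI) (simp add: additive_map_add[OF \<phi>(1)] \<zeta>_add M_cycles \<phi>(2))
  define P where "P c = \<phi> c + \<zeta> (\<phi> (boundary c))" for c
  have P: "additive_map P" "\<And>c. boundary (P c) = P (boundary c)" "\<And>c. P c \<in> frags (Pow D)"
    "\<And>c. c \<in> frags X \<Longrightarrow> P c = \<phi>0 c" "\<And>c. P (eps 1 c) = eps 1 (P c)"
  proof -
    show "additive_map P" unfolding P_def
      by (rule additive_mapI) (simp add: additive_map_add[OF \<phi>(1)] \<zeta>_add M_cycles \<phi>(2) boundary_simps)
    have "boundary (\<phi> c) = 0" for c using M_cycles[OF \<phi>(2)] by (simp add: cycles_def)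
    then show "boundary (P c) = P (boundary c)" for c
      by (simp add: P_def boundary_simps M_fix[OF \<phi>(2)] additive_map_zero[OF \<phi>(1)] \<zeta>_0)
    show "P c \<in> frags (Pow D)" for c
      unfolding P_def using M_cycles[OF \<phi>(2)] frags_mono[OF sub] \<zeta>_frags
      by (intro fragsD(4)) (auto simp: cycles_def)
    show "P c = \<phi>0 c" if "c \<in> frags X" for c by (simp add: P_def \<phi>(5,6) that \<phi>0(5) \<zeta>_0)
    show "P (eps 1 c) = eps 1 (P c)" for c
    proof -
      have "\<phi> (boundary (eps 1 c)) = - eps 1 (\<phi> (boundary c))"
        by (simp add: boundary_eps additive_map_minus[OF \<phi>(1)] \<phi>(4))
      moreover have "\<zeta> (- eps 1 (\<phi> (boundary c))) = eps 1 (\<zeta> (\<phi> (boundary c)))"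
      proof -
        have "eps 1 (\<phi> (boundary c)) \<in> cycles X" using \<phi>(2)[of "eps 1 (boundary c)"] M_cycles by (simp add: \<phi>(4))
        then have "\<zeta> (- eps 1 (\<phi> (boundary c))) = - \<zeta> (eps 1 (\<phi> (boundary c)))"
          using \<zeta>_diff[OF Cyc(1)] \<zeta>_0 by simp
        then show ?thesis by (simp add: \<zeta>_eps[OF M_cycles[OF \<phi>(2)]])
      qed
      ultimately show ?thesis by (simp add: P_def \<phi>(4) graded_sign_simps)
    qed
  qed
  \<comment> \<open>On \<open>X\<close> the section \<open>s\<close> gives a homotopy; the defect of its extension factors through the
    quotient of the simplex by \<open>X\<close> and is contracted by a cone.\<close>
  have h0: "e c - \<phi>0 c \<in> boundaries X" for c
    using Bnd(3)[OF \<zeta>_boundary[OF e(2)[of c]]] by (simp add: \<phi>0_def)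
  define h' where "h' c = s (e c - \<phi>0 c)" for c
  have h': "additive_map h'" "\<And>c. h' c \<in> frags X" "\<And>c. boundary (h' c) = e c - \<phi>0 c" "\<And>c. h' (eps 1 c) = - eps 1 (h' c)"
  proof -
    show "additive_map h'"
    proof (rule additive_mapI)
      fix x y
      have "e (x + y) - \<phi>0 (x + y) = (e x - \<phi>0 x) + (e y - \<phi>0 y)" by (simp add: additive_map_add[OF \<phi>0(1)] additive_map_add[OF e(1)])
      then show "h' (x + y) = h' x + h' y" using s(3)[OF h0 h0] by (simp add: h'_def)
    qed
    show "h' c \<in> frags X" "boundary (h' c) = e c - \<phi>0 c" for c using s(1,2)[OF h0] by (simp_all add: h'_def)
    show "h' (eps 1 c) = - eps 1 (h' c)" for c
      using s(4)[OF h0[of c]] by (simp add: h'_def e(4) \<phi>0(4) graded_sign_simps)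
  qed
  define R where "R c = c - P c - boundary (h' c) - h' (boundary c)" for c
  have R_add: "additive_map R" unfolding R_def
    by (rule additive_mapI) (simp add: additive_map_add[OF P(1)] additive_map_add[OF h'(1)] boundary_simps)
  have R_X: "R c = 0" if "c \<in> frags X" for c
  proof -
    have "h' (boundary c) = s (boundary c)"
      by (simp add: h'_def \<phi>0(5)[OF that] e(3)[OF boundaries_cycles[OF bX[OF that]]])
    then show ?thesis by (simp add: R_def P(4)[OF that] h'(3)) (simp add: e_def \<rho>(3)[OF that])
  qed
  have R_boundary: "boundary (R c) = R (boundary c)" for c
    by (simp add: R_def boundary_simps P(2) additive_map_zero[OF h'(1)])
  have R_frags: "R c \<in> frags (Pow D)" if "c \<in> frags (Pow D)" for c
    unfolding R_def
    by (intro fragsD(2) that P(3) boundary_frags[OF down_closed_Pow] frags_mono[OF sub h'(2)])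
  have R_eps: "R (eps 1 c) = eps 1 (R c)" for c
    by (simp add: R_def P(5) h'(4) boundary_eps additive_map_minus[OF h'(1)] boundary_simps graded_sign_simps)
  obtain v where v: "v \<in> D" using ne by auto
  define h where "h c = h' c + cone v (R c)" for c
  have homotopy: "boundary (h c) + h (boundary c) = c - P c" if "c \<in> frags (Pow D)" for c
  proof -
    have "boundary (cone v (R c)) + cone v (boundary (R c)) = R c"
      by (rule cone_homotopy[OF frags_finite[OF fin R_frags[OF that]]])
    then have "boundary (h c) + h (boundary c) = boundary (h' c) + h' (boundary c) + R c"
      by (simp add: h_def boundary_simps R_boundary algebra_simps)
    then show ?thesis by (simp add: R_def)
  qed
  have "finite (Pow D)" by (simp add: fin)
  moreover have "M \<subseteq> frags (Pow D)" using M_cycles frags_mono[OF sub] by (auto simp: cycles_def)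
  ultimately obtain r \<beta> coef where "is_basis M r \<beta> coef" using finite_basis[OF _ M] by blast
  note b = is_basisD[OF this]
  define \<alpha> where "\<alpha> i c = coef i (\<phi> c)" for i c
  have \<alpha>_add: "additive_map (\<alpha> i)" for i
    by (rule additive_mapI) (simp add: \<alpha>_def additive_map_add[OF \<phi>(1)] b(2) \<phi>(2))
  have coef_0: "coef i 0 = 0" for i using b(2)[of 0 0] additive_subsetD(1)[OF M] by simp
  have Sb: "(\<Sum>i<r. frag_cmul (\<alpha> i c) (\<beta> i)) = \<phi> c" for c using b(4)[OF \<phi>(2)] by (simp add: \<alpha>_def)
  have Sw: "(\<Sum>i<r. frag_cmul (\<alpha> i c) (\<zeta> (\<beta> i))) = \<zeta> (\<phi> c)" for c
  proof -
    \<comment> \<open>\<open>\<zeta> \<circ> \<phi>0\<close> is additive everywhere and agrees with \<open>\<zeta>\<close> on \<open>M\<close>\<close>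
    have "\<zeta> (\<phi> c) = \<zeta> (\<phi>0 (\<Sum>i<r. frag_cmul (\<alpha> i c) (\<beta> i)))" by (simp add: Sb \<phi>0(3)[OF \<phi>(2)])
    also have "\<dots> = (\<Sum>i<r. frag_cmul (\<alpha> i c) (\<zeta> (\<phi>0 (\<beta> i))))"
      by (simp add: additive_map_sum[OF \<zeta>\<phi>0] additive_map_cmul[OF \<zeta>\<phi>0])
    finally show ?thesis using b(1) by (simp add: \<phi>0(3))
  qed
  show ?thesis
  proof (rule that[of r "\<lambda>i. \<zeta> (\<beta> i)" \<beta> \<alpha> h])
    show "\<beta> i = boundary (\<zeta> (\<beta> i))" if "i < r" for i using M_fix[OF b(1)[OF that]] by simp
    show "\<beta> i \<in> cycles X" "\<zeta> (\<beta> i) \<in> frags (Pow D)" if "i < r" for i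
      using M_cycles[OF b(1)[OF that]] \<zeta>_frags by auto
    show "\<exists>n. c - (\<Sum>i<r. frag_cmul (n i) (\<beta> i)) \<in> boundaries X" if c: "c \<in> cycles X" for c
    proof (intro exI)
      have "boundary (\<zeta> c) \<in> M" using c by (auto simp: M_def)
      from b(4)[OF this] Bnd(3)[OF \<zeta>_boundary[OF c]]
      show "c - (\<Sum>i<r. frag_cmul (coef i (boundary (\<zeta> c))) (\<beta> i)) \<in> boundaries X" by simp
    qed
    show "\<alpha> i (\<beta> j) = (if i = j then 1 else 0)" if "i < r" "j < r" for i j
      using b(3)[OF that] by (simp add: \<alpha>_def \<phi>(3)[OF b(1)[OF that(2)]])
    show "\<alpha> i (eps n (\<zeta> (\<beta> j))) = 0" if "i < r" "j < r" for i j n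
    proof -
      have "\<phi> (eps n (\<zeta> (\<beta> j))) = 0"
        using \<phi>(7)[OF b(1)[OF that(2)]] \<phi>(4)[of "\<zeta> (\<beta> j)"]
          graded_sign_parity[of n 1 card "\<zeta> (\<beta> j)"] graded_sign_even[of n card "\<zeta> (\<beta> j)"]
        by (cases "even n") (auto simp: graded_sign_simps)
      then show ?thesis by (simp add: \<alpha>_def coef_0)
    qed
    show "\<alpha> i (boundary c) = 0" if "c \<in> frags X" for i c by (simp add: \<alpha>_def \<phi>(6) \<phi>0(5)[OF that] coef_0)
    show "additive_map h" unfolding h_def
      by (rule additive_mapI) (simp add: additive_map_add[OF h'(1)] additive_map_add[OF R_add] cone_simps)
    show "h c \<in> frags X" if "c \<in> frags X" for c using h'(2) by (simp add: h_def R_X[OF that] cone_simps)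
    show "h c \<in> frags (Pow D)" if "c \<in> frags (Pow D)" for c unfolding h_def
      by (intro fragsD(4) frags_mono[OF sub h'(2)] cone_frags v R_frags that)
    show "h (eps 1 c) = - eps 1 (h c)" if "c \<in> frags (Pow D)" for c
      by (simp add: h_def h'(4) R_eps cone_eps[OF frags_finite[OF fin R_frags[OF that]]] graded_sign_simps)
    show "boundary (h c) + h (boundary c) =
       c - ((\<Sum>i<r. frag_cmul (\<alpha> i c) (\<beta> i)) + (\<Sum>i<r. frag_cmul (\<alpha> i (boundary c)) (\<zeta> (\<beta> i))))" if "c \<in> frags (Pow D)" for c
      using homotopy[OF that] by (simp add: Sb Sw P_def)
    show "(\<Sum>i<r. frag_cmul (\<alpha> i (eps 1 c)) (\<beta> i)) = eps 1 (\<Sum>i<r. frag_cmul (\<alpha> i c) (\<beta> i))" for c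
      by (simp only: Sb \<phi>(4))
    show "(\<Sum>i<r. frag_cmul (\<alpha> i (eps 1 c)) (\<zeta> (\<beta> i))) = - eps 1 (\<Sum>i<r. frag_cmul (\<alpha> i c) (\<zeta> (\<beta> i)))" for c
      by (simp only: Sw \<phi>(4) \<zeta>_eps[OF M_cycles[OF \<phi>(2)]])
  qed (auto simp: \<alpha>_add)
qed

end

section \<open>Polyhedral joins of pairs of complexes\<close>

lemma tensor_op_frag_of: "tensor_op I g (frag_of \<eta>) = join_chain I (\<lambda>k. g k (frag_of (slice \<eta> k)))"
  by (simp add: tensor_op_def)

lemma tensor_op_cong:
  assumes "finite I" "\<And>k x. k \<in> I \<Longrightarrow> x \<in> frags (Pow (D k)) \<Longrightarrow> g k x = g' k x" "c \<in> frags (Pow (Sigma I D))"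
  shows "tensor_op I g c = tensor_op I g' c"
proof (rule additive_map_eqI[OF _ _ _ assms(3), where g = "tensor_op I g" and h = "tensor_op I g'"])
  fix \<tau> assume "\<tau> \<in> Pow (Sigma I D)"
  then have "frag_of (slice \<tau> k) \<in> frags (Pow (D k))" if "k \<in> I" for k by (auto simp: slice_def)
  then show "tensor_op I g (frag_of \<tau>) = tensor_op I g' (frag_of \<tau>)"
    unfolding tensor_op_frag_of using assms(2) by (intro join_chain_cong assms(1)) auto
qed simp_all

text \<open>
  The tensor product of operators is additive in each of them; this is how the retraction of a join is
  compared with the identity one block at a time.
\<close>

lemma tensor_op_slot:
  assumes "finite I" "k \<in> I" "c \<in> frags (Pow (Sigma I D))"
    and g: "\<And>i x. i \<in> I \<Longrightarrow> i \<noteq> k \<Longrightarrow> x \<in> frags (Pow (D i)) \<Longrightarrow> g i x = g'' i x \<and> g' i x = g'' i x"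
    and e: "\<And>x. x \<in> frags (Pow (D k)) \<Longrightarrow> g'' k x = g k x + g' k x"
  shows "tensor_op I g'' c = tensor_op I g c + tensor_op I g' c"
proof (rule additive_map_eqI[OF _ _ _ assms(3), where g = "tensor_op I g''" and h = "\<lambda>c. tensor_op I g c + tensor_op I g' c"])
  fix \<tau> assume "\<tau> \<in> Pow (Sigma I D)"
  then have \<tau>: "frag_of (slice \<tau> i) \<in> frags (Pow (D i))" if "i \<in> I" for i by (auto simp: slice_def)
  let ?x = "\<lambda>i. frag_of (slice \<tau> i)"
  have "tensor_op I g'' (frag_of \<tau>) = join_chain I ((\<lambda>i. g'' i (?x i))(k := g k (?x k) + g' k (?x k)))"
    unfolding tensor_op_frag_of using e[OF \<tau>[OF assms(2)]] by (intro join_chain_cong assms(1)) simp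
  also have "\<dots> = join_chain I ((\<lambda>i. g'' i (?x i))(k := g k (?x k))) + join_chain I ((\<lambda>i. g'' i (?x i))(k := g' k (?x k)))"
    by (rule join_chain_upd_add[OF assms(1,2)])
  also have "\<dots> = tensor_op I g (frag_of \<tau>) + tensor_op I g' (frag_of \<tau>)"
    unfolding tensor_op_frag_of using g[OF _ _ \<tau>] by (intro arg_cong2[where f = "(+)"] join_chain_cong assms(1)) auto
  finally show "tensor_op I g'' (frag_of \<tau>) = tensor_op I g (frag_of \<tau>) + tensor_op I g' (frag_of \<tau>)" .
qed (simp_all add: additive_map_def additive_dist)

lemma tensor_op_zero:
  assumes "finite I" "k \<in> I" "\<And>x. g k x = 0" shows "tensor_op I g c = 0"
  by (rule additive_map_eqI[where S = UNIV and c = c and g = "tensor_op I g" and h = "\<lambda>c. 0"])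
     (auto simp: tensor_op_frag_of intro!: join_chain_zero[OF assms(1,2)] assms(3))

lemma join_chain_binary:
  assumes "finite I" "finite A" "A \<subseteq> I"
  shows "join_chain I (\<lambda>k. if k \<in> A then p k + q k else q k) = (\<Sum>\<tau>\<in>Pow A. join_chain I (\<lambda>k. if k \<in> \<tau> then p k else q k))"
proof -
  have "join_chain I (\<lambda>k. if k \<in> A then p k + q k else if k \<in> B then p k else q k) =
     (\<Sum>\<tau>\<in>Pow A. join_chain I (\<lambda>k. if k \<in> \<tau> \<union> B then p k else q k))" if "finite A" "A \<subseteq> I" "A \<inter> B = {}" for A B
    using that
  proof (induction A arbitrary: B rule: finite_induct)
    case (insert a A)
    let ?c = "\<lambda>k. if k \<in> A then p k + q k else if k \<in> B then p k else q k"
    have aI: "a \<in> I" using insert by auto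
    have "join_chain I (\<lambda>k. if k \<in> insert a A then p k + q k else if k \<in> B then p k else q k) = join_chain I (?c(a := p a + q a))"
      by (intro join_chain_cong assms(1)) auto
    also have "\<dots> = join_chain I (?c(a := p a)) + join_chain I (?c(a := q a))" by (rule join_chain_upd_add[OF assms(1) aI])
    also have "join_chain I (?c(a := p a)) = join_chain I (\<lambda>k. if k \<in> A then p k + q k else if k \<in> insert a B then p k else q k)"
      using insert.hyps by (intro join_chain_cong assms(1)) auto
    also have "\<dots> = (\<Sum>\<tau>\<in>Pow A. join_chain I (\<lambda>k. if k \<in> \<tau> \<union> insert a B then p k else q k))"
      using insert by (intro insert.IH) auto
    also have "join_chain I (?c(a := q a)) = join_chain I ?c"
      using insert by (intro join_chain_cong assms(1)) auto
    also have "\<dots> = (\<Sum>\<tau>\<in>Pow A. join_chain I (\<lambda>k. if k \<in> \<tau> \<union> B then p k else q k))"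
      using insert by (intro insert.IH) auto
    also have "(\<Sum>\<tau>\<in>Pow A. join_chain I (\<lambda>k. if k \<in> \<tau> \<union> insert a B then p k else q k)) =
       (\<Sum>\<tau>\<in>insert a ` Pow A. join_chain I (\<lambda>k. if k \<in> \<tau> \<union> B then p k else q k))"
      using insert.hyps by (subst sum.reindex) (auto simp: inj_on_def comp_def intro!: sum.cong join_chain_cong assms(1))
    also have "\<dots> + (\<Sum>\<tau>\<in>Pow A. join_chain I (\<lambda>k. if k \<in> \<tau> \<union> B then p k else q k)) =
       (\<Sum>\<tau>\<in>Pow (insert a A). join_chain I (\<lambda>k. if k \<in> \<tau> \<union> B then p k else q k))"
      unfolding Pow_insert using insert.hyps by (subst (2) Un_commute, subst sum.union_disjoint) auto
    finally show ?case .
  qed simp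
  from this[OF assms(2,3), of "{}"] show ?thesis by (simp only: empty_iff if_False Un_empty_right Int_empty_right simp_thms)
qed

definition later :: "nat set \<Rightarrow> nat \<Rightarrow> nat" where
  "later \<tau> k = card {i \<in> \<tau>. k < i}"

text \<open>
  \<open>block_chain\<close> substitutes chains of the blocks for the letters of a simplex \<open>\<tau>\<close>: \<open>w k\<close> for
  \<open>n-bar\<close>, that is, \<open>k \<in> \<tau>\<close>, and \<open>b k\<close> for \<open>n\<close>. The sign is that of moving the letters past
  the chains.
\<close>

definition block_chain :: "nat set \<Rightarrow> (nat \<Rightarrow> 'a set \<Rightarrow>\<^sub>0 int) \<Rightarrow> (nat \<Rightarrow> 'a set \<Rightarrow>\<^sub>0 int)
    \<Rightarrow> (nat set \<Rightarrow>\<^sub>0 int) \<Rightarrow> ((nat \<times> 'a) set \<Rightarrow>\<^sub>0 int)" where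
  "block_chain I w b = frag_extend (\<lambda>\<tau>. join_chain I (\<lambda>k.
     if k \<in> \<tau> then frag_cmul ((-1) ^ later \<tau> k) (eps (later \<tau> k) (w k)) else eps (later \<tau> k) (b k)))"

lemma additive_map_block_chain [simp]: "additive_map (block_chain I w b)"
  by (simp add: block_chain_def)

lemmas block_chain_simps = additive_map_zero[OF additive_map_block_chain] additive_map_add[OF additive_map_block_chain]
  additive_map_diff[OF additive_map_block_chain] additive_map_minus[OF additive_map_block_chain]
  additive_map_cmul[OF additive_map_block_chain] additive_map_sum[OF additive_map_block_chain]

declare additive_map_add[OF additive_map_block_chain, additive_dist]

lemma block_chain_of: "block_chain I w b (frag_of \<tau>) = join_chain I (\<lambda>k.
     if k \<in> \<tau> then frag_cmul ((-1) ^ later \<tau> k) (eps (later \<tau> k) (w k)) else eps (later \<tau> k) (b k))"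
  by (simp add: block_chain_def)

lemma block_chain_slot:
  assumes "finite I" "k \<in> I"
  shows "block_chain I (w(k := x + y)) (b(k := p + q)) c =
    block_chain I (w(k := x)) (b(k := p)) c + block_chain I (w(k := y)) (b(k := q)) c"
proof (rule additive_map_eqI[where S = UNIV and c = c and g = "block_chain I (w(k := x + y)) (b(k := p + q))"
      and h = "\<lambda>c. block_chain I (w(k := x)) (b(k := p)) c + block_chain I (w(k := y)) (b(k := q)) c"])
  fix \<tau> :: "nat set"
  let ?c = "\<lambda>i. if i \<in> \<tau> then frag_cmul ((-1) ^ later \<tau> i) (eps (later \<tau> i) (w i)) else eps (later \<tau> i) (b i)"
  let ?f = "\<lambda>x p. if k \<in> \<tau> then frag_cmul ((-1) ^ later \<tau> k) (eps (later \<tau> k) x) else eps (later \<tau> k) p"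
  have e: "block_chain I (w(k := x)) (b(k := p)) (frag_of \<tau>) = join_chain I (?c(k := ?f x p))" for x p
    unfolding block_chain_of by (intro join_chain_cong assms(1)) auto
  have "?f (x + y) (p + q) = ?f x p + ?f y q" by (simp add: graded_sign_simps frag_cmul_distrib2)
  then show "block_chain I (w(k := x + y)) (b(k := p + q)) (frag_of \<tau>) =
    block_chain I (w(k := x)) (b(k := p)) (frag_of \<tau>) + block_chain I (w(k := y)) (b(k := q)) (frag_of \<tau>)"
    unfolding e by (simp only: join_chain_upd_add[OF assms])
qed (simp_all add: additive_map_def additive_dist)

lemma later_remove:
  assumes "finite \<tau>" "k \<in> \<tau>"
  shows "later \<tau> i = (if i < k then Suc (later (\<tau> - {k}) i) else later (\<tau> - {k}) i)"
proof (cases "i < k")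
  case True
  then have "{j \<in> \<tau>. i < j} = insert k {j \<in> \<tau> - {k}. i < j}" using assms by auto
  then show ?thesis using True assms by (simp add: later_def)
next
  case False
  then have "{j \<in> \<tau>. i < j} = {j \<in> \<tau> - {k}. i < j}" by auto
  then show ?thesis using False by (simp add: later_def)
qed

text \<open>
  The polyhedral join at one index: a complex \<open>K\<close> on the blocks in \<open>W\<close>, each carrying a pair of the simplex
  on \<open>D k\<close> and a subcomplex \<open>Y k\<close>. A block outside \<open>W\<close> has no vertices and contributes the empty simplex.
\<close>

locale block_complexes =
  fixes m :: nat and I W :: "nat set" and D :: "nat \<Rightarrow> 'a::linorder set" and Y :: "nat \<Rightarrow> 'a set set" and K :: "nat set set"
  assumes I_eq: "I = {1..m}" and W: "W \<subseteq> I" and D_finite: "\<And>k. k \<in> I \<Longrightarrow> finite (D k)"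
    and Y_sub: "\<And>k. k \<in> I \<Longrightarrow> Y k \<subseteq> Pow (D k)" and Y_down: "\<And>k. k \<in> I \<Longrightarrow> down_closed (Y k)"
    and outside: "\<And>k. k \<in> I \<Longrightarrow> k \<notin> W \<Longrightarrow> D k = {} \<and> Y k = {{}}"
    and K_sub: "K \<subseteq> Pow W" and K_down: "down_closed K"
begin

lemma I_finite [simp]: "finite I" by (simp add: I_eq)

definition nonfaces :: "(nat \<times> 'a) set \<Rightarrow> nat set" where
  "nonfaces \<eta> = {k \<in> I. slice \<eta> k \<notin> Y k}"

definition Z :: "(nat \<times> 'a) set set" where
  "Z = {\<eta>. \<eta> \<subseteq> Sigma I D \<and> nonfaces \<eta> \<in> K}"

lemma W_finite: "finite W" by (rule finite_subset[OF W I_finite])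

lemma D_Sigma_finite: "finite (Sigma I D)" using D_finite by auto

lemma Z_sub: "Z \<subseteq> Pow (Sigma I D)" by (auto simp: Z_def)

lemma Z_down: "down_closed Z"
  unfolding down_closed_def
proof (intro ballI allI impI)
  fix \<eta> \<rho> assume \<eta>: "\<eta> \<in> Z" and \<rho>: "\<rho> \<subseteq> \<eta>"
  have "slice \<rho> k \<subseteq> slice \<eta> k" for k using \<rho> by (auto simp: slice_def)
  then have "nonfaces \<rho> \<subseteq> nonfaces \<eta>" using Y_down unfolding nonfaces_def down_closed_def by blast
  then show "\<rho> \<in> Z" using \<eta> \<rho> K_down unfolding Z_def down_closed_def by blast
qed

lemma Sigma_in_Z:
  assumes "\<And>k. k \<in> I \<Longrightarrow> \<rho> k \<subseteq> D k" "\<And>k. k \<in> I \<Longrightarrow> k \<notin> \<tau> \<Longrightarrow> \<rho> k \<in> Y k" "\<tau> \<in> K"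
  shows "Sigma I \<rho> \<in> Z"
proof -
  have "nonfaces (Sigma I \<rho>) \<subseteq> \<tau>"
  proof
    fix k assume "k \<in> nonfaces (Sigma I \<rho>)"
    then have k: "k \<in> I" "slice (Sigma I \<rho>) k \<notin> Y k" unfolding nonfaces_def by blast+
    then show "k \<in> \<tau>" using assms(2)[OF k(1)] slice_Sigma[OF k(1), of \<rho>] by metis
  qed
  then have "nonfaces (Sigma I \<rho>) \<in> K" using assms(3) K_down unfolding down_closed_def by blast
  then show ?thesis using assms(1) by (auto simp: Z_def)
qed

lemma frags_Y_D: "k \<in> I \<Longrightarrow> c \<in> frags (Y k) \<Longrightarrow> c \<in> frags (Pow (D k))"
  using frags_mono[OF Y_sub] by blast

text \<open>
  Here \<open>f \<tau>\<close> contains the blocks in which the substituted chain may leave \<open>Y k\<close>. In general this is \<open>\<tau>\<close> itself;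
  it is \<open>\<tau> - {k}\<close> when \<open>w k\<close> lies in \<open>Y k\<close>.
\<close>

lemma block_chain_frags:
  assumes w: "\<And>k. k \<in> W \<Longrightarrow> w k \<in> frags (Pow (D k))" and b: "\<And>k. k \<in> I \<Longrightarrow> b k \<in> frags (Pow (D k))"
    and Y: "\<And>k \<tau>. \<tau> \<in> A \<Longrightarrow> k \<in> I \<Longrightarrow> k \<notin> f \<tau> \<Longrightarrow> (if k \<in> \<tau> then w k else b k) \<in> frags (Y k)"
    and A: "\<And>\<tau>. \<tau> \<in> A \<Longrightarrow> \<tau> \<subseteq> W \<and> f \<tau> \<in> K" and c: "c \<in> frags A"
  shows "block_chain I w b c \<in> frags Z"
proof (rule additive_map_into[OF additive_map_block_chain additive_subset_frags _ c])
  fix \<tau> assume \<tau>: "\<tau> \<in> A"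
  show "block_chain I w b (frag_of \<tau>) \<in> frags Z"
    unfolding block_chain_of
  proof (rule join_chain_in_frags[where S = "\<lambda>k. if k \<in> f \<tau> then Pow (D k) else Y k"])
    fix k assume k: "k \<in> I"
    show "(if k \<in> \<tau> then frag_cmul ((-1) ^ later \<tau> k) (eps (later \<tau> k) (w k)) else eps (later \<tau> k) (b k))
      \<in> frags (if k \<in> f \<tau> then Pow (D k) else Y k)"
      using w[of k] b[OF k] Y[OF \<tau> k] A[OF \<tau>] by (auto intro!: frags_cmul graded_sign_frags split: if_splits)
  next
    fix \<rho> assume \<rho>: "\<And>k. k \<in> I \<Longrightarrow> \<rho> k \<in> (if k \<in> f \<tau> then Pow (D k) else Y k)"
    show "Sigma I \<rho> \<in> Z"
      by (rule Sigma_in_Z[of _ "f \<tau>"]) (use \<rho> Y_sub A[OF \<tau>] in \<open>force split: if_splits\<close>)+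
  qed simp
qed

text \<open>
  Removing \<open>k\<close> from \<open>\<tau>\<close> lowers the exponent \<open>later \<tau> i\<close> by one for the blocks \<open>i < k\<close>. The degree signs thus
  lost are the Koszul signs of the differential in block \<open>k\<close>, and the remaining factors \<open>-1\<close>, one for each
  \<open>i \<in> \<tau>\<close> with \<open>i < k\<close>, multiply to the incidence number.
\<close>

lemma block_chain_boundary:
  assumes w: "\<And>k. k \<in> W \<Longrightarrow> w k \<in> frags (Pow (D k))" and b: "\<And>k. k \<in> I \<Longrightarrow> b k \<in> frags (Pow (D k))"
    and wb: "\<And>k. k \<in> W \<Longrightarrow> boundary (w k) = b k" and b0: "\<And>k. k \<in> I \<Longrightarrow> boundary (b k) = 0"
    and c: "c \<in> frags (Pow W)"
  shows "boundary (block_chain I w b c) = block_chain I w b (boundary c)"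
proof (rule additive_map_eqI[OF _ _ _ c, where g = "\<lambda>c. boundary (block_chain I w b c)" and h = "\<lambda>c. block_chain I w b (boundary c)"])
  fix \<tau> assume "\<tau> \<in> Pow W"
  then have \<tau>: "\<tau> \<subseteq> W" by simp
  then have \<tau>I: "\<tau> \<subseteq> I" and fin: "finite \<tau>" using W W_finite finite_subset by auto
  let ?c = "\<lambda>\<tau> k. if k \<in> \<tau> then frag_cmul ((-1) ^ later \<tau> k) (eps (later \<tau> k) (w k)) else eps (later \<tau> k) (b k)"
  have cD: "?c \<tau> k \<in> frags (Pow (D k))" if "k \<in> I" for k
    using w[of k] b[OF that] \<tau> by (auto intro!: frags_cmul graded_sign_frags)
  have cfin: "?c \<tau> k \<in> frags {\<tau>. finite \<tau>}" if "k \<in> I" for k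
    by (rule frags_finite[OF D_finite[OF that] cD[OF that]])
  have slot: "join_chain I (\<lambda>i. slot_boundary k i (?c \<tau> i)) =
      (if k \<in> \<tau> then frag_cmul (incidence k \<tau>) (block_chain I w b (frag_of (\<tau> - {k}))) else 0)" if k: "k \<in> I" for k
  proof (cases "k \<in> \<tau>")
    case False
    then show ?thesis
      by (auto intro!: join_chain_zero[OF _ k] simp: slot_boundary_def boundary_eps b0[OF k] graded_sign_simps)
  next
    case True
    let ?s = "\<lambda>i. if i < k \<and> i \<in> \<tau> then -1 else (1 :: int)"
    have "join_chain I (\<lambda>i. slot_boundary k i (?c \<tau> i)) = join_chain I (\<lambda>i. frag_cmul (?s i) (?c (\<tau> - {k}) i))"
    proof (rule join_chain_cong)
      fix i assume i: "i \<in> I"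
      consider "i < k" | "i = k" | "k < i" by linarith
      then show "slot_boundary k i (?c \<tau> i) = frag_cmul (?s i) (?c (\<tau> - {k}) i)"
      proof cases
        case 1
        have "eps 1 (eps (Suc n) x) = eps n x" for n and x :: "'a set \<Rightarrow>\<^sub>0 int"
          by (simp add: graded_sign_comp) (rule graded_sign_parity, simp)
        then show ?thesis using 1 later_remove[OF fin True, of i]
          by (auto simp: slot_boundary_def graded_sign_simps)
      next
        case 2
        then show ?thesis using True later_remove[OF fin True, of i] wb[of k] \<tau>
          by (auto simp: slot_boundary_def boundary_simps boundary_eps simp flip: power_mult_distrib)
      next
        case 3
        then show ?thesis using later_remove[OF fin True, of i] by (auto simp: slot_boundary_def)
      qed
    qed simp
    also have "\<dots> = frag_cmul (\<Prod>i\<in>I. ?s i) (block_chain I w b (frag_of (\<tau> - {k})))"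
      unfolding block_chain_of by (rule join_chain_scale) simp
    also have "(\<Prod>i\<in>I. ?s i) = (\<Prod>i\<in>{i \<in> \<tau>. i < k}. -1)"
      by (rule prod.mono_neutral_cong_right) (use \<tau>I in auto)
    also have "\<dots> = incidence k \<tau>" by (simp add: incidence_def)
    finally show ?thesis using True by simp
  qed
  have "boundary (block_chain I w b (frag_of \<tau>)) = (\<Sum>k\<in>I. join_chain I (\<lambda>i. slot_boundary k i (?c \<tau> i)))"
    unfolding block_chain_of by (rule boundary_join_chain[OF _ cfin]) simp
  also have "\<dots> = (\<Sum>k\<in>I. if k \<in> \<tau> then frag_cmul (incidence k \<tau>) (block_chain I w b (frag_of (\<tau> - {k}))) else 0)"
    by (intro sum.cong refl slot)
  also have "\<dots> = (\<Sum>k\<in>\<tau>. frag_cmul (incidence k \<tau>) (block_chain I w b (frag_of (\<tau> - {k}))))"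
    using \<tau>I by (simp add: sum.If_cases Int_absorb1 Int_def[symmetric] inf.absorb2)
  also have "\<dots> = block_chain I w b (boundary (frag_of \<tau>))"
    by (simp add: boundary_frag_of block_chain_simps)
  finally show "boundary (block_chain I w b (frag_of \<tau>)) = block_chain I w b (boundary (frag_of \<tau>))" .
qed (simp_all add: additive_map_def additive_dist)

subsection \<open>Independence of the bounding chains\<close>

lemma block_chain_cong:
  assumes "\<And>k. k \<in> W \<Longrightarrow> w k = w' k" "\<And>k. k \<in> I \<Longrightarrow> b k = b' k" "c \<in> frags (Pow W)"
  shows "block_chain I w b c = block_chain I w' b' c"
proof (rule additive_map_eqI[OF _ _ _ assms(3), where g = "block_chain I w b" and h = "block_chain I w' b'"])
  show "block_chain I w b (frag_of \<tau>) = block_chain I w' b' (frag_of \<tau>)" if "\<tau> \<in> Pow W" for \<tau>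
    unfolding block_chain_of using that assms by (intro join_chain_cong) auto
qed simp_all

definition block_data :: "(nat \<Rightarrow> 'a set \<Rightarrow>\<^sub>0 int) \<Rightarrow> (nat \<Rightarrow> 'a set \<Rightarrow>\<^sub>0 int) \<Rightarrow> bool" where
  "block_data w b \<longleftrightarrow> (\<forall>k\<in>W. w k \<in> frags (Pow (D k)) \<and> boundary (w k) = b k) \<and>
     (\<forall>k\<in>I. b k \<in> frags (Y k) \<and> boundary (b k) = 0)"

lemma block_dataD:
  assumes "block_data w b"
  shows "\<And>k. k \<in> W \<Longrightarrow> w k \<in> frags (Pow (D k))" "\<And>k. k \<in> W \<Longrightarrow> boundary (w k) = b k"
    "\<And>k. k \<in> I \<Longrightarrow> b k \<in> frags (Y k)" "\<And>k. k \<in> I \<Longrightarrow> boundary (b k) = 0" "\<And>k. k \<in> I \<Longrightarrow> b k \<in> frags (Pow (D k))"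
  using assms frags_Y_D by (auto simp: block_data_def)

lemma block_data_Z:
  assumes "block_data w b" "c \<in> frags K"
  shows "block_chain I w b c \<in> frags Z"
  by (rule block_chain_frags[where A = K and f = "\<lambda>\<tau>. \<tau>"]) (use block_dataD[OF assms(1)] assms(2) K_sub in auto)

lemma block_data_boundary:
  assumes "block_data w b" "c \<in> frags (Pow W)"
  shows "boundary (block_chain I w b c) = block_chain I w b (boundary c)"
  by (rule block_chain_boundary) (use block_dataD[OF assms(1)] assms(2) in auto)

text \<open>
  If \<open>w k\<close> lies in \<open>Y k\<close>, simplices may acquire the vertex \<open>k\<close> freely, so the cone with apex \<open>k\<close>
  bounds every cycle.
\<close>

lemma block_chain_inside:
  assumes wb: "block_data w b" and k: "k \<in> W" "w k \<in> frags (Y k)" and c: "c \<in> cycles K"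
  shows "block_chain I w b c \<in> boundaries Z"
proof -
  let ?A = "{\<tau>. \<tau> \<subseteq> W \<and> \<tau> - {k} \<in> K}"
  have cW: "c \<in> frags (Pow W)" using c frags_mono[OF K_sub] by (auto simp: cycles_def)
  have "cone k c \<in> frags ?A"
  proof (rule additive_map_into[OF additive_map_cone additive_subset_frags])
    show "c \<in> frags K" using c by (simp add: cycles_def)
    show "cone k (frag_of \<tau>) \<in> frags ?A" if "\<tau> \<in> K" for \<tau>
      using that k(1) K_sub K_down[unfolded down_closed_def, rule_format, OF that, of "\<tau> - {k}"]
      by (auto simp: cone_of intro!: frags_cmul fragsD(1))
  qed
  then have "block_chain I w b (cone k c) \<in> frags Z"
    by (rule block_chain_frags[where f = "\<lambda>\<tau>. \<tau> - {k}", rotated 4]) (use block_dataD[OF wb] k in \<open>auto split: if_splits\<close>)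
  moreover have "boundary (cone k c) = c"
    using cone_homotopy[OF frags_finite[OF W_finite cW], of k] c by (simp add: cycles_def cone_simps)
  then have "boundary (block_chain I w b (cone k c)) = block_chain I w b c"
    using block_data_boundary[OF wb cone_frags[OF k(1) cW]] by simp
  ultimately show ?thesis by (metis boundaries_eq imageI)
qed

text \<open>
  If \<open>w k = boundary g\<close>, a homotopy keeps the part of a chain that involves the vertex \<open>k\<close> and
  substitutes \<open>g\<close> for this vertex.
\<close>

lemma block_chain_boundary_slot:
  assumes wb: "block_data w b" and k: "k \<in> W" "g \<in> frags (Pow (D k))" "w k = boundary g" and c: "c \<in> cycles K"
  shows "block_chain I w b c \<in> boundaries Z"
proof -
  have kI: "k \<in> I" using k(1) W by auto
  have bk: "b k = 0" using block_dataD(2)[OF wb k(1)] k(3) by simp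
  define w' where "w' i = (if i < k then - eps 1 (w i) else if i = k then g else w i)" for i
  define b' where "b' i = (if i < k then eps 1 (b i) else if i = k then boundary g else b i)" for i
  define \<pi> where "\<pi> = cochain_restrict {\<tau>. k \<in> \<tau>}"
  define M where "M c = block_chain I w' b' (\<pi> (eps 1 c))" for c
  note wbD = block_dataD[OF wb]
  have w'D: "w' i \<in> frags (Pow (D i))" if "i \<in> W" for i
    using wbD(1)[OF that] k by (auto simp: w'_def intro!: fragsD(3) graded_sign_frags)
  have b'D: "b' i \<in> frags (Pow (D i))" if "i \<in> I" for i
    using wbD(5)[OF that] k by (auto simp: b'_def intro!: graded_sign_frags boundary_frags)
  have b'Y: "b' i \<in> frags (Y i)" if "i \<in> I" "i \<noteq> k" for i
    using wbD(3)[OF that(1)] that(2) by (auto simp: b'_def intro!: graded_sign_frags)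
  have w'b': "boundary (w' i) = b' i" if "i \<in> W" for i
    using wbD(2)[OF that] by (auto simp: w'_def b'_def boundary_simps boundary_eps)
  have b'0: "boundary (b' i) = 0" if "i \<in> I" for i
    using wbD(4)[OF that] by (auto simp: b'_def boundary_eps graded_sign_simps)
  have M_add: "additive_map M" unfolding M_def \<pi>_def by (simp add: additive_map_def additive_dist)
  have M_frags: "M c \<in> frags Z" if "c \<in> frags K" for c
    unfolding M_def
  proof (rule block_chain_frags[where f = "\<lambda>\<tau>. \<tau>" and A = "K \<inter> {\<tau>. k \<in> \<tau>}", OF w'D b'D])
    show "\<pi> (eps 1 c) \<in> frags (K \<inter> {\<tau>. k \<in> \<tau>})"
      unfolding \<pi>_def
      by (rule additive_map_into[where g = "cochain_restrict {\<tau>. k \<in> \<tau>}", OF _ _ _ graded_sign_frags[OF that]])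
         (auto simp: cochain_restrict_of fragsD(1))
    show "(if i \<in> \<tau> then w' i else b' i) \<in> frags (Y i)" if "\<tau> \<in> K \<inter> {\<tau>. k \<in> \<tau>}" "i \<in> I" "i \<notin> \<tau>" for i \<tau>
      using that b'Y[of i] by auto
  qed (use K_sub in auto)
  have homotopy: "boundary (M c) + M (boundary c) = - block_chain I w b c" if "c \<in> frags (Pow W)" for c
  proof (rule additive_map_eqI[OF _ _ _ that, where g = "\<lambda>c. boundary (M c) + M (boundary c)" and h = "\<lambda>c. - block_chain I w b c"])
    fix \<tau> assume "\<tau> \<in> Pow W"
    then have \<tau>: "\<tau> \<subseteq> W" and fin: "finite \<tau>" using W_finite finite_subset by auto
    have epsb: "eps 1 (boundary (frag_of \<tau>)) = frag_cmul ((-1) ^ (card \<tau> + 1)) (boundary (frag_of \<tau>))"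
      by (simp add: eps_boundary graded_sign_of boundary_simps power_add)
    show "boundary (M (frag_of \<tau>)) + M (boundary (frag_of \<tau>)) = - block_chain I w b (frag_of \<tau>)"
    proof (cases "k \<in> \<tau>")
      case False
      then have "\<pi> (boundary (frag_of \<tau>)) = 0" by (simp add: \<pi>_def boundary_frag_of cochain_restrict_simps cochain_restrict_of)
      then have "M (boundary (frag_of \<tau>)) = 0"
        unfolding M_def epsb \<pi>_def by (simp add: cochain_restrict_simps block_chain_simps)
      moreover have "M (frag_of \<tau>) = 0"
        using False by (simp add: M_def \<pi>_def graded_sign_of cochain_restrict_simps cochain_restrict_of block_chain_simps)
      moreover have "block_chain I w b (frag_of \<tau>) = 0"
        unfolding block_chain_of using False bk by (intro join_chain_zero[OF _ kI]) (auto simp: graded_sign_simps)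
      ultimately show ?thesis by (simp add: boundary_simps)
    next
      case True
      let ?U = "\<lambda>\<tau>. block_chain I w' b' (frag_of \<tau>)"
      let ?s = "(-1 :: int) ^ card \<tau>"
      have M1: "M (frag_of \<tau>) = frag_cmul ?s (?U \<tau>)"
        using True by (simp add: M_def \<pi>_def graded_sign_of cochain_restrict_simps cochain_restrict_of block_chain_simps)
      have "boundary (?U \<tau>) = block_chain I w' b' (boundary (frag_of \<tau>))"
        by (rule block_chain_boundary[OF w'D b'D w'b' b'0]) (use \<tau> in auto)
      also have "\<dots> = (\<Sum>i\<in>\<tau>. frag_cmul (incidence i \<tau>) (?U (\<tau> - {i})))"
        by (simp add: boundary_frag_of block_chain_simps)
      also have "\<dots> = frag_cmul (incidence k \<tau>) (?U (\<tau> - {k})) + (\<Sum>i\<in>\<tau> - {k}. frag_cmul (incidence i \<tau>) (?U (\<tau> - {i})))"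
        by (rule sum.remove[OF fin True])
      finally have M2: "boundary (?U \<tau>) = \<dots>" .
      have "\<pi> (boundary (frag_of \<tau>)) = (\<Sum>i\<in>\<tau>. frag_cmul (incidence i \<tau>) (if k \<in> \<tau> - {i} then frag_of (\<tau> - {i}) else 0))"
        by (simp add: \<pi>_def boundary_frag_of cochain_restrict_simps cochain_restrict_of)
      also have "\<dots> = (\<Sum>i\<in>\<tau> - {k}. frag_cmul (incidence i \<tau>) (frag_of (\<tau> - {i})))"
        by (rule sum.mono_neutral_cong_right) (use fin True in auto)
      finally have "M (boundary (frag_of \<tau>)) = frag_cmul (- ?s) (\<Sum>i\<in>\<tau> - {k}. frag_cmul (incidence i \<tau>) (?U (\<tau> - {i})))"
        unfolding M_def epsb \<pi>_def by (simp add: cochain_restrict_simps block_chain_simps power_add)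
      then have 1: "boundary (M (frag_of \<tau>)) + M (boundary (frag_of \<tau>)) = frag_cmul (?s * incidence k \<tau>) (?U (\<tau> - {k}))"
        unfolding M1 boundary_simps M2 by (simp add: frag_cmul_distrib2 flip: frag_cmul_distrib)
      have "block_chain I w b (frag_of \<tau>) = join_chain I (\<lambda>i. frag_cmul (if i = k then (-1) ^ later \<tau> k else 1)
         (if i \<in> \<tau> - {k} then frag_cmul ((-1) ^ later (\<tau> - {k}) i) (eps (later (\<tau> - {k}) i) (w' i))
          else eps (later (\<tau> - {k}) i) (b' i)))"
        unfolding block_chain_of
      proof (rule join_chain_cong)
        fix i assume i: "i \<in> I"
        consider "i < k" | "i = k" | "k < i" by linarith
        then show "(if i \<in> \<tau> then frag_cmul ((-1) ^ later \<tau> i) (eps (later \<tau> i) (w i)) else eps (later \<tau> i) (b i)) =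
          frag_cmul (if i = k then (-1) ^ later \<tau> k else 1)
         (if i \<in> \<tau> - {k} then frag_cmul ((-1) ^ later (\<tau> - {k}) i) (eps (later (\<tau> - {k}) i) (w' i))
          else eps (later (\<tau> - {k}) i) (b' i))"
          using True later_remove[OF fin True, of i]
          by cases (auto simp: w'_def b'_def graded_sign_simps graded_sign_comp k(3) additive_map_minus[OF additive_map_cmul'] simp flip: Suc_eq_plus1)
      qed simp
      also have "\<dots> = frag_cmul (\<Prod>i\<in>I. if i = k then (-1) ^ later \<tau> k else 1) (?U (\<tau> - {k}))"
        unfolding block_chain_of[of I w' b'] by (rule join_chain_scale) simp
      also have "(\<Prod>i\<in>I. if i = k then (-1) ^ later \<tau> k else 1) = ((-1) ^ later \<tau> k :: int)"
        using kI by (simp add: prod.delta)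
      finally have 2: "block_chain I w b (frag_of \<tau>) = frag_cmul ((-1) ^ later \<tau> k) (?U (\<tau> - {k}))" .
      have "x \<in> \<tau> \<longleftrightarrow> x \<in> {i \<in> \<tau>. i < k} \<union> insert k {i \<in> \<tau>. k < i}" for x
        using True by (cases x k rule: linorder_cases) simp_all
      then have "\<tau> = {i \<in> \<tau>. i < k} \<union> insert k {i \<in> \<tau>. k < i}" by blast
      moreover have "card ({i \<in> \<tau>. i < k} \<union> insert k {i \<in> \<tau>. k < i}) = card {i \<in> \<tau>. i < k} + card (insert k {i \<in> \<tau>. k < i})"
        by (rule card_Un_disjoint) (simp_all add: fin disjoint_iff)
      moreover have "card (insert k {i \<in> \<tau>. k < i}) = later \<tau> k + 1"
        unfolding later_def by (subst card_insert_disjoint) (simp_all add: fin)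
      ultimately have "card \<tau> = card {i \<in> \<tau>. i < k} + later \<tau> k + 1" by simp
      then have "?s * incidence k \<tau> = - ((-1) ^ later \<tau> k)"
        unfolding incidence_def by (simp add: power_add flip: power_mult_distrib)
      then show ?thesis unfolding 1 2 by simp
    qed
  qed (simp_all add: additive_map_def additive_dist additive_map_add[OF M_add])
  have cK: "c \<in> frags K" "boundary c = 0" using c by (auto simp: cycles_def)
  have "boundary (M c) = - block_chain I w b c"
    using homotopy[of c] cK frags_mono[OF K_sub] by (simp add: additive_map_zero[OF M_add])
  then have "boundary (- M c) = block_chain I w b c" by (simp add: boundary_simps)
  then show ?thesis using fragsD(3)[OF M_frags[OF cK(1)]] by (metis boundaries_eq imageI)
qed

text \<open>
  A relative boundary is the sum of a boundary and a chain of \<open>Y k\<close>, and a change of \<open>w k\<close> by either of them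
  changes the cycle by a boundary; the blocks are changed one after the other.
\<close>

lemma block_chain_independent:
  assumes wb: "block_data w b" and wb': "block_data w' b'"
    and rel: "\<And>k. k \<in> W \<Longrightarrow> w' k - w k \<in> relative_boundaries (Pow (D k)) (Y k)"
    and out: "\<And>k. k \<in> I \<Longrightarrow> k \<notin> W \<Longrightarrow> b' k = b k" and c: "c \<in> cycles K"
  shows "block_chain I w' b' c - block_chain I w b c \<in> boundaries Z"
proof -
  note Bnd = additive_subsetD[OF additive_subset_boundaries[of Z]]
  have cW: "c \<in> frags (Pow W)" using c frags_mono[OF K_sub] by (auto simp: cycles_def)
  have "block_chain I (\<lambda>k. if k \<in> A then w' k else w k) (\<lambda>k. if k \<in> A then b' k else b k) c - block_chain I w b c \<in> boundaries Z"
    if "finite A" "A \<subseteq> W" for A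
    using that
  proof (induction A rule: finite_induct)
    case empty
    then show ?case using Bnd(1) by simp
  next
    case (insert k A)
    have k: "k \<in> W" and kI: "k \<in> I" using insert.prems W by auto
    let ?w = "\<lambda>k. if k \<in> A then w' k else w k" and ?b = "\<lambda>k. if k \<in> A then b' k else b k"
    have old: "block_data ?w ?b" using wb wb' insert.prems by (auto simp: block_data_def)
    obtain g a where ga: "g \<in> frags (Pow (D k))" "a \<in> frags (Y k)" "w' k = w k + (a + boundary g)"
      using rel[OF k] unfolding relative_boundaries_def boundaries_eq by (auto simp: algebra_simps)
    have b'k: "b' k = b k + (boundary a + 0)"
      using block_dataD(2)[OF wb k] block_dataD(2)[OF wb' k] ga(3) by (auto simp: boundary_simps)
    have a_Y: "boundary a \<in> frags (Y k)" by (rule boundary_frags[OF Y_down[OF kI] ga(2)])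
    have d1: "block_data (?w(k := a)) (?b(k := boundary a))"
      using old ga(2) a_Y frags_Y_D[OF kI ga(2)] by (simp add: block_data_def)
    have d2: "block_data (?w(k := boundary g)) (?b(k := 0))"
      using old boundary_frags[OF down_closed_Pow ga(1)] by (simp add: block_data_def boundary_simps fragsD(1))
    have "block_chain I (\<lambda>i. if i \<in> insert k A then w' i else w i) (\<lambda>i. if i \<in> insert k A then b' i else b i) c =
      block_chain I (?w(k := w k + (a + boundary g))) (?b(k := b k + (boundary a + 0))) c"
      by (rule block_chain_cong[OF _ _ cW]) (auto simp: ga(3) b'k)
    also have "\<dots> = block_chain I (?w(k := w k)) (?b(k := b k)) c + (block_chain I (?w(k := a)) (?b(k := boundary a)) c
       + block_chain I (?w(k := boundary g)) (?b(k := 0)) c)"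
      by (simp only: block_chain_slot[OF I_finite kI])
    also have "block_chain I (?w(k := w k)) (?b(k := b k)) c = block_chain I ?w ?b c"
      by (rule block_chain_cong[OF _ _ cW]) (use insert.hyps in auto)
    finally have "block_chain I (\<lambda>i. if i \<in> insert k A then w' i else w i) (\<lambda>i. if i \<in> insert k A then b' i else b i) c
      - block_chain I w b c = (block_chain I ?w ?b c - block_chain I w b c) + (block_chain I (?w(k := a)) (?b(k := boundary a)) c
       + block_chain I (?w(k := boundary g)) (?b(k := 0)) c)" by (simp only: diff_add_eq)
    also have "\<dots> \<in> boundaries Z"
    proof (intro Bnd(4))
      show "block_chain I ?w ?b c - block_chain I w b c \<in> boundaries Z" using insert by auto
      show "block_chain I (?w(k := a)) (?b(k := boundary a)) c \<in> boundaries Z"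
        by (rule block_chain_inside[OF d1 k _ c]) (simp add: ga(2))
      show "block_chain I (?w(k := boundary g)) (?b(k := 0)) c \<in> boundaries Z"
        by (rule block_chain_boundary_slot[OF d2 k ga(1) _ c]) simp
    qed
    finally show ?case .
  qed
  from this[OF W_finite order_refl]
  have "block_chain I (\<lambda>k. if k \<in> W then w' k else w k) (\<lambda>k. if k \<in> W then b' k else b k) c - block_chain I w b c \<in> boundaries Z" .
  moreover have "block_chain I (\<lambda>k. if k \<in> W then w' k else w k) (\<lambda>k. if k \<in> W then b' k else b k) c = block_chain I w' b' c"
    by (rule block_chain_cong[OF _ _ cW]) (auto simp: out)
  ultimately show ?thesis by simp
qed

end

section \<open>The Kunneth isomorphism on the chain level\<close>

text \<open>
  Each block comes with the data produced by a splitting of its pair: \<open>b k i\<close> represents a basis of the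
  homology of \<open>Y k\<close>, \<open>w k i\<close> is a chain of the simplex bounded by \<open>b k i\<close>, \<open>\<alpha> k i\<close> is the coordinate
  function, and \<open>h k\<close> is a homotopy from the identity to the retraction \<open>P k\<close> onto
  the span of the \<open>b k i\<close> and \<open>w k i\<close>. A block without vertices has the single generator \<open>frag_of {}\<close>.
\<close>

locale kunneth = block_complexes m I W D Y K
  for m I W and D :: "nat \<Rightarrow> 'a::linorder set" and Y K +
  fixes r :: "nat \<Rightarrow> nat" and b w :: "nat \<Rightarrow> nat \<Rightarrow> 'a set \<Rightarrow>\<^sub>0 int"
    and \<alpha> :: "nat \<Rightarrow> nat \<Rightarrow> ('a set \<Rightarrow>\<^sub>0 int) \<Rightarrow> int" and h :: "nat \<Rightarrow> ('a set \<Rightarrow>\<^sub>0 int) \<Rightarrow> ('a set \<Rightarrow>\<^sub>0 int)"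
  assumes b_Y: "\<And>k i. k \<in> I \<Longrightarrow> i < r k \<Longrightarrow> b k i \<in> frags (Y k)"
    and b_0: "\<And>k i. k \<in> I \<Longrightarrow> i < r k \<Longrightarrow> boundary (b k i) = 0"
    and w_D: "\<And>k i. k \<in> I \<Longrightarrow> i < r k \<Longrightarrow> w k i \<in> frags (Pow (D k))"
    and w_b: "\<And>k i. k \<in> W \<Longrightarrow> i < r k \<Longrightarrow> boundary (w k i) = b k i"
    and \<alpha>_add: "\<And>k i. k \<in> I \<Longrightarrow> additive_map (\<alpha> k i)"
    and \<alpha>_b: "\<And>k i j. k \<in> I \<Longrightarrow> i < r k \<Longrightarrow> j < r k \<Longrightarrow> \<alpha> k i (b k j) = (if i = j then 1 else 0)"
    and \<alpha>_w: "\<And>k i j n. k \<in> I \<Longrightarrow> i < r k \<Longrightarrow> j < r k \<Longrightarrow> \<alpha> k i (eps n (w k j)) = 0"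
    and \<alpha>_boundary: "\<And>k i c. k \<in> I \<Longrightarrow> i < r k \<Longrightarrow> c \<in> frags (Y k) \<Longrightarrow> \<alpha> k i (boundary c) = 0"
    and h_add: "\<And>k. k \<in> I \<Longrightarrow> additive_map (h k)"
    and h_Y: "\<And>k c. k \<in> I \<Longrightarrow> c \<in> frags (Y k) \<Longrightarrow> h k c \<in> frags (Y k)"
    and h_D: "\<And>k c. k \<in> I \<Longrightarrow> c \<in> frags (Pow (D k)) \<Longrightarrow> h k c \<in> frags (Pow (D k))"
    and h_eps: "\<And>k c. k \<in> I \<Longrightarrow> c \<in> frags (Pow (D k)) \<Longrightarrow> h k (eps 1 c) = - eps 1 (h k c)"
    and h_homotopy: "\<And>k c. k \<in> I \<Longrightarrow> c \<in> frags (Pow (D k)) \<Longrightarrow> boundary (h k c) + h k (boundary c) =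
       c - ((\<Sum>i<r k. frag_cmul (\<alpha> k i c) (b k i)) + (\<Sum>i<r k. frag_cmul (\<alpha> k i (boundary c)) (w k i)))"
    and b_eps: "\<And>k c. k \<in> I \<Longrightarrow> c \<in> frags (Pow (D k)) \<Longrightarrow>
       (\<Sum>i<r k. frag_cmul (\<alpha> k i (eps 1 c)) (b k i)) = eps 1 (\<Sum>i<r k. frag_cmul (\<alpha> k i c) (b k i))"
    and w_eps: "\<And>k c. k \<in> I \<Longrightarrow> c \<in> frags (Pow (D k)) \<Longrightarrow>
       (\<Sum>i<r k. frag_cmul (\<alpha> k i (eps 1 c)) (w k i)) = - eps 1 (\<Sum>i<r k. frag_cmul (\<alpha> k i c) (w k i))"
begin

definition b_part where "b_part k c = (\<Sum>i<r k. frag_cmul (\<alpha> k i c) (b k i))"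
definition w_part where "w_part k c = (\<Sum>i<r k. frag_cmul (\<alpha> k i c) (w k i))"
definition P where "P k c = b_part k c + w_part k (boundary c)"

definition J :: "(nat \<Rightarrow> nat) set" where "J = (\<Pi>\<^sub>E k\<in>I. {..<r k})"

definition \<Phi> where "\<Phi> j = block_chain I (\<lambda>k. w k (j k)) (\<lambda>k. b k (j k))"

definition letter_part :: "nat set \<Rightarrow> nat \<Rightarrow> ('a set \<Rightarrow>\<^sub>0 int) \<Rightarrow> ('a set \<Rightarrow>\<^sub>0 int)" where
  "letter_part \<tau> k c = eps (later \<tau> k) (if k \<in> \<tau> then boundary c else c)"

text \<open>The coordinates of a chain of the join: \<open>Q j\<close> is left inverse to \<open>\<Phi> j\<close>.\<close>

definition Q :: "(nat \<Rightarrow> nat) \<Rightarrow> ((nat \<times> 'a) set \<Rightarrow>\<^sub>0 int) \<Rightarrow> (nat set \<Rightarrow>\<^sub>0 int)" where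
  "Q j = frag_extend (\<lambda>\<eta>. \<Sum>\<tau>\<in>Pow W.
     frag_cmul (\<Prod>k\<in>I. \<alpha> k (j k) (letter_part \<tau> k (frag_of (slice \<eta> k)))) (frag_of \<tau>))"

lemma J_finite: "finite J" unfolding J_def by (intro finite_PiE) auto

lemma J_less: "j \<in> J \<Longrightarrow> k \<in> I \<Longrightarrow> j k < r k" by (auto simp: J_def)

lemma additive_map_parts [simp]: "k \<in> I \<Longrightarrow> additive_map (b_part k)" "k \<in> I \<Longrightarrow> additive_map (w_part k)" "k \<in> I \<Longrightarrow> additive_map (P k)"
proof -
  show b: "additive_map (b_part k)" if "k \<in> I" for k unfolding b_part_def
    by (rule additive_mapI) (simp add: additive_map_add[OF \<alpha>_add[OF that]] frag_cmul_distrib sum.distrib)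
  show w: "additive_map (w_part k)" if "k \<in> I" for k unfolding w_part_def
    by (rule additive_mapI) (simp add: additive_map_add[OF \<alpha>_add[OF that]] frag_cmul_distrib sum.distrib)
  show "additive_map (P k)" if "k \<in> I" for k unfolding P_def
    by (rule additive_mapI) (simp add: additive_map_add[OF b[OF that]] additive_map_add[OF w[OF that]] boundary_simps)
qed

lemma letter_part_add [simp]: "additive_map (letter_part \<tau> k)"
  unfolding letter_part_def by (auto simp: additive_map_def additive_dist)

lemma additive_map_Q [simp]: "additive_map (Q j)" by (simp add: Q_def)

lemma additive_map_\<Phi> [simp]: "additive_map (\<Phi> j)" by (simp add: \<Phi>_def)

lemma Q_join_chain:
  "Q j (join_chain I c) = (\<Sum>\<tau>\<in>Pow W. frag_cmul (\<Prod>k\<in>I. \<alpha> k (j k) (letter_part \<tau> k (c k))) (frag_of \<tau>))"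
proof (rule multi_additive_eqI[where F = "\<lambda>c. Q j (join_chain I c)" and c = c and S = "\<lambda>_. UNIV" and I = I
      and G = "\<lambda>c. \<Sum>\<tau>\<in>Pow W. frag_cmul (\<Prod>k\<in>I. \<alpha> k (j k) (letter_part \<tau> k (c k))) (frag_of \<tau>)"])
  show "multi_additive I (\<lambda>c. Q j (join_chain I c))"
    by (rule multi_additive_post[OF multi_additive_join_chain additive_map_Q]) simp
  have "multi_additive I (\<lambda>c. frag_cmul (\<Prod>k\<in>I. \<alpha> k (j k) (letter_part \<tau> k (c k))) (frag_of \<tau>))" for \<tau>
  proof (rule multi_additive_post[where h = "\<lambda>n. frag_cmul n (frag_of \<tau>)"])
    show "multi_additive I (\<lambda>c. \<Prod>k\<in>I. \<alpha> k (j k) (letter_part \<tau> k (c k)))"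
      by (rule multi_additive_prod[where l = "\<lambda>k c. \<alpha> k (j k) (letter_part \<tau> k c)"])
         (auto intro!: additive_map_comp[OF \<alpha>_add letter_part_add])
    show "additive_map (\<lambda>n. frag_cmul n (frag_of \<tau>))" by (rule additive_mapI) (rule frag_cmul_distrib)
  qed
  then show "multi_additive I (\<lambda>c. \<Sum>\<tau>\<in>Pow W. frag_cmul (\<Prod>k\<in>I. \<alpha> k (j k) (letter_part \<tau> k (c k))) (frag_of \<tau>))"
    by (rule multi_additive_sum)
  show "Q j (join_chain I (\<lambda>k. frag_of (\<rho> k))) =
      (\<Sum>\<tau>\<in>Pow W. frag_cmul (\<Prod>k\<in>I. \<alpha> k (j k) (letter_part \<tau> k (frag_of (\<rho> k)))) (frag_of \<tau>))" for \<rho>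
    by (simp add: join_chain_frag_of Q_def)
qed simp_all

lemma \<Phi>_data: "j \<in> J \<Longrightarrow> block_data (\<lambda>k. w k (j k)) (\<lambda>k. b k (j k))"
  unfolding block_data_def using W J_less b_Y b_0 w_D w_b by blast

lemma Q_\<Phi>:
  assumes j: "j \<in> J" "j' \<in> J" and c: "c \<in> frags (Pow W)"
  shows "Q j (\<Phi> j' c) = (if j = j' then c else 0)"
proof (rule additive_map_eqI[OF _ _ _ c, where g = "\<lambda>c. Q j (\<Phi> j' c)" and h = "\<lambda>c. if j = j' then c else 0"])
  show "additive_map (\<lambda>c. Q j (\<Phi> j' c))" by (rule additive_map_comp) simp_all
  show "additive_map (\<lambda>c. if j = j' then c else 0)" by (simp add: additive_map_def)
  fix \<tau>' assume \<tau>': "\<tau>' \<in> Pow W"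
  let ?c = "\<lambda>k. if k \<in> \<tau>' then frag_cmul ((-1) ^ later \<tau>' k) (eps (later \<tau>' k) (w k (j' k))) else eps (later \<tau>' k) (b k (j' k))"
  have coef: "(\<Prod>k\<in>I. \<alpha> k (j k) (letter_part \<tau> k (?c k))) = (if \<tau> = \<tau>' \<and> j = j' then 1 else 0)" if \<tau>: "\<tau> \<subseteq> W" for \<tau>
  proof (cases "\<tau> = \<tau>'")
    case True
    have "\<alpha> k (j k) (letter_part \<tau> k (?c k)) = (if j k = j' k then 1 else 0)" if k: "k \<in> I" for k
    proof -
      have e: "eps n (eps n x) = x" for n and x :: "'a set \<Rightarrow>\<^sub>0 int" by (simp add: graded_sign_comp graded_sign_even)
      have "letter_part \<tau> k (?c k) = b k (j' k)"
        using True \<tau> w_b[of k, OF _ J_less[OF j(2) k]]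
        by (auto simp: letter_part_def boundary_simps boundary_eps graded_sign_simps e simp flip: power_mult_distrib)
      then show ?thesis using \<alpha>_b[OF k J_less[OF j(1) k] J_less[OF j(2) k]] by simp
    qed
    then have "(\<Prod>k\<in>I. \<alpha> k (j k) (letter_part \<tau> k (?c k))) = (\<Prod>k\<in>I. if j k = j' k then 1 else 0)"
      by (rule prod.cong[OF refl])
    also have "\<dots> = (if j = j' then 1 else 0)"
    proof (cases "j = j'")
      case False
      then obtain k where "k \<in> I" "j k \<noteq> j' k"
        using j unfolding J_def by (metis PiE_ext)
      then have "(\<Prod>k\<in>I. if j k = j' k then 1 else 0 :: int) = 0" by (intro prod_zero) (auto intro!: bexI[of _ k])
      then show ?thesis using False by simp
    qed simp
    finally show ?thesis using True by simp
  next
    case False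
    then consider k where "k \<in> \<tau>" "k \<notin> \<tau>'" | k where "k \<notin> \<tau>" "k \<in> \<tau>'" by auto
    then obtain k where k: "k \<in> I" "\<alpha> k (j k) (letter_part \<tau> k (?c k)) = 0"
    proof cases
      case (1 k)
      have kI: "k \<in> I" using 1 \<tau> W by auto
      then have "letter_part \<tau> k (?c k) = 0"
        using 1 b_0[OF kI J_less[OF j(2) kI]] by (simp add: letter_part_def boundary_eps graded_sign_simps)
      then show ?thesis using that[OF kI] additive_map_zero[OF \<alpha>_add[OF kI]] by simp
    next
      case (2 k)
      have kI: "k \<in> I" using 2 \<tau>' W by auto
      have "\<alpha> k (j k) (frag_cmul n c) = n * \<alpha> k (j k) c" if "n = 1 \<or> n = -1" for n c
        using that additive_map_minus[OF \<alpha>_add[OF kI]] by auto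
      moreover have "(-1 :: int) ^ n = 1 \<or> (-1 :: int) ^ n = -1" for n by (cases "even n") simp_all
      ultimately have "\<alpha> k (j k) (letter_part \<tau> k (?c k)) = 0"
        using 2 \<alpha>_w[OF kI J_less[OF j(1) kI] J_less[OF j(2) kI]]
        by (simp add: letter_part_def graded_sign_simps graded_sign_comp)
      then show ?thesis using that[OF kI] by simp
    qed
    then have "(\<Prod>k\<in>I. \<alpha> k (j k) (letter_part \<tau> k (?c k))) = 0" by (intro prod_zero bexI[of _ k]) (simp_all add: k)
    then show ?thesis using False by simp
  qed
  have "Q j (\<Phi> j' (frag_of \<tau>')) = (\<Sum>\<tau>\<in>Pow W. frag_cmul (if \<tau> = \<tau>' \<and> j = j' then 1 else 0) (frag_of \<tau>))"
    unfolding \<Phi>_def block_chain_of Q_join_chain by (intro sum.cong refl) (simp only: coef Pow_iff)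
  also have "\<dots> = (\<Sum>\<tau>\<in>Pow W. if \<tau> = \<tau>' then (if j = j' then frag_of \<tau>' else 0) else 0)"
    by (intro sum.cong refl) auto
  also have "\<dots> = (if j = j' then frag_of \<tau>' else 0)" using \<tau>' W_finite by (simp add: sum.delta)
  finally show "Q j (\<Phi> j' (frag_of \<tau>')) = (if j = j' then frag_of \<tau>' else 0)" .
qed

lemma b_part_eps: assumes "k \<in> I" "c \<in> frags (Pow (D k))" shows "b_part k (eps n c) = eps n (b_part k c)"
proof (cases "even n")
  case False
  have "eps n x = eps 1 x" for x :: "'a set \<Rightarrow>\<^sub>0 int" by (rule graded_sign_parity) (use False in simp)
  then show ?thesis by (simp add: b_part_def b_eps[OF assms])
qed (simp add: graded_sign_even)

lemma w_part_eps:
  assumes "k \<in> I" "c \<in> frags (Pow (D k))" shows "w_part k (eps n c) = frag_cmul ((-1) ^ n) (eps n (w_part k c))"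
proof (cases "even n")
  case False
  have "eps n x = eps 1 x" for x :: "'a set \<Rightarrow>\<^sub>0 int" by (rule graded_sign_parity) (use False in simp)
  then show ?thesis using False by (simp add: w_part_def w_eps[OF assms])
qed (simp add: graded_sign_even)

text \<open>
  Multiplying out the sum over all \<open>\<tau>\<close>, block \<open>k\<close> contributes \<open>b_part\<close> without and \<open>w_part \<circ> boundary\<close> with the
  letter \<open>n-bar\<close>, which add up to \<open>P k\<close>.
\<close>

lemma \<Phi>_Q:
  assumes c: "c \<in> frags (Pow (Sigma I D))"
  shows "(\<Sum>j\<in>J. \<Phi> j (Q j c)) = tensor_op I P c"
proof (rule additive_map_eqI[OF _ _ _ c, where g = "\<lambda>c. \<Sum>j\<in>J. \<Phi> j (Q j c)" and h = "tensor_op I P"])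
  show "additive_map (\<lambda>c. \<Sum>j\<in>J. \<Phi> j (Q j c))"
    by (rule additive_map_sum_fun) (rule additive_map_comp, simp_all)
  fix \<eta> assume \<eta>: "\<eta> \<in> Pow (Sigma I D)"
  let ?x = "\<lambda>k. frag_of (slice \<eta> k)"
  have xD: "?x k \<in> frags (Pow (D k))" if "k \<in> I" for k using \<eta> by (auto simp: slice_def)
  let ?u = "\<lambda>\<tau> k i. if k \<in> \<tau> then frag_cmul ((-1) ^ later \<tau> k) (eps (later \<tau> k) (w k i)) else eps (later \<tau> k) (b k i)"
  have "(\<Sum>j\<in>J. \<Phi> j (Q j (frag_of \<eta>))) =
     (\<Sum>j\<in>J. \<Sum>\<tau>\<in>Pow W. frag_cmul (\<Prod>k\<in>I. \<alpha> k (j k) (letter_part \<tau> k (?x k))) (join_chain I (\<lambda>k. ?u \<tau> k (j k))))"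
    by (simp add: Q_def \<Phi>_def block_chain_simps block_chain_of)
  also have "\<dots> = (\<Sum>\<tau>\<in>Pow W. \<Sum>j\<in>J. join_chain I (\<lambda>k. frag_cmul (\<alpha> k (j k) (letter_part \<tau> k (?x k))) (?u \<tau> k (j k))))"
    by (subst sum.swap) (simp only: join_chain_scale[OF I_finite])
  also have "\<dots> = (\<Sum>\<tau>\<in>Pow W. join_chain I (\<lambda>k. \<Sum>i\<in>{..<r k}. frag_cmul (\<alpha> k i (letter_part \<tau> k (?x k))) (?u \<tau> k i)))"
    unfolding J_def by (intro sum.cong refl join_chain_sum[symmetric]) simp_all
  also have "\<dots> = (\<Sum>\<tau>\<in>Pow W. join_chain I (\<lambda>k. if k \<in> \<tau> then w_part k (boundary (?x k)) else b_part k (?x k)))"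
  proof (intro sum.cong refl join_chain_cong)
    fix \<tau> k assume k: "k \<in> I"
    let ?n = "later \<tau> k"
    have e: "eps n (eps n x) = x" for n and x :: "'a set \<Rightarrow>\<^sub>0 int" by (simp add: graded_sign_comp graded_sign_even)
    show "(\<Sum>i\<in>{..<r k}. frag_cmul (\<alpha> k i (letter_part \<tau> k (?x k))) (?u \<tau> k i)) =
      (if k \<in> \<tau> then w_part k (boundary (?x k)) else b_part k (?x k))"
    proof (cases "k \<in> \<tau>")
      case True
      have "(\<Sum>i\<in>{..<r k}. frag_cmul (\<alpha> k i (letter_part \<tau> k (?x k))) (?u \<tau> k i)) =
        frag_cmul ((-1) ^ ?n) (eps ?n (w_part k (eps ?n (boundary (?x k)))))"
        using True by (simp add: letter_part_def w_part_def graded_sign_simps frag_cmul_sum mult.commute)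
      also have "\<dots> = w_part k (boundary (?x k))"
        using boundary_frags[OF down_closed_Pow xD[OF k]]
        by (simp add: w_part_eps[OF k] graded_sign_simps e flip: power_mult_distrib)
      finally show ?thesis using True by simp
    next
      case False
      have "(\<Sum>i\<in>{..<r k}. frag_cmul (\<alpha> k i (letter_part \<tau> k (?x k))) (?u \<tau> k i)) = eps ?n (b_part k (eps ?n (?x k)))"
        using False by (simp add: letter_part_def b_part_def graded_sign_simps)
      also have "\<dots> = b_part k (?x k)" by (simp add: b_part_eps[OF k xD[OF k]] e)
      finally show ?thesis using False by simp
    qed
  qed simp
  also have "\<dots> = join_chain I (\<lambda>k. if k \<in> W then w_part k (boundary (?x k)) + b_part k (?x k) else b_part k (?x k))"
    by (rule join_chain_binary[symmetric]) (use W W_finite in auto)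
  also have "\<dots> = tensor_op I P (frag_of \<eta>)"
    unfolding tensor_op_frag_of
  proof (rule join_chain_cong)
    fix k assume k: "k \<in> I"
    have "boundary (?x k) = 0" if "k \<notin> W"
    proof -
      have "slice \<eta> k = {}" using outside[OF k that] \<eta> by (auto simp: slice_def)
      then show ?thesis by (simp add: boundary_frag_of)
    qed
    then show "(if k \<in> W then w_part k (boundary (?x k)) + b_part k (?x k) else b_part k (?x k)) = P k (?x k)"
      using additive_map_zero[OF additive_map_parts(2)[OF k]] by (simp add: P_def add.commute)
  qed simp
  finally show "(\<Sum>j\<in>J. \<Phi> j (Q j (frag_of \<eta>))) = tensor_op I P (frag_of \<eta>)" .
qed simp

lemma P_eq: "k \<in> I \<Longrightarrow> c \<in> frags (Pow (D k)) \<Longrightarrow> P k c = c - boundary (h k c) - h k (boundary c)"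
  using h_homotopy[of k c] by (simp add: P_def b_part_def w_part_def algebra_simps)

lemma P_D: "k \<in> I \<Longrightarrow> P k c \<in> frags (Pow (D k))"
  unfolding P_def b_part_def w_part_def
  by (intro fragsD(4) frags_sum frags_cmul) (auto intro: frags_Y_D b_Y w_D)

lemma P_Y: "k \<in> I \<Longrightarrow> c \<in> frags (Y k) \<Longrightarrow> P k c \<in> frags (Y k)"
proof -
  assume k: "k \<in> I" and c: "c \<in> frags (Y k)"
  have "w_part k (boundary c) = 0" unfolding w_part_def by (rule sum.neutral) (simp add: \<alpha>_boundary[OF k _ c])
  moreover have "b_part k c \<in> frags (Y k)" unfolding b_part_def by (intro frags_sum frags_cmul b_Y[OF k]) simp
  ultimately show ?thesis by (simp add: P_def)
qed

lemma P_eps: "k \<in> I \<Longrightarrow> c \<in> frags (Pow (D k)) \<Longrightarrow> P k (eps n c) = eps n (P k c)"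
  by (simp add: P_def b_part_eps boundary_eps additive_map_cmul[OF additive_map_parts(2)] w_part_eps
      boundary_frags[OF down_closed_Pow] graded_sign_simps flip: power_mult_distrib)

lemma P_boundary: "k \<in> I \<Longrightarrow> c \<in> frags (Pow (D k)) \<Longrightarrow> boundary (P k c) = P k (boundary c)"
  by (simp add: P_eq boundary_frags[OF down_closed_Pow] boundary_simps additive_map_zero[OF h_add])

subsection \<open>The homotopy on the join\<close>

text \<open>
  The homotopy of a tensor product of retractions: retract the blocks before \<open>j\<close>, apply the homotopy in
  block \<open>j\<close>, leave the later ones alone.
\<close>

definition slot_homotopy :: "nat \<Rightarrow> nat \<Rightarrow> ('a set \<Rightarrow>\<^sub>0 int) \<Rightarrow> ('a set \<Rightarrow>\<^sub>0 int)" where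
  "slot_homotopy j i = (if i < j then (\<lambda>c. eps 1 (P i c)) else if i = j then h j else (\<lambda>c. c))"

definition H where "H c = (\<Sum>j\<in>I. tensor_op I (slot_homotopy j) c)"

lemma additive_map_slot_homotopy: "i \<in> I \<Longrightarrow> additive_map (slot_homotopy j i)"
  using h_add additive_map_parts(3)[of i]
  by (auto simp: slot_homotopy_def additive_map_add[OF additive_map_graded_sign] additive_map_def)

lemma slot_homotopy_D: "i \<in> I \<Longrightarrow> c \<in> frags (Pow (D i)) \<Longrightarrow> slot_homotopy j i c \<in> frags (Pow (D i))"
  by (auto simp: slot_homotopy_def intro: h_D P_D graded_sign_frags)

lemma slot_homotopy_Y: "i \<in> I \<Longrightarrow> c \<in> frags (Y i) \<Longrightarrow> slot_homotopy j i c \<in> frags (Y i)"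
  by (auto simp: slot_homotopy_def intro: h_Y P_Y graded_sign_frags)

lemma tensor_op_D:
  assumes "\<And>i c. i \<in> I \<Longrightarrow> c \<in> frags (Pow (D i)) \<Longrightarrow> g i c \<in> frags (Pow (D i))" "c \<in> frags (Pow (Sigma I D))"
  shows "tensor_op I g c \<in> frags (Pow (Sigma I D))"
proof (rule additive_map_into[OF additive_map_tensor_op additive_subset_frags _ assms(2)])
  fix \<eta> assume \<eta>: "\<eta> \<in> Pow (Sigma I D)"
  show "tensor_op I g (frag_of \<eta>) \<in> frags (Pow (Sigma I D))"
    unfolding tensor_op_frag_of
    by (rule join_chain_in_frags[where S = "\<lambda>k. Pow (D k)"]) (use \<eta> in \<open>auto simp: slice_def intro!: assms(1)\<close>)
qed

lemma tensor_op_Z: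
  assumes "\<And>i c. i \<in> I \<Longrightarrow> c \<in> frags (Pow (D i)) \<Longrightarrow> g i c \<in> frags (Pow (D i))"
    "\<And>i c. i \<in> I \<Longrightarrow> c \<in> frags (Y i) \<Longrightarrow> g i c \<in> frags (Y i)" "c \<in> frags Z"
  shows "tensor_op I g c \<in> frags Z"
proof (rule additive_map_into[OF additive_map_tensor_op additive_subset_frags _ assms(3)])
  fix \<eta> assume \<eta>: "\<eta> \<in> Z"
  show "tensor_op I g (frag_of \<eta>) \<in> frags Z"
    unfolding tensor_op_frag_of
  proof (rule join_chain_in_frags[where S = "\<lambda>k. if k \<in> nonfaces \<eta> then Pow (D k) else Y k"])
    show "g k (frag_of (slice \<eta> k)) \<in> frags (if k \<in> nonfaces \<eta> then Pow (D k) else Y k)" if "k \<in> I" for k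
    proof (cases "k \<in> nonfaces \<eta>")
      case True
      have "frag_of (slice \<eta> k) \<in> frags (Pow (D k))" using \<eta> by (auto simp: Z_def slice_def)
      then show ?thesis using True assms(1)[OF that] by simp
    next
      case False
      then have "frag_of (slice \<eta> k) \<in> frags (Y k)" using that by (simp add: nonfaces_def)
      then show ?thesis using False assms(2)[OF that] by simp
    qed
    fix \<rho> assume \<rho>: "\<And>k. k \<in> I \<Longrightarrow> \<rho> k \<in> (if k \<in> nonfaces \<eta> then Pow (D k) else Y k)"
    show "Sigma I \<rho> \<in> Z"
    proof (rule Sigma_in_Z[of _ "nonfaces \<eta>"])
      show "\<rho> k \<subseteq> D k" if "k \<in> I" for k using \<rho>[OF that] Y_sub[OF that] by (auto split: if_splits)
      show "\<rho> k \<in> Y k" if "k \<in> I" "k \<notin> nonfaces \<eta>" for k using \<rho>[OF that(1)] that(2) by simp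
      show "nonfaces \<eta> \<in> K" using \<eta> by (simp add: Z_def)
    qed
  qed simp
qed

definition partial_P where "partial_P j = tensor_op I (\<lambda>i. if i < j then P i else (\<lambda>c. c))"

text \<open>
  For \<open>j \<noteq> k\<close> the two terms cancel, since \<open>h\<close> anticommutes with \<open>eps 1\<close>; for \<open>j = k\<close> the homotopy formula of
  block \<open>k\<close> appears, and the sum over \<open>j\<close> telescopes.
\<close>

lemma homotopy_terms:
  assumes j: "j \<in> I" and k: "k \<in> I" and c: "c \<in> frags (Pow (Sigma I D))"
  shows "tensor_op I (\<lambda>i x. slot_boundary k i (slot_homotopy j i x)) c + tensor_op I (\<lambda>i x. slot_homotopy j i (slot_boundary k i x)) c
    = (if j = k then partial_P j c - partial_P (Suc j) c else 0)"
proof -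
  let ?g = "\<lambda>i x. slot_boundary k i (slot_homotopy j i x)" and ?g' = "\<lambda>i x. slot_homotopy j i (slot_boundary k i x)"
  have fI: "finite I" by simp
  have e: "eps 1 (eps 1 x) = x" for x :: "'a set \<Rightarrow>\<^sub>0 int" by (simp add: graded_sign_comp graded_sign_even)
  have hm: "h i (- x) = - h i x" if "i \<in> I" for i x by (rule additive_map_minus[OF h_add[OF that]])
  show ?thesis
  proof (cases "j = k")
    case True
    let ?s = "\<lambda>i. if i < j then P i else if i = j then (\<lambda>x. x - P j x) else (\<lambda>x. x)"
    have "tensor_op I ?s c = tensor_op I ?g c + tensor_op I ?g' c"
    proof (rule tensor_op_slot[OF fI j c])
      show "?g i x = ?s i x \<and> ?g' i x = ?s i x" if "i \<in> I" "i \<noteq> j" "x \<in> frags (Pow (D i))" for i x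
        using that True by (auto simp: slot_boundary_def slot_homotopy_def e P_eps)
      show "?s j x = ?g j x + ?g' j x" if "x \<in> frags (Pow (D j))" for x
        using True P_eq[OF j that] by (simp add: slot_boundary_def slot_homotopy_def)
    qed
    moreover have "partial_P j c = tensor_op I (\<lambda>i. if i < Suc j then P i else (\<lambda>c. c)) c + tensor_op I ?s c"
      unfolding partial_P_def by (rule tensor_op_slot[OF fI j c]) auto
    ultimately show ?thesis using True by (simp add: partial_P_def algebra_simps)
  next
    case False
    define l where "l = min j k"
    have l: "l \<in> I" using j k by (simp add: l_def min_def)
    have "tensor_op I (\<lambda>i x. if i = l then 0 else ?g i x) c = tensor_op I ?g c + tensor_op I ?g' c"
    proof (rule tensor_op_slot[OF fI l c])
      show "?g i x = (if i = l then 0 else ?g i x) \<and> ?g' i x = (if i = l then 0 else ?g i x)"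
        if "i \<in> I" "i \<noteq> l" "x \<in> frags (Pow (D i))" for i x
        using that False by (auto simp: slot_boundary_def slot_homotopy_def e P_eps l_def min_def split: if_splits)
      show "(if l = l then 0 else ?g l x) = ?g l x + ?g' l x" if x: "x \<in> frags (Pow (D l))" for x
      proof (cases "k < j")
        case True
        then have "l = k" by (simp add: l_def)
        then show ?thesis using True P_boundary[OF k] x
          by (simp add: slot_boundary_def slot_homotopy_def boundary_eps)
      next
        case False
        then have "l = j" "j < k" using \<open>j \<noteq> k\<close> by (auto simp: l_def)
        then show ?thesis using h_eps[OF j] x by (simp add: slot_boundary_def slot_homotopy_def)
      qed
    qed
    moreover have "tensor_op I (\<lambda>i x. if i = l then 0 else ?g i x) c = 0" by (rule tensor_op_zero[OF fI l]) simp
    ultimately show ?thesis using False by simp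
  qed
qed

lemma H_homotopy:
  assumes c: "c \<in> frags (Pow (Sigma I D))"
  shows "boundary (H c) + H (boundary c) = c - tensor_op I P c"
proof -
  have fI: "finite I" by simp
  have Hc: "tensor_op I (slot_homotopy j) c \<in> frags (Pow (Sigma I D))" for j
    by (rule tensor_op_D[OF slot_homotopy_D c])
  have "boundary (H c) = (\<Sum>j\<in>I. \<Sum>k\<in>I. tensor_op I (slot_boundary k) (tensor_op I (slot_homotopy j) c))"
    unfolding H_def boundary_simps by (intro sum.cong refl boundary_eq_tensor_op[OF fI D_finite Hc])
  also have "\<dots> = (\<Sum>j\<in>I. \<Sum>k\<in>I. tensor_op I (\<lambda>i x. slot_boundary k i (slot_homotopy j i x)) c)"
    by (intro sum.cong refl tensor_op_comp) simp_all
  finally have 1: "boundary (H c) = \<dots>" .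
  have "H (boundary c) = (\<Sum>j\<in>I. tensor_op I (slot_homotopy j) (\<Sum>k\<in>I. tensor_op I (slot_boundary k) c))"
    unfolding H_def by (intro sum.cong refl arg_cong[where f = "tensor_op I _"] boundary_eq_tensor_op[OF fI D_finite c])
  also have "\<dots> = (\<Sum>j\<in>I. \<Sum>k\<in>I. tensor_op I (slot_homotopy j) (tensor_op I (slot_boundary k) c))"
    by (simp add: tensor_op_simps)
  also have "\<dots> = (\<Sum>j\<in>I. \<Sum>k\<in>I. tensor_op I (\<lambda>i x. slot_homotopy j i (slot_boundary k i x)) c)"
    by (intro sum.cong refl tensor_op_comp additive_map_slot_homotopy) simp_all
  finally have 2: "H (boundary c) = \<dots>" .
  have "boundary (H c) + H (boundary c) = (\<Sum>j\<in>I. \<Sum>k\<in>I. if j = k then partial_P j c - partial_P (Suc j) c else 0)"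
    unfolding 1 2 sum.distrib[symmetric] by (intro sum.cong refl homotopy_terms c)
  also have "\<dots> = (\<Sum>j\<in>I. partial_P j c - partial_P (Suc j) c)" by simp
  also have "\<dots> = partial_P 1 c - partial_P (Suc m) c"
  proof -
    have "(\<Sum>j\<in>{1..n}. f j - f (Suc j)) = f 1 - f (Suc n)" for n and f :: "nat \<Rightarrow> (nat \<times> 'a) set \<Rightarrow>\<^sub>0 int"
      by (induction n) (auto simp: One_nat_def)
    then show ?thesis by (simp only: I_eq)
  qed
  also have "partial_P 1 c = c"
  proof -
    have "partial_P 1 c = tensor_op I (\<lambda>i c. c) c"
      unfolding partial_P_def by (rule tensor_op_cong[OF fI _ c]) (auto simp: I_eq)
    also have "\<dots> = c"
    proof (rule additive_map_eqI[OF _ _ _ c, where g = "tensor_op I (\<lambda>i c. c)" and h = "\<lambda>c. c"])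
      show "tensor_op I (\<lambda>i c. c) (frag_of \<eta>) = frag_of \<eta>" if "\<eta> \<in> Pow (Sigma I D)" for \<eta>
        using that unfolding tensor_op_frag_of by (simp add: join_chain_frag_of[OF fI] Sigma_slice)
    qed simp_all
    finally show ?thesis .
  qed
  also have "partial_P (Suc m) c = tensor_op I P c"
    unfolding partial_P_def by (rule tensor_op_cong[OF fI _ c]) (auto simp: I_eq)
  finally show ?thesis .
qed

lemma H_Z: "c \<in> frags Z \<Longrightarrow> H c \<in> frags Z"
  unfolding H_def by (intro frags_sum tensor_op_Z slot_homotopy_D slot_homotopy_Y)

text \<open>
  The coordinate at \<open>\<tau>\<close> involves \<open>\<alpha> (boundary x)\<close> in the blocks of \<open>\<tau>\<close>, which vanishes on chains \<open>x\<close> of \<open>Y k\<close>; so only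
  sets \<open>\<tau>\<close> of blocks in which the slice is not a face of \<open>Y k\<close> contribute.
\<close>

lemma Q_K:
  assumes "j \<in> J" "c \<in> frags Z" shows "Q j c \<in> frags K"
proof (rule additive_map_into[OF additive_map_Q additive_subset_frags _ assms(2)])
  fix \<eta> assume \<eta>: "\<eta> \<in> Z"
  have "frag_cmul (\<Prod>k\<in>I. \<alpha> k (j k) (letter_part \<tau> k (frag_of (slice \<eta> k)))) (frag_of \<tau>) \<in> frags K" if \<tau>: "\<tau> \<in> Pow W" for \<tau>
  proof (cases "\<tau> \<subseteq> nonfaces \<eta>")
    case True
    then have "\<tau> \<in> K" using \<eta> K_down unfolding Z_def down_closed_def by auto
    then show ?thesis by (simp add: frags_cmul)
  next
    case False
    then obtain k where k: "k \<in> \<tau>" "k \<in> I" "slice \<eta> k \<in> Y k" using \<tau> W unfolding nonfaces_def by blast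
    have "letter_part \<tau> k (frag_of (slice \<eta> k)) = frag_cmul ((-1) ^ later \<tau> k) (boundary (eps (later \<tau> k) (frag_of (slice \<eta> k))))"
      using k(1) by (simp add: letter_part_def eps_boundary)
    also have "\<dots> = boundary (frag_cmul ((-1) ^ later \<tau> k) (eps (later \<tau> k) (frag_of (slice \<eta> k))))"
      by (simp add: boundary_simps)
    finally have "\<alpha> k (j k) (letter_part \<tau> k (frag_of (slice \<eta> k))) = 0"
      using \<alpha>_boundary[OF k(2) J_less[OF assms(1) k(2)]] k(3) by (simp add: frags_cmul graded_sign_frags)
    then have "(\<Prod>k\<in>I. \<alpha> k (j k) (letter_part \<tau> k (frag_of (slice \<eta> k)))) = 0"
      by (intro prod_zero bexI[of _ k]) (simp_all add: k(2))
    then show ?thesis by (simp only: frag_cmul_zero fragsD(1))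
  qed
  then show "Q j (frag_of \<eta>) \<in> frags K" unfolding Q_def frag_extend_of by (rule frags_sum)
qed

lemma Q_boundary:
  assumes j: "j \<in> J" and c: "c \<in> frags Z"
  shows "Q j (boundary c) = boundary (Q j c)"
proof -
  have cD: "c \<in> frags (Pow (Sigma I D))" by (rule frags_mono[OF Z_sub c])
  have bc: "boundary c \<in> frags Z" "boundary c \<in> frags (Pow (Sigma I D))"
    using boundary_frags[OF Z_down c] boundary_frags[OF down_closed_Pow cD] by auto
  have QW: "Q i x \<in> frags (Pow W)" if "i \<in> J" "x \<in> frags Z" for i x
    by (rule frags_mono[OF K_sub Q_K[OF that]])
  have "tensor_op I P (boundary c) = boundary (tensor_op I P c)"
  proof -
    have H0: "H 0 = 0" by (simp add: H_def tensor_op_simps)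
    have "tensor_op I P (boundary c) = boundary c - boundary (H (boundary c))"
      using H_homotopy[OF bc(2)] H0 by (simp add: algebra_simps)
    moreover have "tensor_op I P c = c - (boundary (H c) + H (boundary c))" using H_homotopy[OF cD] by simp
    ultimately show ?thesis by (simp add: boundary_simps)
  qed
  then have "(\<Sum>i\<in>J. \<Phi> i (Q i (boundary c))) = (\<Sum>i\<in>J. boundary (\<Phi> i (Q i c)))"
    by (simp only: \<Phi>_Q[OF bc(2), symmetric] \<Phi>_Q[OF cD, symmetric] boundary_simps)
  also have "\<dots> = (\<Sum>i\<in>J. \<Phi> i (boundary (Q i c)))"
    unfolding \<Phi>_def by (intro sum.cong refl block_data_boundary[OF \<Phi>_data]) (auto intro: QW c)
  finally have eq: "(\<Sum>i\<in>J. \<Phi> i (Q i (boundary c))) = (\<Sum>i\<in>J. \<Phi> i (boundary (Q i c)))" .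
  have pick: "Q j (\<Sum>i\<in>J. \<Phi> i (x i)) = x j" if "\<And>i. i \<in> J \<Longrightarrow> x i \<in> frags (Pow W)" for x
  proof -
    have "Q j (\<Sum>i\<in>J. \<Phi> i (x i)) = (\<Sum>i\<in>J. if j = i then x i else 0)"
      unfolding additive_map_sum[OF additive_map_Q] by (intro sum.cong refl Q_\<Phi>[OF j]) (auto intro: that)
    then show ?thesis using j J_finite by simp
  qed
  have "Q j (boundary c) = Q j (\<Sum>i\<in>J. \<Phi> i (Q i (boundary c)))"
    by (rule pick[symmetric]) (rule QW[OF _ bc(1)])
  also have "\<dots> = boundary (Q j c)"
    unfolding eq by (rule pick) (intro boundary_frags[OF down_closed_Pow] QW c)
  finally show ?thesis .
qed

lemma kunneth_surj:
  assumes c: "c \<in> cycles Z"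
  shows "\<And>j. j \<in> J \<Longrightarrow> Q j c \<in> cycles K" "c - (\<Sum>j\<in>J. \<Phi> j (Q j c)) \<in> boundaries Z"
proof -
  have cZ: "c \<in> frags Z" "boundary c = 0" and cD: "c \<in> frags (Pow (Sigma I D))"
    using c frags_mono[OF Z_sub] by (auto simp: cycles_def)
  show "Q j c \<in> cycles K" if "j \<in> J" for j
    using Q_K[OF that cZ(1)] Q_boundary[OF that cZ(1)] cZ(2) by (simp add: cycles_def additive_map_zero[OF additive_map_Q])
  have "c - (\<Sum>j\<in>J. \<Phi> j (Q j c)) = boundary (H c)"
    using H_homotopy[OF cD] cZ(2) \<Phi>_Q[OF cD] by (simp add: H_def tensor_op_simps)
  then show "c - (\<Sum>j\<in>J. \<Phi> j (Q j c)) \<in> boundaries Z"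
    using H_Z[OF cZ(1)] by (simp add: boundaries_eq)
qed

lemma kunneth_inj:
  assumes x: "\<And>j. j \<in> J \<Longrightarrow> x j \<in> frags K" and bd: "(\<Sum>j\<in>J. \<Phi> j (x j)) \<in> boundaries Z" and j: "j \<in> J"
  shows "x j \<in> boundaries K"
proof -
  obtain d where d: "d \<in> frags Z" "(\<Sum>j\<in>J. \<Phi> j (x j)) = boundary d" using bd by (auto simp: boundaries_eq)
  have "x j = (\<Sum>i\<in>J. if j = i then x i else 0)" using j J_finite by simp
  also have "\<dots> = Q j (\<Sum>i\<in>J. \<Phi> i (x i))"
    unfolding additive_map_sum[OF additive_map_Q]
    by (intro sum.cong refl Q_\<Phi>[OF j, symmetric]) (auto intro: frags_mono[OF K_sub] x)
  also have "\<dots> = boundary (Q j d)" unfolding d(2) by (rule Q_boundary[OF j d(1)])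
  finally show ?thesis using Q_K[OF j d(1)] by (simp add: boundaries_eq)
qed

end

section \<open>Duality for chains of a polyhedral join\<close>

lemma minus_one_power_cancel: "(-1 :: int) ^ n * ((-1) ^ n * a) = a"
  by (simp flip: mult.assoc power_mult_distrib)

lemma frags_empty_simplex:
  assumes "c \<in> frags {{}}"
  shows "eps n c = c" "complement {} c = c" "boundary c = 0"
proof -
  show "eps n c = c"
    by (rule additive_map_eqI[OF _ _ _ assms, where g = "eps n" and h = "\<lambda>c. c"]) (auto simp: graded_sign_of)
  show "complement {} c = c"
    by (rule additive_map_eqI[OF _ _ _ assms, where g = "complement {}" and h = "\<lambda>c. c"])
       (auto simp: complement_of complement_sign_def)
  show "boundary c = 0"
    by (rule additive_map_eqI[OF _ _ _ assms, where g = boundary and h = "\<lambda>c. 0"]) (auto simp: boundary_frag_of)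
qed

lemma (in simplex_pair) complement_relative_iff:
  assumes v: "v \<in> frags (Pow D)" and c: "complement_map D X v \<in> coboundaries (dual_complex D X)"
  shows "v \<in> relative_boundaries (Pow D) X"
proof -
  obtain g where g: "g \<in> frags (dual_complex D X)" "complement_map D X v = coboundary (dual_complex D X) g"
    using c by (auto simp: coboundaries_eq)
  obtain d where d: "d \<in> frags (Pow D)" "complement_map D X d = g" using complement_map_surj[OF fin g(1)] .
  have "v - boundary d \<in> frags (Pow D)" by (intro fragsD(2) v boundary_frags[OF _ d(1)]) simp
  then have "v - boundary d \<in> frags X"
    by (rule complement_map_eq_0[OF fin])
       (use g(2) d coboundary_complement_map[OF fin down d(1)] in \<open>simp add: complement_simps\<close>)
  then show ?thesis unfolding relative_boundaries_def boundaries_eq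
    using d(1) by (intro CollectI exI[of _ "boundary d"] exI[of _ "v - boundary d"]) simp
qed

lemma relative_boundaries_eps:
  assumes "v \<in> relative_boundaries Y X" shows "eps n v \<in> relative_boundaries Y X"
proof -
  obtain d a where *: "v = boundary d + a" "d \<in> frags Y" "a \<in> frags X"
    using assms by (auto simp: relative_boundaries_def boundaries_eq)
  have "eps n v = boundary (frag_cmul ((-1) ^ n) (eps n d)) + eps n a"
    by (simp add: * graded_sign_simps eps_boundary boundary_simps)
  then show ?thesis unfolding relative_boundaries_def boundaries_eq
    using * by (intro CollectI exI[of _ "boundary (frag_cmul ((-1) ^ n) (eps n d))"] exI[of _ "eps n a"] conjI imageI)
      (auto intro: frags_cmul graded_sign_frags)
qed

text \<open>
  The cochain counterpart of \<open>block_chain\<close>. The coboundary is taken after the degree sign, which accounts for the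
  sign of the letter \<open>n-bar\<close>.
\<close>

definition block_cochain :: "nat set \<Rightarrow> (nat \<Rightarrow> 'a::linorder set) \<Rightarrow> (nat \<Rightarrow> 'a set \<Rightarrow>\<^sub>0 int) \<Rightarrow> (nat set \<Rightarrow>\<^sub>0 int) \<Rightarrow> ((nat \<times> 'a) set \<Rightarrow>\<^sub>0 int)" where
  "block_cochain I D f = frag_extend (\<lambda>\<tau>. join_chain I (\<lambda>k.
     if k \<in> \<tau> then coboundary (Pow (D k)) (eps (later \<tau> k) (f k)) else eps (later \<tau> k) (f k)))"

lemma additive_map_block_cochain [simp]: "additive_map (block_cochain I D f)"
  by (simp add: block_cochain_def)

lemmas block_cochain_simps = additive_map_zero[OF additive_map_block_cochain] additive_map_add[OF additive_map_block_cochain]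
  additive_map_diff[OF additive_map_block_cochain] additive_map_minus[OF additive_map_block_cochain]
  additive_map_cmul[OF additive_map_block_cochain] additive_map_sum[OF additive_map_block_cochain]

declare additive_map_add[OF additive_map_block_cochain, additive_dist]

lemma block_cochain_of: "block_cochain I D f (frag_of \<tau>) = join_chain I (\<lambda>k.
     if k \<in> \<tau> then coboundary (Pow (D k)) (eps (later \<tau> k) (f k)) else eps (later \<tau> k) (f k))"
  by (simp add: block_cochain_def)

lemma block_cochain_slot:
  assumes "finite I" "k \<in> I"
  shows "block_cochain I D (f(k := x + y)) c = block_cochain I D (f(k := x)) c + block_cochain I D (f(k := y)) c"
proof (rule additive_map_eqI[where S = UNIV and c = c and g = "block_cochain I D (f(k := x + y))"
      and h = "\<lambda>c. block_cochain I D (f(k := x)) c + block_cochain I D (f(k := y)) c"])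
  fix \<tau> :: "nat set"
  let ?c = "\<lambda>i. if i \<in> \<tau> then coboundary (Pow (D i)) (eps (later \<tau> i) (f i)) else eps (later \<tau> i) (f i)"
  let ?f = "\<lambda>x. if k \<in> \<tau> then coboundary (Pow (D k)) (eps (later \<tau> k) x) else eps (later \<tau> k) x"
  have e: "block_cochain I D (f(k := x)) (frag_of \<tau>) = join_chain I (?c(k := ?f x))" for x
    unfolding block_cochain_of by (intro join_chain_cong assms(1)) auto
  have "?f (x + y) = ?f x + ?f y" by (simp add: graded_sign_simps coboundary_simps)
  then show "block_cochain I D (f(k := x + y)) (frag_of \<tau>) =
    block_cochain I D (f(k := x)) (frag_of \<tau>) + block_cochain I D (f(k := y)) (frag_of \<tau>)"
    unfolding e by (simp only: join_chain_upd_add[OF assms])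
qed (simp_all add: additive_map_def additive_dist)

context block_complexes
begin

definition size_before :: "nat \<Rightarrow> nat" where
  "size_before k = (\<Sum>i\<in>{i \<in> I. i < k}. card (D i))"

lemma size_before_W: "size_before k = (\<Sum>i\<in>{i \<in> W. i < k}. card (D i))"
  unfolding size_before_def
proof (rule sum.mono_neutral_right)
  show "\<forall>i\<in>{i \<in> I. i < k} - {i \<in> W. i < k}. card (D i) = 0"
  proof
    fix i assume "i \<in> {i \<in> I. i < k} - {i \<in> W. i < k}"
    then have "i \<in> I" "i \<notin> W" by auto
    then show "card (D i) = 0" using outside by simp
  qed
qed (use W in auto)

text \<open>
  The substitution of chains intertwines the two complement maps. All signs come from moving
  the letters past the chains, from the degrees of the duality maps, and from the lexicographic order;
  interchanging the order of summation over pairs \<open>k < i\<close> shows that they cancel. Here \<open>G k\<close> is, up to parity,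
  the total degree of the duality maps preceding block \<open>k\<close>.
\<close>

lemma complement_block_chain:
  assumes wb: "block_data w b" and G: "\<And>k. k \<in> W \<Longrightarrow> even (G k + size_before k + later W k)"
    and f: "\<And>k. k \<in> W \<Longrightarrow> f k = complement (D k) (eps (G k) (w k))"
    and f': "\<And>k. k \<in> I \<Longrightarrow> k \<notin> W \<Longrightarrow> f k = b k"
    and c: "c \<in> frags (Pow W)"
  shows "complement (Sigma I D) (block_chain I w b c) = block_cochain I D f (complement W c)"
proof (rule additive_map_eqI[OF _ _ _ c, where g = "\<lambda>c. complement (Sigma I D) (block_chain I w b c)"
      and h = "\<lambda>c. block_cochain I D f (complement W c)"])
  fix \<tau> assume "\<tau> \<in> Pow W"
  then have \<tau>: "\<tau> \<subseteq> W" and fin: "finite \<tau>" using W_finite finite_subset by auto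
  note wbD = block_dataD[OF wb]
  let ?n = "later \<tau>" and ?n' = "later (W - \<tau>)"
  have n: "later W k = ?n k + ?n' k" for k
  proof -
    have "{i \<in> W. k < i} = {i \<in> \<tau>. k < i} \<union> {i \<in> W - \<tau>. k < i}" using \<tau> by blast
    then show ?thesis unfolding later_def
      by (simp add: card_Un_disjoint fin W_finite disjoint_iff)
  qed
  let ?c = "\<lambda>k. if k \<in> \<tau> then frag_cmul ((-1) ^ ?n k) (eps (?n k) (w k)) else eps (?n k) (b k)"
  let ?d = "\<lambda>k. if k \<in> W - \<tau> then coboundary (Pow (D k)) (eps (?n' k) (f k)) else eps (?n' k) (f k)"
  define x where "x k = (if k \<in> \<tau> then ?n k + card (D k) * ?n' k
     else if k \<in> W then size_before k + ?n k + card (D k) * ?n' k else 0)" for k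
  have entry: "complement (D k) (eps (size_before k) (?c k)) = frag_cmul ((-1) ^ x k) (?d k)" if k: "k \<in> I" for k
  proof (cases "k \<in> W")
    case False
    have D: "D k = {}" and bk: "b k \<in> frags {{}}" using outside[OF k False] wbD(3)[OF k] by auto
    have "eps i (b k) = b k" for i by (rule frags_empty_simplex(1)[OF bk])
    moreover have "complement {} (b k) = b k" by (rule frags_empty_simplex(2)[OF bk])
    ultimately show ?thesis using False \<tau> f'[OF k False] D by (auto simp: x_def)
  next
    case True
    have wD: "w k \<in> frags (Pow (D k))" by (rule wbD(1)[OF True])
    have eD: "eps i (w k) \<in> frags (Pow (D k))" for i by (rule graded_sign_frags[OF wD])
    have par: "eps (?n' k + G k) (w k) = eps (size_before k + ?n k) (w k)"
      by (rule graded_sign_parity) (use G[OF True] n[of k] in presburger)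
    have fk: "eps (?n' k) (f k) = frag_cmul ((-1) ^ (?n' k * card (D k))) (complement (D k) (eps (size_before k + ?n k) (w k)))"
    proof -
      have "complement (D k) (eps (?n' k) (eps (G k) (w k))) = frag_cmul ((-1) ^ (?n' k * card (D k))) (eps (?n' k) (f k))"
        unfolding f[OF True] by (rule complement_eps[OF D_finite[OF k] eD])
      then have "frag_cmul ((-1) ^ (?n' k * card (D k))) (complement (D k) (eps (?n' k + G k) (w k))) = eps (?n' k) (f k)"
        by (simp add: graded_sign_comp flip: power_mult_distrib)
      then show ?thesis by (simp add: par)
    qed
    show ?thesis
    proof (cases "k \<in> \<tau>")
      case True
      then show ?thesis
        by (simp add: fk x_def graded_sign_simps complement_simps graded_sign_comp power_add ac_simps minus_one_power_cancel)
    next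
      case False
      have "complement (D k) (eps (size_before k) (eps (?n k) (b k)))
        = complement (D k) (eps (size_before k + ?n k) (boundary (w k)))"
        using wbD(2)[OF \<open>k \<in> W\<close>] by (simp add: graded_sign_comp)
      also have "\<dots> = frag_cmul ((-1) ^ (size_before k + ?n k)) (coboundary (Pow (D k)) (complement (D k) (eps (size_before k + ?n k) (w k))))"
        by (simp add: eps_boundary complement_simps coboundary_complement[OF D_finite[OF k] eD])
      finally show ?thesis using False \<open>k \<in> W\<close>
        by (simp add: fk x_def coboundary_simps power_add ac_simps minus_one_power_cancel)
    qed
  qed
  have sign: "(\<Prod>k\<in>I. (-1) ^ x k) = complement_sign W \<tau>"
  proof -
    have count: "(\<Sum>k\<in>W. a k * card {i \<in> A. k < i}) = (\<Sum>i\<in>A. \<Sum>k\<in>{k \<in> W. k < i}. a k)" if "finite A" for a :: "nat \<Rightarrow> nat" and A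
    proof -
      have "(\<Sum>k\<in>W. a k * card {i \<in> A. k < i}) = (\<Sum>k\<in>W. \<Sum>i\<in>A. if k < i then a k else 0)"
      proof (rule sum.cong[OF refl])
        fix k
        have "(\<Sum>i\<in>A. if k < i then a k else 0) = (\<Sum>i\<in>{i \<in> A. k < i}. a k)" by (rule sum.inter_filter[symmetric, OF that])
        then show "a k * card {i \<in> A. k < i} = (\<Sum>i\<in>A. if k < i then a k else 0)" by simp
      qed
      also have "\<dots> = (\<Sum>i\<in>A. \<Sum>k\<in>W. if k < i then a k else 0)" by (rule sum.swap)
      also have "\<dots> = (\<Sum>i\<in>A. \<Sum>k\<in>{k \<in> W. k < i}. a k)"
        by (intro sum.cong refl sum.inter_filter[symmetric] W_finite)
      finally show ?thesis .
    qed
    have "(\<Sum>k\<in>I. x k) = (\<Sum>k\<in>W. x k)"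
      by (rule sum.mono_neutral_right) (use W \<tau> in \<open>auto simp: x_def\<close>)
    also have "\<dots> = (\<Sum>k\<in>W. ?n k + card (D k) * ?n' k + (if k \<in> W - \<tau> then size_before k else 0))"
      by (intro sum.cong refl) (auto simp: x_def)
    also have "\<dots> = (\<Sum>k\<in>W. 1 * ?n k) + (\<Sum>k\<in>W. card (D k) * ?n' k) + (\<Sum>k\<in>W. if k \<in> W - \<tau> then size_before k else 0)"
      by (simp add: sum.distrib)
    also have "(\<Sum>k\<in>W. 1 * ?n k) = (\<Sum>i\<in>\<tau>. card {k \<in> W. k < i})"
      unfolding later_def using count[OF fin, of "\<lambda>_. 1"] by simp
    also have "(\<Sum>k\<in>W. card (D k) * ?n' k) = (\<Sum>i\<in>W - \<tau>. size_before i)"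
      unfolding later_def size_before_W using count[of "W - \<tau>" "\<lambda>k. card (D k)"] W_finite by simp
    also have "(\<Sum>k\<in>W. if k \<in> W - \<tau> then size_before k else 0) = (\<Sum>i\<in>W - \<tau>. size_before i)"
      by (rule sum.mono_neutral_cong_right) (use W_finite in auto)
    finally have "(\<Sum>k\<in>I. x k) = (\<Sum>i\<in>\<tau>. card {k \<in> W. k < i}) + 2 * (\<Sum>i\<in>W - \<tau>. size_before i)" by simp
    then have "(-1 :: int) ^ (\<Sum>k\<in>I. x k) = complement_sign W \<tau>"
      by (simp add: power_add complement_sign_def)
    then show ?thesis by (simp add: power_sum)
  qed
  have cD: "?c k \<in> frags (Pow (D k))" if "k \<in> I" for k
    using wbD(1)[of k] wbD(5)[OF that] \<tau> by (auto intro!: frags_cmul graded_sign_frags)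
  have "complement (Sigma I D) (block_chain I w b (frag_of \<tau>)) = join_chain I (\<lambda>k. complement (D k) (eps (size_before k) (?c k)))"
    unfolding block_chain_of size_before_def by (rule complement_join_chain[OF I_finite D_finite cD])
  also have "\<dots> = join_chain I (\<lambda>k. frag_cmul ((-1) ^ x k) (?d k))"
    by (intro join_chain_cong I_finite entry)
  also have "\<dots> = frag_cmul (complement_sign W \<tau>) (block_cochain I D f (frag_of (W - \<tau>)))"
    unfolding block_cochain_of join_chain_scale[OF I_finite] sign ..
  finally show "complement (Sigma I D) (block_chain I w b (frag_of \<tau>)) = block_cochain I D f (complement W (frag_of \<tau>))"
    by (simp add: complement_of block_cochain_simps)
qed (simp_all add: additive_map_def additive_dist)

lemma complement_map_block_chain:
  assumes "block_data w b" "\<And>k. k \<in> W \<Longrightarrow> even (G k + size_before k + later W k)"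
    "\<And>k. k \<in> W \<Longrightarrow> f k = complement (D k) (eps (G k) (w k))" "\<And>k. k \<in> I \<Longrightarrow> k \<notin> W \<Longrightarrow> f k = b k"
    and c: "c \<in> frags (Pow W)"
  shows "cochain_restrict (dual_complex (Sigma I D) Z) (block_cochain I D f (complement_map W K c))
     = complement_map (Sigma I D) Z (block_chain I w b c)"
proof (rule additive_map_eqI[OF _ _ _ c, where h = "\<lambda>c. complement_map (Sigma I D) Z (block_chain I w b c)"
      and g = "\<lambda>c. cochain_restrict (dual_complex (Sigma I D) Z) (block_cochain I D f (complement_map W K c))"])
  fix \<tau> assume \<tau>: "\<tau> \<in> Pow W"
  show "cochain_restrict (dual_complex (Sigma I D) Z) (block_cochain I D f (complement_map W K (frag_of \<tau>)))
     = complement_map (Sigma I D) Z (block_chain I w b (frag_of \<tau>))"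
  proof (cases "\<tau> \<in> K")
    case True
    have "block_chain I w b (frag_of \<tau>) \<in> frags Z" by (rule block_data_Z[OF assms(1)]) (simp add: True)
    then show ?thesis using True
      by (simp add: complement_map_zero complement_map_zero[of "frag_of \<tau>" K] block_cochain_simps cochain_restrict_simps)
  next
    case False
    then have "complement_map W K (frag_of \<tau>) = complement W (frag_of \<tau>)" by (simp add: complement_map_def)
    moreover have "block_chain I w b (frag_of \<tau>) \<in> frags (Pow (Sigma I D))"
    proof -
      note wbD = block_dataD[OF assms(1)]
      show ?thesis unfolding block_chain_of
        by (rule join_chain_in_frags[where S = "\<lambda>k. Pow (D k)"])
           (use wbD(1,5) \<tau> in \<open>auto intro!: frags_cmul graded_sign_frags\<close>)
    qed
    ultimately show ?thesis
      using complement_block_chain[OF assms(1-4), of "frag_of \<tau>"] \<tau>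
      by (simp add: complement_map_eq_restrict[of _ "Sigma I D" Z])
  qed
qed (simp_all add: additive_map_def additive_dist)

end

section \<open>The Kunneth isomorphism for homology groups\<close>

locale kunneth_groups = kunneth m I W D Y K r b w \<alpha> h
  for m I W and D :: "nat \<Rightarrow> nat set" and Y K r b w \<alpha> h +
  assumes generate: "\<And>k c. k \<in> I \<Longrightarrow> c \<in> cycles (Y k) \<Longrightarrow> \<exists>n. c - (\<Sum>i<r k. frag_cmul (n i) (b k i)) \<in> boundaries (Y k)"
begin

definition G :: "nat \<Rightarrow> (nat set \<Rightarrow>\<^sub>0 int) set monoid" where
  "G k = (if k = 0 then homology K else homology (Y k))"

abbreviation T where "T \<equiv> tensor_group {0..m} G"
abbreviation R where "R \<equiv> tensor_relations {0..m} G"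

lemma zero_notin_I: "0 \<notin> I" by (simp add: I_eq)

lemma I_sub: "k \<in> I \<Longrightarrow> k \<in> {0..m} \<and> k \<noteq> 0" by (auto simp: I_eq)

lemma G_0: "G 0 = homology K" by (simp add: G_def)

lemma G_I: "k \<in> I \<Longrightarrow> G k = homology (Y k)" using zero_notin_I by (auto simp: G_def)

lemmas q_K = quotient_homology[OF K_down]
lemmas q_Z = quotient_homology[OF Z_down]

lemma q_Y: "k \<in> I \<Longrightarrow> quotient_of (cycles (Y k)) (boundaries (Y k)) (homology (Y k))"
  by (rule quotient_homology[OF Y_down])

lemma G_group: "\<forall>k\<in>{0..m}. group (G k)"
proof
  fix k assume "k \<in> {0..m}"
  then consider "k = 0" | "k \<in> I" by (cases "k = 0") (auto simp: I_eq Suc_le_eq One_nat_def)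
  then show "group (G k)"
    by cases (auto simp: G_0 G_I intro: group_quotient[OF q_K] group_quotient[OF q_Y])
qed

lemmas q_T = quotient_tensor[OF G_group]

lemma b_cycles: "k \<in> I \<Longrightarrow> i < r k \<Longrightarrow> b k i \<in> cycles (Y k)"
  by (simp add: cycles_def b_Y b_0)

definition basis_class :: "nat \<Rightarrow> nat \<Rightarrow> (nat set \<Rightarrow>\<^sub>0 int) set" where
  "basis_class k i = coset (boundaries (Y k)) (b k i)"

definition basis_tensor :: "(nat set \<Rightarrow>\<^sub>0 int) set \<Rightarrow> (nat \<Rightarrow> nat) \<Rightarrow> nat \<Rightarrow> (nat set \<Rightarrow>\<^sub>0 int) set" where
  "basis_tensor g j = (\<lambda>k\<in>{0..m}. if k = 0 then g else basis_class k (j k))"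

lemma basis_class_in: "k \<in> I \<Longrightarrow> i < r k \<Longrightarrow> basis_class k i \<in> carrier (G k)"
  unfolding basis_class_def G_I by (rule quotient_ofD(7)[OF q_Y b_cycles])

lemma basis_tensor_in:
  assumes "g \<in> carrier (homology K)" "j \<in> J"
  shows "basis_tensor g j \<in> tensor_generators {0..m} G"
proof (rule PiE_I)
  fix k assume k: "k \<in> {0..m}"
  show "basis_tensor g j k \<in> carrier (G k)"
  proof (cases "k = 0")
    case False
    then have "k \<in> I" using k by (simp add: I_eq)
    then show ?thesis using k False basis_class_in[OF _ J_less[OF assms(2)]] by (simp add: basis_tensor_def)
  qed (use assms(1) in \<open>simp add: basis_tensor_def G_0\<close>)
qed (simp add: basis_tensor_def)

lemma slot_relation:
  assumes "x \<in> tensor_generators {0..m} G" "k \<in> {0..m}" "y \<in> carrier (G k)" "z \<in> carrier (G k)"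
  shows "frag_of (x(k := y \<otimes>\<^bsub>G k\<^esub> z)) - frag_of (x(k := y)) - frag_of (x(k := z)) \<in> R"
  by (rule tensor_relations_incl[OF G_group]) (use assms in \<open>auto simp: multilinearity_relations_def\<close>)

lemma slot_zero:
  assumes "x \<in> tensor_generators {0..m} G" "k \<in> {0..m}"
  shows "frag_of (x(k := \<one>\<^bsub>G k\<^esub>)) \<in> R"
proof -
  have o: "\<one>\<^bsub>G k\<^esub> \<in> carrier (G k)" "\<one>\<^bsub>G k\<^esub> \<otimes>\<^bsub>G k\<^esub> \<one>\<^bsub>G k\<^esub> = \<one>\<^bsub>G k\<^esub>"
    using bspec[OF G_group assms(2)] by (simp_all add: group.is_monoid)
  have "- frag_of (x(k := \<one>\<^bsub>G k\<^esub>)) \<in> R" using slot_relation[OF assms o(1) o(1)] by (simp add: o(2))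
  from additive_subsetD(3)[OF quotient_ofD(2)[OF q_T] this] show ?thesis by simp
qed

lemma slot_diff:
  assumes x: "x \<in> tensor_generators {0..m} G" "k \<in> {0..m}" and q: "quotient_of S B (G k)" and cd: "c \<in> S" "d \<in> S"
  shows "frag_of (x(k := coset B (c - d))) - (frag_of (x(k := coset B c)) - frag_of (x(k := coset B d))) \<in> R"
proof -
  note Q = quotient_ofD[OF q]
  have m: "c - d \<in> S" using additive_subsetD(2)[OF Q(1) cd] .
  have "coset B (c - d) \<otimes>\<^bsub>G k\<^esub> coset B d = coset B c" using Q(6)[OF m cd(2)] by simp
  then have "frag_of (x(k := coset B c)) - frag_of (x(k := coset B (c - d))) - frag_of (x(k := coset B d)) \<in> R"
    using slot_relation[OF x Q(7)[OF m] Q(7)[OF cd(2)]] by simp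
  from additive_subsetD(3)[OF quotient_ofD(2)[OF q_T] this] show ?thesis by (simp add: algebra_simps)
qed

definition span where
  "span = {c. \<exists>g. (\<forall>j\<in>J. g j \<in> carrier (homology K)) \<and> c - (\<Sum>j\<in>J. frag_of (basis_tensor (g j) j)) \<in> R}"

lemma basis_tensor_upd: "basis_tensor g j = (basis_tensor g' j)(0 := g)"
  by (rule ext) (simp add: basis_tensor_def)

lemma additive_subset_span: "additive_subset span" and R_span: "R \<subseteq> span"
proof -
  note RR = additive_subsetD[OF quotient_ofD(2)[OF q_T]] and QK = quotient_ofD[OF q_K]
  have one: "\<one>\<^bsub>homology K\<^esub> \<in> carrier (homology K)" using group_quotient[OF q_K] by (simp add: group.is_monoid)
  show R: "R \<subseteq> span"
  proof
    fix c assume c: "c \<in> R"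
    have "(\<Sum>j\<in>J. frag_of (basis_tensor \<one>\<^bsub>homology K\<^esub> j)) \<in> R"
    proof (rule additive_subset_sum[OF quotient_ofD(2)[OF q_T]])
      fix j assume "j \<in> J"
      from slot_zero[OF basis_tensor_in[OF one this], of 0] show "frag_of (basis_tensor \<one>\<^bsub>homology K\<^esub> j) \<in> R"
        by (simp add: G_0 flip: basis_tensor_upd)
    qed
    from RR(2)[OF c this] one show "c \<in> span" unfolding span_def by (intro CollectI exI[of _ "\<lambda>_. \<one>\<^bsub>homology K\<^esub>"]) simp
  qed
  show "additive_subset span"
    unfolding additive_subset_def
  proof (intro conjI ballI)
    show "0 \<in> span" using R RR(1) by auto
    fix c d assume "c \<in> span" "d \<in> span"
    then obtain g g' where g: "\<And>j. j \<in> J \<Longrightarrow> g j \<in> carrier (homology K)" "c - (\<Sum>j\<in>J. frag_of (basis_tensor (g j) j)) \<in> R"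
      and g': "\<And>j. j \<in> J \<Longrightarrow> g' j \<in> carrier (homology K)" "d - (\<Sum>j\<in>J. frag_of (basis_tensor (g' j) j)) \<in> R"
      unfolding span_def by blast
    define g'' where "g'' j = coset (boundaries K) (rep (g j) - rep (g' j))" for j
    have g'': "g'' j \<in> carrier (homology K)" if "j \<in> J" for j unfolding g''_def
      by (intro QK(7) additive_subsetD(2)[OF QK(1)] quotient_rep(1)[OF q_K] g g' that)
    have "(\<Sum>j\<in>J. frag_of (basis_tensor (g'' j) j) - (frag_of (basis_tensor (g j) j) - frag_of (basis_tensor (g' j) j))) \<in> R"
    proof (rule additive_subset_sum[OF quotient_ofD(2)[OF q_T]])
      fix j assume j: "j \<in> J"
      have "frag_of ((basis_tensor (g j) j)(0 := coset (boundaries K) (rep (g j) - rep (g' j)))) -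
        (frag_of ((basis_tensor (g j) j)(0 := coset (boundaries K) (rep (g j)))) - frag_of ((basis_tensor (g j) j)(0 := coset (boundaries K) (rep (g' j))))) \<in> R"
        by (rule slot_diff[OF basis_tensor_in[OF g(1)[OF j] j] _ _ quotient_rep(1)[OF q_K g(1)[OF j]] quotient_rep(1)[OF q_K g'(1)[OF j]]])
           (simp_all add: G_0 q_K)
      then show "frag_of (basis_tensor (g'' j) j) - (frag_of (basis_tensor (g j) j) - frag_of (basis_tensor (g' j) j)) \<in> R"
        unfolding quotient_rep(2)[OF q_K g(1)[OF j], symmetric] quotient_rep(2)[OF q_K g'(1)[OF j], symmetric]
        by (simp add: g''_def flip: basis_tensor_upd)
    qed
    then have s: "(\<Sum>j\<in>J. frag_of (basis_tensor (g'' j) j)) - ((\<Sum>j\<in>J. frag_of (basis_tensor (g j) j)) - (\<Sum>j\<in>J. frag_of (basis_tensor (g' j) j))) \<in> R"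
      by (simp add: sum_subtractf)
    have "(c - (\<Sum>j\<in>J. frag_of (basis_tensor (g j) j))) - (d - (\<Sum>j\<in>J. frag_of (basis_tensor (g' j) j))) -
      ((\<Sum>j\<in>J. frag_of (basis_tensor (g'' j) j)) - ((\<Sum>j\<in>J. frag_of (basis_tensor (g j) j)) - (\<Sum>j\<in>J. frag_of (basis_tensor (g' j) j)))) \<in> R"
      by (intro RR(2) g(2) g'(2) s)
    then have "c - d - (\<Sum>j\<in>J. frag_of (basis_tensor (g'' j) j)) \<in> R" by (simp add: algebra_simps)
    then show "c - d \<in> span" unfolding span_def using g'' by blast
  qed
qed

lemma generator_in_span:
  assumes x: "x \<in> tensor_generators {0..m} G"
  shows "frag_of x \<in> span"
proof -
  note RR = additive_subsetD[OF quotient_ofD(2)[OF q_T]] and SS = additive_subsetD[OF additive_subset_span]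
  have "frag_of x \<in> span" if "finite A" "A \<subseteq> I" "x \<in> tensor_generators {0..m} G"
    "\<And>k. k \<in> I - A \<Longrightarrow> \<exists>i<r k. x k = basis_class k i" for A x
    using that
  proof (induction A arbitrary: x rule: finite_induct)
    case empty
    then have "\<forall>k\<in>I. \<exists>i. i < r k \<and> x k = basis_class k i" by auto
    then obtain j0 where j0: "\<forall>k\<in>I. j0 k < r k \<and> x k = basis_class k (j0 k)" by (rule bchoice[THEN exE])
    define j where "j = restrict j0 I"
    have jJ: "j \<in> J" using j0 by (auto simp: J_def j_def)
    have x0: "x 0 \<in> carrier (homology K)" using empty.prems(2) by (force simp: PiE_iff G_0[symmetric])
    have xb: "x = basis_tensor (x 0) j"
    proof (rule PiE_ext[OF empty.prems(2) basis_tensor_in[OF x0 jJ]])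
      fix k assume k: "k \<in> {0..m}"
      show "x k = basis_tensor (x 0) j k"
      proof (cases "k = 0")
        case False
        then have "k \<in> I" using k by (simp add: I_eq)
        then show ?thesis using k False j0 by (simp add: basis_tensor_def j_def)
      qed (use k in \<open>simp add: basis_tensor_def\<close>)
    qed
    have one: "\<one>\<^bsub>homology K\<^esub> \<in> carrier (homology K)" using group_quotient[OF q_K] by (simp add: group.is_monoid)
    let ?g = "\<lambda>i. if i = j then x 0 else \<one>\<^bsub>homology K\<^esub>"
    have "(\<Sum>i\<in>J. frag_of (basis_tensor (?g i) i)) = frag_of (basis_tensor (x 0) j) + (\<Sum>i\<in>J - {j}. frag_of (basis_tensor (?g i) i))"
      using sum.remove[OF J_finite jJ, of "\<lambda>i. frag_of (basis_tensor (?g i) i)"] by simp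
    moreover have "(\<Sum>i\<in>J - {j}. frag_of (basis_tensor (?g i) i)) \<in> R"
    proof (rule additive_subset_sum[OF quotient_ofD(2)[OF q_T]])
      fix i assume i: "i \<in> J - {j}"
      from slot_zero[OF basis_tensor_in[OF one, of i], of 0] i show "frag_of (basis_tensor (?g i) i) \<in> R"
        by (simp add: G_0 flip: basis_tensor_upd)
    qed
    ultimately have "frag_of x - (\<Sum>i\<in>J. frag_of (basis_tensor (?g i) i)) \<in> R" using xb RR(3) by simp
    then show ?case unfolding span_def using x0 one by (intro CollectI exI[of _ ?g]) auto
  next
    case (insert a A)
    have a: "a \<in> I" and am: "a \<in> {0..m}" using insert.prems(1) I_sub by auto
    let ?f = "\<lambda>c. frag_of (x(a := coset (boundaries (Y a)) c))"
    have q: "quotient_of (cycles (Y a)) (boundaries (Y a)) (G a)" using q_Y[OF a] by (simp add: G_I[OF a])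
    note Qa = quotient_ofD[OF q]
    define C where "C = {c \<in> cycles (Y a). ?f c \<in> span}"
    have zero: "?f 0 \<in> span" using slot_zero[OF insert.prems(2) am] R_span by (auto simp: Qa(5))
    have C: "additive_subset C"
      unfolding additive_subset_def
    proof (intro conjI ballI)
      show "0 \<in> C" using zero additive_subsetD(1)[OF Qa(1)] by (simp add: C_def)
      fix c d assume cd: "c \<in> C" "d \<in> C"
      have "?f (c - d) - (?f c - ?f d) \<in> span"
        using slot_diff[OF insert.prems(2) am q, of c d] cd R_span by (auto simp: C_def)
      then have "(?f (c - d) - (?f c - ?f d)) + (?f c - ?f d) \<in> span"
        using cd by (intro SS(4) SS(2)[of "?f c" "?f d"]) (auto simp: C_def)
      then show "c - d \<in> C" using additive_subsetD(2)[OF Qa(1)] cd by (simp add: C_def)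
    qed
    have bC: "b a i \<in> C" if i: "i < r a" for i
    proof -
      have "?f (b a i) \<in> span"
      proof (rule insert.IH)
        show "x(a := coset (boundaries (Y a)) (b a i)) \<in> tensor_generators {0..m} G"
          by (rule PiE_upd[where A = "\<lambda>i. carrier (G i)", OF insert.prems(2) am]) (rule Qa(7)[OF b_cycles[OF a i]])
        show "\<exists>i'<r k. (x(a := coset (boundaries (Y a)) (b a i))) k = basis_class k i'" if "k \<in> I - A" for k
          using that insert.prems(3)[of k] i by (auto simp: basis_class_def)
      qed (use insert.prems in auto)
      then show ?thesis using b_cycles[OF a i] by (simp add: C_def)
    qed
    have xa: "x a \<in> carrier (G a)" using insert.prems(2) am by (auto simp: PiE_iff)
    obtain n where n: "rep (x a) - (\<Sum>i<r a. frag_cmul (n i) (b a i)) \<in> boundaries (Y a)"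
      using generate[OF a quotient_rep(1)[OF q xa]] by blast
    have "(\<Sum>i<r a. frag_cmul (n i) (b a i)) \<in> C"
      by (intro additive_subset_sum[OF C] additive_subset_cmul[OF C] bC) simp
    moreover have "x a = coset (boundaries (Y a)) (\<Sum>i<r a. frag_cmul (n i) (b a i))"
      using n quotient_rep(2)[OF q xa] coset_eq_iff[OF Qa(2)] by metis
    ultimately show ?case by (simp add: C_def)  (metis fun_upd_triv)
  qed
  from this[OF I_finite order_refl x] show ?thesis by simp
qed

text \<open>
  Expanding every factor in its basis writes each element of the tensor product as a sum of basis tensors.
\<close>

lemma tensor_expansion:
  assumes "u \<in> carrier T"
  obtains g where "\<And>j. j \<in> J \<Longrightarrow> g j \<in> carrier (homology K)" "u = coset R (\<Sum>j\<in>J. frag_of (basis_tensor (g j) j))"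
proof -
  note Q = quotient_ofD[OF q_T]
  obtain c where c: "c \<in> frags (tensor_generators {0..m} G)" "u = coset R c" using assms Q(4) by auto
  have "c \<in> span"
    using additive_map_into[OF additive_map_id(1) additive_subset_span _ c(1)] generator_in_span by simp
  then show ?thesis using that c(2) unfolding span_def by (auto simp: coset_eq_iff[OF Q(2)])
qed

text \<open>
  By \<open>tensor_expansion\<close> an element is given by classes \<open>g j\<close> of \<open>K\<close>, and it is mapped to the sum of the \<open>\<Phi> j\<close> of
  their representatives. On chains the coordinates \<open>Q j\<close> recover the \<open>g j\<close> (\<open>kunneth_inj\<close>), and every cycle is
  homologous to such a sum (\<open>kunneth_surj\<close>).
\<close>

lemma kunneth_iso:
  assumes U: "U \<in> hom T (homology Z)"
    and U_basis: "\<And>g j. g \<in> carrier (homology K) \<Longrightarrow> j \<in> J \<Longrightarrow> U (pure_tensor {0..m} G (basis_tensor g j)) = coset (boundaries Z) (\<Phi> j (rep g))"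
  shows "U \<in> iso T (homology Z)"
proof -
  note QT = quotient_ofD[OF q_T] and QZ = quotient_ofD[OF q_Z] and QK = quotient_ofD[OF q_K]
  interpret T: group T by (rule group_quotient[OF q_T])
  interpret HZ: group "homology Z" by (rule group_quotient[OF q_Z])
  interpret U: group_hom T "homology Z" U using U by unfold_locales
  have \<Phi>_cycle: "\<Phi> j c \<in> cycles Z" if "j \<in> J" "c \<in> cycles K" for j c
    using block_data_Z[OF \<Phi>_data[OF that(1)]] block_data_boundary[OF \<Phi>_data[OF that(1)], of c] that(2) frags_mono[OF K_sub]
    by (auto simp: cycles_def \<Phi>_def block_chain_simps)
  have gen: "frag_of (basis_tensor (g j) j) \<in> frags (tensor_generators {0..m} G)"
    if "\<And>j. j \<in> J \<Longrightarrow> g j \<in> carrier (homology K)" "j \<in> J" for g j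
    using basis_tensor_in[OF that(1)[OF that(2)] that(2)] by (simp only: frags_of)
  have U_sum: "U (coset R (\<Sum>j\<in>A. frag_of (basis_tensor (g j) j))) = coset (boundaries Z) (\<Sum>j\<in>A. \<Phi> j (rep (g j)))"
    if g: "\<And>j. j \<in> J \<Longrightarrow> g j \<in> carrier (homology K)" and "finite A" "A \<subseteq> J" for g A
    using that(2,3)
  proof (induction A rule: finite_induct)
    case empty
    then show ?case using U.hom_one by (simp add: QT(5) QZ(5))
  next
    case (insert j A)
    have A: "(\<Sum>j\<in>A. frag_of (basis_tensor (g j) j)) \<in> frags (tensor_generators {0..m} G)"
      using insert.prems by (intro frags_sum gen[OF g]) auto
    have jJ: "j \<in> J" using insert.prems by auto
    have j: "frag_of (basis_tensor (g j) j) \<in> frags (tensor_generators {0..m} G)" by (rule gen[OF g jJ])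
    have Z1: "\<Phi> j (rep (g j)) \<in> cycles Z" using insert.prems by (intro \<Phi>_cycle quotient_rep(1)[OF q_K] g) auto
    have Z2: "(\<Sum>j\<in>A. \<Phi> j (rep (g j))) \<in> cycles Z"
      using insert.prems by (intro additive_subset_sum[OF additive_subset_cycles] \<Phi>_cycle quotient_rep(1)[OF q_K] g) auto
    have "coset R (\<Sum>j\<in>insert j A. frag_of (basis_tensor (g j) j)) =
      coset R (frag_of (basis_tensor (g j) j)) \<otimes>\<^bsub>T\<^esub> coset R (\<Sum>j\<in>A. frag_of (basis_tensor (g j) j))"
      using insert.hyps by (simp add: QT(6)[OF j A])
    then have "U (coset R (\<Sum>j\<in>insert j A. frag_of (basis_tensor (g j) j))) =
       U (pure_tensor {0..m} G (basis_tensor (g j) j)) \<otimes>\<^bsub>homology Z\<^esub> U (coset R (\<Sum>j\<in>A. frag_of (basis_tensor (g j) j)))"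
      using U.hom_mult[OF QT(7)[OF j] QT(7)[OF A]] by (simp add: pure_tensor_def)
    also have "\<dots> = coset (boundaries Z) (\<Phi> j (rep (g j))) \<otimes>\<^bsub>homology Z\<^esub> coset (boundaries Z) (\<Sum>j\<in>A. \<Phi> j (rep (g j)))"
      using insert.prems insert.IH by (simp add: U_basis[OF g[OF jJ] jJ])
    also have "\<dots> = coset (boundaries Z) (\<Sum>j\<in>insert j A. \<Phi> j (rep (g j)))"
      using insert.hyps by (simp add: QZ(6)[OF Z1 Z2])
    finally show ?case .
  qed
  have "inj_on U (carrier T)"
    unfolding U.inj_on_one_iff
  proof (intro ballI impI allI)
    fix u assume u: "u \<in> carrier T" "U u = \<one>\<^bsub>homology Z\<^esub>"
    obtain g where g: "\<And>j. j \<in> J \<Longrightarrow> g j \<in> carrier (homology K)" "u = coset R (\<Sum>j\<in>J. frag_of (basis_tensor (g j) j))"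
      using tensor_expansion[OF u(1)] by blast
    have "coset (boundaries Z) (\<Sum>j\<in>J. \<Phi> j (rep (g j))) = coset (boundaries Z) 0"
      using u(2) g(2) U_sum[OF g(1) J_finite order_refl] by (simp add: QZ(5))
    then have bd: "(\<Sum>j\<in>J. \<Phi> j (rep (g j))) \<in> boundaries Z" by (simp add: coset_eq_iff[OF QZ(2)])
    have "(\<Sum>j\<in>J. frag_of (basis_tensor (g j) j)) \<in> R"
    proof (rule additive_subset_sum[OF QT(2)])
      fix j assume j: "j \<in> J"
      have "rep (g j) \<in> boundaries K"
        by (rule kunneth_inj[OF _ bd j]) (use quotient_rep(1)[OF q_K g(1)] in \<open>simp add: cycles_def\<close>)
      then have "g j = \<one>\<^bsub>homology K\<^esub>"
        using quotient_rep(2)[OF q_K g(1)[OF j]] QK(5) coset_eq_iff[OF QK(2), of "rep (g j)" 0] by simp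
      then show "frag_of (basis_tensor (g j) j) \<in> R"
        using slot_zero[OF basis_tensor_in[OF g(1)[OF j] j], of 0] by (simp add: G_0 flip: basis_tensor_upd)
    qed
    then show "u = \<one>\<^bsub>T\<^esub>" using g(2) by (simp add: QT(5) coset_eq_iff[OF QT(2)])
  qed
  moreover have "carrier (homology Z) \<subseteq> U ` carrier T"
  proof
    fix y assume "y \<in> carrier (homology Z)"
    then obtain c where c: "c \<in> cycles Z" "y = coset (boundaries Z) c" by (auto simp: QZ(4))
    define g where "g j = coset (boundaries K) (Q j c)" for j
    have g: "g j \<in> carrier (homology K)" if "j \<in> J" for j
      unfolding g_def by (rule QK(7)[OF kunneth_surj(1)[OF c(1) that]])
    have "(\<Sum>j\<in>J. \<Phi> j (rep (g j))) - (\<Sum>j\<in>J. \<Phi> j (Q j c)) \<in> boundaries Z"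
      unfolding sum_subtractf[symmetric]
    proof (rule additive_subset_sum[OF additive_subset_boundaries])
      fix j assume j: "j \<in> J"
      obtain d where d: "d \<in> frags K" "rep (g j) - Q j c = boundary d"
        using rep_coset[OF additive_subset_boundaries, of K "Q j c"] unfolding g_def boundaries_eq by auto
      have "\<Phi> j (rep (g j)) - \<Phi> j (Q j c) = boundary (\<Phi> j d)"
        using block_data_boundary[OF \<Phi>_data[OF j] frags_mono[OF K_sub d(1)]]
        by (simp add: additive_map_diff[OF additive_map_\<Phi>, symmetric] d(2)) (simp add: \<Phi>_def)
      then show "\<Phi> j (rep (g j)) - \<Phi> j (Q j c) \<in> boundaries Z"
        using block_data_Z[OF \<Phi>_data[OF j] d(1)] by (auto simp: boundaries_eq \<Phi>_def)
    qed
    from additive_subsetD(2)[OF additive_subset_boundaries kunneth_surj(2)[OF c(1)] this]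
    have "c - (\<Sum>j\<in>J. \<Phi> j (rep (g j))) \<in> boundaries Z" by simp
    then have "y = U (coset R (\<Sum>j\<in>J. frag_of (basis_tensor (g j) j)))"
      using U_sum[of g, OF g J_finite order_refl] c(2) by (simp add: coset_eq_iff[OF QZ(2)])
    moreover have "coset R (\<Sum>j\<in>J. frag_of (basis_tensor (g j) j)) \<in> carrier T"
      by (intro QT(7) frags_sum gen g)
    ultimately show "y \<in> U ` carrier T" by blast
  qed
  ultimately show ?thesis unfolding iso_def bij_betw_def using U U.hom_closed by blast
qed

end

section \<open>Degrees and signs of the chosen representatives\<close>

abbreviation degree_part :: "nat \<Rightarrow> ('a set \<Rightarrow>\<^sub>0 int) \<Rightarrow> ('a set \<Rightarrow>\<^sub>0 int)" where
  "degree_part p \<equiv> cochain_restrict {\<tau>. card \<tau> = p}"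

lemma homogeneous_iff_frags: "homogeneous p c \<longleftrightarrow> c \<in> frags {\<tau>. card \<tau> = p}"
  by (auto simp: homogeneous_def frags_def)

lemma eps_homogeneous:
  assumes "homogeneous p c" shows "eps n c = frag_cmul ((-1) ^ (n * p)) c"
  by (rule additive_map_eqI[where S = "{\<tau>. card \<tau> = p}" and c = c and g = "eps n" and h = "frag_cmul ((-1) ^ (n * p))"])
     (use assms in \<open>auto simp: graded_sign_of homogeneous_iff_frags\<close>)

lemma degree_part_homogeneous: "homogeneous p (degree_part p c)"
  by (simp add: homogeneous_iff_frags cochain_restrict_frags)

lemma sum_degree_parts: "(\<Sum>p\<in>card ` Poly_Mapping.keys c. degree_part p c) = c"
proof (rule poly_mapping_eqI)
  fix \<tau>
  show "Poly_Mapping.lookup (\<Sum>p\<in>card ` Poly_Mapping.keys c. degree_part p c) \<tau> = Poly_Mapping.lookup c \<tau>"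
    by (cases "\<tau> \<in> Poly_Mapping.keys c")
       (auto simp: lookup_sum lookup_cochain_restrict sum.delta in_keys_iff)
qed

text \<open>A map that shifts degrees by \<open>e\<close> commutes with \<open>eps n\<close> up to the sign \<open>(-1) ^ (n * e)\<close>.\<close>

lemma homogeneous_map_eps:
  fixes g :: "('a set \<Rightarrow>\<^sub>0 int) \<Rightarrow> ('b set \<Rightarrow>\<^sub>0 int)"
  assumes S: "additive_subset S" and g: "\<And>c d. c \<in> S \<Longrightarrow> d \<in> S \<Longrightarrow> g (c + d) = g c + g d"
    and part: "\<And>c p. c \<in> S \<Longrightarrow> degree_part p c \<in> S"
    and hom: "\<And>c p. c \<in> S \<Longrightarrow> homogeneous p c \<Longrightarrow> homogeneous (p + e) (g c)"
    and c: "c \<in> S"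
  shows "g (eps n c) = frag_cmul ((-1) ^ (n * e)) (eps n (g c))"
proof -
  note SS = additive_subsetD[OF S]
  have g0: "g 0 = 0" using g[OF SS(1) SS(1)] by simp
  have gm: "g (- c) = - g c" if "c \<in> S" for c
    using g[OF that SS(3)[OF that]] g0 by (simp add: eq_neg_iff_add_eq_0 add.commute)
  have gs: "g (frag_cmul ((-1) ^ k) c) = frag_cmul ((-1) ^ k) (g c)" if "c \<in> S" for c k
    using gm[OF that] by (cases "even k") simp_all
  have gsum: "g (\<Sum>p\<in>A. x p) = (\<Sum>p\<in>A. g (x p))" if "finite A" "\<And>p. p \<in> A \<Longrightarrow> x p \<in> S" for A :: "nat set" and x
    using that by (induction A rule: finite_induct) (auto simp: g0 g additive_subset_sum[OF S])
  have one: "g (eps n (degree_part p c)) = frag_cmul ((-1) ^ (n * e)) (eps n (g (degree_part p c)))" for p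
  proof -
    have "g (eps n (degree_part p c)) = frag_cmul ((-1) ^ (n * p)) (g (degree_part p c))"
      by (simp add: eps_homogeneous[OF degree_part_homogeneous] gs[OF part[OF c]])
    moreover have "eps n (g (degree_part p c)) = frag_cmul ((-1) ^ (n * (p + e))) (g (degree_part p c))"
      by (rule eps_homogeneous[OF hom[OF part[OF c] degree_part_homogeneous]])
    ultimately show ?thesis by (simp add: distrib_left power_add ac_simps minus_one_power_cancel)
  qed
  let ?A = "card ` Poly_Mapping.keys c"
  have pS: "eps n (degree_part p c) \<in> S" for p
    unfolding eps_homogeneous[OF degree_part_homogeneous] by (rule additive_subset_cmul[OF S part[OF c]])
  have "g (eps n (\<Sum>p\<in>?A. degree_part p c)) = (\<Sum>p\<in>?A. g (eps n (degree_part p c)))"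
    by (simp add: graded_sign_simps gsum pS)
  also have "\<dots> = frag_cmul ((-1) ^ (n * e)) (eps n (g (\<Sum>p\<in>?A. degree_part p c)))"
    by (simp add: one gsum part c graded_sign_simps frag_cmul_sum)
  finally show ?thesis by (simp add: sum_degree_parts)
qed

lemma boundary_degree_part:
  assumes "c \<in> frags {\<tau>. finite \<tau>}"
  shows "boundary (degree_part (Suc p) c) = degree_part p (boundary c)"
proof (rule additive_map_eqI[OF _ _ _ assms, where g = "\<lambda>c. boundary (degree_part (Suc p) c)" and h = "\<lambda>c. degree_part p (boundary c)"])
  fix \<tau> :: "'a set" assume "\<tau> \<in> {\<tau>. finite \<tau>}"
  then have "card (\<tau> - {v}) = p \<longleftrightarrow> card \<tau> = Suc p" if "v \<in> \<tau>" for v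
    using that card_Suc_Diff1[of \<tau> v] by auto
  then show "boundary (degree_part (Suc p) (frag_of \<tau>)) = degree_part p (boundary (frag_of \<tau>))"
    by (auto simp: cochain_restrict_of boundary_frag_of cochain_restrict_simps boundary_simps intro!: sum.cong sum.neutral[symmetric])
qed (simp_all add: additive_map_def additive_dist)

lemma degree_part_frags: "c \<in> frags X \<Longrightarrow> degree_part p c \<in> frags X"
  by (rule additive_map_into[where S = X and c = c and g = "degree_part p"]) (auto simp: cochain_restrict_of fragsD(1))

lemma cycles_degree_part:
  assumes "finite D" "X \<subseteq> Pow D" "c \<in> cycles X"
  shows "degree_part p c \<in> cycles X"
proof -
  have c: "c \<in> frags X" "boundary c = 0" using assms(3) by (auto simp: cycles_def)
  have fin: "c \<in> frags {\<tau>. finite \<tau>}" by (rule frags_finite[OF assms(1) frags_mono[OF assms(2) c(1)]])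
  have "boundary (degree_part p c) = 0"
  proof (cases p)
    case 0
    have "degree_part 0 c \<in> frags {{}}"
      by (rule additive_map_into[where S = "{\<tau>. finite \<tau>}" and c = c and g = "degree_part 0"])
         (auto simp: cochain_restrict_of fragsD(1) fin)
    then show ?thesis using 0 frags_empty_simplex(3) by simp
  next
    case (Suc q)
    then show ?thesis by (simp add: boundary_degree_part[OF fin] c(2) cochain_restrict_simps)
  qed
  then show ?thesis by (simp add: cycles_def degree_part_frags[OF c(1)])
qed

lemma coboundary_degree_part:
  assumes "finite D" "X \<subseteq> Pow D" "f \<in> frags (Pow D)"
  shows "coboundary X (degree_part p f) = degree_part (Suc p) (coboundary X f)"
proof -
  have swap: "cochain_restrict A (cochain_restrict B c) = cochain_restrict B (cochain_restrict A c)" for A B and c :: "'a set \<Rightarrow>\<^sub>0 int"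
    by (rule poly_mapping_eqI) (simp add: lookup_cochain_restrict)
  have fP: "finite (Pow D)" using assms(1) by simp
  have "coboundary (Pow D) (degree_part p f) = degree_part (Suc p) (coboundary (Pow D) f)"
  proof (rule additive_map_eqI[OF _ _ _ assms(3), where g = "\<lambda>f. coboundary (Pow D) (degree_part p f)"
        and h = "\<lambda>f. degree_part (Suc p) (coboundary (Pow D) f)"])
    fix \<rho> assume "\<rho> \<in> Pow D"
    then have \<rho>: "\<rho> \<subseteq> D" "finite \<rho>" using assms(1) finite_subset by auto
    have "card (insert v \<rho>) = Suc p \<longleftrightarrow> card \<rho> = p" if "v \<in> D - \<rho>" for v
      using that \<rho> by simp
    then show "coboundary (Pow D) (degree_part p (frag_of \<rho>)) = degree_part (Suc p) (coboundary (Pow D) (frag_of \<rho>))"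
      by (auto simp: cochain_restrict_of coboundary_simplex_of[OF assms(1) \<rho>(1)] cochain_restrict_simps coboundary_simps
          intro!: sum.cong sum.neutral[symmetric])
  qed (simp_all add: additive_map_def additive_dist)
  then show ?thesis
    using swap[of X "{\<tau>. card \<tau> = Suc p}"] by (simp flip: coboundary_restrict[OF fP assms(2)])
qed

lemma cocycles_degree_part:
  assumes "finite D" "X \<subseteq> Pow D" "c \<in> cocycles X"
  shows "degree_part p c \<in> cocycles X"
  using assms(3) coboundary_degree_part[OF assms(1,2), of c p] frags_mono[OF assms(2), of c]
  by (auto simp: cocycles_def degree_part_frags cochain_restrict_simps)

lemma coboundary_eps:
  assumes "finite D" "X \<subseteq> Pow D" "f \<in> frags (Pow D)"
  shows "coboundary X (eps n f) = frag_cmul ((-1) ^ n) (eps n (coboundary X f))"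
proof -
  have fP: "finite (Pow D)" using assms(1) by simp
  have "coboundary (Pow D) (eps n f) = frag_cmul ((-1) ^ n) (eps n (coboundary (Pow D) f))"
  proof (rule additive_map_eqI[OF _ _ _ assms(3), where g = "\<lambda>f. coboundary (Pow D) (eps n f)"
        and h = "\<lambda>f. frag_cmul ((-1) ^ n) (eps n (coboundary (Pow D) f))"])
    fix \<rho> assume "\<rho> \<in> Pow D"
    then have \<rho>: "\<rho> \<subseteq> D" "finite \<rho>" using assms(1) finite_subset by auto
    show "coboundary (Pow D) (eps n (frag_of \<rho>)) = frag_cmul ((-1) ^ n) (eps n (coboundary (Pow D) (frag_of \<rho>)))"
      using \<rho> by (auto simp: graded_sign_of coboundary_simplex_of[OF assms(1) \<rho>(1)] graded_sign_simps coboundary_simps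
          frag_cmul_sum power_add ac_simps minus_one_power_cancel intro!: sum.cong)
  qed (simp_all add: additive_map_def additive_dist)
  then show ?thesis
    by (simp add: cochain_restrict_simps cochain_restrict_graded_sign flip: coboundary_restrict[OF fP assms(2)])
qed

lemma boundaries_eps: "c \<in> boundaries X \<Longrightarrow> eps n c \<in> boundaries X"
  by (auto simp: boundaries_eq eps_boundary intro!: graded_sign_frags frags_cmul simp flip: boundary_simps(5))

lemma coboundaries_eps:
  assumes "finite D" "X \<subseteq> Pow D" "c \<in> coboundaries X" shows "eps n c \<in> coboundaries X"
proof -
  obtain g where g: "g \<in> frags X" "c = coboundary X g" using assms(3) by (auto simp: coboundaries_eq)
  have "eps n c = coboundary X (frag_cmul ((-1) ^ n) (eps n g))"
    by (simp add: g(2) coboundary_simps coboundary_eps[OF assms(1,2) frags_mono[OF assms(2) g(1)]] flip: power_mult_distrib)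
  then show ?thesis using g(1) by (auto simp: coboundaries_eq intro!: frags_cmul graded_sign_frags)
qed

lemma image_coset:
  assumes "additive_map g" "\<And>b. b \<in> B \<Longrightarrow> g b \<in> B" "\<And>c. g (g c) = c"
  shows "g ` coset B c = coset B (g c)"
proof
  show "g ` coset B c \<subseteq> coset B (g c)"
    using assms(2) by (auto simp: mem_coset simp flip: additive_map_diff[OF assms(1)])
  show "coset B (g c) \<subseteq> g ` coset B c"
  proof
    fix x assume "x \<in> coset B (g c)"
    then have "g (x - g c) \<in> B" using assms(2) by (simp add: mem_coset)
    then have "g x \<in> coset B c" by (simp add: mem_coset additive_map_diff[OF assms(1)] assms(3))
    then show "x \<in> g ` coset B c" using assms(3) by (metis imageI)
  qed
qed

lemma eps_eps: "eps n (eps n c) = c"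
  by (simp add: graded_sign_comp graded_sign_even)

lemma eps_coset_homology: "eps n ` coset (boundaries X) c = coset (boundaries X) (eps n c)"
  by (rule image_coset) (simp_all add: boundaries_eps eps_eps)

lemma eps_coset_cohomology:
  "finite D \<Longrightarrow> X \<subseteq> Pow D \<Longrightarrow> eps n ` coset (coboundaries X) c = coset (coboundaries X) (eps n c)"
  by (rule image_coset) (simp_all add: coboundaries_eps eps_eps)

lemma shifted_sign_coset:
  "graded_sign n (\<lambda>\<tau>. card \<tau> + 1) ` coset (boundaries X) c = coset (boundaries X) (frag_cmul ((-1) ^ n) (eps n c))"
proof -
  have "graded_sign n (\<lambda>\<tau>. card \<tau> + 1) ` coset (boundaries X) c = coset (boundaries X) (graded_sign n (\<lambda>\<tau>. card \<tau> + 1) c)"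
  proof (rule image_coset)
    show "graded_sign n (\<lambda>\<tau>. card \<tau> + 1) c \<in> boundaries X" if "c \<in> boundaries X" for c
      unfolding graded_sign_shift by (intro additive_subset_cmul[OF additive_subset_boundaries] boundaries_eps that)
    show "graded_sign n (\<lambda>\<tau>. card \<tau> + 1) (graded_sign n (\<lambda>\<tau>. card \<tau> + 1) c) = c" for c :: "'a set \<Rightarrow>\<^sub>0 int"
      by (simp only: graded_sign_comp) (rule graded_sign_even, simp)
  qed simp
  then show ?thesis by (simp only: graded_sign_shift)
qed

lemma empty_simplex_groups:
  "boundaries {{} :: 'a::linorder set} = {0}" "coboundaries {{} :: 'a set} = {0}"
  "cycles {{} :: 'a set} = frags {{}}" "cocycles {{} :: 'a set} = frags {{}}"
proof -
  have b: "boundary c = 0" if "c \<in> frags {{}}" for c :: "'a set \<Rightarrow>\<^sub>0 int" by (rule frags_empty_simplex(3)[OF that])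
  have d: "coboundary {{}} f = 0" for f :: "'a set \<Rightarrow>\<^sub>0 int"
    by (simp add: coboundary_def boundary_frag_of additive_map_zero[OF additive_map_pairing])
  show "boundaries {{} :: 'a set} = {0}" using b fragsD(1) by (fastforce simp: boundaries_eq)
  show "coboundaries {{} :: 'a set} = {0}" using d fragsD(1) by (fastforce simp: coboundaries_eq)
  show "cycles {{} :: 'a set} = frags {{}}" "cocycles {{} :: 'a set} = frags {{}}"
    using b d by (auto simp: cycles_def cocycles_def)
qed

lemma coset_singleton: "coset {0} c = {c}"
  by (auto simp: mem_coset)

lemma rep_singleton [simp]: "rep {c} = c"
  by (simp add: rep_def)

subsection \<open>Choices of bounding chains and of extensions\<close>

text \<open>
  The condition on degrees in a choice of representatives matters only for signs: \<open>z\<close> raises degrees by one and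
  so commutes with \<open>eps n\<close> up to \<open>(-1) ^ n\<close>, while an extension \<open>f\<close> preserves degrees and commutes strictly.
\<close>

lemma bounding_choiceD:
  assumes bc: "bounding_choice L t z" and X: "X = local_complex L t" and L: "down_closed L" and D: "D = snd t" "finite D"
  shows "x \<in> carrier (homology X) \<Longrightarrow> z x \<in> frags (Pow D)"
    "x \<in> carrier (homology X) \<Longrightarrow> boundary (z x) \<in> x"
    "x \<in> carrier (homology X) \<Longrightarrow> y \<in> carrier (homology X) \<Longrightarrow> z (x \<otimes>\<^bsub>homology X\<^esub> y) = z x + z y"
    "x \<in> carrier (homology X) \<Longrightarrow> z (eps n ` x) = frag_cmul ((-1) ^ n) (eps n (z x))"
proof -
  have down: "down_closed X" unfolding X by (rule down_closed_local[OF L])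
  have sub: "X \<subseteq> Pow D" unfolding X D by (rule local_complex_subset)
  note q = quotient_homology[OF down] note Q = quotient_ofD[OF q]
  show zD: "z x \<in> frags (Pow D)" if "x \<in> carrier (homology X)" for x
    using bc that unfolding bounding_choice_def X[symmetric] D(1)[symmetric] by (auto simp: hom_def carrier_eq_frags)
  show "boundary (z x) \<in> x" if "x \<in> carrier (homology X)" for x
    using bc that unfolding bounding_choice_def X by auto
  show add: "z (x \<otimes>\<^bsub>homology X\<^esub> y) = z x + z y" if "x \<in> carrier (homology X)" "y \<in> carrier (homology X)" for x y
    using bc that unfolding bounding_choice_def X by (auto simp: hom_def)
  show "z (eps n ` x) = frag_cmul ((-1) ^ n) (eps n (z x))" if x: "x \<in> carrier (homology X)" for x
  proof -
    obtain c where c: "c \<in> cycles X" "x = coset (boundaries X) c" using x by (auto simp: Q(4))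
    have "z (coset (boundaries X) (eps n c)) = frag_cmul ((-1) ^ (n * 1)) (eps n (z (coset (boundaries X) c)))"
    proof (rule homogeneous_map_eps[where g = "\<lambda>c. z (coset (boundaries X) c)", OF additive_subset_cycles _ cycles_degree_part[OF D(2) sub] _ c(1)])
      show "z (coset (boundaries X) (c + d)) = z (coset (boundaries X) c) + z (coset (boundaries X) d)"
        if "c \<in> cycles X" "d \<in> cycles X" for c d
        using add[OF Q(7)[OF that(1)] Q(7)[OF that(2)]] by (simp add: Q(6)[OF that])
      show "homogeneous (p + 1) (z (coset (boundaries X) c))" if "c \<in> cycles X" "homogeneous p c" for c p
      proof -
        have "c \<in> coset (boundaries X) c" by (simp add: mem_coset additive_subsetD(1)[OF additive_subset_boundaries])
        then have "homogeneous (Suc p) (z (coset (boundaries X) c))"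
          using bc Q(7)[OF that(1)] that(2) unfolding bounding_choice_def X[symmetric] by blast
        then show ?thesis by (simp only: Suc_eq_plus1)
      qed
    qed
    then show ?thesis by (simp add: c(2) eps_coset_homology)
  qed
qed

lemma extension_choiceD:
  assumes ec: "extension_choice L t f" and X: "X = local_complex L t" and L: "down_closed L" and D: "D = snd t" "finite D"
  shows "y \<in> carrier (cohomology X) \<Longrightarrow> f y \<in> frags (Pow D)"
    "y \<in> carrier (cohomology X) \<Longrightarrow> cochain_restrict X (f y) \<in> y"
    "y \<in> carrier (cohomology X) \<Longrightarrow> y' \<in> carrier (cohomology X) \<Longrightarrow> f (y \<otimes>\<^bsub>cohomology X\<^esub> y') = f y + f y'"
    "y \<in> carrier (cohomology X) \<Longrightarrow> f (eps n ` y) = eps n (f y)"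
proof -
  have down: "down_closed X" unfolding X by (rule down_closed_local[OF L])
  have sub: "X \<subseteq> Pow D" unfolding X D by (rule local_complex_subset)
  have finX: "finite X" by (rule finite_subset[OF sub]) (simp add: D(2))
  note q = quotient_cohomology[OF finX down] note Q = quotient_ofD[OF q]
  show "f y \<in> frags (Pow D)" if "y \<in> carrier (cohomology X)" for y
    using ec that unfolding extension_choice_def X[symmetric] D(1)[symmetric] by (auto simp: hom_def carrier_eq_frags)
  show "cochain_restrict X (f y) \<in> y" if "y \<in> carrier (cohomology X)" for y
    using ec that unfolding extension_choice_def X by auto
  show add: "f (y \<otimes>\<^bsub>cohomology X\<^esub> y') = f y + f y'" if "y \<in> carrier (cohomology X)" "y' \<in> carrier (cohomology X)" for y y'
    using ec that unfolding extension_choice_def X by (auto simp: hom_def)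
  show "f (eps n ` y) = eps n (f y)" if y: "y \<in> carrier (cohomology X)" for y
  proof -
    obtain c where c: "c \<in> cocycles X" "y = coset (coboundaries X) c" using y by (auto simp: Q(4))
    have "f (coset (coboundaries X) (eps n c)) = frag_cmul ((-1) ^ (n * 0)) (eps n (f (coset (coboundaries X) c)))"
    proof (rule homogeneous_map_eps[where g = "\<lambda>c. f (coset (coboundaries X) c)", OF additive_subset_cocycles _ cocycles_degree_part[OF D(2) sub] _ c(1)])
      show "f (coset (coboundaries X) (c + d)) = f (coset (coboundaries X) c) + f (coset (coboundaries X) d)"
        if "c \<in> cocycles X" "d \<in> cocycles X" for c d
        using add[OF Q(7)[OF that(1)] Q(7)[OF that(2)]] by (simp add: Q(6)[OF that])
      show "homogeneous (p + 0) (f (coset (coboundaries X) c))" if "c \<in> cocycles X" "homogeneous p c" for c p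
      proof -
        have "c \<in> coset (coboundaries X) c" by (simp add: mem_coset additive_subsetD(1)[OF additive_subset_coboundaries])
        then have "homogeneous p (f (coset (coboundaries X) c))"
          using ec Q(7)[OF that(1)] that(2) unfolding extension_choice_def X[symmetric] by blast
        then show ?thesis by simp
      qed
    qed
    then show ?thesis by (simp add: c(2) eps_coset_cohomology[OF D(2) sub])
  qed
qed

text \<open>A cycle is sent to the chain chosen for its class.\<close>

lemma bounding_choice_bounded_pair:
  assumes bc: "bounding_choice L t z" and X: "X = local_complex L t" and L: "down_closed L" and D: "D = snd t" "finite D" "D \<noteq> {}"
  shows "bounded_pair D X (\<lambda>c. z (coset (boundaries X) c))"
proof -
  have down: "down_closed X" unfolding X by (rule down_closed_local[OF L])
  have sub: "X \<subseteq> Pow D" unfolding X D by (rule local_complex_subset)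
  note q = quotient_homology[OF down] note Q = quotient_ofD[OF q]
  note bcD = bounding_choiceD[OF bc X L D(1,2)]
  show ?thesis
  proof unfold_locales
    show "boundary (z (coset (boundaries X) c)) - c \<in> boundaries X" if "c \<in> cycles X" for c
      using bcD(2)[OF Q(7)[OF that]] by (simp add: mem_coset)
    show "z (coset (boundaries X) (c + d)) = z (coset (boundaries X) c) + z (coset (boundaries X) d)"
      if "c \<in> cycles X" "d \<in> cycles X" for c d
      using bcD(3)[OF Q(7)[OF that(1)] Q(7)[OF that(2)]] by (simp add: Q(6)[OF that])
    show "z (coset (boundaries X) c) = 0" if c: "c \<in> boundaries X" for c
    proof -
      have "\<one>\<^bsub>homology X\<^esub> \<in> carrier (homology X)" "\<one>\<^bsub>homology X\<^esub> \<otimes>\<^bsub>homology X\<^esub> \<one>\<^bsub>homology X\<^esub> = \<one>\<^bsub>homology X\<^esub>"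
        using group_quotient[OF q] by (simp_all add: group.is_monoid)
      then have "z \<one>\<^bsub>homology X\<^esub> = 0" using bcD(3)[of "\<one>\<^bsub>homology X\<^esub>" "\<one>\<^bsub>homology X\<^esub>"] by simp
      moreover have "coset (boundaries X) c = \<one>\<^bsub>homology X\<^esub>"
        using c coset_eq_iff[OF Q(2), of c 0] by (simp add: Q(5))
      ultimately show ?thesis by simp
    qed
    show "z (coset (boundaries X) (eps 1 c)) = - eps 1 (z (coset (boundaries X) c))" if "c \<in> cycles X" for c
      using bcD(4)[OF Q(7)[OF that], of 1] by (simp add: eps_coset_homology)
  qed (use D down sub bcD(1) Q(7) in auto)
qed

section \<open>One index of a polyhedral join\<close>

lemma simplicial_complexD:
  assumes "simplicial_complex V K" shows "down_closed K" "K \<subseteq> Pow V"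
  using assms by (auto simp: simplicial_complex_def down_closed_def)

text \<open>
  The face \<open>\<tau>\<close> of \<open>K\<close> in the definition may be taken minimal: the blocks in which the slice is not a face of \<open>L k\<close>.
\<close>

lemma polyhedral_join_iff:
  assumes K: "simplicial_complex {1..m} K" and L: "\<And>k. k \<in> {1..m} \<Longrightarrow> simplicial_complex (V k) (L k)"
  shows "S \<in> polyhedral_join m V K L \<longleftrightarrow> S \<subseteq> Sigma {1..m} V \<and> {k \<in> {1..m}. slice S k \<notin> L k} \<in> K"
proof
  assume "S \<in> polyhedral_join m V K L"
  then obtain \<tau> \<rho> where S: "\<tau> \<in> K" "S = Sigma {1..m} \<rho>" "\<And>k. k \<in> {1..m} \<Longrightarrow> \<rho> k \<in> (if k \<in> \<tau> then Pow (V k) else L k)"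
    unfolding polyhedral_join_def by blast
  have sl: "slice S k = \<rho> k" if "k \<in> {1..m}" for k unfolding S(2) by (rule slice_Sigma[OF that])
  have "\<rho> k \<subseteq> V k" if "k \<in> {1..m}" for k
    using S(3)[OF that] simplicial_complexD(2)[OF L[OF that]] by (auto split: if_splits)
  then have "S \<subseteq> Sigma {1..m} V" unfolding S(2) by (intro Sigma_mono) auto
  moreover have "{k \<in> {1..m}. slice S k \<notin> L k} \<subseteq> \<tau>"
  proof
    fix k assume "k \<in> {k \<in> {1..m}. slice S k \<notin> L k}"
    then have k: "k \<in> {1..m}" "slice S k \<notin> L k" by blast+
    then show "k \<in> \<tau>" using S(3)[OF k(1)] sl[OF k(1)] by metis
  qed
  then have "{k \<in> {1..m}. slice S k \<notin> L k} \<in> K" using S(1) simplicial_complexD(1)[OF K] unfolding down_closed_def by blast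
  ultimately show "S \<subseteq> Sigma {1..m} V \<and> {k \<in> {1..m}. slice S k \<notin> L k} \<in> K" ..
next
  let ?\<tau> = "{k \<in> {1..m}. slice S k \<notin> L k}"
  assume S: "S \<subseteq> Sigma {1..m} V \<and> ?\<tau> \<in> K"
  then have "S = Sigma {1..m} (slice S)" by (metis Sigma_slice)
  moreover have "\<forall>k\<in>{1..m}. slice S k \<in> (if k \<in> ?\<tau> then Pow (V k) else L k)"
    using S by (auto simp: slice_def)
  ultimately show "S \<in> polyhedral_join m V K L" using S unfolding polyhedral_join_def by blast
qed

lemma simplicial_complex_dual:
  assumes "simplicial_complex V K" shows "simplicial_complex V (dual_complex V K)"
  using down_closed_dual[OF simplicial_complexD(1)[OF assms], of V] dual_complex_subset[of V K]
  by (simp add: simplicial_complex_def down_closed_def)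

lemma simplicial_complex_polyhedral_join:
  assumes K: "simplicial_complex {1..m} K" and L: "\<And>k. k \<in> {1..m} \<Longrightarrow> simplicial_complex (V k) (L k)"
  shows "simplicial_complex (Sigma {1..m} V) (polyhedral_join m V K L)"
  unfolding simplicial_complex_def
proof (intro conjI ballI allI impI)
  have iff: "S \<in> polyhedral_join m V K L \<longleftrightarrow> S \<subseteq> Sigma {1..m} V \<and> {k \<in> {1..m}. slice S k \<notin> L k} \<in> K" for S
    by (rule polyhedral_join_iff[OF K L])
  show "polyhedral_join m V K L \<subseteq> Pow (Sigma {1..m} V)" using iff by blast
  fix S T assume S: "S \<in> polyhedral_join m V K L" and T: "T \<subseteq> S"
  have sub: "slice T k \<subseteq> slice S k" for k using T by (auto simp: slice_def)
  have "{k \<in> {1..m}. slice T k \<notin> L k} \<subseteq> {k \<in> {1..m}. slice S k \<notin> L k}"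
  proof
    fix k assume "k \<in> {k \<in> {1..m}. slice T k \<notin> L k}"
    then have k: "k \<in> {1..m}" "slice T k \<notin> L k" by blast+
    then have "slice S k \<notin> L k" using simplicial_complexD(1)[OF L[OF k(1)]] sub unfolding down_closed_def by blast
    then show "k \<in> {k \<in> {1..m}. slice S k \<notin> L k}" using k(1) by blast
  qed
  moreover have "{k \<in> {1..m}. slice S k \<notin> L k} \<in> K" "S \<subseteq> Sigma {1..m} V" using S iff by blast+
  ultimately have "{k \<in> {1..m}. slice T k \<notin> L k} \<in> K"
    using simplicial_complexD(1)[OF K] unfolding down_closed_def by blast
  then show "T \<in> polyhedral_join m V K L" using iff T \<open>S \<subseteq> Sigma {1..m} V\<close> by blast
qed

text \<open>
  A slice fails to be a face of the dual of \<open>L k\<close> iff its complement is a face of \<open>L k\<close>. So the blocks that enter the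
  criterion for \<open>S\<close> and for its complement are complementary, which is the condition in the dual of \<open>K\<close>.
\<close>

lemma dual_polyhedral_join:
  assumes K: "simplicial_complex {1..m} K" and L: "\<And>k. k \<in> {1..m} \<Longrightarrow> simplicial_complex (V k) (L k)"
  shows "polyhedral_join m V (dual_complex {1..m} K) (\<lambda>k. dual_complex (V k) (L k)) =
    dual_complex (Sigma {1..m} V) (polyhedral_join m V K L)"
proof (rule Set.set_eqI)
  fix S
  let ?N = "Sigma {1..m} V" and ?A = "{k \<in> {1..m}. slice S k \<notin> dual_complex (V k) (L k)}"
  have iff': "S \<in> polyhedral_join m V (dual_complex {1..m} K) (\<lambda>k. dual_complex (V k) (L k)) \<longleftrightarrow>
     S \<subseteq> ?N \<and> ?A \<in> dual_complex {1..m} K"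
    by (rule polyhedral_join_iff) (intro simplicial_complex_dual K L; assumption)+
  show "S \<in> polyhedral_join m V (dual_complex {1..m} K) (\<lambda>k. dual_complex (V k) (L k)) \<longleftrightarrow>
    S \<in> dual_complex ?N (polyhedral_join m V K L)"
  proof (cases "S \<subseteq> ?N")
    case True
    have 1: "slice S k \<notin> dual_complex (V k) (L k) \<longleftrightarrow> V k - slice S k \<in> L k" if k: "k \<in> {1..m}" for k
      using dual_complex_iff'[of "slice S k" "V k" "L k"] True by (auto simp: slice_def)
    have 2: "slice (?N - S) k = V k - slice S k" if "k \<in> {1..m}" for k
      using that by (auto simp: slice_def)
    have "slice (?N - S) k \<notin> L k \<longleftrightarrow> slice S k \<in> dual_complex (V k) (L k)" if "k \<in> {1..m}" for k
      unfolding 2[OF that] using 1[OF that] by blast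
    then have "{1..m} - ?A = {k \<in> {1..m}. slice (?N - S) k \<notin> L k}" by blast
    moreover have "?A \<in> dual_complex {1..m} K \<longleftrightarrow> {1..m} - ?A \<notin> K" by (rule dual_complex_iff') auto
    moreover have "?N - S \<in> polyhedral_join m V K L \<longleftrightarrow> {k \<in> {1..m}. slice (?N - S) k \<notin> L k} \<in> K"
      using polyhedral_join_iff[of m K V L "?N - S", OF K L] by auto
    ultimately show ?thesis using True iff' dual_complex_iff'[OF True, of "polyhedral_join m V K L"] by simp
  next
    case False
    then show ?thesis using iff' dual_complex_subset[of ?N] by blast
  qed
qed

lemma fst_opposite [simp]: "fst (opposite V t) = V - (fst t \<union> snd t)"
  by (simp add: opposite_def split: prod.splits)

lemma X_index_iff: "t \<in> X_index V \<longleftrightarrow> fst t \<subseteq> V \<and> snd t \<subseteq> V \<and> fst t \<inter> snd t = {}"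
  by (simp add: X_index_def case_prod_beta)

lemma block_opposite:
  "t \<in> X_index (Sigma {1..m} V) \<Longrightarrow> k \<in> {1..m} \<Longrightarrow> block (opposite (Sigma {1..m} V) t) k = opposite (V k) (block t k)"
  by (auto simp: block_def opposite_def split: prod.splits)

lemma block_X_index: "t \<in> X_index (Sigma {1..m} V) \<Longrightarrow> block t k \<in> X_index (V k)"
  by (auto simp: block_def X_index_def)

lemma block_index_opposite:
  assumes t: "t \<in> X_index (Sigma {1..m} V)"
  shows "block_index m (\<lambda>k. dual_complex (V k) (L k)) (opposite (Sigma {1..m} V) t) = opposite {1..m} (block_index m L t)"
proof -
  have o: "fst (opposite (V k) (block t k)) \<notin> dual_complex (V k) (L k) \<longleftrightarrow> fst (block t k) \<in> L k"
    if "snd (block t k) = {}" for k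
  proof -
    have "fst (block t k) \<subseteq> V k" using block_X_index[OF t, of k] by (auto simp: X_index_def)
    then show ?thesis using that dual_complex_iff[of "fst (block t k)" "V k" "L k"] by simp
  qed
  then have *: "snd (block t k) = {} \<and> fst (opposite (V k) (block t k)) \<notin> dual_complex (V k) (L k) \<longleftrightarrow>
    snd (block t k) = {} \<and> fst (block t k) \<in> L k" for k using o[of k] by blast
  have o': "block (opposite (Sigma {1..m} V) t) k = opposite (V k) (block t k)" if "k \<in> {1..m}" for k
    by (rule block_opposite[OF t that])
  have "fst (block_index m (\<lambda>k. dual_complex (V k) (L k)) (opposite (Sigma {1..m} V) t)) =
      {k \<in> {1..m}. snd (block t k) = {} \<and> fst (block t k) \<in> L k}"
    unfolding block_index_def fst_conv by (rule Collect_cong, rule conj_cong[OF refl]) (simp only: o' snd_opposite *)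
  moreover have "snd (block_index m (\<lambda>k. dual_complex (V k) (L k)) (opposite (Sigma {1..m} V) t)) = {k \<in> {1..m}. snd (block t k) \<noteq> {}}"
    unfolding block_index_def snd_conv by (rule Collect_cong, rule conj_cong[OF refl]) (simp only: o' snd_opposite)
  ultimately show ?thesis by (intro prod_eqI) (auto simp: block_index_def opposite_def)
qed

lemma block_index_L_index:
  assumes "t \<in> L_index (Sigma {1..m} V)" shows "block_index m L t \<in> L_index {1..m}"
proof -
  have "snd t \<subseteq> Sigma {1..m} V" "snd t \<noteq> {}"
    using L_index_X_index[OF assms] L_index_nonempty[OF assms] by (simp_all add: X_index_iff)
  then obtain k v where "(k, v) \<in> snd t" "k \<in> {1..m}" by blast
  then have "k \<in> {k \<in> {1..m}. snd (block t k) \<noteq> {}}" by (auto simp: block_def)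
  then show ?thesis by (auto simp: L_index_def X_index_def block_index_def)
qed

lemma local_complex_empty_index:
  assumes "down_closed L" "\<sigma> \<in> L" shows "local_complex L (\<sigma>, {}) = {{}}"
  using assms by (auto simp: local_complex_def)

lemma tensor_group_cong:
  assumes "\<And>i. i \<in> I \<Longrightarrow> G i = H i"
  shows "tensor_group I G = tensor_group I H" "tensor_relations I G = tensor_relations I H"
    "pure_tensor I G x = pure_tensor I H x" "tensor_generators I G = tensor_generators I H"
proof -
  show g: "tensor_generators I G = tensor_generators I H" using assms by (intro PiE_cong) simp
  have "multilinearity_relations I G = multilinearity_relations I H"
    unfolding multilinearity_relations_def g using assms by (intro Collect_cong ex_cong1) auto
  then show r: "tensor_relations I G = tensor_relations I H"
    unfolding tensor_relations_def multilinearity_relations_def[symmetric] unfolding g by simp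
  show "tensor_group I G = tensor_group I H" unfolding tensor_group_def r g ..
  show "pure_tensor I G x = pure_tensor I H x" unfolding pure_tensor_def r ..
qed

text \<open>
  At a fixed index \<open>t\<close> the local complex of the polyhedral join is a polyhedral join of local complexes,
  where a block with empty \<open>\<omega>\<close> contributes the complex \<open>{{}}\<close>, and all the factors of the diagonal tensor
  product are homology groups of these complexes.
\<close>

locale join_index =
  fixes m :: nat and V :: "nat \<Rightarrow> nat set" and K :: "nat set set" and L :: "nat \<Rightarrow> nat set set"
    and t :: "(nat \<times> nat) set \<times> (nat \<times> nat) set"
  assumes V_finite': "\<And>k. k \<in> {1..m} \<Longrightarrow> finite (V k)"
    and K_complex: "simplicial_complex {1..m} K"
    and L_complex': "\<And>k. k \<in> {1..m} \<Longrightarrow> simplicial_complex (V k) (L k)"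
    and t_index: "t \<in> L_index (Sigma {1..m} V)"
begin

definition I :: "nat set" where "I = {1..m}"
definition s where "s = block_index m L t"
definition W where "W = snd s"
definition D where "D k = snd (block t k)"
definition Y where "Y k = (if k \<in> W then local_complex (L k) (block t k) else {{}})"
definition Ks where "Ks = local_complex K s"
definition full where "full = polyhedral_join m V K L"

lemma V_finite: "k \<in> I \<Longrightarrow> finite (V k)" unfolding I_def by (rule V_finite')

lemma L_complex: "k \<in> I \<Longrightarrow> simplicial_complex (V k) (L k)" unfolding I_def by (rule L_complex')

lemmas L_down = simplicial_complexD(1)[OF L_complex] and L_sub = simplicial_complexD(2)[OF L_complex]
lemmas K_simplicial = simplicial_complexD[OF K_complex]

lemma tX: "t \<in> X_index (Sigma {1..m} V)" by (rule L_index_X_index[OF t_index])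

lemma s_index: "s \<in> L_index {1..m}" unfolding s_def by (rule block_index_L_index[OF t_index])

lemma in_W: "k \<in> W \<longleftrightarrow> k \<in> I \<and> D k \<noteq> {}" by (auto simp: W_def s_def block_index_def I_def D_def)

lemma in_fst_s: "k \<in> fst s \<longleftrightarrow> k \<in> I \<and> D k = {} \<and> fst (block t k) \<notin> L k"
  by (auto simp: s_def block_index_def I_def D_def)

lemma W_nonempty: "W \<noteq> {}" unfolding W_def by (rule L_index_nonempty[OF s_index])

lemma D_V: "D k \<subseteq> V k" and fst_block_V: "fst (block t k) \<subseteq> V k"
  using block_X_index[OF tX, of k] by (simp_all add: X_index_iff D_def)

lemma block_L_index: "k \<in> W \<Longrightarrow> block t k \<in> L_index (V k)"
  using block_X_index[OF tX, of k] by (simp add: in_W L_index_def D_def case_prod_beta)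

lemma snd_t: "snd t = Sigma I D"
proof -
  have "snd t \<subseteq> Sigma {1..m} V" using tX by (simp add: X_index_iff)
  then show ?thesis by (auto simp: I_def D_def block_def)
qed

sublocale block_complexes m I W D Y Ks
proof unfold_locales
  show "I = {1..m}" by (rule I_def)
  show "W \<subseteq> I" by (auto simp: in_W)
  show "finite (D k)" if "k \<in> I" for k by (rule finite_subset[OF D_V V_finite[OF that]])
  show "Y k \<subseteq> Pow (D k)" if "k \<in> I" for k using local_complex_subset[of "L k" "block t k"] by (auto simp: Y_def D_def)
  show "down_closed (Y k)" if "k \<in> I" for k
    using down_closed_local[OF L_down[OF that]] by (auto simp: Y_def down_closed_def)
  show "D k = {} \<and> Y k = {{}}" if "k \<in> I" "k \<notin> W" for k using that by (simp add: Y_def in_W)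
  show "Ks \<subseteq> Pow W" unfolding Ks_def W_def by (rule local_complex_subset)
  show "down_closed Ks" unfolding Ks_def by (rule down_closed_local[OF K_simplicial(1)])
qed

lemma full_complex: "simplicial_complex (Sigma {1..m} V) full"
  unfolding full_def by (rule simplicial_complex_polyhedral_join[OF K_complex L_complex'])

lemma in_full: "S \<in> full \<longleftrightarrow> S \<subseteq> Sigma I V \<and> {k \<in> I. slice S k \<notin> L k} \<in> K"
  unfolding full_def I_def by (rule polyhedral_join_iff[OF K_complex L_complex'])

lemma Z_eq: "Z = local_complex full t"
proof (rule Set.set_eqI)
  fix \<eta>
  have full_down: "down_closed full" by (rule simplicial_complexD(1)[OF full_complex])
  have "fst t \<in> full" if "\<eta> \<union> fst t \<in> full" using full_down that unfolding down_closed_def by blast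
  then have 1: "\<eta> \<in> local_complex full t \<longleftrightarrow> \<eta> \<subseteq> snd t \<and> \<eta> \<union> fst t \<in> full"
    by (auto simp: local_complex_def split: prod.splits)
  have fs: "fst s \<in> K" if "A \<union> fst s \<in> K" for A using that K_simplicial(1) unfolding down_closed_def by blast
  have "\<eta> \<in> Z \<longleftrightarrow> \<eta> \<union> fst t \<in> full" if \<eta>: "\<eta> \<subseteq> Sigma I D"
  proof -
    have tI: "fst t \<subseteq> Sigma I V" using tX by (simp add: X_index_iff I_def)
    have sl: "slice (\<eta> \<union> fst t) k = slice \<eta> k \<union> fst (block t k)" for k by (auto simp: slice_def block_def)
    have sD: "slice \<eta> k \<subseteq> D k" for k using \<eta> by (auto simp: slice_def)
    have face: "slice \<eta> k \<union> fst (block t k) \<in> L k \<longleftrightarrow> slice \<eta> k \<in> Y k" if k: "k \<in> W" for k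
    proof -
      have kI: "k \<in> I" using k W by auto
      have "fst (block t k) \<in> L k" if "slice \<eta> k \<union> fst (block t k) \<in> L k"
        using that L_down[OF kI] unfolding down_closed_def by blast
      then show ?thesis using k sD[of k] by (auto simp: Y_def local_complex_def D_def split: prod.splits)
    qed
    have empty: "slice \<eta> k = {}" if "k \<in> I" "k \<notin> W" for k using sD[of k] that by (auto simp: in_W)
    have "{k \<in> I. slice (\<eta> \<union> fst t) k \<notin> L k} = nonfaces \<eta> \<union> fst s"
    proof (rule Set.set_eqI)
      fix k
      show "k \<in> {k \<in> I. slice (\<eta> \<union> fst t) k \<notin> L k} \<longleftrightarrow> k \<in> nonfaces \<eta> \<union> fst s"
      proof (cases "k \<in> W")
        case True
        then show ?thesis using face[OF True] in_W[of k] in_fst_s[of k] unfolding nonfaces_def sl by blast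
      next
        case False
        then show ?thesis using empty[of k] in_W[of k] in_fst_s[of k] unfolding nonfaces_def sl by (auto simp: Y_def)
      qed
    qed
    moreover have "nonfaces \<eta> \<subseteq> W" using empty unfolding nonfaces_def by (auto simp: Y_def)
    moreover have "\<eta> \<subseteq> Sigma I V" using \<eta> D_V by blast
    moreover have "nonfaces \<eta> \<in> Ks \<longleftrightarrow> nonfaces \<eta> \<subseteq> W \<and> nonfaces \<eta> \<union> fst s \<in> K"
      using fs by (auto simp: Ks_def local_complex_def W_def case_prod_beta)
    ultimately show ?thesis using \<eta> tI unfolding Z_def in_full by simp
  qed
  then show "\<eta> \<in> Z \<longleftrightarrow> \<eta> \<in> local_complex full t" using 1 snd_t Z_sub by auto
qed

definition HF where "HF = hom_factor V K L s t"
definition CF where "CF = cohom_factor V K L s t"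

lemma letter: "k \<in> I \<Longrightarrow> letter_of s k = (if k \<in> W then Ln else if fst (block t k) \<notin> L k then Le else Li)"
  using in_W[of k] in_fst_s[of k] by (auto simp: letter_of_def W_def)

lemma HF_0: "HF 0 = homology Ks" and CF_0: "CF 0 = cohomology Ks"
  by (simp_all add: HF_def CF_def hom_factor_def cohom_factor_def Ks_def)

lemma HF_I: "k \<in> I \<Longrightarrow> HF k = homology (Y k)" and CF_I: "k \<in> I \<Longrightarrow> CF k = cohomology (Y k)"
proof -
  assume k: "k \<in> I"
  then have k0: "k \<noteq> 0" by (auto simp: I_def)
  have b: "block t k = (fst (block t k), D k)" by (simp add: D_def)
  have e: "local_complex (L k) (block t k) = {{}}" if "k \<notin> W" "fst (block t k) \<in> L k"
    using local_complex_empty_index[OF L_down[OF k] that(2)] that(1) k b by (simp add: in_W)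
  have e': "local_complex (Pow (V k)) (block t k) = {{}}" if "k \<notin> W"
    using local_complex_empty_index[OF down_closed_Pow, of "fst (block t k)" "V k"] fst_block_V[of k] that k b by (simp add: in_W)
  have D: "snd (block t k) \<noteq> {} \<longleftrightarrow> k \<in> W" using k by (simp add: in_W D_def)
  show "HF k = homology (Y k)"
    using k0 e e' D letter[OF k] by (auto simp: HF_def hom_factor_def dense_homology_def Y_def)
  show "CF k = cohomology (Y k)"
    using k0 e e' D letter[OF k] by (auto simp: CF_def cohom_factor_def dense_cohomology_def Y_def)
qed

lemma I_cases: "k \<in> {0..m} \<Longrightarrow> (k = 0 \<Longrightarrow> thesis) \<Longrightarrow> (k \<in> I \<Longrightarrow> thesis) \<Longrightarrow> thesis"
  unfolding I_def by (cases "k = 0") (auto simp: Suc_le_eq One_nat_def)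

lemma I_sub: "k \<in> I \<Longrightarrow> k \<in> {0..m}" and zero_notin_I: "0 \<notin> I" by (auto simp: I_def)

lemma Y_finite: "k \<in> I \<Longrightarrow> finite (Y k)" using finite_subset[OF Y_sub] D_finite by simp

lemma Ks_finite: "finite Ks" using finite_subset[OF K_sub] W_finite by simp

lemma Z_finite: "finite Z" using finite_subset[OF Z_sub] D_Sigma_finite by simp

lemmas qh_K = quotient_homology[OF K_down] and qc_K = quotient_cohomology[OF Ks_finite K_down]
lemmas qh_Z = quotient_homology[OF Z_down] and qc_Z = quotient_cohomology[OF Z_finite Z_down]

lemma qh_Y: "k \<in> I \<Longrightarrow> quotient_of (cycles (Y k)) (boundaries (Y k)) (homology (Y k))"
  by (rule quotient_homology[OF Y_down])

lemma qc_Y: "k \<in> I \<Longrightarrow> quotient_of (cocycles (Y k)) (coboundaries (Y k)) (cohomology (Y k))"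
  by (rule quotient_cohomology[OF Y_finite Y_down])

lemma HF_group: "\<forall>k\<in>{0..m}. group (HF k)" and CF_group: "\<forall>k\<in>{0..m}. group (CF k)"
  by (auto elim!: I_cases simp: HF_0 CF_0 HF_I CF_I simp del: atLeastAtMost_iff
      intro: group_quotient[OF qh_K] group_quotient[OF qc_K] group_quotient[OF qh_Y] group_quotient[OF qc_Y])

lemma outside_singleton:
  assumes k: "k \<in> I" "k \<notin> W" and x: "x \<in> carrier (homology (Y k)) \<or> x \<in> carrier (cohomology (Y k))"
  shows "x = {rep x}" "rep x \<in> frags {{}}" "rep (eps n ` x) = rep x"
proof -
  have "Y k = {{}}" using k(2) by (simp add: Y_def)
  then obtain c where c: "c \<in> frags {{}}" "x = coset {0} c"
    using x quotient_ofD(4)[OF qh_Y[OF k(1)]] quotient_ofD(4)[OF qc_Y[OF k(1)]] by (auto simp: empty_simplex_groups)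
  then show "x = {rep x}" "rep x \<in> frags {{}}" by (simp_all add: coset_singleton)
  show "rep (eps n ` x) = rep x" using c frags_empty_simplex(1)[OF c(1)] by (simp add: coset_singleton)
qed

lemma outside_mult:
  assumes k: "k \<in> I" "k \<notin> W"
  shows "x \<in> carrier (homology (Y k)) \<Longrightarrow> y \<in> carrier (homology (Y k)) \<Longrightarrow> rep (x \<otimes>\<^bsub>homology (Y k)\<^esub> y) = rep x + rep y"
    "x \<in> carrier (cohomology (Y k)) \<Longrightarrow> y \<in> carrier (cohomology (Y k)) \<Longrightarrow> rep (x \<otimes>\<^bsub>cohomology (Y k)\<^esub> y) = rep x + rep y"
proof -
  have Y: "Y k = {{}}" using k(2) by (simp add: Y_def)
  show "rep (x \<otimes>\<^bsub>homology (Y k)\<^esub> y) = rep x + rep y" if xy: "x \<in> carrier (homology (Y k))" "y \<in> carrier (homology (Y k))"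
  proof -
    note Q = quotient_ofD[OF qh_Y[OF k(1)], unfolded Y empty_simplex_groups]
    obtain c d where "c \<in> frags {{}}" "d \<in> frags {{}}" "x = coset {0} c" "y = coset {0} d"
      using xy Q(4) unfolding Y by auto
    then show ?thesis unfolding Y by (simp add: Q(6)) (simp add: coset_singleton)
  qed
  show "rep (x \<otimes>\<^bsub>cohomology (Y k)\<^esub> y) = rep x + rep y" if xy: "x \<in> carrier (cohomology (Y k))" "y \<in> carrier (cohomology (Y k))"
  proof -
    note Q = quotient_ofD[OF qc_Y[OF k(1)], unfolded Y empty_simplex_groups]
    obtain c d where "c \<in> frags {{}}" "d \<in> frags {{}}" "x = coset {0} c" "y = coset {0} d"
      using xy Q(4) unfolding Y by auto
    then show ?thesis unfolding Y by (simp add: Q(6)) (simp add: coset_singleton)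
  qed
qed

end

section \<open>The upper isomorphism at one index\<close>

text \<open>
  The conclusion of \<open>splitting\<close> as one predicate, to be chosen for all blocks at once. A block without vertices has
  the single representative \<open>frag_of {}\<close>, which nothing bounds; its \<open>w\<close> is the default \<open>0\<close>.
\<close>

definition block_splitting where
  "block_splitting nonempty D X \<zeta> r b w \<alpha> h \<longleftrightarrow>
     (\<forall>i<r::nat. b i \<in> frags X \<and> boundary (b i) = 0 \<and> w i \<in> frags (Pow D) \<and>
        (nonempty \<longrightarrow> boundary (w i) = b i \<and> w i = \<zeta> (b i))) \<and>
     (\<forall>i. additive_map (\<alpha> i)) \<and>
     (\<forall>i<r. \<forall>j<r. \<alpha> i (b j) = (if i = j then 1 else 0 :: int) \<and> (\<forall>n. \<alpha> i (eps n (w j)) = 0)) \<and>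
     (\<forall>i<r. \<forall>c\<in>frags X. \<alpha> i (boundary c) = 0) \<and>
     additive_map h \<and> (\<forall>c\<in>frags X. h c \<in> frags X) \<and>
     (\<forall>c\<in>frags (Pow D). h c \<in> frags (Pow D) \<and> h (eps 1 c) = - eps 1 (h c) \<and>
        boundary (h c) + h (boundary c) =
          c - ((\<Sum>i<r. frag_cmul (\<alpha> i c) (b i)) + (\<Sum>i<r. frag_cmul (\<alpha> i (boundary c)) (w i))) \<and>
        (\<Sum>i<r. frag_cmul (\<alpha> i (eps 1 c)) (b i)) = eps 1 (\<Sum>i<r. frag_cmul (\<alpha> i c) (b i)) \<and>
        (\<Sum>i<r. frag_cmul (\<alpha> i (eps 1 c)) (w i)) = - eps 1 (\<Sum>i<r. frag_cmul (\<alpha> i c) (w i))) \<and>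
     (\<forall>c\<in>cycles X. \<exists>n. c - (\<Sum>i<r. frag_cmul (n i) (b i)) \<in> boundaries X)"

lemma (in bounded_pair) block_splitting_exists:
  "\<exists>r b w \<alpha> h. block_splitting True D X \<zeta> (r::nat) b w \<alpha> h"
proof (rule splitting)
  fix r :: nat and b w :: "nat \<Rightarrow> 'a set \<Rightarrow>\<^sub>0 int" and \<alpha> h
  assume *: "\<And>i. i < r \<Longrightarrow> w i = \<zeta> (b i)" "\<And>i. i < r \<Longrightarrow> b i = boundary (w i)"
    "\<And>i. i < r \<Longrightarrow> b i \<in> cycles X" "\<And>i. i < r \<Longrightarrow> w i \<in> frags (Pow D)"
    "\<And>c. c \<in> cycles X \<Longrightarrow> \<exists>n. c - (\<Sum>i<r. frag_cmul (n i) (b i)) \<in> boundaries X"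
    "\<And>i. additive_map (\<alpha> i)" "\<And>i j. i < r \<Longrightarrow> j < r \<Longrightarrow> \<alpha> i (b j) = (if i = j then 1 else 0)"
    "\<And>i j n. i < r \<Longrightarrow> j < r \<Longrightarrow> \<alpha> i (eps n (w j)) = 0"
    "\<And>i c. i < r \<Longrightarrow> c \<in> frags X \<Longrightarrow> \<alpha> i (boundary c) = 0"
    "additive_map h" "\<And>c. c \<in> frags X \<Longrightarrow> h c \<in> frags X" "\<And>c. c \<in> frags (Pow D) \<Longrightarrow> h c \<in> frags (Pow D)"
    "\<And>c. c \<in> frags (Pow D) \<Longrightarrow> h (eps 1 c) = - eps 1 (h c)"
    "\<And>c. c \<in> frags (Pow D) \<Longrightarrow> boundary (h c) + h (boundary c) =
       c - ((\<Sum>i<r. frag_cmul (\<alpha> i c) (b i)) + (\<Sum>i<r. frag_cmul (\<alpha> i (boundary c)) (w i)))"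
    "\<And>c. c \<in> frags (Pow D) \<Longrightarrow> (\<Sum>i<r. frag_cmul (\<alpha> i (eps 1 c)) (b i)) = eps 1 (\<Sum>i<r. frag_cmul (\<alpha> i c) (b i))"
    "\<And>c. c \<in> frags (Pow D) \<Longrightarrow> (\<Sum>i<r. frag_cmul (\<alpha> i (eps 1 c)) (w i)) = - eps 1 (\<Sum>i<r. frag_cmul (\<alpha> i c) (w i))"
  have "\<And>i. i < r \<Longrightarrow> b i \<in> frags X \<and> boundary (b i) = 0" using *(3) by (simp add: cycles_def)
  moreover have "\<And>i. i < r \<Longrightarrow> boundary (w i) = b i" by (rule *(2)[symmetric])
  ultimately have "block_splitting True D X \<zeta> r b w \<alpha> h"
    unfolding block_splitting_def
    by (intro conjI allI ballI impI *) blast+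
  then show ?thesis by blast
qed

lemma block_splitting_empty:
  "block_splitting False {} {{} :: 'a::linorder set} \<zeta> 1 (\<lambda>_. frag_of {}) (\<lambda>_. 0) (\<lambda>_ c. Poly_Mapping.lookup c {}) (\<lambda>_. 0)"
proof -
  have c: "frag_cmul (Poly_Mapping.lookup c {}) (frag_of {}) = c" if "c \<in> frags {{}}" for c :: "'a set \<Rightarrow>\<^sub>0 int"
    by (rule additive_map_eqI[OF _ _ _ that, where g = "\<lambda>c. frag_cmul (Poly_Mapping.lookup c {}) (frag_of {})" and h = "\<lambda>c. c"])
       (auto simp: additive_map_def lookup_add frag_cmul_distrib)
  have [simp]: "{..<1::nat} = {0}" by auto
  have "\<exists>n::nat \<Rightarrow> int. c - frag_cmul (n 0) (frag_of {}) \<in> boundaries {{}}" if "c \<in> cycles {{}}" for c :: "'a set \<Rightarrow>\<^sub>0 int"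
    by (rule exI[of _ "\<lambda>_. Poly_Mapping.lookup c {}"]) (use that in \<open>simp add: c cycles_def empty_simplex_groups\<close>)
  then show ?thesis
    unfolding block_splitting_def
    by (simp add: c frags_empty_simplex graded_sign_simps fragsD(1) boundary_frag_of empty_simplex_groups additive_map_def lookup_add)
qed

locale bounded_index = join_index m V K L t
  for m V K L t +
  fixes z :: "nat \<Rightarrow> nat set \<times> nat set \<Rightarrow> (nat set \<Rightarrow>\<^sub>0 int) set \<Rightarrow> (nat set \<Rightarrow>\<^sub>0 int)"
  assumes z': "\<And>k u. k \<in> {1..m} \<Longrightarrow> u \<in> L_index (V k) \<Longrightarrow> bounding_choice (L k) u (z k u)"
begin

abbreviation generators where "generators \<equiv> tensor_generators {0..m} HF"

lemma Y_W: "k \<in> W \<Longrightarrow> Y k = local_complex (L k) (block t k)" by (simp add: Y_def)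

lemma W_I: "k \<in> W \<Longrightarrow> k \<in> I" using W by auto

lemma z_choice: "k \<in> W \<Longrightarrow> bounding_choice (L k) (block t k) (z k (block t k))"
  using z'[of k "block t k"] block_L_index[of k] W_I[of k] by (simp add: I_def)

lemmas zD = bounding_choiceD[OF z_choice Y_W L_down[OF W_I] D_def D_finite[OF W_I]]

lemma generators_0: "x \<in> generators \<Longrightarrow> x 0 \<in> carrier (homology Ks)"
  by (auto simp: PiE_iff HF_0 dest: bspec[where x = 0])

lemma generators_I: "x \<in> generators \<Longrightarrow> k \<in> I \<Longrightarrow> x k \<in> carrier (homology (Y k))"
  using I_sub[of k] by (auto simp: PiE_iff HF_I[symmetric])

definition wz where "wz x k = z k (block t k) (x k)"
definition bz where "bz x k = (if k \<in> W then boundary (wz x k) else rep (x k))"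

lemma wz_data:
  assumes "x \<in> generators" shows "block_data (wz x) (bz x)"
  unfolding block_data_def
proof (intro conjI ballI)
  fix k assume k: "k \<in> W"
  note xk = generators_I[OF assms W_I[OF k]]
  show "wz x k \<in> frags (Pow (D k))" unfolding wz_def by (rule zD(1)[OF k k k k xk])
  show "boundary (wz x k) = bz x k" using k by (simp add: bz_def)
next
  fix k assume k: "k \<in> I"
  note xk = generators_I[OF assms k]
  have "bz x k \<in> frags (Y k) \<and> boundary (bz x k) = 0"
  proof (cases "k \<in> W")
    case True
    have "boundary (wz x k) \<in> cycles (Y k)" unfolding wz_def
      by (rule quotient_mem(1)[OF qh_Y[OF k] xk zD(2)[OF True True True True xk]])
    then show ?thesis using True by (simp add: bz_def cycles_def)
  next
    case False
    then have "bz x k \<in> frags {{}}" using outside_singleton(2)[OF k False] xk by (simp add: bz_def)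
    then show ?thesis using False frags_empty_simplex(3) by (simp add: Y_def)
  qed
  then show "bz x k \<in> frags (Y k)" "boundary (bz x k) = 0" by auto
qed

text \<open>
  The degree sign acts on classes in \<open>upper_chain\<close> and on chains in \<open>block_chain\<close>; the choice of bounding chains
  commutes with it up to the sign of the letter \<open>n-bar\<close>.
\<close>

lemma upper_chain_eq:
  assumes x: "x \<in> generators" and c: "c \<in> frags (Pow W)"
  shows "frag_extend (upper_chain m z t x) c = block_chain I (wz x) (bz x) c"
proof (rule additive_map_eqI[OF _ _ _ c, where g = "frag_extend (upper_chain m z t x)" and h = "block_chain I (wz x) (bz x)"])
  fix \<tau> assume "\<tau> \<in> Pow W"
  then have \<tau>: "\<tau> \<subseteq> W" by simp
  have "upper_chain m z t x \<tau> = block_chain I (wz x) (bz x) (frag_of \<tau>)"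
    unfolding upper_chain_def block_chain_of I_def[symmetric] Let_def later_def[symmetric] D_def[symmetric]
  proof (rule join_chain_cong)
    fix k assume k: "k \<in> I"
    note xk = generators_I[OF x k]
    let ?n = "later \<tau> k"
    show "(if D k = {} then rep (eps ?n ` x k) else if k \<in> \<tau> then z k (block t k) (eps ?n ` x k) else boundary (z k (block t k) (eps ?n ` x k)))
      = (if k \<in> \<tau> then frag_cmul ((-1) ^ ?n) (eps ?n (wz x k)) else eps ?n (bz x k))"
    proof (cases "k \<in> W")
      case True
      have "z k (block t k) (eps ?n ` x k) = frag_cmul ((-1) ^ ?n) (eps ?n (wz x k))"
        unfolding wz_def by (rule zD(4)[OF True True True True xk])
      then show ?thesis using True by (simp add: in_W bz_def boundary_simps boundary_eps minus_one_power_cancel flip: power_mult_distrib)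
    next
      case False
      then have "D k = {}" "k \<notin> \<tau>" using k \<tau> by (auto simp: in_W)
      moreover have "rep (eps ?n ` x k) = eps ?n (rep (x k))"
        using outside_singleton(2,3)[OF k False, of "x k"] xk frags_empty_simplex(1) by metis
      ultimately show ?thesis using False by (simp add: bz_def)
    qed
  qed simp
  then show "frag_extend (upper_chain m z t x) (frag_of \<tau>) = block_chain I (wz x) (bz x) (frag_of \<tau>)" by simp
qed simp_all

definition upper_cycle where "upper_cycle x = block_chain I (wz x) (bz x) (rep (x 0))"

lemma rep_0: "x \<in> generators \<Longrightarrow> rep (x 0) \<in> cycles Ks" "x \<in> generators \<Longrightarrow> rep (x 0) \<in> frags (Pow W)"
  using quotient_rep(1)[OF qh_K generators_0] frags_mono[OF K_sub] by (auto simp: cycles_def)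

lemma upper_cycle_cycles: "x \<in> generators \<Longrightarrow> upper_cycle x \<in> cycles Z"
  unfolding upper_cycle_def
  using block_data_Z[OF wz_data, of x "rep (x 0)"] block_data_boundary[OF wz_data rep_0(2), of x x] rep_0(1)[of x]
  by (simp add: cycles_def block_chain_simps)

lemma HF_upd: "x \<in> generators \<Longrightarrow> i \<in> {0..m} \<Longrightarrow> y \<in> carrier (HF i) \<Longrightarrow> x(i := y) \<in> generators"
  by (rule PiE_upd[where A = "\<lambda>i. carrier (HF i)"])

lemma wz_upd: "wz (x(k := y)) = (wz x)(k := z k (block t k) y)"
  by (auto simp: wz_def)

lemma bz_upd: "bz (x(k := y)) = (bz x)(k := if k \<in> W then boundary (z k (block t k) y) else rep y)"
  by (auto simp: bz_def wz_def)

text \<open>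
  Multilinearity is strict in the blocks, where the representatives are additive; in slot 0 the representative
  of a sum is the sum of representatives only up to a boundary.
\<close>

lemma upper_cycle_multilinear:
  assumes x: "x \<in> generators" and i: "i \<in> {0..m}" and y: "y \<in> carrier (HF i)" "y' \<in> carrier (HF i)"
  shows "upper_cycle (x(i := y \<otimes>\<^bsub>HF i\<^esub> y')) - upper_cycle (x(i := y)) - upper_cycle (x(i := y')) \<in> boundaries Z"
proof (rule I_cases[OF i])
  assume i0: "i = 0"
  have same: "wz (x(0 := u)) = (wz x)(0 := wz (x(0 := u)) 0)" "bz (x(0 := u)) = (bz x)(0 := bz (x(0 := u)) 0)" for u
    by (auto simp: wz_def bz_def)
  have cong: "block_chain I (wz (x(0 := u))) (bz (x(0 := u))) c = block_chain I (wz x) (bz x) c" if "c \<in> frags (Pow W)" for u c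
    by (rule block_chain_cong[OF _ _ that]) (use zero_notin_I W_I in \<open>auto simp: wz_def bz_def\<close>)
  have y': "y \<in> carrier (homology Ks)" "y' \<in> carrier (homology Ks)" using y by (simp_all add: i0 HF_0)
  note Q = quotient_ofD[OF qh_K]
  have yy: "y \<otimes>\<^bsub>homology Ks\<^esub> y' \<in> carrier (homology Ks)"
    using group_quotient[OF qh_K] y' by (simp add: group.is_monoid monoid.m_closed)
  have r: "rep u \<in> cycles Ks" "rep u \<in> frags (Pow W)" if "u \<in> carrier (homology Ks)" for u
    using quotient_rep(1)[OF qh_K that] frags_mono[OF K_sub] by (auto simp: cycles_def)
  have "y \<otimes>\<^bsub>homology Ks\<^esub> y' = coset (boundaries Ks) (rep y + rep y')"
    using Q(6)[OF r(1)[OF y'(1)] r(1)[OF y'(2)]] quotient_rep(2)[OF qh_K y'(1)] quotient_rep(2)[OF qh_K y'(2)] by simp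
  then have "rep (y \<otimes>\<^bsub>homology Ks\<^esub> y') - (rep y + rep y') \<in> boundaries Ks"
    using rep_coset[OF Q(2), of "rep y + rep y'"] by simp
  then obtain d where d: "d \<in> frags Ks" "rep (y \<otimes>\<^bsub>homology Ks\<^esub> y') - rep y - rep y' = boundary d"
    by (auto simp: boundaries_eq diff_diff_eq)
  have "upper_cycle (x(i := y \<otimes>\<^bsub>HF i\<^esub> y')) - upper_cycle (x(i := y)) - upper_cycle (x(i := y')) =
     block_chain I (wz x) (bz x) (rep (y \<otimes>\<^bsub>homology Ks\<^esub> y') - rep y - rep y')"
    unfolding upper_cycle_def i0 HF_0 using r(2)[OF yy] r(2)[OF y'(1)] r(2)[OF y'(2)]
    by (simp add: cong block_chain_simps)
  also have "\<dots> = boundary (block_chain I (wz x) (bz x) d)"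
    unfolding d(2) by (rule block_data_boundary[OF wz_data[OF x] frags_mono[OF K_sub d(1)], symmetric])
  finally show ?thesis using block_data_Z[OF wz_data[OF x] d(1)] by (auto simp: boundaries_eq)
next
  assume k: "i \<in> I"
  then have i0: "i \<noteq> 0" using zero_notin_I by metis
  have yi: "y \<in> carrier (homology (Y i))" "y' \<in> carrier (homology (Y i))" using y by (simp_all add: HF_I[OF k])
  let ?y = "y \<otimes>\<^bsub>homology (Y i)\<^esub> y'"
  let ?p = "\<lambda>u. if i \<in> W then boundary (z i (block t i) u) else rep u"
  have "block_chain I ((wz x)(i := z i (block t i) ?y)) ((bz x)(i := ?p ?y)) (rep (x 0)) =
    block_chain I ((wz x)(i := z i (block t i) y + z i (block t i) y')) ((bz x)(i := ?p y + ?p y')) (rep (x 0))"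
  proof (rule block_chain_cong[OF _ _ rep_0(2)[OF x]])
    show "((wz x)(i := z i (block t i) ?y)) k = ((wz x)(i := z i (block t i) y + z i (block t i) y')) k" if "k \<in> W" for k
      using that zD(3)[of i y y'] yi by (cases "k = i") simp_all
    show "((bz x)(i := ?p ?y)) k' = ((bz x)(i := ?p y + ?p y')) k'" if "k' \<in> I" for k'
      using zD(3)[of i y y'] yi outside_mult(1)[OF k _ yi] by (cases "k' = i") (auto simp: boundary_simps)
  qed
  also have "\<dots> = block_chain I ((wz x)(i := z i (block t i) y)) ((bz x)(i := ?p y)) (rep (x 0))
     + block_chain I ((wz x)(i := z i (block t i) y')) ((bz x)(i := ?p y')) (rep (x 0))"
    by (rule block_chain_slot[OF I_finite k])
  finally have "upper_cycle (x(i := y \<otimes>\<^bsub>HF i\<^esub> y')) = upper_cycle (x(i := y)) + upper_cycle (x(i := y'))"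
    unfolding upper_cycle_def wz_upd bz_upd HF_I[OF k] fun_upd_other[OF i0[symmetric]] .
  then show ?thesis by (simp add: additive_subsetD(1)[OF additive_subset_boundaries])
qed

lemma upper_local_eq: "upper_local m V K L z t = class_map (boundaries Z) (frag_extend (\<lambda>x. frag_extend (upper_chain m z t x) (rep (x 0))))"
  by (simp add: upper_local_def Z_eq full_def)

lemma upper_local_hom: "upper_local m V K L z t \<in> hom (tensor_group {0..m} HF) (homology Z)"
  and upper_local_pure: "x \<in> generators \<Longrightarrow> upper_local m V K L z t (pure_tensor {0..m} HF x) = coset (boundaries Z) (upper_cycle x)"
proof -
  have e: "frag_extend (upper_chain m z t x) (rep (x 0)) = upper_cycle x" if "x \<in> generators" for x
    unfolding upper_cycle_def by (rule upper_chain_eq[OF that rep_0(2)[OF that]])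
  have 1: "frag_extend (upper_chain m z t x) (rep (x 0)) \<in> cycles Z" if "x \<in> generators" for x
    unfolding e[OF that] by (rule upper_cycle_cycles[OF that])
  have 2: "frag_extend (upper_chain m z t (x(i := y \<otimes>\<^bsub>HF i\<^esub> y'))) (rep ((x(i := y \<otimes>\<^bsub>HF i\<^esub> y')) 0))
     - frag_extend (upper_chain m z t (x(i := y))) (rep ((x(i := y)) 0)) - frag_extend (upper_chain m z t (x(i := y'))) (rep ((x(i := y')) 0)) \<in> boundaries Z"
    if x: "x \<in> generators" "i \<in> {0..m}" "y \<in> carrier (HF i)" "y' \<in> carrier (HF i)" for x i y y'
  proof -
    have "y \<otimes>\<^bsub>HF i\<^esub> y' \<in> carrier (HF i)" using bspec[OF HF_group x(2)] x(3,4) by (simp add: group.is_monoid monoid.m_closed)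
    then show ?thesis
      unfolding e[OF HF_upd[OF x(1,2)]] e[OF HF_upd[OF x(1,2,3)]] e[OF HF_upd[OF x(1,2,4)]]
      by (simp only: e[OF HF_upd[OF x(1,2)]] upper_cycle_multilinear[OF x])
  qed
  note u = tensor_universal[OF HF_group qh_Z, of "\<lambda>x. frag_extend (upper_chain m z t x) (rep (x 0))", OF 1 2]
  show "upper_local m V K L z t \<in> hom (tensor_group {0..m} HF) (homology Z)"
    unfolding upper_local_eq by (rule u(1))
  show "upper_local m V K L z t (pure_tensor {0..m} HF x) = coset (boundaries Z) (upper_cycle x)" if "x \<in> generators"
    unfolding upper_local_eq by (simp only: u(2) e[OF that])
qed

text \<open>
  The bases of the splittings are made of the representatives chosen by \<open>z\<close>, so on basis tensors the map is
  substitution into the block chains \<open>\<Phi> j\<close>.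
\<close>

lemma upper_local_iso: "upper_local m V K L z t \<in> iso (tensor_group {0..m} HF) (homology Z)"
proof -
  let ?\<zeta> = "\<lambda>k c. z k (block t k) (coset (boundaries (Y k)) c)"
  have ex: "\<exists>r b w \<alpha> h. block_splitting (k \<in> W) (D k) (Y k) (?\<zeta> k) (r::nat) b w \<alpha> h" if k: "k \<in> I" for k
  proof (cases "k \<in> W")
    case True
    have "D k \<noteq> {}" using True by (simp add: in_W)
    then interpret bounded_pair "D k" "Y k" "?\<zeta> k"
      by (rule bounding_choice_bounded_pair[OF z_choice[OF True] Y_W[OF True] L_down[OF k] D_def D_finite[OF k]])
    show ?thesis using block_splitting_exists True by simp
  next
    case False
    then have e: "D k = {}" "Y k = {{}}" using outside[OF k False] by (simp_all add: Y_def)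
    show ?thesis unfolding e using block_splitting_empty[of "?\<zeta> k"] False by (simp only: e simp_thms) blast
  qed
  define P where "P k S = (case S of (r, b, w, \<alpha>, h) \<Rightarrow> block_splitting (k \<in> W) (D k) (Y k) (?\<zeta> k) (r::nat) b w \<alpha> h)" for k S
  define S where "S k = (SOME S. P k S)" for k
  have "\<exists>S. P k S" if "k \<in> I" for k
    using ex[OF that] by (elim exE) (rule exI[of _ "(_, _, _, _, _)"], simp add: P_def)
  then have P: "P k (S k)" if "k \<in> I" for k unfolding S_def using that by (blast intro: someI_ex)
  define r where "r k = fst (S k)" for k
  define b where "b k = fst (snd (S k))" for k
  define w where "w k = fst (snd (snd (S k)))" for k
  define \<alpha> where "\<alpha> k = fst (snd (snd (snd (S k))))" for k
  define h where "h k = snd (snd (snd (snd (S k))))" for k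
  have S: "block_splitting (k \<in> W) (D k) (Y k) (?\<zeta> k) (r k) (b k) (w k) (\<alpha> k) (h k)" if "k \<in> I" for k
    using P[OF that] by (simp add: P_def r_def b_def w_def \<alpha>_def h_def case_prod_beta)
  note S' = S[unfolded block_splitting_def]
  interpret kg: kunneth_groups m I W D Y Ks r b w \<alpha> h
  proof unfold_locales
    show "boundary (w k i) = b k i" if "k \<in> W" "i < r k" for k i using S'[OF W_I[OF that(1)]] that by blast
  qed (use S' in blast)+
  have G: "kg.G k = HF k" if "k \<in> {0..m}" for k
    using that by (rule I_cases) (simp_all add: kg.G_0 HF_0 kg.G_I HF_I)
  have cong: "tensor_group {0..m} kg.G = tensor_group {0..m} HF"
    "pure_tensor {0..m} kg.G x = pure_tensor {0..m} HF x" "tensor_generators {0..m} kg.G = generators" for x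
    by (rule tensor_group_cong[OF G]; assumption)+
  have "upper_local m V K L z t \<in> iso (tensor_group {0..m} kg.G) (homology Z)"
  proof (rule kg.kunneth_iso)
    show "upper_local m V K L z t \<in> hom (tensor_group {0..m} kg.G) (homology Z)"
      unfolding cong(1) by (rule upper_local_hom)
    fix g j assume g: "g \<in> carrier (homology Ks)" and j: "j \<in> kg.J"
    have x: "kg.basis_tensor g j \<in> generators" using kg.basis_tensor_in[OF g j] unfolding cong(3) .
    have bt: "kg.basis_tensor g j k = coset (boundaries (Y k)) (b k (j k))" if "k \<in> I" for k
      using I_sub[OF that] that zero_notin_I by (auto simp: kg.basis_tensor_def kg.basis_class_def)
    have wb: "wz (kg.basis_tensor g j) k = w k (j k)" if "k \<in> W" for k
    proof -
      have "w k (j k) = ?\<zeta> k (b k (j k))" using S'[OF W_I[OF that]] that kg.J_less[OF j W_I[OF that]] by blast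
      then show ?thesis by (simp add: wz_def bt[OF W_I[OF that]])
    qed
    have bb: "bz (kg.basis_tensor g j) k = b k (j k)" if k: "k \<in> I" for k
    proof (cases "k \<in> W")
      case True
      then show ?thesis using wb[OF True] kg.w_b[OF True kg.J_less[OF j k]] by (simp add: bz_def)
    next
      case False
      then show ?thesis using bt[OF k] by (simp add: bz_def Y_def empty_simplex_groups coset_singleton)
    qed
    have g0: "kg.basis_tensor g j 0 = g" by (simp add: kg.basis_tensor_def)
    have "upper_cycle (kg.basis_tensor g j) = kg.\<Phi> j (rep g)"
      unfolding upper_cycle_def kg.\<Phi>_def g0
      by (rule block_chain_cong) (use wb bb rep_0(2)[OF x] g0 in auto)
    then show "upper_local m V K L z t (pure_tensor {0..m} kg.G (kg.basis_tensor g j)) = coset (boundaries Z) (kg.\<Phi> j (rep g))"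
      unfolding cong(2) upper_local_pure[OF x] by simp
  qed
  then show ?thesis unfolding cong(1) .
qed

end

section \<open>Duality at one index\<close>

lemma (in simplex_pair) cocycle_complement:
  assumes "g \<in> cocycles (dual_complex D X)"
  obtains w where "w \<in> relative_cycles (Pow D) X" "complement_map D X w = g"
proof -
  have g: "g \<in> frags (dual_complex D X)" "coboundary (dual_complex D X) g = 0" using assms by (auto simp: cocycles_def)
  obtain w where w: "w \<in> frags (Pow D)" "complement_map D X w = g" by (rule complement_map_surj[OF fin g(1)])
  have "complement_map D X (boundary w) = 0"
    using coboundary_complement_map[OF fin down w(1)] g(2) w(2) by simp
  then have "boundary w \<in> frags X" by (rule complement_map_eq_0[OF fin boundary_frags[OF down_closed_Pow w(1)]])
  then show thesis using that w by (simp add: relative_cycles_def)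
qed

lemma complement_map_frags: "c \<in> frags (Pow D) \<Longrightarrow> complement_map D X c \<in> frags (dual_complex D X)"
  by (simp only: complement_map_eq_restrict[of c D X] cochain_restrict_frags)

lemma (in block_complexes) block_data_Pow:
  assumes wb: "block_data w b" and c: "c \<in> frags (Pow W)"
  shows "block_chain I w b c \<in> frags (Pow (Sigma I D))"
proof (rule additive_map_into[OF additive_map_block_chain additive_subset_frags _ c])
  fix \<tau> assume "\<tau> \<in> Pow W"
  then have "\<tau> \<subseteq> W" by simp
  then show "block_chain I w b (frag_of \<tau>) \<in> frags (Pow (Sigma I D))"
    unfolding block_chain_of using block_dataD[OF wb]
    by (intro join_chain_in_frags[where S = "\<lambda>k. Pow (D k)"]) (auto simp: subset_iff intro: frags_cmul graded_sign_frags)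
qed

lemma (in block_complexes) block_data_relative:
  assumes wb: "block_data w b" and c: "c \<in> relative_cycles (Pow W) K"
  shows "block_chain I w b c \<in> relative_cycles (Pow (Sigma I D)) Z"
  using c block_data_Pow[OF wb] block_data_Z[OF wb] block_data_boundary[OF wb] by (simp add: relative_cycles_def)

lemma shifted_sign_hom:
  assumes "down_closed X"
  shows "(\<lambda>x. graded_sign n (\<lambda>\<tau>. card \<tau> + 1) ` x) \<in> hom (homology X) (homology X)"
    "(\<lambda>x. graded_sign n (\<lambda>\<tau>. card \<tau> + 1) ` x) ` carrier (homology X) = carrier (homology X)"
proof -
  note q = quotient_homology[OF assms] note Q = quotient_ofD[OF q]
  let ?g = "\<lambda>c :: 'a set \<Rightarrow>\<^sub>0 int. frag_cmul ((-1) ^ n) (eps n c)"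
  let ?s = "\<lambda>x. graded_sign n (\<lambda>\<tau>. card \<tau> + 1) ` x"
  have g: "?g c \<in> cycles X" if "c \<in> cycles X" for c
    using that by (auto simp: cycles_def boundary_simps boundary_eps graded_sign_simps intro!: frags_cmul graded_sign_frags)
  have s: "?s (coset (boundaries X) c) = coset (boundaries X) (?g c)" for c by (rule shifted_sign_coset)
  have add: "?g (c + d) = ?g c + ?g d" for c d by (simp add: additive_dist)
  have in': "?s x \<in> carrier (homology X)" if "x \<in> carrier (homology X)" for x
    using that g by (auto simp: Q(4) s)
  show "?s \<in> hom (homology X) (homology X)"
  proof (rule homI[OF in'])
    fix x y assume "x \<in> carrier (homology X)" "y \<in> carrier (homology X)"
    then obtain c d where "c \<in> cycles X" "d \<in> cycles X" "x = coset (boundaries X) c" "y = coset (boundaries X) d"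
      by (auto simp: Q(4))
    then show "?s (x \<otimes>\<^bsub>homology X\<^esub> y) = ?s x \<otimes>\<^bsub>homology X\<^esub> ?s y" by (simp only: Q(6) s g add)
  qed
  have "?s (?s x) = x" for x :: "('a set \<Rightarrow>\<^sub>0 int) set"
    by (simp add: image_image graded_sign_comp graded_sign_even)
  then show "?s ` carrier (homology X) = carrier (homology X)" using in' by (metis (no_types, lifting) image_eqI image_subsetI subsetI subset_antisym)
qed

text \<open>
  The dual index \<open>t'\<close> has the same blocks and the same \<open>\<omega>\<close>; all complexes are replaced by their duals, so the
  groups of the lower row are again those of a \<open>join_index\<close>.
\<close>

locale duality_index = bounded_index m V K L t z for m V K L t z +
  fixes f :: "nat \<Rightarrow> nat set \<times> nat set \<Rightarrow> (nat set \<Rightarrow>\<^sub>0 int) set \<Rightarrow> (nat set \<Rightarrow>\<^sub>0 int)"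
  assumes f': "\<And>k u. k \<in> {1..m} \<Longrightarrow> u \<in> L_index (V k) \<Longrightarrow> extension_choice (dual_complex (V k) (L k)) u (f k u)"
begin

abbreviation t' where "t' \<equiv> opposite (Sigma {1..m} V) t"
abbreviation K' where "K' \<equiv> dual_complex {1..m} K"
abbreviation L' where "L' \<equiv> \<lambda>k. dual_complex (V k) (L k)"

sublocale dual: join_index m V K' L' t'
proof unfold_locales
  show "simplicial_complex {1..m} K'" by (rule simplicial_complex_dual[OF K_complex])
  show "simplicial_complex (V k) (L' k)" if "k \<in> {1..m}" for k by (rule simplicial_complex_dual[OF L_complex'[OF that]])
  show "t' \<in> L_index (Sigma {1..m} V)" by (rule opposite_L_index[OF t_index])
qed (rule V_finite')

lemma sX: "s \<in> X_index {1..m}" by (rule L_index_X_index[OF s_index])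

lemma dual_s: "dual.s = opposite {1..m} s"
  by (simp add: dual.s_def s_def block_index_opposite[OF tX])

lemma dual_W: "dual.W = W" by (simp add: dual.W_def W_def dual_s)

lemma dual_D: "dual.D = D" by (rule ext) (simp add: dual.D_def D_def block_def)

lemma block_t': "k \<in> I \<Longrightarrow> block t' k = opposite (V k) (block t k)"
  unfolding I_def by (rule block_opposite[OF tX])

lemma dual_Y_W: "k \<in> W \<Longrightarrow> dual.Y k = local_complex (L' k) (block t' k)"
  by (simp add: dual.Y_def dual_W)

lemma dual_Y: "k \<in> W \<Longrightarrow> dual.Y k = dual_complex (D k) (Y k)"
  unfolding dual_Y_W block_t'[OF W_I] local_dual[OF L_down[OF W_I] block_X_index[OF tX]] Y_W D_def ..

lemma dual_Y_outside: "k \<notin> W \<Longrightarrow> dual.Y k = {{}}" "k \<notin> W \<Longrightarrow> Y k = {{}}"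
  by (simp_all add: dual.Y_def dual_W Y_def)

lemma dual_Ks: "dual.Ks = dual_complex W Ks"
  unfolding dual.Ks_def dual_s Ks_def W_def by (rule local_dual[OF K_simplicial(1) sX])

lemma dual_Z: "dual.Z = dual_complex (Sigma I D) Z"
proof -
  have "dual.full = dual_complex (Sigma {1..m} V) full"
    unfolding dual.full_def full_def by (rule dual_polyhedral_join[OF K_complex L_complex'])
  then show ?thesis
    unfolding dual.Z_eq Z_eq
    using local_dual[OF simplicial_complexD(1)[OF full_complex] tX] by (simp add: snd_t)
qed

lemma pair_Y: "k \<in> W \<Longrightarrow> simplex_pair (D k) (Y k)"
  using in_W[of k] D_finite[OF W_I] Y_down[OF W_I] Y_sub[OF W_I] by unfold_locales auto

lemma pair_Z: "simplex_pair (Sigma I D) Z"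
  using L_index_nonempty[OF t_index] D_Sigma_finite Z_down Z_sub by unfold_locales (auto simp: snd_t)

sublocale pair_K: simplex_pair W Ks
  using W_nonempty W_finite K_down K_sub by unfold_locales auto

sublocale pair_Z: simplex_pair "Sigma I D" Z by (rule pair_Z)

abbreviation cogenerators where "cogenerators \<equiv> tensor_generators {0..m} dual.CF"

lemma cogenerators_0: "y \<in> cogenerators \<Longrightarrow> y 0 \<in> carrier (cohomology dual.Ks)"
  by (auto simp: PiE_iff dual.CF_0 dest: bspec[where x = 0])

lemma cogenerators_I: "y \<in> cogenerators \<Longrightarrow> k \<in> I \<Longrightarrow> y k \<in> carrier (cohomology (dual.Y k))"
  using I_sub[of k] by (auto simp: PiE_iff dual.CF_I[symmetric])

lemma f_choice: "k \<in> W \<Longrightarrow> extension_choice (L' k) (block t' k) (f k (block t' k))"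
  using f'[of k "block t' k"] dual.block_L_index[of k] W_I[of k] by (simp add: I_def dual_W)

lemma fD:
  assumes k: "k \<in> W" and y: "y \<in> carrier (cohomology (dual.Y k))"
  shows "f k (block t' k) y \<in> frags (Pow (D k))" "cochain_restrict (dual.Y k) (f k (block t' k) y) \<in> y"
    "y' \<in> carrier (cohomology (dual.Y k)) \<Longrightarrow> f k (block t' k) (y \<otimes>\<^bsub>cohomology (dual.Y k)\<^esub> y') = f k (block t' k) y + f k (block t' k) y'"
    "f k (block t' k) (eps n ` y) = eps n (f k (block t' k) y)"
proof -
  have D: "D k = snd (block t' k)" by (simp add: dual.D_def[symmetric] dual_D)
  note e = extension_choiceD[OF f_choice[OF k] dual_Y_W[OF k] dual.L_down[OF W_I[OF k]] D D_finite[OF W_I[OF k]]]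
  show "f k (block t' k) y \<in> frags (Pow (D k))" "cochain_restrict (dual.Y k) (f k (block t' k) y) \<in> y"
    "f k (block t' k) (eps n ` y) = eps n (f k (block t' k) y)"
    by (rule e(1)[OF y] e(2)[OF y] e(4)[OF y])+
  show "f k (block t' k) (y \<otimes>\<^bsub>cohomology (dual.Y k)\<^esub> y') = f k (block t' k) y + f k (block t' k) y'"
    if "y' \<in> carrier (cohomology (dual.Y k))" by (rule e(3)[OF y that])
qed

definition fy where "fy y k = (if k \<in> W then f k (block t' k) (y k) else rep (y k))"

lemma lower_cochain_eq:
  assumes y: "y \<in> cogenerators" and c: "c \<in> frags (Pow W)"
  shows "frag_extend (lower_cochain m f t' y) c = block_cochain I D (fy y) c"
proof (rule additive_map_eqI[OF _ _ _ c, where g = "frag_extend (lower_cochain m f t' y)" and h = "block_cochain I D (fy y)"])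
  fix \<tau> assume "\<tau> \<in> Pow W"
  then have \<tau>: "\<tau> \<subseteq> W" by simp
  have "lower_cochain m f t' y \<tau> = block_cochain I D (fy y) (frag_of \<tau>)"
    unfolding lower_cochain_def block_cochain_of I_def Let_def later_def[symmetric] dual.D_def[symmetric] dual_D
  proof (rule join_chain_cong)
    fix k assume "k \<in> {1..m}"
    then have k: "k \<in> I" unfolding I_def .
    note yk = cogenerators_I[OF y k]
    let ?n = "later \<tau> k"
    show "(if D k = {} then rep (eps ?n ` y k) else if k \<in> \<tau> then coboundary (Pow (D k)) (f k (block t' k) (eps ?n ` y k)) else f k (block t' k) (eps ?n ` y k))
      = (if k \<in> \<tau> then coboundary (Pow (D k)) (eps ?n (fy y k)) else eps ?n (fy y k))"
    proof (cases "k \<in> W")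
      case True
      then show ?thesis using fD(4)[OF True yk, of ?n] by (simp add: in_W fy_def)
    next
      case False
      then have "D k = {}" "k \<notin> \<tau>" using k \<tau> by (auto simp: in_W)
      moreover have "rep (eps ?n ` y k) = eps ?n (rep (y k))"
        using dual.outside_singleton(2,3)[of k "y k"] k False yk frags_empty_simplex(1) unfolding dual_W by metis
      ultimately show ?thesis using False by (simp add: fy_def)
    qed
  qed simp
  then show "frag_extend (lower_cochain m f t' y) (frag_of \<tau>) = block_cochain I D (fy y) (frag_of \<tau>)" by simp
qed simp_all

abbreviation Gd where "Gd k \<equiv> gamma_degree_before s t k"

text \<open>
  Each block before \<open>k\<close> contributes its number of vertices minus one to the degree of the duality maps, and
  \<open>card W - 1\<close> counts these blocks and the later ones; so modulo 2 the degree is the number of earlier vertices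
  plus the number of later blocks, which is the sign required by \<open>complement_block_chain\<close>.
\<close>

lemma gamma_degree_parity:
  assumes k: "k \<in> W" shows "even (Gd k + size_before k + later W k)"
proof -
  let ?A = "{i \<in> W. i < k}" and ?B = "{i \<in> W. k < i}"
  have fin: "finite ?A" "finite ?B" using W_finite by auto
  have n: "k \<notin> ?A \<union> ?B" "?A \<inter> ?B = {}" "W = insert k (?A \<union> ?B)" using k by (blast | force)+
  have "card W = Suc (card (?A \<union> ?B))"
    by (rule trans[OF arg_cong[OF n(3), of card] card_insert_disjoint[OF finite_UnI[OF fin] n(1)]])
  then have cW: "card W = Suc (card ?A + later W k)" by (simp only: later_def card_Un_disjoint[OF fin n(2)])
  have mem: "i \<in> {1..<k} \<and> letter_of s i = Ln \<longleftrightarrow> i \<in> ?A" for i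
  proof -
    have "i \<in> I" if "i \<in> {1..<k}" using that W_I[OF k] by (auto simp: I_def)
    moreover have "i \<in> {1..<k}" if "i \<in> W" "i < k" using W_I[OF that(1)] that(2) by (auto simp: I_def)
    ultimately show ?thesis using letter[of i] W_I[of i] by (auto split: if_splits)
  qed
  have "(\<Sum>i\<in>{1..<k}. if letter_of s i = Ln then card (snd (block t i)) - 1 else 0) = (\<Sum>i\<in>{i \<in> {1..<k}. letter_of s i = Ln}. card (D i) - 1)"
    unfolding D_def by (rule sum.inter_filter[symmetric]) simp
  also have "{i \<in> {1..<k}. letter_of s i = Ln} = ?A" using mem by blast
  finally have G: "Gd k = card W - 1 + (\<Sum>i\<in>?A. card (D i) - 1)" by (simp add: gamma_degree_before_def W_def)
  have "card (D i) = (card (D i) - 1) + 1" if "i \<in> ?A" for i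
  proof -
    have "i \<in> W" using that by simp
    then have "finite (D i)" "D i \<noteq> {}" using D_finite[OF W_I] in_W by auto
    then have "card (D i) > 0" by (simp add: card_gt_0_iff)
    then show ?thesis by simp
  qed
  then have "(\<Sum>i\<in>?A. card (D i)) = (\<Sum>i\<in>?A. (card (D i) - 1) + 1)" by (rule sum.cong[OF refl])
  also have "\<dots> = (\<Sum>i\<in>?A. card (D i) - 1) + card ?A" by (simp only: sum.distrib card_eq_sum)
  finally have "size_before k = (\<Sum>i\<in>?A. card (D i) - 1) + card ?A" by (simp only: size_before_W)
  then show ?thesis by (simp add: G cW) blast
qed

text \<open>
  The complement map is an involution up to sign: \<open>lift y k\<close> is the chain with complement the chosen cochain, and
  \<open>w_dual\<close> inserts the Koszul sign of \<open>gamma_tensor\<close>.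
\<close>

definition lift where "lift y k = frag_cmul (complement_sign (D k) (D k)) (complement (D k) (fy y k))"

lemma lift_data:
  assumes y: "y \<in> cogenerators" and k: "k \<in> W"
  shows "lift y k \<in> frags (Pow (D k))" "complement (D k) (lift y k) = fy y k"
    "complement_map (D k) (Y k) (lift y k) \<in> y k" "lift y k \<in> relative_cycles (Pow (D k)) (Y k)"
proof -
  interpret p: simplex_pair "D k" "Y k" by (rule pair_Y[OF k])
  note yk = cogenerators_I[OF y W_I[OF k]]
  have fk: "fy y k \<in> frags (Pow (D k))" using fD(1)[OF k yk] k by (simp add: fy_def)
  show vD: "lift y k \<in> frags (Pow (D k))" unfolding lift_def by (intro frags_cmul complement_frags)
  show vc: "complement (D k) (lift y k) = fy y k"
    unfolding lift_def complement_simps complement_complement[OF p.fin fk] by simp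
  show vy: "complement_map (D k) (Y k) (lift y k) \<in> y k"
    unfolding complement_map_eq_restrict[of "lift y k" "D k" "Y k", OF vD] vc dual_Y[OF k, symmetric]
    using fD(2)[OF k yk] k by (simp add: fy_def)
  have "complement_map (D k) (Y k) (lift y k) \<in> cocycles (dual.Y k)"
    by (rule quotient_mem(1)[OF dual.qc_Y yk vy]) (simp add: W_I[OF k])
  then have "complement_map (D k) (Y k) (boundary (lift y k)) = 0"
    using coboundary_complement_map[OF p.fin p.down vD] by (simp add: cocycles_def dual_Y[OF k])
  then have "boundary (lift y k) \<in> frags (Y k)"
    by (rule complement_map_eq_0[OF p.fin boundary_frags[OF down_closed_Pow vD]])
  then show "lift y k \<in> relative_cycles (Pow (D k)) (Y k)" using vD by (simp add: relative_cycles_def)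
qed

definition w_dual where "w_dual y k = eps (Gd k) (lift y k)"
definition b_dual where "b_dual y k = (if k \<in> W then boundary (w_dual y k) else rep (y k))"

lemma w_dual_data:
  assumes y: "y \<in> cogenerators" shows "block_data (w_dual y) (b_dual y)"
  unfolding block_data_def
proof (intro conjI ballI)
  fix k assume k: "k \<in> W"
  show "w_dual y k \<in> frags (Pow (D k))" unfolding w_dual_def by (rule graded_sign_frags[OF lift_data(1)[OF y k]])
  show "boundary (w_dual y k) = b_dual y k" using k by (simp add: b_dual_def)
next
  fix k assume k: "k \<in> I"
  have "b_dual y k \<in> frags (Y k) \<and> boundary (b_dual y k) = 0"
  proof (cases "k \<in> W")
    case True
    have "boundary (lift y k) \<in> frags (Y k)" using lift_data(4)[OF y True] by (simp add: relative_cycles_def)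
    then show ?thesis using True by (auto simp: b_dual_def w_dual_def boundary_eps boundary_simps graded_sign_simps intro!: frags_cmul graded_sign_frags)
  next
    case False
    then have "b_dual y k \<in> frags {{}}"
      using dual.outside_singleton(2)[of k "y k"] k cogenerators_I[OF y k] by (simp add: b_dual_def dual_W)
    then show ?thesis using False frags_empty_simplex(3) by (simp add: dual_Y_outside)
  qed
  then show "b_dual y k \<in> frags (Y k)" "boundary (b_dual y k) = 0" by auto
qed

lemma join_cochain_complement:
  assumes y: "y \<in> cogenerators" and c: "c \<in> frags (Pow W)"
  shows "cochain_restrict dual.Z (block_cochain I D (fy y) (complement_map W Ks c)) = complement_map (Sigma I D) Z (block_chain I (w_dual y) (b_dual y) c)"
  unfolding dual_Z
proof (rule complement_map_block_chain[OF w_dual_data[OF y] gamma_degree_parity _ _ c])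
  show "fy y k = complement (D k) (eps (Gd k) (w_dual y k))" if "k \<in> W" for k
    by (simp add: w_dual_def eps_eps lift_data(2)[OF y that])
  show "fy y k = b_dual y k" if "k \<in> I" "k \<notin> W" for k using that by (simp add: fy_def b_dual_def)
qed

definition join_cochain where "join_cochain y c = cochain_restrict dual.Z (block_cochain I D (fy y) c)"

lemma additive_map_join_cochain [simp]: "additive_map (join_cochain y)"
  by (simp add: additive_map_def additive_dist join_cochain_def)

lemma join_cochain_cocycles:
  assumes y: "y \<in> cogenerators" and c: "c \<in> cocycles dual.Ks"
  shows "join_cochain y c \<in> cocycles dual.Z"
proof -
  obtain w where w: "w \<in> relative_cycles (Pow W) Ks" "complement_map W Ks w = c"
    using c unfolding dual_Ks by (rule pair_K.cocycle_complement)
  have "join_cochain y c = complement_map (Sigma I D) Z (block_chain I (w_dual y) (b_dual y) w)"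
    unfolding join_cochain_def w(2)[symmetric] using w(1) by (intro join_cochain_complement[OF y]) (simp add: relative_cycles_def)
  then show ?thesis
    using pair_Z.complement_map_cocycles[OF block_data_relative[OF w_dual_data[OF y] w(1)]] by (simp add: dual_Z)
qed

text \<open>
  A cochain of the dual of \<open>Ks\<close> is the complement of a chain, and substitution into complements is the
  complement of a substitution, which commutes with boundaries.
\<close>

lemma join_cochain_coboundaries:
  assumes y: "y \<in> cogenerators" and c: "c \<in> coboundaries dual.Ks"
  shows "join_cochain y c \<in> coboundaries dual.Z"
proof -
  obtain g where g: "g \<in> frags (dual_complex W Ks)" "c = coboundary (dual_complex W Ks) g"
    using c by (auto simp: coboundaries_eq dual_Ks)
  obtain w where w: "w \<in> frags (Pow W)" "complement_map W Ks w = g" by (rule complement_map_surj[OF W_finite g(1)])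
  let ?B = "block_chain I (w_dual y) (b_dual y) w"
  have BD: "?B \<in> frags (Pow (Sigma I D))"
    using block_data_Pow[OF w_dual_data[OF y] w(1)] .
  have "c = complement_map W Ks (boundary w)"
    using coboundary_complement_map[OF W_finite K_down w(1)] g(2) w(2) by simp
  then have "join_cochain y c = complement_map (Sigma I D) Z (boundary ?B)"
    unfolding join_cochain_def block_data_boundary[OF w_dual_data[OF y] w(1)]
    by (simp only: join_cochain_complement[OF y boundary_frags[OF down_closed_Pow w(1)]])
  also have "\<dots> = coboundary dual.Z (complement_map (Sigma I D) Z ?B)"
    unfolding dual_Z by (rule coboundary_complement_map[OF D_Sigma_finite Z_down BD, symmetric])
  finally show ?thesis using complement_map_frags[OF BD, of Z] by (auto simp: coboundaries_eq dual_Z)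
qed

definition lower_cocycle where "lower_cocycle y = join_cochain y (rep (y 0))"

lemma corep_0: "y \<in> cogenerators \<Longrightarrow> rep (y 0) \<in> cocycles dual.Ks"
  by (rule quotient_rep(1)[OF dual.qc_K cogenerators_0])

lemma dual_Ks_Pow: "c \<in> cocycles dual.Ks \<Longrightarrow> c \<in> frags (Pow W)"
  using frags_mono[OF dual.K_sub] by (auto simp: cocycles_def dual_W)

lemma lower_cocycle_multilinear:
  assumes x: "x \<in> cogenerators" and i: "i \<in> {0..m}" and y: "y \<in> carrier (dual.CF i)" "y' \<in> carrier (dual.CF i)"
  shows "lower_cocycle (x(i := y \<otimes>\<^bsub>dual.CF i\<^esub> y')) - lower_cocycle (x(i := y)) - lower_cocycle (x(i := y')) \<in> coboundaries dual.Z"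
proof (rule I_cases[OF i])
  assume i0: "i = 0"
  have same: "join_cochain (x(0 := u)) c = join_cochain x c" for u c
  proof -
    have "block_cochain I D (fy (x(0 := u))) c = block_cochain I D (fy x) c"
      unfolding block_cochain_def using zero_notin_I
      by (intro arg_cong2[where f = frag_extend] ext join_chain_cong) (auto simp: fy_def)
    then show ?thesis by (simp add: join_cochain_def)
  qed
  have y': "y \<in> carrier (cohomology dual.Ks)" "y' \<in> carrier (cohomology dual.Ks)" using y by (simp_all add: i0 dual.CF_0)
  note Q = quotient_ofD[OF dual.qc_K] and r = quotient_rep[OF dual.qc_K]
  have "y \<otimes>\<^bsub>cohomology dual.Ks\<^esub> y' = coset (coboundaries dual.Ks) (rep y + rep y')"
    using Q(6)[OF r(1)[OF y'(1)] r(1)[OF y'(2)]] r(2)[OF y'(1)] r(2)[OF y'(2)] by simp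
  then have d: "rep (y \<otimes>\<^bsub>cohomology dual.Ks\<^esub> y') - (rep y + rep y') \<in> coboundaries dual.Ks"
    using rep_coset[OF Q(2), of "rep y + rep y'"] by simp
  show ?thesis
    using join_cochain_coboundaries[OF x d]
    by (simp add: lower_cocycle_def i0 same dual.CF_0 additive_map_diff[OF additive_map_join_cochain]
        additive_map_add[OF additive_map_join_cochain] diff_diff_eq)
next
  assume k: "i \<in> I"
  then have i0: "i \<noteq> 0" using zero_notin_I by metis
  have yi: "y \<in> carrier (cohomology (dual.Y i))" "y' \<in> carrier (cohomology (dual.Y i))" using y by (simp_all add: dual.CF_I k)
  have upd: "fy (x(i := u)) = (fy x)(i := fy (x(i := u)) i)" for u by (auto simp: fy_def)
  have "fy (x(i := y \<otimes>\<^bsub>dual.CF i\<^esub> y')) i = fy (x(i := y)) i + fy (x(i := y')) i"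
    using fD(3)[OF _ yi] dual.outside_mult(2)[of i y y'] yi k by (auto simp: fy_def dual.CF_I dual_W)
  then have e: "fy (x(i := y \<otimes>\<^bsub>dual.CF i\<^esub> y')) = (fy x)(i := fy (x(i := y)) i + fy (x(i := y')) i)"
    by (subst upd) (simp only:)
  have "block_cochain I D (fy (x(i := y \<otimes>\<^bsub>dual.CF i\<^esub> y'))) c = block_cochain I D (fy (x(i := y))) c + block_cochain I D (fy (x(i := y'))) c" for c
    unfolding e block_cochain_slot[OF I_finite k] by (simp only: upd[symmetric])
  then have "lower_cocycle (x(i := y \<otimes>\<^bsub>dual.CF i\<^esub> y')) = lower_cocycle (x(i := y)) + lower_cocycle (x(i := y'))"
    unfolding lower_cocycle_def join_cochain_def fun_upd_other[OF i0[symmetric]] by (simp add: cochain_restrict_simps)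
  then show ?thesis by (simp add: additive_subsetD(1)[OF additive_subset_coboundaries])
qed

lemma lower_local_eq: "lower_local m V K' L' f t' =
    class_map (coboundaries dual.Z) (frag_extend (\<lambda>y. cochain_restrict dual.Z (frag_extend (lower_cochain m f t' y) (rep (y 0)))))"
  by (simp add: lower_local_def dual.Z_eq dual.full_def Let_def)

lemma lower_local_hom: "lower_local m V K' L' f t' \<in> hom (tensor_group {0..m} dual.CF) (cohomology dual.Z)"
  and lower_local_pure: "y \<in> cogenerators \<Longrightarrow>
    lower_local m V K' L' f t' (pure_tensor {0..m} dual.CF y) = coset (coboundaries dual.Z) (lower_cocycle y)"
proof -
  let ?F = "\<lambda>y. cochain_restrict dual.Z (frag_extend (lower_cochain m f t' y) (rep (y 0)))"
  have e: "?F y = lower_cocycle y" if "y \<in> cogenerators" for y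
    unfolding lower_cocycle_def join_cochain_def lower_cochain_eq[OF that dual_Ks_Pow[OF corep_0[OF that]]] ..
  have 1: "?F y \<in> cocycles dual.Z" if "y \<in> cogenerators" for y
    unfolding e[OF that] lower_cocycle_def by (rule join_cochain_cocycles[OF that corep_0[OF that]])
  have 2: "?F (x(i := y \<otimes>\<^bsub>dual.CF i\<^esub> y')) - ?F (x(i := y)) - ?F (x(i := y')) \<in> coboundaries dual.Z"
    if x: "x \<in> cogenerators" "i \<in> {0..m}" "y \<in> carrier (dual.CF i)" "y' \<in> carrier (dual.CF i)" for x i y y'
  proof -
    have yy: "y \<otimes>\<^bsub>dual.CF i\<^esub> y' \<in> carrier (dual.CF i)"
      using bspec[OF dual.CF_group x(2)] x(3,4) by (simp add: group.is_monoid monoid.m_closed)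
    have upd: "x(i := u) \<in> cogenerators" if "u \<in> carrier (dual.CF i)" for u
      by (rule PiE_upd[where A = "\<lambda>i. carrier (dual.CF i)", OF x(1,2) that])
    show ?thesis by (simp only: e[OF upd[OF yy]] e[OF upd[OF x(3)]] e[OF upd[OF x(4)]] lower_cocycle_multilinear[OF x])
  qed
  note u = tensor_universal[OF dual.CF_group dual.qc_Z, of ?F, OF 1 2]
  show "lower_local m V K' L' f t' \<in> hom (tensor_group {0..m} dual.CF) (cohomology dual.Z)"
    unfolding lower_local_eq by (rule u(1))
  show "lower_local m V K' L' f t' (pure_tensor {0..m} dual.CF y) = coset (coboundaries dual.Z) (lower_cocycle y)" if "y \<in> cogenerators"
    unfolding lower_local_eq by (simp only: u(2) e[OF that])
qed

abbreviation gf where "gf \<equiv> gamma_factor m V K L s t"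

lemma gf_0: "gf 0 = duality W Ks"
  unfolding W_def Ks_def gamma_eq_duality[OF K_simplicial(1) sX, symmetric] by (rule ext) (simp add: gamma_factor_def)

lemma gf_W:
  assumes k: "k \<in> W" shows "gf k x = duality (D k) (Y k) (graded_sign (Gd k) (\<lambda>\<tau>. card \<tau> + 1) ` x)"
proof -
  have "k \<noteq> 0" using W_I[OF k] zero_notin_I by metis
  moreover have "letter_of s k = Ln" "snd (block t k) \<noteq> {}" using letter[OF W_I[OF k]] k in_W[of k] by (simp_all add: D_def)
  ultimately show ?thesis
    unfolding gamma_factor_def dense_gamma_def
    by (simp add: gamma_eq_duality[OF L_down[OF W_I[OF k]] block_X_index[OF tX]] Y_W[OF k] D_def)
qed

lemma gf_outside:
  assumes k: "k \<in> I" "k \<notin> W" shows "gf k x = x"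
proof -
  have "k \<noteq> 0" using k zero_notin_I by metis
  moreover have "letter_of s k \<noteq> Ln" using letter[OF k(1)] k(2) by simp
  ultimately show ?thesis unfolding gamma_factor_def dense_gamma_def by simp
qed

lemma gf_hom_surj:
  assumes "k \<in> {0..m}" shows "gf k \<in> hom (HF k) (dual.CF k) \<and> gf k ` carrier (HF k) = carrier (dual.CF k)"
proof (rule I_cases[OF assms])
  assume k: "k = 0"
  show ?thesis
    using pair_K.duality_iso by (simp add: k gf_0 HF_0 dual.CF_0 dual_Ks iso_iff)
next
  assume k: "k \<in> I"
  have kI: "k \<in> dual.I" using k by simp
  show ?thesis
  proof (cases "k \<in> W")
    case True
    interpret p: simplex_pair "D k" "Y k" by (rule pair_Y[OF True])
    let ?s = "\<lambda>x. graded_sign (Gd k) (\<lambda>\<tau>. card \<tau> + 1) ` x"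
    have e: "gf k = duality (D k) (Y k) \<circ> ?s" by (rule ext) (simp add: gf_W[OF True])
    have d: "duality (D k) (Y k) \<in> hom (homology (Y k)) (dual.CF k)" "duality (D k) (Y k) ` carrier (homology (Y k)) = carrier (dual.CF k)"
      using p.duality_iso by (simp_all add: dual.CF_I[OF kI] dual_Y[OF True] iso_iff)
    note s = shifted_sign_hom[OF p.down, of "Gd k"]
    show ?thesis
      unfolding e HF_I[OF k] image_comp[symmetric] s(2) using hom_compose[OF s(1) d(1)] d(2) by simp
  next
    case False
    have e: "gf k = (\<lambda>x. x)" by (rule ext) (rule gf_outside[OF k False])
    have Y: "Y k = {{}}" "dual.Y k = {{}}" using False by (simp_all add: dual_Y_outside)
    note Q = quotient_ofD[OF qh_Y[OF k], unfolded Y empty_simplex_groups]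
    note Q' = quotient_ofD[OF dual.qc_Y[OF kI], unfolded Y empty_simplex_groups]
    show ?thesis
      unfolding e HF_I[OF k] dual.CF_I[OF kI] Y by (auto simp: hom_def Q(4) Q'(4) Q(6) Q'(6))
  qed
qed

lemma gamma_tensor_eq: "gamma_tensor m V K L s t = tensor_map {0..m} dual.CF gf"
  by (simp add: gamma_tensor_def dual.CF_def dual_s)

lemma gamma_tensor_hom: "gamma_tensor m V K L s t \<in> hom (tensor_group {0..m} HF) (tensor_group {0..m} dual.CF)"
  unfolding gamma_tensor_eq by (rule tensor_map_hom[OF HF_group dual.CF_group]) (simp only: gf_hom_surj)

lemma gamma_tensor_pure:
  "x \<in> generators \<Longrightarrow> gamma_tensor m V K L s t (pure_tensor {0..m} HF x) = pure_tensor {0..m} dual.CF (\<lambda>i\<in>{0..m}. gf i (x i))"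
  unfolding gamma_tensor_eq by (rule tensor_map_pure[OF HF_group dual.CF_group]) (simp_all only: gf_hom_surj)

lemma gf_in: "x \<in> generators \<Longrightarrow> (\<lambda>i\<in>{0..m}. gf i (x i)) \<in> cogenerators"
  using gf_hom_surj by (fastforce simp: PiE_iff hom_def)

lemma gamma_tensor_surj:
  "gamma_tensor m V K L s t ` carrier (tensor_group {0..m} HF) = carrier (tensor_group {0..m} dual.CF)"
proof (rule tensor_hom_surj[OF dual.CF_group group_quotient[OF quotient_tensor[OF HF_group]] gamma_tensor_hom])
  fix y assume y: "y \<in> cogenerators"
  define x where "x = (\<lambda>i\<in>{0..m}. SOME u. u \<in> carrier (HF i) \<and> gf i u = y i)"
  have *: "x i \<in> carrier (HF i) \<and> gf i (x i) = y i" if i: "i \<in> {0..m}" for i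
  proof -
    have "y i \<in> gf i ` carrier (HF i)" using gf_hom_surj[OF i] PiE_mem[OF y i] by simp
    then have "\<exists>u. u \<in> carrier (HF i) \<and> gf i u = y i" by blast
    then have "(SOME u. u \<in> carrier (HF i) \<and> gf i u = y i) \<in> carrier (HF i) \<and> gf i (SOME u. u \<in> carrier (HF i) \<and> gf i u = y i) = y i"
      by (rule someI_ex)
    then show ?thesis using i by (simp add: x_def)
  qed
  have x: "x \<in> generators" using * by (auto simp: x_def)
  have "(\<lambda>i\<in>{0..m}. gf i (x i)) = y"
    using * by (intro PiE_ext[OF gf_in[OF x] y]) simp
  then have "pure_tensor {0..m} dual.CF y = gamma_tensor m V K L s t (pure_tensor {0..m} HF x)"
    by (simp only: gamma_tensor_pure[OF x])
  then show "pure_tensor {0..m} dual.CF y \<in> gamma_tensor m V K L s t ` carrier (tensor_group {0..m} HF)"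
    by (rule image_eqI[OF _ pure_tensor_in[OF HF_group x]])
qed

text \<open>
  The cochain chosen for the dual class and the complement of the chain chosen for the class represent the same
  cohomology class, and the complement map is an isomorphism of quotients; so the two bounding chains differ by a
  relative boundary.
\<close>

lemma choices_agree:
  assumes x: "x \<in> generators" and k: "k \<in> W"
  shows "w_dual (\<lambda>i\<in>{0..m}. gf i (x i)) k - wz x k \<in> relative_boundaries (Pow (D k)) (Y k)"
proof -
  let ?y = "\<lambda>i\<in>{0..m}. gf i (x i)"
  interpret p: simplex_pair "D k" "Y k" by (rule pair_Y[OF k])
  note y = gf_in[OF x] and kI = W_I[OF k]
  let ?w = "eps (Gd k) (wz x k)"
  note wz = block_dataD(1-3)[OF wz_data[OF x]]
  have wr: "?w \<in> relative_cycles (Pow (D k)) (Y k)"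
    using wz(1)[OF k] wz(2)[OF k] wz(3)[OF kI]
    by (auto simp: relative_cycles_def boundary_eps intro!: frags_cmul graded_sign_frags)
  have xk: "x k = coset (boundaries (Y k)) (boundary (wz x k))"
    unfolding wz_def
    by (rule quotient_mem(2)[OF qh_Y[OF kI] generators_I[OF x kI] zD(2)[OF k k k k generators_I[OF x kI]]])
  have "?y k = duality (D k) (Y k) (coset (boundaries (Y k)) (boundary ?w))"
    using I_sub[OF kI] by (simp add: gf_W[OF k] xk shifted_sign_coset boundary_eps)
  also have "\<dots> = coset (coboundaries (dual_complex (D k) (Y k))) (complement_map (D k) (Y k) ?w)" by (rule p.duality_class[OF wr])
  finally have "complement_map (D k) (Y k) (lift ?y k - ?w) \<in> coboundaries (dual_complex (D k) (Y k))"
    using lift_data(3)[OF y k] by (simp add: mem_coset complement_simps)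
  then have "lift ?y k - ?w \<in> relative_boundaries (Pow (D k)) (Y k)"
    using p.complement_relative_iff fragsD(2)[OF lift_data(1)[OF y k] graded_sign_frags[OF wz(1)[OF k]]] by blast
  from relative_boundaries_eps[OF this, of "Gd k"] show ?thesis
    by (simp add: graded_sign_simps eps_eps w_dual_def)
qed

text \<open>
  The two ways around the square are complements of block chains built from \<open>wz\<close> and from \<open>w_dual\<close>, so they differ by
  the complement of a relative cycle whose boundary is null-homologous by \<open>block_chain_independent\<close>.
\<close>

lemma commutes_pure:
  assumes x: "x \<in> generators"
  shows "duality (Sigma I D) Z (coset (boundaries Z) (upper_cycle x)) =
    coset (coboundaries dual.Z) (lower_cocycle (\<lambda>i\<in>{0..m}. gf i (x i)))"
proof -
  let ?y = "\<lambda>i\<in>{0..m}. gf i (x i)"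
  note y = gf_in[OF x]
  let ?U = "block_chain I (wz x) (bz x)" and ?V = "block_chain I (w_dual ?y) (b_dual ?y)"
  note U = wz_data[OF x] and V = w_dual_data[OF y]
  obtain w where w: "w \<in> relative_cycles (Pow W) Ks" "x 0 = coset (boundaries Ks) (boundary w)"
    by (rule pair_K.homology_class_bounding[OF generators_0[OF x]])
  have wW: "w \<in> frags (Pow W)" using w(1) by (simp add: relative_cycles_def)
  have "rep (x 0) - boundary w \<in> boundaries Ks" unfolding w(2) by (rule rep_coset[OF additive_subset_boundaries])
  then obtain d where d: "d \<in> frags Ks" "rep (x 0) - boundary w = boundary d" by (auto simp: boundaries_eq)
  have "upper_cycle x - boundary (?U w) = boundary (?U d)"
    unfolding upper_cycle_def block_data_boundary[OF U wW] block_data_boundary[OF U frags_mono[OF K_sub d(1)]] d(2)[symmetric]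
    by (simp add: block_chain_simps)
  then have "upper_cycle x - boundary (?U w) \<in> boundaries Z"
    using block_data_Z[OF U d(1)] by (auto simp: boundaries_eq)
  then have "coset (boundaries Z) (upper_cycle x) = coset (boundaries Z) (boundary (?U w))"
    by (simp only: coset_eq_iff[OF additive_subset_boundaries])
  then have left: "duality (Sigma I D) Z (coset (boundaries Z) (upper_cycle x)) = coset (coboundaries dual.Z) (complement_map (Sigma I D) Z (?U w))"
    using pair_Z.duality_class[OF block_data_relative[OF U w(1)]] by (simp add: dual_Z)
  have "?y 0 = coset (coboundaries dual.Ks) (complement_map W Ks w)"
    using pair_K.duality_class[OF w(1)] by (simp add: gf_0 w(2) dual_Ks)
  then have "rep (?y 0) - complement_map W Ks w \<in> coboundaries dual.Ks"
    using rep_coset[OF additive_subset_coboundaries] by metis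
  from join_cochain_coboundaries[OF y this]
  have "lower_cocycle ?y - join_cochain ?y (complement_map W Ks w) \<in> coboundaries dual.Z"
    by (simp add: lower_cocycle_def additive_map_diff[OF additive_map_join_cochain])
  moreover have "join_cochain ?y (complement_map W Ks w) = complement_map (Sigma I D) Z (?V w)"
    unfolding join_cochain_def by (rule join_cochain_complement[OF y wW])
  ultimately have right: "lower_cocycle ?y - complement_map (Sigma I D) Z (?V w) \<in> coboundaries dual.Z" by simp
  have "?V (boundary w) - ?U (boundary w) \<in> boundaries Z"
  proof (rule block_chain_independent[OF U V choices_agree[OF x] _ pair_K.boundary_in_cycles[OF w(1)]])
    show "b_dual ?y k = bz x k" if k: "k \<in> I" "k \<notin> W" for k
      using I_sub[OF k(1)] k by (simp add: b_dual_def bz_def gf_outside)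
  qed
  then have "boundary (?V w - ?U w) \<in> boundaries Z"
    by (simp add: boundary_simps block_data_boundary[OF U wW] block_data_boundary[OF V wW])
  moreover have "?V w - ?U w \<in> relative_cycles (Pow (Sigma I D)) Z"
    using additive_subsetD(2)[OF quotient_ofD(1)[OF pair_Z.q_relative] block_data_relative[OF V w(1)] block_data_relative[OF U w(1)]] .
  ultimately have "?V w - ?U w \<in> relative_boundaries (Pow (Sigma I D)) Z" using pair_Z.relative_boundary_iff by blast
  then have "complement_map (Sigma I D) Z (?V w) - complement_map (Sigma I D) Z (?U w) \<in> coboundaries dual.Z"
    using pair_Z.complement_relative by (fastforce simp: dual_Z complement_simps)
  from additive_subsetD(4)[OF additive_subset_coboundaries right this]
  have "lower_cocycle ?y - complement_map (Sigma I D) Z (?U w) \<in> coboundaries dual.Z" by simp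
  then show ?thesis
    unfolding left by (rule iffD2[OF coset_eq_iff[OF additive_subset_coboundaries], symmetric])
qed

lemma gamma_join: "gamma (Sigma {1..m} V) full t = duality (Sigma I D) Z"
  unfolding gamma_eq_duality[OF simplicial_complexD(1)[OF full_complex] tX] Z_eq snd_t ..

lemma gamma_join_iso: "gamma (Sigma {1..m} V) full t \<in> iso (homology Z) (cohomology dual.Z)"
  unfolding gamma_join dual_Z by (rule pair_Z.duality_iso)

lemma local_commutes:
  assumes u: "u \<in> carrier (tensor_group {0..m} HF)"
  shows "gamma (Sigma {1..m} V) full t (upper_local m V K L z t u) = lower_local m V K' L' f t' (gamma_tensor m V K L s t u)"
proof -
  let ?g = "gamma (Sigma {1..m} V) full t"
  have g: "?g \<in> hom (homology Z) (cohomology dual.Z)" using gamma_join_iso by (simp add: iso_iff)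
  have "(?g \<circ> upper_local m V K L z t) u = (lower_local m V K' L' f t' \<circ> gamma_tensor m V K L s t) u"
  proof (rule tensor_hom_eqI[OF HF_group group_quotient[OF dual.qc_Z] hom_compose[OF upper_local_hom g] hom_compose[OF gamma_tensor_hom lower_local_hom] _ u])
    fix x assume x: "x \<in> generators"
    show "(?g \<circ> upper_local m V K L z t) (pure_tensor {0..m} HF x) = (lower_local m V K' L' f t' \<circ> gamma_tensor m V K L s t) (pure_tensor {0..m} HF x)"
      by (simp only: o_apply upper_local_pure[OF x] gamma_tensor_pure[OF x] lower_local_pure[OF gf_in[OF x]] gamma_join commutes_pure[OF x])
  qed
  then show ?thesis by simp
qed

text \<open>
  In the commutative square the upper map and the duality map of the join are bijective and \<open>gamma_tensor\<close> is onto;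
  hence \<open>gamma_tensor\<close> and the lower map are bijective as well.
\<close>

lemma lower_local_iso: "lower_local m V K' L' f t' \<in> iso (tensor_group {0..m} dual.CF) (cohomology dual.Z)"
proof -
  let ?g = "gamma (Sigma {1..m} V) full t" and ?l = "lower_local m V K' L' f t'" and ?\<gamma> = "gamma_tensor m V K L s t"
  let ?T = "carrier (tensor_group {0..m} HF)"
  have "?g \<circ> upper_local m V K L z t \<in> iso (tensor_group {0..m} HF) (cohomology dual.Z)"
    by (rule iso_set_trans[OF upper_local_iso gamma_join_iso])
  then have b: "bij_betw (?g \<circ> upper_local m V K L z t) ?T (carrier (cohomology dual.Z))" by (simp add: iso_def)
  have "bij_betw (?l \<circ> ?\<gamma>) ?T (carrier (cohomology dual.Z))"
    by (rule bij_betw_cong[THEN iffD1, OF _ b]) (simp only: o_apply local_commutes)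
  then have "inj_on (?l \<circ> ?\<gamma>) ?T" "(?l \<circ> ?\<gamma>) ` ?T = carrier (cohomology dual.Z)" by (simp_all add: bij_betw_def)
  then have "inj_on ?l (?\<gamma> ` ?T)" "?l ` (?\<gamma> ` ?T) = carrier (cohomology dual.Z)"
    by (simp_all add: image_comp inj_on_imageI2[of ?l ?\<gamma>] inj_on_imageI)
  then show ?thesis using lower_local_hom unfolding gamma_tensor_surj iso_iff by blast
qed

end

section \<open>Summation over all indices\<close>

lemma sum_group_diagonal_iso:
  assumes fin: "finite A" "finite B" and b: "\<And>t. t \<in> B \<Longrightarrow> b t \<in> A"
    and G: "\<And>s t. s \<in> A \<Longrightarrow> t \<in> B \<Longrightarrow> group (G s t)" and H: "\<And>t. t \<in> B \<Longrightarrow> group (H t)"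
    and trivial: "\<And>s t. s \<in> A \<Longrightarrow> t \<in> B \<Longrightarrow> s \<noteq> b t \<Longrightarrow> carrier (G s t) = {\<one>\<^bsub>G s t\<^esub>}"
    and \<phi>: "\<And>t. t \<in> B \<Longrightarrow> \<phi> t \<in> iso (G (b t) t) (H t)"
  shows "(\<lambda>y. \<lambda>t\<in>B. \<phi> t (y (b t, t))) \<in> iso (sum_group (A \<times> B) (\<lambda>(s, t). G s t)) (sum_group B H)"
proof -
  let ?S = "sum_group (A \<times> B) (\<lambda>(s, t). G s t)" and ?T = "sum_group B H" and ?F = "\<lambda>y. \<lambda>t\<in>B. \<phi> t (y (b t, t))"
  have "carrier ?S = {y \<in> \<Pi>\<^sub>E p\<in>A \<times> B. carrier (case p of (s, t) \<Rightarrow> G s t). finite {p \<in> A \<times> B. y p \<noteq> \<one>\<^bsub>case p of (s, t) \<Rightarrow> G s t\<^esub>}}"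
    by (rule carrier_sum_group) (auto simp: G)
  moreover have "finite {p \<in> A \<times> B. y p \<noteq> \<one>\<^bsub>case p of (s, t) \<Rightarrow> G s t\<^esub>}" for y
    by (rule finite_subset[OF _ finite_cartesian_product[OF fin]]) blast
  ultimately have S: "carrier ?S = (\<Pi>\<^sub>E p\<in>A \<times> B. carrier (case p of (s, t) \<Rightarrow> G s t))" by simp
  have T: "carrier ?T = (\<Pi>\<^sub>E t\<in>B. carrier (H t))"
    using fin by (simp add: carrier_sum_group H)
  have Sin: "y (s, t) \<in> carrier (G s t)" if "y \<in> carrier ?S" "s \<in> A" "t \<in> B" for y s t
    using PiE_mem[OF that(1)[unfolded S], of "(s, t)"] that(2,3) by simp
  have \<phi>h: "\<phi> t \<in> hom (G (b t) t) (H t)" and \<phi>b: "bij_betw (\<phi> t) (carrier (G (b t) t)) (carrier (H t))" if "t \<in> B" for t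
    using \<phi>[OF that] by (simp_all add: iso_def)
  have in': "?F y \<in> carrier ?T" if "y \<in> carrier ?S" for y
    using Sin[OF that b] hom_in_carrier[OF \<phi>h] by (simp add: T)
  have hom: "?F \<in> hom ?S ?T"
  proof (rule homI[OF in'])
    fix x y assume "x \<in> carrier ?S" "y \<in> carrier ?S"
    then show "?F (x \<otimes>\<^bsub>?S\<^esub> y) = ?F x \<otimes>\<^bsub>?T\<^esub> ?F y"
      using b Sin hom_mult[OF \<phi>h] by (auto intro!: restrict_ext)
  qed
  have inj: "inj_on ?F (carrier ?S)"
  proof (rule inj_onI)
    fix x y assume x: "x \<in> carrier ?S" and y: "y \<in> carrier ?S" and eq: "?F x = ?F y"
    show "x = y"
    proof (rule PiE_ext[OF x[unfolded S] y[unfolded S]])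
      fix p assume "p \<in> A \<times> B"
      then obtain s t where p: "p = (s, t)" "s \<in> A" "t \<in> B" by blast
      show "x p = y p"
      proof (cases "s = b t")
        case True
        have "\<phi> t (x (b t, t)) = \<phi> t (y (b t, t))" using fun_cong[OF eq, of t] p(3) by simp
        then show ?thesis
          using bij_betw_imp_inj_on[OF \<phi>b[OF p(3)]] Sin[OF x b[OF p(3)] p(3)] Sin[OF y b[OF p(3)] p(3)]
          by (simp add: inj_on_def p(1) True)
      next
        case False
        then show ?thesis using trivial[OF p(2,3) False] Sin[OF x p(2,3)] Sin[OF y p(2,3)] by (simp add: p(1))
      qed
    qed
  qed
  have "w \<in> ?F ` carrier ?S" if w: "w \<in> carrier ?T" for w
  proof (rule image_eqI)
    let ?y = "\<lambda>p\<in>A \<times> B. case p of (s, t) \<Rightarrow> if s = b t then inv_into (carrier (G (b t) t)) (\<phi> t) (w t) else \<one>\<^bsub>G s t\<^esub>"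
    have i: "w t \<in> \<phi> t ` carrier (G (b t) t)" if "t \<in> B" for t
      using bij_betw_imp_surj_on[OF \<phi>b[OF that]] PiE_mem[OF w[unfolded T] that] by simp
    show "?y \<in> carrier ?S"
      unfolding S using inv_into_into[OF i] by (auto simp: group.is_monoid[OF G] monoid.one_closed)
    show "w = ?F ?y"
    proof (rule ext)
      fix t show "w t = ?F ?y t"
        using b[of t] f_inv_into_f[OF i, of t] PiE_arb[OF w[unfolded T], of t] by (cases "t \<in> B") simp_all
    qed
  qed
  then have "?F ` carrier ?S = carrier ?T" using in' by blast
  then show ?thesis using hom inj by (simp add: iso_iff)
qed

lemma finite_L_index: "finite V \<Longrightarrow> finite (L_index V)"
  by (rule finite_subset[of _ "Pow V \<times> Pow V"]) (auto simp: L_index_def X_index_def)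

text \<open>Off the diagonal some block has a letter that its index excludes.\<close>

lemma dense_mismatch:
  assumes s: "s \<in> X_index {1..m}" and ne: "s \<noteq> block_index m L t"
  obtains k where "k \<in> {1..m}" "dense_homology (letter_of s k) (V k) (L k) (block t k) = homology {}"
    "dense_cohomology (letter_of s k) (V k) (L k) (block t k) = cohomology {}"
proof -
  have "\<exists>k\<in>{1..m}. dense_homology (letter_of s k) (V k) (L k) (block t k) = homology {} \<and>
     dense_cohomology (letter_of s k) (V k) (L k) (block t k) = cohomology {}"
  proof (rule ccontr)
    assume "\<not> ?thesis"
    then have *: "dense_homology (letter_of s k) (V k) (L k) (block t k) \<noteq> homology {} \<or>
      dense_cohomology (letter_of s k) (V k) (L k) (block t k) \<noteq> cohomology {}" if "k \<in> {1..m}" for k using that by blast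
    have "k \<in> fst s \<longleftrightarrow> k \<in> fst (block_index m L t)" "k \<in> snd s \<longleftrightarrow> k \<in> snd (block_index m L t)" if k: "k \<in> {1..m}" for k
      using *[OF k] s k by (auto simp: dense_homology_def dense_cohomology_def letter_of_def block_index_def X_index_iff
          split: if_splits)
    moreover have "fst s \<subseteq> {1..m}" "snd s \<subseteq> {1..m}" using s by (simp_all add: X_index_iff)
    moreover have "fst (block_index m L t) \<subseteq> {1..m}" "snd (block_index m L t) \<subseteq> {1..m}" by (auto simp: block_index_def)
    ultimately have "s = block_index m L t" by (intro prod_eqI Set.set_eqI) blast+
    then show False using ne by simp
  qed
  then show thesis using that by blast
qed

lemma void_groups:
  "carrier (homology ({} :: 'a::linorder set set)) = {\<one>\<^bsub>homology ({} :: 'a set set)\<^esub>}" "carrier (cohomology ({} :: 'a set set)) = {\<one>\<^bsub>cohomology ({} :: 'a set set)\<^esub>}"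
proof -
  have c: "c \<in> frags {} \<longleftrightarrow> c = 0" for c :: "'a set \<Rightarrow>\<^sub>0 int" by (auto simp: frags_def)
  have d: "down_closed ({} :: 'a set set)" by (simp add: down_closed_def)
  have "cycles {} = {0 :: 'a set \<Rightarrow>\<^sub>0 int}" "cocycles {} = {0 :: 'a set \<Rightarrow>\<^sub>0 int}"
    by (auto simp: cycles_def cocycles_def c boundary_simps coboundary_simps)
  then show "carrier (homology ({} :: 'a set set)) = {\<one>\<^bsub>homology ({} :: 'a set set)\<^esub>}"
    "carrier (cohomology ({} :: 'a set set)) = {\<one>\<^bsub>cohomology ({} :: 'a set set)\<^esub>}"
    using quotient_ofD(4,5)[OF quotient_homology[OF d]] quotient_ofD(4,5)[OF quotient_cohomology[OF _ d]] by auto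
qed

lemma factor_groups:
  assumes K: "simplicial_complex {1..m} K" and L: "\<And>k. k \<in> {1..m} \<Longrightarrow> simplicial_complex (V k) (L k)"
    and V: "\<And>k. k \<in> {1..m} \<Longrightarrow> finite (V k)" and s: "s \<in> L_index {1..m}" and t: "t \<in> L_index (Sigma {1..m} V)"
  shows "\<forall>k\<in>{0..m}. group (hom_factor V K L s t k)" "\<forall>k\<in>{0..m}. group (cohom_factor V K L s t k)"
proof -
  have h: "group (homology X)" if "down_closed X" for X :: "nat set set"
    by (rule group_quotient[OF quotient_homology[OF that]])
  have c: "group (cohomology X)" if "down_closed X" "finite X" for X :: "nat set set"
    by (rule group_quotient[OF quotient_cohomology[OF that(2,1)]])
  have e: "down_closed {}" by (simp add: down_closed_def)
  have fin: "finite (local_complex M u)" if "finite (snd u)" for M and u :: "nat set \<times> nat set"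
    using finite_subset[OF local_complex_subset] that by simp
  have "finite (snd s)" using L_index_X_index[OF s] by (auto simp: X_index_iff intro: finite_subset)
  moreover have "finite (snd (block t k))" if "k \<in> {1..m}" for k
    using block_X_index[OF L_index_X_index[OF t], of k] V[OF that] by (auto simp: X_index_iff intro: finite_subset)
  moreover have "k \<in> {1..m}" if "k \<in> {0..m}" "k \<noteq> 0" for k using that by (simp add: Suc_le_eq One_nat_def)
  ultimately show "\<forall>k\<in>{0..m}. group (hom_factor V K L s t k)" "\<forall>k\<in>{0..m}. group (cohom_factor V K L s t k)"
    unfolding hom_factor_def cohom_factor_def dense_homology_def dense_cohomology_def
    by (auto split: letter.split intro!: h c e fin down_closed_local down_closed_Pow simplicial_complexD(1)[OF K] simplicial_complexD(1)[OF L]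
        simp del: atLeastAtMost_iff)
qed

lemma off_diagonal_trivial:
  assumes "simplicial_complex {1..m} K" "\<And>k. k \<in> {1..m} \<Longrightarrow> simplicial_complex (V k) (L k)"
    "\<And>k. k \<in> {1..m} \<Longrightarrow> finite (V k)" "s \<in> L_index {1..m}" "t \<in> L_index (Sigma {1..m} V)"
    and ne: "s \<noteq> block_index m L t"
  shows "carrier (tensor_group {0..m} (hom_factor V K L s t)) = {\<one>\<^bsub>tensor_group {0..m} (hom_factor V K L s t)\<^esub>}"
    "carrier (tensor_group {0..m} (cohom_factor V K L s t)) = {\<one>\<^bsub>tensor_group {0..m} (cohom_factor V K L s t)\<^esub>}"
proof -
  note g = factor_groups[OF assms(1-5)]
  obtain k where k: "k \<in> {1..m}" "dense_homology (letter_of s k) (V k) (L k) (block t k) = homology {}"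
    "dense_cohomology (letter_of s k) (V k) (L k) (block t k) = cohomology {}"
    by (rule dense_mismatch[OF L_index_X_index[OF assms(4)] ne])
  have k0: "k \<in> {0..m}" "k \<noteq> 0" using k(1) by auto
  have "hom_factor V K L s t k = homology {}" "cohom_factor V K L s t k = cohomology {}"
    using k0 k(2,3) by (simp_all add: hom_factor_def cohom_factor_def)
  then show "carrier (tensor_group {0..m} (hom_factor V K L s t)) = {\<one>\<^bsub>tensor_group {0..m} (hom_factor V K L s t)\<^esub>}"
    "carrier (tensor_group {0..m} (cohom_factor V K L s t)) = {\<one>\<^bsub>tensor_group {0..m} (cohom_factor V K L s t)\<^esub>}"
    using tensor_trivial[OF g(1) k0(1)] tensor_trivial[OF g(2) k0(1)] void_groups by simp_all
qed

theorem theorem5p7: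
  fixes m :: nat and n :: "nat \<Rightarrow> nat"
    and K :: "nat set set" and L :: "nat \<Rightarrow> nat set set"
    and z f :: "nat \<Rightarrow> nat set \<times> nat set \<Rightarrow> (nat set \<Rightarrow>\<^sub>0 int) set \<Rightarrow> (nat set \<Rightarrow>\<^sub>0 int)"
    and V :: "nat \<Rightarrow> nat set" and N :: "(nat \<times> nat) set"
    and K' :: "nat set set" and L' :: "nat \<Rightarrow> nat set set"
    and Z Z' :: "(nat \<times> nat) set set"
  assumes V: "V = (\<lambda>k. {1..n k})" and N: "N = Sigma {1..m} V"
    and K': "K' = dual_complex {1..m} K" and L': "L' = (\<lambda>k. dual_complex (V k) (L k))"
    and Z: "Z = polyhedral_join m V K L" and Z': "Z' = polyhedral_join m V K' L'"
    and m: "m \<ge> 1"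
    and K: "simplicial_complex {1..m} K"
    and L: "\<And>k. k \<in> {1..m} \<Longrightarrow> simplicial_complex (V k) (L k)"
    and L_nontrivial: "\<And>k. k \<in> {1..m} \<Longrightarrow> L k \<noteq> {} \<and> L k \<noteq> Pow (V k)"
    and split: "\<And>k. k \<in> {1..m} \<Longrightarrow> densely_split (V k) (L k)"
    and z: "\<And>k t. k \<in> {1..m} \<Longrightarrow> t \<in> L_index (V k) \<Longrightarrow> bounding_choice (L k) t (z k t)"
    and f: "\<And>k t. k \<in> {1..m} \<Longrightarrow> t \<in> L_index (V k) \<Longrightarrow> extension_choice (L' k) t (f k t)"
  shows "upper_iso m V K L z \<in> iso (diagonal_homology m V K L) (L_homology N Z) \<and>
    lower_iso m V K' L' f \<in> iso (diagonal_cohomology m V K' L') (L_cohomology N Z') \<and>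
    (\<forall>y\<in>carrier (diagonal_homology m V K L).
       gamma_bar N Z (upper_iso m V K L z y) = lower_iso m V K' L' f (gamma_bar_tensor m V K L y)) \<and>
    (\<forall>t\<in>L_index N. let s = block_index m L t in
       \<forall>x\<in>carrier (tensor_group {0..m} (hom_factor V K L s t)).
         gamma N Z t (upper_local m V K L z t x) =
         lower_local m V K' L' f (opposite N t) (gamma_tensor m V K L s t x))"
proof -
  let ?B = "L_index N" and ?A = "L_index {1..m}"
  have V_fin: "finite (V k)" for k by (simp add: V)
  have L'_complex: "simplicial_complex (V k) (L' k)" if "k \<in> {1..m}" for k
    unfolding L' by (rule simplicial_complex_dual[OF L[OF that]])
  have K'_complex: "simplicial_complex {1..m} K'" unfolding K' by (rule simplicial_complex_dual[OF K])
  have fin: "finite ?A" "finite ?B" by (auto intro!: finite_L_index simp: N V_fin)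
  have index: "duality_index m V K L t z f" if "t \<in> ?B" for t
  proof unfold_locales
    show "extension_choice (dual_complex (V k) (L k)) u (f k u)" if "k \<in> {1..m}" "u \<in> L_index (V k)" for k u
      using f[OF that] by (simp only: L')
  qed (use that V_fin K L z in \<open>simp_all add: N\<close>)
  have Z_complex: "simplicial_complex N Z"
    unfolding N Z by (rule simplicial_complex_polyhedral_join[OF K L])
  have Z'_complex: "simplicial_complex N Z'"
    unfolding N Z' by (rule simplicial_complex_polyhedral_join[OF K'_complex L'_complex])
  have s': "block_index m L' (opposite N t) = opposite {1..m} (block_index m L t)" if "t \<in> ?B" for t
    unfolding N L' by (rule block_index_opposite[OF L_index_X_index[OF that[unfolded N]]])
  have upper: "upper_local m V K L z t \<in> iso (tensor_group {0..m} (hom_factor V K L (block_index m L t) t)) (homology (local_complex Z t))"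
    if t: "t \<in> ?B" for t
  proof -
    interpret d: duality_index m V K L t z f by (rule index[OF t])
    show ?thesis using d.upper_local_iso unfolding d.HF_def d.s_def d.Z_eq d.full_def Z .
  qed
  \<comment> \<open>The index of the lower row is the opposite of an index of the upper row.\<close>
  have lower: "lower_local m V K' L' f t \<in> iso (tensor_group {0..m} (cohom_factor V K' L' (block_index m L' t) t)) (cohomology (local_complex Z' t))"
    if t: "t \<in> ?B" for t
  proof -
    interpret d: duality_index m V K L "opposite N t" z f by (rule index[OF opposite_L_index[OF t]])
    have e: "opposite N (opposite N t) = t" by (rule opposite_opposite[OF L_index_X_index[OF t]])
    show ?thesis
      unfolding Z'
      by (rule d.lower_local_iso[unfolded d.dual.CF_def d.dual.s_def d.dual.Z_eq d.dual.full_def, folded K' L' N, unfolded e])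
  qed
  have local: "gamma N Z t (upper_local m V K L z t x) =
      lower_local m V K' L' f (opposite N t) (gamma_tensor m V K L (block_index m L t) t x)"
    if t: "t \<in> ?B" and x: "x \<in> carrier (tensor_group {0..m} (hom_factor V K L (block_index m L t) t))" for t x
  proof -
    interpret d: duality_index m V K L t z f by (rule index[OF t])
    show ?thesis using d.local_commutes x unfolding d.HF_def d.s_def d.full_def Z N K' L' .
  qed
  have B: "block_index m L t \<in> ?A" "block_index m L' t \<in> ?A" if "t \<in> ?B" for t
    using block_index_L_index that unfolding N by blast+
  have Hg: "group (homology (local_complex Z t))" and Cg: "group (cohomology (local_complex Z' t))" if "t \<in> ?B" for t
  proof -
    have "finite (snd t)" using L_index_X_index[OF that] by (auto simp: X_index_iff N V_fin intro: finite_subset[of _ "Sigma {1..m} V"])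
    then have "finite (local_complex Z' t)" using finite_subset[OF local_complex_subset] by simp
    then show "group (homology (local_complex Z t))" "group (cohomology (local_complex Z' t))"
      using group_quotient[OF quotient_homology] group_quotient[OF quotient_cohomology]
        down_closed_local simplicial_complexD(1)[OF Z_complex] simplicial_complexD(1)[OF Z'_complex] by blast+
  qed
  have Gg: "group (tensor_group {0..m} (hom_factor V K L s t))" if "s \<in> ?A" "t \<in> ?B" for s t
    using that unfolding N by (intro group_quotient[OF quotient_tensor] factor_groups(1)[OF K L V_fin])
  have upper_iso: "upper_iso m V K L z \<in> iso (diagonal_homology m V K L) (L_homology N Z)"
    unfolding upper_iso_def[abs_def] diagonal_homology_def L_homology_def N[symmetric]
  proof (rule sum_group_diagonal_iso[where b = "block_index m L" and \<phi> = "upper_local m V K L z"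
        and G = "\<lambda>s t. tensor_group {0..m} (hom_factor V K L s t)", OF fin B(1) _ Hg _ upper])
    fix s t assume st: "s \<in> ?A" "t \<in> ?B"
    show "group (tensor_group {0..m} (hom_factor V K L s t))" by (rule Gg[OF st])
    show "carrier (tensor_group {0..m} (hom_factor V K L s t)) = {\<one>\<^bsub>tensor_group {0..m} (hom_factor V K L s t)\<^esub>}" if "s \<noteq> block_index m L t"
      using st that unfolding N by (intro off_diagonal_trivial(1)[OF K L V_fin])
  qed
  have lower_iso: "lower_iso m V K' L' f \<in> iso (diagonal_cohomology m V K' L') (L_cohomology N Z')"
    unfolding lower_iso_def[abs_def] diagonal_cohomology_def L_cohomology_def N[symmetric]
  proof (rule sum_group_diagonal_iso[where b = "block_index m L'" and \<phi> = "lower_local m V K' L' f"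
        and G = "\<lambda>s t. tensor_group {0..m} (cohom_factor V K' L' s t)", OF fin B(2) _ Cg _ lower])
    fix s t assume st: "s \<in> ?A" "t \<in> ?B"
    show "group (tensor_group {0..m} (cohom_factor V K' L' s t))"
      using st unfolding N by (intro group_quotient[OF quotient_tensor] factor_groups(2)[OF K'_complex L'_complex V_fin])
    show "carrier (tensor_group {0..m} (cohom_factor V K' L' s t)) = {\<one>\<^bsub>tensor_group {0..m} (cohom_factor V K' L' s t)\<^esub>}" if "s \<noteq> block_index m L' t"
      using st that unfolding N by (intro off_diagonal_trivial(2)[OF K'_complex L'_complex V_fin])
  qed
  have global: "gamma_bar N Z (upper_iso m V K L z y) = lower_iso m V K' L' f (gamma_bar_tensor m V K L y)"
    if y: "y \<in> carrier (diagonal_homology m V K L)" for y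
    unfolding gamma_bar_def lower_iso_def N[symmetric]
  proof (rule restrict_ext)
    fix t assume t: "t \<in> ?B"
    let ?u = "opposite N t"
    let ?s = "block_index m L ?u"
    have u: "?u \<in> ?B" by (rule opposite_L_index[OF t])
    have e: "opposite N ?u = t" by (rule opposite_opposite[OF L_index_X_index[OF t]])
    have sA: "?s \<in> ?A" by (rule B(1)[OF u])
    have s_t: "block_index m L' t = opposite {1..m} ?s" using s'[OF u] by (simp only: e)
    have ss: "opposite {1..m} (opposite {1..m} ?s) = ?s" by (rule opposite_opposite[OF L_index_X_index[OF sA]])
    have "carrier (diagonal_homology m V K L) \<subseteq> (\<Pi>\<^sub>E p\<in>?A \<times> ?B. carrier (case p of (s, t) \<Rightarrow> tensor_group {0..m} (hom_factor V K L s t)))"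
      unfolding diagonal_homology_def N[symmetric]
      by (subst carrier_sum_group) (auto intro: Gg)
    then have x: "y (?s, ?u) \<in> carrier (tensor_group {0..m} (hom_factor V K L ?s ?u))"
      using y PiE_mem[of y "?A \<times> ?B" _ "(?s, ?u)"] sA u by fastforce
    have "gamma N Z ?u (upper_iso m V K L z y ?u) = gamma N Z ?u (upper_local m V K L z ?u (y (?s, ?u)))"
      using u by (simp add: upper_iso_def N)
    also have "\<dots> = lower_local m V K' L' f t (gamma_tensor m V K L ?s ?u (y (?s, ?u)))"
      using local[OF u x] by (simp only: e)
    also have "gamma_tensor m V K L ?s ?u (y (?s, ?u)) = gamma_bar_tensor m V K L y (block_index m L' t, t)"
      unfolding gamma_bar_tensor_def N[symmetric] s_t using opposite_L_index[OF sA] t by (simp add: ss Let_def)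
    finally show "gamma N Z ?u (upper_iso m V K L z y ?u) = lower_local m V K' L' f t (gamma_bar_tensor m V K L y (block_index m L' t, t))" .
  qed
  show ?thesis unfolding Let_def using upper_iso lower_iso global local by blast
qed

end
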